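(* Assume that $n \geq 2$, $0 < s,t < 1$, $n > 2s + 1$, $n > 2t + 1$, $p,q \geq 1$ and $pq > 1$. If $$\left(\frac{2s}{p}+2t\right)\frac{p}{pq-1}\geq n-2s \quad\text{or}\quad \left(\frac{2t}{q}+2s\right)\frac{q}{pq-1}\geq n-2t ,$$ then the only non-negative viscosity bounded solution $(u,v)$ of the system $$\begin{cases}(-\Delta)^{s} u = v^{p} & \text{in } \mathbb{R}^n_+\\ (-\Delta)^{t} v = u^{q} & \text{in } \mathbb{R}^n_+\\ u=v=0 & \text{in } \mathbb{R}^n\setminus\mathbb{R}^n_+\end{cases}$$ is the trivial one $(u,v)=(0,0)$.
   Context: $\mathbb{R}^{n}_{+} = \{ x =(x_1, \ldots, x_n) \in \mathbb{R}^n:\ x_n > 0\}$. For $0<s<1$ the fractional Laplace operator on $\mathbb{R}^n$ is $$(-\Delta)^{s}u(x) = C(n,s)\,\mathrm{P.V.}\int_{\mathbb{R}^{n}}\frac{u(x)-u(y)}{|x-y|^{n+2s}}\,dy,\qquad C(n,s) = \left(\int_{\mathbb{R}^{n}}\frac{1-\cos(\zeta_{1})}{|\zeta|^{n+2s}}\, d\zeta\right)^{-1}.$$ Let $G=\mathbb{R}^n_+$. A viscosity super-solution of $(-\Delta)^{s} u = v^{p}$, $(-\Delta)^{t} v = u^{q}$ in $G$ is a couple $(u,v)$ of continuous functions in $\mathbb{R}^n$ such that $u,v \geq 0$ in $\mathbb{R}^{n} \setminus \overline{G}$ and for each point $x_{0}\in G$ there exists a neighborhood $U$ of $x_{0}$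 with $\overline{U} \subset G$ such that for any $\varphi,\psi \in C^{2}(\overline{U})$ satisfying $u(x_{0}) = \varphi(x_{0})$, $v(x_{0}) = \psi(x_{0})$, $u \geq \varphi$ and $v \geq \psi$ in $U$, the functions $\overline{u}$ (equal to $\varphi$ in $U$ and to $u$ in $\mathbb{R}^n\setminus U$) and $\overline{v}$ (equal to $\psi$ in $U$ and to $v$ in $\mathbb{R}^n\setminus U$) satisfy $(-\Delta)^{s}\overline{u}(x_{0}) \geq v^{p}(x_{0})$ and $(-\Delta)^{t}\overline{v}(x_{0}) \geq u^{q}(x_{0})$. A viscosity sub-solution is defined in the same way with all inequalities reversed, and a viscosity solution is a couple that is both a viscosity super-solution and a viscosity sub-solution; here it is moreover required that $u=v=0$ in $\mathbb{R}^n\setminus\mathbb{R}^n_+$. Non-negative means $u,v\ge 0$, and bounded means that $u$ and $v$ are bounded functions.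
   Formalization: Test functions φ for u and ψ for v are decoupled (each touching φ, respectively ψ, gives its own inequality); requiring them only for jointly touching pairs makes the claim false, since rough couples never touched at a common point would be nontrivial solutions. *)

theory Defs
  imports "HOL-Analysis.Analysis"
begin

text \<open>
  Points of \<open>R^n\<close> have type \<open>real ^ 'n\<close> with \<open>n = CARD('n)\<close>. The index type is linearly ordered,
  so that the first coordinate is the one at \<open>Min UNIV\<close> and the last the one at \<open>Max UNIV\<close>.
\<close>

definition half_space :: "(real ^ 'n::{finite,linorder}) set" where
  "half_space = {x. x $ Max UNIV > 0}"

definition frac_const :: "'n::{finite,linorder} itself \<Rightarrow> real \<Rightarrow> real" where
  "frac_const _ s =
     inverse (LINT \<zeta>|(lborel :: (real ^ 'n::_) measure).
                (1 - cos (\<zeta> $ Min UNIV)) / norm \<zeta> powr (real CARD('n) + 2 * s))"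

text \<open>
  The fractional Laplacian of \<open>u\<close> at \<open>x\<close> exists and equals \<open>L\<close>: the integrals over the complements
  of the balls \<open>B(x,\<epsilon>)\<close> converge absolutely and have a finite limit as \<open>\<epsilon>\<close> tends to \<open>0\<close>. It is a
  relation, like \<^const>\<open>has_integral\<close>, so that no default value is involved when the principal
  value does not exist.
\<close>

definition has_frac_laplacian ::
  "real \<Rightarrow> (real ^ 'n::{finite,linorder} \<Rightarrow> real) \<Rightarrow> real ^ 'n::_ \<Rightarrow> real \<Rightarrow> bool" where
  "has_frac_laplacian s u x L \<longleftrightarrow>
     (let k = (\<lambda>y. (u x - u y) / norm (x - y) powr (real CARD('n) + 2 * s)) in
       (\<forall>\<epsilon>>0. set_integrable lborel (- ball x \<epsilon>) k) \<and>
       (\<exists>I. ((\<lambda>\<epsilon>. LINT y:(- ball x \<epsilon>)|lborel. k y) \<longlongrightarrow> I) (at_right 0) \<and>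
            L = frac_const TYPE('n) s * I))"

text \<open>
  \<open>C\<^sup>2\<close> up to the boundary, for open \<open>U\<close>: the function, its gradient \<open>D\<close> and its Hessian \<open>H\<close> in \<open>U\<close>
  extend continuously to the closure of \<open>U\<close>.
\<close>

definition C2_closure :: "(real ^ 'n) set \<Rightarrow> (real ^ 'n \<Rightarrow> real) \<Rightarrow> bool" where
  "C2_closure U \<phi> \<longleftrightarrow>
     continuous_on (closure U) \<phi> \<and>
     (\<exists>(D :: real ^ 'n \<Rightarrow> real ^ 'n) (H :: real ^ 'n \<Rightarrow> real ^ 'n ^ 'n).
        continuous_on (closure U) D \<and> continuous_on (closure U) H \<and>
        (\<forall>x\<in>U. (\<phi> has_derivative (\<lambda>h. D x \<bullet> h)) (at x)) \<and>
        (\<forall>x\<in>U. (D has_derivative (\<lambda>h. H x *v h)) (at x)))"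

text \<open>
  Viscosity super- and sub-solutions of \<open>(-\<Delta>)^s u = v^p\<close>, \<open>(-\<Delta>)^t v = u^q\<close> in \<open>G\<close>. The test
  functions \<open>\<phi>\<close> for \<open>u\<close> and \<open>\<psi>\<close> for \<open>v\<close> are read respectively: every \<open>\<phi>\<close> touching \<open>u\<close> gives the first
  inequality and every \<open>\<psi>\<close> touching \<open>v\<close> gives the second. Requiring the inequalities only for
  simultaneously touching pairs \<open>(\<phi>, \<psi>)\<close> would make them vacuous for rough couples that are never
  touched at a common point. The function \<open>override_on u \<phi> U\<close> is \<open>\<phi>\<close> in \<open>U\<close> and \<open>u\<close> elsewhere.
\<close>

definition viscosity_supersolution ::
  "real \<Rightarrow> real \<Rightarrow> real \<Rightarrow> real \<Rightarrow> (real ^ 'n::{finite,linorder}) set \<Rightarrow>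
   (real ^ 'n::_ \<Rightarrow> real) \<Rightarrow> (real ^ 'n::_ \<Rightarrow> real) \<Rightarrow> bool" where
  "viscosity_supersolution s t p q G u v \<longleftrightarrow>
     continuous_on UNIV u \<and> continuous_on UNIV v \<and>
     (\<forall>x\<in>- closure G. u x \<ge> 0 \<and> v x \<ge> 0) \<and>
     (\<forall>x0\<in>G. \<exists>U. open U \<and> x0 \<in> U \<and> closure U \<subseteq> G \<and>
        (\<forall>\<phi>. C2_closure U \<phi> \<and> u x0 = \<phi> x0 \<and> (\<forall>x\<in>U. u x \<ge> \<phi> x) \<longrightarrow>
           (\<exists>L. has_frac_laplacian s (override_on u \<phi> U) x0 L \<and> L \<ge> v x0 powr p)) \<and>
        (\<forall>\<psi>. C2_closure U \<psi> \<and> v x0 = \<psi> x0 \<and> (\<forall>x\<in>U. v x \<ge> \<psi> x) \<longrightarrow>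
           (\<exists>L. has_frac_laplacian t (override_on v \<psi> U) x0 L \<and> L \<ge> u x0 powr q)))"

definition viscosity_subsolution ::
  "real \<Rightarrow> real \<Rightarrow> real \<Rightarrow> real \<Rightarrow> (real ^ 'n::{finite,linorder}) set \<Rightarrow>
   (real ^ 'n::_ \<Rightarrow> real) \<Rightarrow> (real ^ 'n::_ \<Rightarrow> real) \<Rightarrow> bool" where
  "viscosity_subsolution s t p q G u v \<longleftrightarrow>
     continuous_on UNIV u \<and> continuous_on UNIV v \<and>
     (\<forall>x\<in>- closure G. u x \<le> 0 \<and> v x \<le> 0) \<and>
     (\<forall>x0\<in>G. \<exists>U. open U \<and> x0 \<in> U \<and> closure U \<subseteq> G \<and>
        (\<forall>\<phi>. C2_closure U \<phi> \<and> u x0 = \<phi> x0 \<and> (\<forall>x\<in>U. u x \<le> \<phi> x) \<longrightarrow>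
           (\<exists>L. has_frac_laplacian s (override_on u \<phi> U) x0 L \<and> L \<le> v x0 powr p)) \<and>
        (\<forall>\<psi>. C2_closure U \<psi> \<and> v x0 = \<psi> x0 \<and> (\<forall>x\<in>U. v x \<le> \<psi> x) \<longrightarrow>
           (\<exists>L. has_frac_laplacian t (override_on v \<psi> U) x0 L \<and> L \<le> u x0 powr q)))"

definition viscosity_solution ::
  "real \<Rightarrow> real \<Rightarrow> real \<Rightarrow> real \<Rightarrow> (real ^ 'n::{finite,linorder}) set \<Rightarrow>
   (real ^ 'n::_ \<Rightarrow> real) \<Rightarrow> (real ^ 'n::_ \<Rightarrow> real) \<Rightarrow> bool" where
  "viscosity_solution s t p q G u v \<longleftrightarrow>
     viscosity_supersolution s t p q G u v \<and> viscosity_subsolution s t p q G u v \<and>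
     (\<forall>x\<in>- G. u x = 0 \<and> v x = 0)"

end

theory Submission
  imports Defs "HOL-Complex_Analysis.Great_Picard"
begin

text \<open>
  Touching by paraboloids turns the viscosity inequalities into integral inequalities for symmetric
  second differences. This class of subsolutions is stable under locally uniform limits (Fatou) and
  additive (doubling of variables), so differences of reflected solutions satisfy linear inequalities,
  with no regularity theory. Barriers of the form \<open>(x \<bullet> e) powr \<alpha>\<close> at the boundary, followed by their odd
  extensions across arbitrary hyperplanes for the reflected differences, give a global Hoelder bound.

  The solutions with a common bound and a common modulus of continuity therefore form a compact class,
  and the method of moving planes is run on the whole class at once: suprema over the class and over
  the unbounded slab are attained after translations parallel to the boundary. Hence every solution is
  nondecreasing in \<open>x \<bullet> e\<close>, where \<open>e\<close> is the inner normal.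

  Letting \<open>x \<bullet> e\<close> tend to infinity gives a supersolution \<open>(U, V)\<close> of the system in the whole space which
  dominates \<open>(u, v)\<close> and does not depend on \<open>x \<bullet> e\<close>. Testing with Gaussians of width \<open>r\<close> and using Jensen
  bounds the integral of \<open>V powr p\<close> over large balls by a constant, by the condition on the exponents.
  Unless \<open>V = 0\<close>, that integral grows at least linearly in \<open>r\<close>, because \<open>V\<close> is invariant in the
  direction \<open>e\<close>.
\<close>

section \<open>Reflections and the kernel\<close>

text \<open>A viscosity inequality is available only at points of touching, and a sum inherits no
  touching from its summands. The difference of a solution and its reflection and the average of its
  translates are both such sums, so additivity of the subsolution property carries the moving planes
  as well as the mollification. A single bounded solution need not attain its extremal values in an
  unbounded slab, and no decay at infinity is known. This is why all solutions with common bounds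
  are compared at once: their tangential translates and limits stay in the class. The equations are
  coupled only through the powers, so neither comparison closes by itself. Moreover one of
  \<open>p\<close>, \<open>q\<close> may equal 1; the plane is continued with the power whose
  exponent exceeds 1, because only such a factor forces an unknown to stay bounded below at the
  extremal points. The two alternatives on the exponents are exchanged by swapping
  \<open>(u, s, p)\<close> with \<open>(v, t, q)\<close>, so one of them suffices. The converse half
  of the equivalence has content: zero is a solution only if the principal value exists for every
  test function touching it.\<close>

lemma nn_integral_lborel_scale:
  fixes f :: "'a::euclidean_space \<Rightarrow> ennreal"
  assumes [measurable]: "f \<in> borel_measurable borel" and c: "c > 0"
  shows "(\<integral>\<^sup>+x. f x \<partial>lborel) = ennreal (c ^ DIM('a)) * (\<integral>\<^sup>+x. f (c *\<^sub>R x) \<partial>lborel)"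
proof -
  have "c \<noteq> 0" using c by simp
  from lborel_affine[OF this, where t="0::'a"]
  have "(\<integral>\<^sup>+x. f x \<partial>lborel) = (\<integral>\<^sup>+x. f x \<partial>density (distr lborel borel (\<lambda>x::'a. 0
      + c *\<^sub>R x)) (\<lambda>_. ennreal (\<bar>c\<bar> ^ DIM('a))))"
    by (rule arg_cong)
  also have "\<dots> = ennreal (c ^ DIM('a)) * (\<integral>\<^sup>+x. f (c *\<^sub>R x) \<partial>lborel)"
    using c by (subst nn_integral_density) (auto simp: nn_integral_distr nn_integral_cmult)
  finally show ?thesis .
qed

lemma lborel_integral_scale:
  fixes f :: "'a::euclidean_space \<Rightarrow> real"
  assumes [measurable]: "f \<in> borel_measurable borel" and c: "c > 0"
  shows "(LINT x|lborel. f x) = c ^ DIM('a) * (LINT x|lborel. f (c *\<^sub>R x))"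
proof -
  have "c \<noteq> 0" using c by simp
  from lborel_affine[OF this, where t="0::'a"]
  have "(LINT x|lborel. f x) = (LINT x|density (distr lborel borel (\<lambda>x::'a. 0
      + c *\<^sub>R x)) (\<lambda>_. ennreal (\<bar>c\<bar> ^ DIM('a))). f x)"
    by (rule arg_cong)
  also have "\<dots> = c ^ DIM('a) * (LINT x|lborel. f (c *\<^sub>R x))"
    using c by (subst integral_density) (auto simp: integral_distr)
  finally show ?thesis .
qed

definition crefl :: "'a::euclidean_space \<Rightarrow> real \<Rightarrow> 'a \<Rightarrow> 'a" where
  "crefl i a x = x + (2 * (a - x \<bullet> i)) *\<^sub>R i"

lemma crefl_involution [simp]: "i \<in> Basis \<Longrightarrow> crefl i a (crefl i a x) = x"
  by (simp add: crefl_def inner_add_left algebra_simps)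

lemma crefl_inner: "i \<in> Basis \<Longrightarrow> j \<in> Basis \<Longrightarrow> crefl i a x \<bullet> j = (if j = i then 2 * a - x \<bullet> i else x \<bullet> j)"
  by (simp add: crefl_def inner_add_left inner_Basis)

lemma continuous_on_crefl [continuous_intros]:
  "continuous_on S f \<Longrightarrow> continuous_on S (\<lambda>x. crefl i a (f x))"
  unfolding crefl_def by (intro continuous_intros)

lemma tendsto_crefl [tendsto_intros]:
  "(f \<longlongrightarrow> x) F \<Longrightarrow> (g \<longlongrightarrow> a) F \<Longrightarrow> ((\<lambda>j. crefl i (g j) (f j)) \<longlongrightarrow> crefl i a x) F"
  unfolding crefl_def by (intro tendsto_intros)

lemma crefl_measurable [measurable]: "crefl i a \<in> borel_measurable borel"
  by (intro borel_measurable_continuous_onI continuous_intros)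

lemma crefl_add: "i \<in> Basis \<Longrightarrow> crefl i a (x + z) = crefl i a x + crefl i 0 z"
  by (simp add: crefl_def inner_add_left algebra_simps)

lemma crefl_minus: "crefl i 0 (- z) = - crefl i 0 z"
  by (simp add: crefl_def algebra_simps)

lemma norm_crefl [simp]:
  assumes "i \<in> Basis" shows "norm (crefl i 0 z) = norm z"
proof -
  have "crefl i 0 z \<bullet> crefl i 0 z = z \<bullet> z"
    using assms by (simp add: crefl_def inner_add_left inner_add_right inner_commute algebra_simps)
  then show ?thesis by (simp add: norm_eq_sqrt_inner)
qed

lemma inner_crefl: "i \<in> Basis \<Longrightarrow> b \<bullet> crefl i 0 z = crefl i 0 b \<bullet> z"
  by (simp add: crefl_def inner_add_left inner_add_right inner_diff_left inner_diff_right inner_commute)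

lemma lborel_distr_crefl:
  assumes i: "i \<in> Basis"
  shows "distr lborel borel (crefl i a) = (lborel :: 'a::euclidean_space measure)"
proof -
  define c :: "'a \<Rightarrow> real" where "c j = (if j = i then -1 else 1)" for j
  have 1: "(2 * a) *\<^sub>R i + (\<Sum>j\<in>Basis. (c j * (x \<bullet> j)) *\<^sub>R j) = crefl i a x" for x
    by (rule euclidean_eqI)
       (use i in \<open>auto simp: crefl_inner inner_add_left inner_sum_left inner_Basis c_def if_distrib sum.delta' cong:
         if_cong\<close>)
  have 2: "(\<Prod>j\<in>Basis. \<bar>c j\<bar>) = 1" by (rule prod.neutral) (auto simp: c_def)
  have "lborel = density (distr lborel borel (\<lambda>x. (2 * a) *\<^sub>R i
      + (\<Sum>j\<in>Basis. (c j * (x \<bullet> j)) *\<^sub>R j))) (\<lambda>_. (\<Prod>j\<in>Basis. \<bar>c j\<bar>))"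
    by (rule lborel_affine_euclidean) (auto simp: c_def)
  then show ?thesis unfolding 1 2 by (simp add: density_1)
qed

lemma lborel_integral_crefl:
  fixes f :: "'a::euclidean_space \<Rightarrow> real"
  assumes i: "i \<in> Basis" and [measurable]: "f \<in> borel_measurable borel"
  shows "(LINT x|lborel. f (crefl i a x)) = (LINT x|lborel. f x)"
proof -
  have "(LINT x|lborel. f x) = (LINT x|distr lborel borel (crefl i a). f x)"
    by (simp add: lborel_distr_crefl[OF i])
  also have "\<dots> = (LINT x|lborel. f (crefl i a x))"
    by (rule integral_distr) auto
  finally show ?thesis ..
qed

lemma lborel_integrable_crefl:
  fixes f :: "'a::euclidean_space \<Rightarrow> real"
  assumes i: "i \<in> Basis" and [measurable]: "f \<in> borel_measurable borel"
  shows "integrable lborel (\<lambda>x. f (crefl i a x)) \<longleftrightarrow> integrable lborel f"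
  by (subst integrable_distr_eq[where N=borel and M=lborel and g="crefl i a", symmetric])
     (auto simp: lborel_distr_crefl[OF i])

lemma lborel_distr_reflect: "distr lborel borel (\<lambda>x. c - x) = (lborel :: 'a::euclidean_space measure)"
  using lborel_affine[of "-1::real" c] by (simp add: density_1)

lemma lborel_integral_reflect:
  fixes f :: "'a::euclidean_space \<Rightarrow> real"
  assumes [measurable]: "f \<in> borel_measurable borel"
  shows "(LINT x|lborel. f (c - x)) = (LINT x|lborel. f x)"
  using integral_distr[of "\<lambda>x. c - x" lborel borel f] by (simp add: lborel_distr_reflect)

lemma lborel_integrable_reflect:
  fixes f :: "'a::euclidean_space \<Rightarrow> real"
  assumes [measurable]: "f \<in> borel_measurable borel"
  shows "integrable lborel (\<lambda>x. f (c - x)) \<longleftrightarrow> integrable lborel f"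
  using integrable_distr_eq[of "\<lambda>x. c - x" lborel borel f] by (simp add: lborel_distr_reflect)

lemma lborel_integral_translate:
  fixes f :: "'a::euclidean_space \<Rightarrow> real"
  assumes [measurable]: "f \<in> borel_measurable borel"
  shows "(LINT x|lborel. f (c + x)) = (LINT x|lborel. f x)"
  using integral_distr[of "\<lambda>x. c + x" lborel borel f] by (simp add: lborel_distr_plus)

lemma lborel_integrable_translate:
  fixes f :: "'a::euclidean_space \<Rightarrow> real"
  assumes [measurable]: "f \<in> borel_measurable borel"
  shows "integrable lborel (\<lambda>x. f (c + x)) \<longleftrightarrow> integrable lborel f"
  using integrable_distr_eq[of "\<lambda>x. c + x" lborel borel f] by (simp add: lborel_distr_plus)

section \<open>Size and integrability of the kernel\<close>

definition fker :: "real \<Rightarrow> 'a::euclidean_space \<Rightarrow> real" where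
  "fker s z = norm z powr (- (real DIM('a) + 2 * s))"

lemma fker_nonneg [simp]: "fker s z \<ge> 0"
  by (simp add: fker_def)

lemma fker_pos: "z \<noteq> 0 \<Longrightarrow> fker s z > 0"
  by (simp add: fker_def)

lemma fker_0 [simp]: "fker s 0 = 0"
  by (simp add: fker_def)

lemma fker_minus [simp]: "fker s (- z) = fker s z"
  by (simp add: fker_def)

lemma fker_measurable [measurable]: "fker s \<in> borel_measurable borel"
  unfolding fker_def by measurable

lemma fker_crefl [simp]: "i \<in> Basis \<Longrightarrow> fker s (crefl i 0 z) = fker s z"
  by (simp add: fker_def)

lemma fker_antimono:
  fixes x y :: "'a::euclidean_space"
  assumes "s > 0" "0 < norm y" "norm y \<le> norm x" shows "fker s x \<le> fker s y"
  unfolding fker_def using assms by (auto intro!: powr_mono2')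

text \<open>Dilation by \<open>c\<close> maps the annulus between radii 1 and 2 to the given one and
  produces exactly the factor \<open>c powr (- \<sigma>)\<close>. The absolute value in the exponent
  of 2 covers both signs of \<open>real DIM('a) + \<sigma>\<close>.\<close>

lemma norm_powr_annulus:
  fixes \<sigma> :: real
  assumes c: "c > 0"
  shows "(\<integral>\<^sup>+z. ennreal (indicator {z::'a::euclidean_space. c \<le> norm z \<and>
      norm z < 2 * c} z * norm z powr (- (real DIM('a) + \<sigma>))) \<partial>lborel)
     \<le> ennreal (c powr (- \<sigma>) * (2 powr \<bar>real DIM('a) + \<sigma>\<bar> * measure lborel (ball (0::'a) 2)))"
proof -
  let ?g = "\<lambda>c z. indicator {z::'a. c \<le> norm z \<and> norm z < 2 * c} z * norm z powr (- (real DIM('a) + \<sigma>))"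
  have scale: "?g c (c *\<^sub>R z) = c powr (- (real DIM('a) + \<sigma>)) * ?g 1 z" for z
    using c by (auto simp: indicator_def powr_mult)
  have le: "?g 1 z \<le> 2 powr \<bar>real DIM('a) + \<sigma>\<bar> * indicator (ball 0 2) z" for z :: 'a
  proof (cases "1 \<le> norm z \<and> norm z < 2")
    case True
    have "norm z powr (- (real DIM('a) + \<sigma>)) \<le> norm z powr \<bar>real DIM('a) + \<sigma>\<bar>"
      using True by (intro powr_mono) auto
    also have "\<dots> \<le> 2 powr \<bar>real DIM('a) + \<sigma>\<bar>" using True by (intro powr_mono2) auto
    finally show ?thesis using True by (simp add: indicator_def)
  qed (auto simp: indicator_def)
  have fin: "emeasure lborel (ball (0::'a) 2) < \<infinity>"
    by (rule emeasure_bounded_finite) simp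
  have "(\<integral>\<^sup>+z. ennreal (?g 1 z) \<partial>lborel)
      \<le> (\<integral>\<^sup>+z. ennreal (2 powr \<bar>real DIM('a) + \<sigma>\<bar>) * indicator (ball (0::'a) 2) z \<partial>lborel)"
  proof (intro nn_integral_mono)
    fix z :: 'a
    have "ennreal (?g 1 z) \<le> ennreal (2 powr \<bar>real DIM('a) + \<sigma>\<bar> * indicator (ball 0 2) z)"
      by (rule ennreal_leI[OF le])
    also have "\<dots> = ennreal (2 powr \<bar>real DIM('a) + \<sigma>\<bar>) * indicator (ball 0 2) z"
      by (subst ennreal_mult) (simp_all add: ennreal_indicator)
    finally show "ennreal (?g 1 z) \<le> ennreal (2 powr \<bar>real DIM('a) + \<sigma>\<bar>) * indicator (ball 0 2) z" .
  qed
  also have "\<dots> = ennreal (2 powr \<bar>real DIM('a) + \<sigma>\<bar>) * emeasure lborel (ball (0::'a) 2)"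
    by (rule nn_integral_cmult_indicator) simp
  also have "\<dots> = ennreal (2 powr \<bar>real DIM('a) + \<sigma>\<bar> * measure lborel (ball (0::'a) 2))"
    using fin by (subst emeasure_eq_ennreal_measure) (simp_all add: ennreal_mult less_top)
  finally have one: "(\<integral>\<^sup>+z. ennreal (?g 1 z) \<partial>lborel)
      \<le> ennreal (2 powr \<bar>real DIM('a) + \<sigma>\<bar> * measure lborel (ball (0::'a) 2))" .
  have "(\<integral>\<^sup>+z. ennreal (?g c z) \<partial>lborel) = ennreal (c ^ DIM('a)) * (\<integral>\<^sup>+z. ennreal (?g c (c *\<^sub>R z)) \<partial>lborel)"
    by (rule nn_integral_lborel_scale) (use c in auto)
  also have "\<dots> = ennreal (c ^ DIM('a)) * (ennreal (c powr (- (real DIM('a) + \<sigma>))) * (\<integral>\<^sup>+z. ennreal (?g 1 z) \<partial>lborel))"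
    unfolding scale using c by (subst nn_integral_cmult[symmetric]) (auto simp: ennreal_mult)
  also have "\<dots> = ennreal (c powr (- \<sigma>)) * (\<integral>\<^sup>+z. ennreal (?g 1 z) \<partial>lborel)"
    using c by (simp add: mult.assoc[symmetric] ennreal_mult[symmetric] powr_realpow[symmetric] powr_add[symmetric])
  also have "\<dots> \<le> ennreal (c powr (- \<sigma>)) * ennreal (2 powr \<bar>real DIM('a) + \<sigma>\<bar> * measure lborel (ball (0::'a) 2))"
    by (intro mult_left_mono one) auto
  also have "\<dots> = ennreal (c powr (- \<sigma>) * (2 powr \<bar>real DIM('a) + \<sigma>\<bar> * measure lborel (ball (0::'a) 2)))"
    by (simp add: ennreal_mult)
  finally show ?thesis .
qed

text \<open>The integral is summed over annuli that cover \<open>A\<close>; overlaps only enlarge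
  the bound. Radii growing or shrinking geometrically give integrability at infinity for \<sigma> >
  0 and at the origin for \<sigma> < 0.\<close>

lemma integrable_norm_powr_annuli:
  fixes \<sigma> :: real and c :: "nat \<Rightarrow> real" and A :: "'a::euclidean_space set"
  assumes c: "\<And>j. c j > 0" and sm: "summable (\<lambda>j. c j powr (- \<sigma>))"
    and A: "\<And>z. z \<in> A \<Longrightarrow> \<exists>j. c j \<le> norm z \<and> norm z < 2 * c j" and [measurable]: "A \<in> sets borel"
  shows "integrable lborel (\<lambda>z. indicator A z * norm z powr (- (real DIM('a) + \<sigma>)))"
proof (rule integrableI_nonneg)
  let ?g = "\<lambda>c z. indicator {z::'a. c \<le> norm z \<and> norm z < 2 * c} z * norm z powr (- (real DIM('a) + \<sigma>))"
  let ?C = "2 powr \<bar>real DIM('a) + \<sigma>\<bar> * measure lborel (ball (0::'a) 2)"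
  have le: "ennreal (indicator A z * norm z powr (- (real DIM('a) + \<sigma>))) \<le> (\<Sum>j. ennreal (?g (c j) z))" for z
  proof (cases "z \<in> A")
    case True
    then obtain j where j: "c j \<le> norm z" "norm z < 2 * c j" using A by blast
    have "ennreal (indicator A z * norm z powr (- (real DIM('a) + \<sigma>))) = ennreal (?g (c j) z)"
      using True j by simp
    also have "\<dots> \<le> (\<Sum>j. ennreal (?g (c j) z))"
    proof -
      have "sum (\<lambda>j. ennreal (?g (c j) z)) {j} \<le> (\<Sum>j. ennreal (?g (c j) z))"
        by (rule sum_le_suminf[OF summableI]) (rule finite.intros finite.emptyI | simp only: zero_le)+
      then show ?thesis by (simp only: sum.insert[OF finite.emptyI] sum.empty add_0_right empty_iff not_False_eq_True)
    qed
    finally show ?thesis .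
  qed auto
  have "(\<integral>\<^sup>+z. ennreal (indicator A z * norm z powr (- (real DIM('a) + \<sigma>))) \<partial>lborel)
      \<le> (\<integral>\<^sup>+z. (\<Sum>j. ennreal (?g (c j) z)) \<partial>lborel)"
    by (intro nn_integral_mono le)
  also have "\<dots> = (\<Sum>j. (\<integral>\<^sup>+z. ennreal (?g (c j) z) \<partial>lborel))"
    by (rule nn_integral_suminf) measurable
  also have "\<dots> \<le> (\<Sum>j. ennreal (c j powr (- \<sigma>) * ?C))"
    by (intro suminf_le norm_powr_annulus c) (auto intro: summableI)
  also have "\<dots> = ennreal (\<Sum>j. c j powr (- \<sigma>) * ?C)"
    by (intro suminf_ennreal2 summable_mult2 sm) auto
  also have "\<dots> < \<infinity>" by simp
  finally show "(\<integral>\<^sup>+z. ennreal (indicator A z * norm z powr (- (real DIM('a) + \<sigma>))) \<partial>lborel) < \<infinity>" .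
qed auto

lemma integrable_norm_powr_outside:
  fixes r \<sigma> :: real
  assumes r: "r > 0" and \<sigma>: "\<sigma> > 0"
  shows "integrable lborel (\<lambda>z::'a::euclidean_space. indicator {z. r
      \<le> norm z} z * norm z powr (- (real DIM('a) + \<sigma>)))"
proof (rule integrable_norm_powr_annuli[where c="\<lambda>j. r * 2 ^ j"])
  have "(\<lambda>j. (r * 2 ^ j) powr (- \<sigma>)) = (\<lambda>j. r powr (-\<sigma>) * (2 powr (- \<sigma>)) ^ j)"
    using r by (simp add: powr_mult powr_power powr_realpow[symmetric] powr_powr mult.commute fun_eq_iff)
  then show "summable (\<lambda>j. (r * 2 ^ j) powr (- \<sigma>))"
    using \<sigma> by (auto intro!: summable_mult summable_geometric powr_less_one)
  fix z :: 'a assume "z \<in> {z. r \<le> norm z}"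
  then have z: "r \<le> norm z" by simp
  define j where "j = nat \<lfloor>log 2 (norm z / r)\<rfloor>"
  have ge1: "norm z / r \<ge> 1" using z r by simp
  then have l0: "log 2 (norm z / r) \<ge> 0" by simp
  then have j: "real j \<le> log 2 (norm z / r)" "log 2 (norm z / r) < real j + 1"
    unfolding j_def by linarith+
  have pos: "norm z / r > 0" using ge1 by linarith
  have "2 powr real j \<le> norm z / r" using j(1) pos by (simp add: le_log_iff)
  moreover have "norm z / r < 2 powr (real j + 1)" using j(2) pos by (simp add: log_less_iff)
  ultimately have "2 ^ j \<le> norm z / r" "norm z / r < 2 * 2 ^ j"
    by (simp_all add: powr_add powr_realpow)
  then show "\<exists>j. r * 2 ^ j \<le> norm z \<and> norm z < 2 * (r * 2 ^ j)"
    using r by (intro exI[of _ j]) (simp add: field_simps)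
qed (use r in auto)

lemma integrable_norm_powr_inside:
  fixes \<sigma> :: real
  assumes \<sigma>: "\<sigma> < 0"
  shows "integrable lborel (\<lambda>z::'a::euclidean_space. indicator {z. 0 < norm z \<and>
      norm z < 1} z * norm z powr (- (real DIM('a) + \<sigma>)))"
proof (rule integrable_norm_powr_annuli[where c="\<lambda>j. (1/2) ^ Suc j"])
  have "(a ^ k) powr (- \<sigma>) = (a powr (- \<sigma>)) ^ k" if "a > 0" for a :: real and k
    using that by (simp add: powr_power powr_powr mult.commute flip: powr_realpow)
  then have "(\<lambda>j. ((1/2) ^ Suc j) powr (- \<sigma>)) = (\<lambda>j. ((1/2) powr (- \<sigma>)) ^ Suc j)"
    by (intro ext) (simp del: power_Suc)
  moreover have "(1/2::real) powr (- \<sigma>) < 1" 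
    using \<sigma> powr_less_one[of 2 \<sigma>] by (simp add: powr_divide powr_minus_divide)
  ultimately show "summable (\<lambda>j. ((1/2) ^ Suc j) powr (- \<sigma>))"
    by (simp only: summable_Suc_iff) (auto intro!: summable_geometric)
  fix z :: 'a assume "z \<in> {z. 0 < norm z \<and> norm z < 1}"
  then have z: "0 < norm z" "norm z < 1" by auto
  \<comment> \<open>The ceiling minus one, instead of the floor, makes the upper inequality for
    \<open>norm z\<close> the strict one.\<close>
  define j where "j = nat (\<lceil>- log 2 (norm z)\<rceil> - 1)"
  have l0: "- log 2 (norm z) > 0" using z by simp
  then have j: "- log 2 (norm z) \<le> real j + 1" "real j < - log 2 (norm z)"
    unfolding j_def by linarith+
  have "2 powr (- (real j + 1)) \<le> norm z" using j(1) z by (simp add: le_log_iff[symmetric])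
  moreover have "norm z < 2 powr (- real j)" using j(2) z by (simp add: log_less_iff[symmetric])
  ultimately have "(1/2) ^ Suc j \<le> norm z" "norm z < (1/2) ^ j"
    by (simp_all add: powr_diff powr_minus powr_realpow field_simps)
  then show "\<exists>j. (1/2) ^ Suc j \<le> norm z \<and> norm z < 2 * (1/2) ^ Suc j"
    by (intro exI[of _ j]) simp
qed auto

lemma integrable_fker_outside:
  assumes "r > 0" "s > 0"
  shows "integrable lborel (\<lambda>z::'a::euclidean_space. indicator {z. r \<le> norm z} z * fker s z)"
  using integrable_norm_powr_outside[of r "2 * s"] assms by (simp add: fker_def)

text \<open>Near the origin the squared norm turns the exponent 2 s of the kernel into 2 s - 2 < 0.
  This weight bounds the negative part of the second difference of a bounded function that is
  touched from above by a paraboloid.\<close>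

lemma integrable_fker_min:
  assumes s: "0 < s" "s < 1"
  shows "integrable lborel (\<lambda>z::'a::euclidean_space. min 1 ((norm z)\<^sup>2) * fker s z)"
proof -
  have "min 1 ((norm z)\<^sup>2) * fker s z = indicator {z. 0 < norm z \<and>
      norm z < 1} z * norm z powr (- (real DIM('a) + (2 * s - 2)))
     + indicator {z. 1 \<le> norm z} z * fker s z" for z :: 'a
  proof (cases "norm z < 1")
    case True
    then have "(norm z)\<^sup>2 \<le> 1" by (simp add: power_le_one)
    then show ?thesis using True
      by (cases "z = 0") (auto simp: fker_def powr_realpow[symmetric] powr_add[symmetric] algebra_simps simp flip:
        powr_numeral)
  next
    case False
    then have "(norm z)\<^sup>2 \<ge> 1" by (simp add: one_le_power)
    then show ?thesis using False by auto
  qed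
  then show ?thesis
    using integrable_norm_powr_inside[of "2 * s-2", where 'a='a] integrable_fker_outside[of 1 s, where 'a='a] s
      by simp
qed

section \<open>Subsolutions tested by paraboloids\<close>

definition sdiff :: "('a::euclidean_space \<Rightarrow> real) \<Rightarrow> 'a \<Rightarrow> 'a \<Rightarrow> real" where
  "sdiff u x z = 2 * u x - u (x + z) - u (x - z)"

text \<open>
  The second differences make the integral absolutely convergent where the principal value exists, at
  the price of a factor: the integral is \<open>2 / C(n,s)\<close> times the fractional Laplacian. Supersolutions
  \<open>u\<close> are described by the subsolution property of \<open>- u\<close>.
\<close>

definition fsub :: "real \<Rightarrow> 'a::euclidean_space set \<Rightarrow> ('a \<Rightarrow> real) \<Rightarrow> ('a \<Rightarrow> real) \<Rightarrow> bool" where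
  "fsub s A f u \<longleftrightarrow> (\<forall>x\<in>A. \<forall>b K. (\<forall>z. u (x + z) \<le> u x + b \<bullet> z + K * (norm z)\<^sup>2) \<longrightarrow>
     integrable lborel (\<lambda>z. sdiff u x z * fker s z) \<and> (LINT z|lborel. sdiff u x z * fker s z) \<le> f x)"

lemma fsubD:
  assumes "fsub s A f u" "x \<in> A" "\<And>z. u (x + z) \<le> u x + b \<bullet> z + K * (norm z)\<^sup>2"
  shows "integrable lborel (\<lambda>z. sdiff u x z * fker s z)" "(LINT z|lborel. sdiff u x z * fker s z) \<le> f x"
  using assms unfolding fsub_def by blast+

section \<open>Stability of subsolutions under limits and sums\<close>

lemma touched_locally_imp:
  fixes u :: "'a::euclidean_space \<Rightarrow> real"
  assumes r: "r > 0" and loc: "\<And>z. norm z < r \<Longrightarrow> u (x + z) \<le> u x + b \<bullet> z + K * (norm z)\<^sup>2"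
    and M: "\<And>z. u z \<le> M"
  obtains K' where "\<And>z. u (x + z) \<le> u x + b \<bullet> z + K' * (norm z)\<^sup>2"
proof
  fix z
  \<comment> \<open>Outside the ball, 1 is at most the square of \<open>norm z / r\<close> and
    \<open>norm z\<close> at most \<open>r\<close> times that square; the last two summands
    therefore absorb the oscillation of \<open>u\<close> and the linear term.\<close>
  let ?K = "\<bar>K\<bar> + (\<bar>M\<bar> + \<bar>u x\<bar>) / r\<^sup>2 + norm b / r"
  show "u (x + z) \<le> u x + b \<bullet> z + ?K * (norm z)\<^sup>2"
  proof (cases "norm z < r")
    case True
    have "K \<le> ?K" using r by (smt (verit) divide_nonneg_nonneg norm_ge_zero zero_le_power2 abs_ge_self)
    then have "K * (norm z)\<^sup>2 \<le> ?K * (norm z)\<^sup>2" by (intro mult_right_mono) auto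
    then show ?thesis using loc[OF True] by linarith
  next
    case False
    then have z: "norm z \<ge> r" by simp
    have "(norm z)\<^sup>2 \<ge> r\<^sup>2" using z r by (intro power_mono) auto
    then have 1: "(\<bar>M\<bar> + \<bar>u x\<bar>) / r\<^sup>2 * (norm z)\<^sup>2 \<ge> \<bar>M\<bar> + \<bar>u x\<bar>"
      using r by (auto simp: field_simps intro!: add_mono mult_left_mono)
    have "norm b / r * (norm z)\<^sup>2 = norm b * norm z * (norm z / r)" by (simp add: power2_eq_square)
    also have "\<dots> \<ge> norm b * norm z * 1" using z r by (intro mult_left_mono) auto
    finally have 2: "norm b / r * (norm z)\<^sup>2 \<ge> norm b * norm z" by simp
    have 3: "- (norm b * norm z) \<le> b \<bullet> z" using Cauchy_Schwarz_ineq2[of b z] by linarith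
    have "0 \<le> \<bar>K\<bar> * (norm z)\<^sup>2" by simp
    then show ?thesis using 1 2 3 M[of "x + z"] unfolding distrib_right by linarith
  qed
qed

lemma fatou_fker:
  fixes S :: "nat \<Rightarrow> 'a::euclidean_space \<Rightarrow> real"
  assumes s: "0 < s" "s < 1"
    and int: "\<And>j. integrable lborel (\<lambda>z. S j z * fker s z)"
    and lower: "\<And>j z. - (C * min 1 ((norm z)\<^sup>2)) \<le> S j z"
    and lim: "\<And>z. z \<noteq> 0 \<Longrightarrow> (\<lambda>j. S j z) \<longlonglongrightarrow> S' z"
    and le: "\<And>j. (LINT z|lborel. S j z * fker s z) \<le> a j" and a: "a \<longlonglongrightarrow> a'"
  shows "integrable lborel (\<lambda>z. S' z * fker s z)" "(LINT z|lborel. S' z * fker s z) \<le> a'"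
proof -
  define m where "m z = C * (min 1 ((norm z)\<^sup>2) * fker s z)" for z :: 'a
  have m: "integrable lborel m" unfolding m_def using integrable_fker_min[OF s] by (intro integrable_mult_right)
  define g where "g j z = S j z * fker s z + m z" for j z
  define g' where "g' z = S' z * fker s z + m z" for z
  have gint: "integrable lborel (g j)" for j unfolding g_def by (intro Bochner_Integration.integrable_add int m)
  have [measurable]: "g j \<in> borel_measurable lborel" for j using gint by (rule borel_measurable_integrable)
  have gpos: "g j z \<ge> 0" for j z
  proof -
    have "0 \<le> (S j z + C * min 1 ((norm z)\<^sup>2)) * fker s z" using lower[of z j] by (intro mult_nonneg_nonneg) auto
    then show ?thesis by (simp add: g_def m_def algebra_simps)
  qed
  have glim: "(\<lambda>j. g j z) \<longlonglongrightarrow> g' z" for z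
    unfolding g_def g'_def by (cases "z = 0") (auto intro!: tendsto_intros lim)
  have g'pos: "g' z \<ge> 0" for z using LIMSEQ_le_const[OF glim] gpos by blast
  have [measurable]: "g' \<in> borel_measurable lborel" by (rule borel_measurable_LIMSEQ_real[OF glim]) measurable
  have A: "(LINT z|lborel. g j z) \<le> a j + integral\<^sup>L lborel m" for j
    unfolding g_def using le[of j] by (subst Bochner_Integration.integral_add) (auto intro: int m)
  have "a j + integral\<^sup>L lborel m \<ge> 0" for j
    using A[of j] Bochner_Integration.integral_nonneg[of lborel "g j"] gpos by (meson order_trans)
  then have A0: "a' + integral\<^sup>L lborel m \<ge> 0"
    by (intro LIMSEQ_le_const[OF tendsto_add[OF a tendsto_const]]) auto
  have "(\<integral>\<^sup>+z. ennreal (g' z) \<partial>lborel) = (\<integral>\<^sup>+z. liminf (\<lambda>j. ennreal (g j z)) \<partial>lborel)"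
    by (intro nn_integral_cong lim_imp_Liminf[symmetric]) (auto intro: tendsto_ennrealI glim)
  also have "\<dots> \<le> liminf (\<lambda>j. \<integral>\<^sup>+z. ennreal (g j z) \<partial>lborel)"
    by (rule nn_integral_liminf) measurable
  also have "\<dots> \<le> liminf (\<lambda>j. ennreal (a j + integral\<^sup>L lborel m))"
    using A gpos gint by (intro Liminf_mono) (auto simp: nn_integral_eq_integral ennreal_leI)
  also have "\<dots> = ennreal (a' + integral\<^sup>L lborel m)"
    by (intro lim_imp_Liminf) (auto intro!: tendsto_ennrealI tendsto_intros a)
  finally have B: "(\<integral>\<^sup>+z. ennreal (g' z) \<partial>lborel) \<le> ennreal (a' + integral\<^sup>L lborel m)" .
  then have g'int: "integrable lborel g'" using g'pos
    by (intro integrableI_nonneg) (auto simp: le_less_trans)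
  have C: "integral\<^sup>L lborel g' \<le> a' + integral\<^sup>L lborel m"
    using B g'pos A0 by (simp add: nn_integral_eq_integral[OF g'int])
  have eq: "(\<lambda>z. S' z * fker s z) = (\<lambda>z. g' z - m z)" by (auto simp: g'_def)
  show "integrable lborel (\<lambda>z. S' z * fker s z)" unfolding eq by (intro Bochner_Integration.integrable_diff g'int m)
  show "(LINT z|lborel. S' z * fker s z) \<le> a'" unfolding eq using C
    by (subst Bochner_Integration.integral_diff[OF g'int m]) auto
qed

text \<open>Continuous convergence: values are followed along moving points, as is required at
  varying test points and their translates. For families with a common modulus of continuity it
  follows from pointwise convergence.\<close>

definition cconv :: "(nat \<Rightarrow> 'a::metric_space \<Rightarrow> real) \<Rightarrow> ('a \<Rightarrow> real) \<Rightarrow> bool" where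
  "cconv U u \<longleftrightarrow> (\<forall>X x. X \<longlonglongrightarrow> x \<longrightarrow> (\<lambda>j. U j (X j)) \<longlonglongrightarrow> u x)"

lemma cconvD: "cconv U u \<Longrightarrow> X \<longlonglongrightarrow> x \<Longrightarrow> (\<lambda>j. U j (X j)) \<longlonglongrightarrow> u x"
  by (simp add: cconv_def)

lemma cconv_subseq:
  assumes c: "cconv U u" and r: "strict_mono r"
  shows "cconv (\<lambda>j. U (r j)) u"
  unfolding cconv_def
proof (intro allI impI)
  fix X :: "nat \<Rightarrow> 'a" and x assume X: "X \<longlonglongrightarrow> x"
  \<comment> \<open>\<open>X\<close> is indexed along the subsequence only; the other indices are
    filled with the limit \<open>x\<close>.\<close>
  define Y where "Y k = (if k \<in> range r then X (inv r k) else x)" for k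
  have inj: "inj r" using r by (rule strict_mono_imp_inj_on)
  have YX: "Y (r j) = X j" for j by (simp add: Y_def inv_f_f[OF inj])
  have "Y \<longlonglongrightarrow> x"
  proof (rule metric_LIMSEQ_I)
    fix e :: real assume e: "0 < e"
    then obtain N where N: "\<And>n. n \<ge> N \<Longrightarrow> dist (X n) x < e" using metric_LIMSEQ_D[OF X] by blast
    show "\<exists>no. \<forall>n\<ge>no. dist (Y n) x < e"
    proof (intro exI[of _ "r N"] allI impI)
      fix k assume k: "k \<ge> r N"
      show "dist (Y k) x < e"
      proof (cases "k \<in> range r")
        case True
        then obtain j where j: "k = r j" by blast
        then have "j \<ge> N" using k r by (simp add: strict_mono_less_eq)
        then show ?thesis using N j YX by simp
      qed (simp add: Y_def e)
    qed
  qed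
  from cconvD[OF c this] have "((\<lambda>k. U k (Y k)) \<circ> r) \<longlonglongrightarrow> u x"
    by (rule LIMSEQ_subseq_LIMSEQ[OF _ r])
  then show "(\<lambda>j. U (r j) (X j)) \<longlonglongrightarrow> u x" by (simp add: o_def YX)
qed

lemma coercive_attains_sup:
  fixes f :: "'a::euclidean_space \<Rightarrow> real"
  assumes "continuous_on UNIV f" and "\<And>x. norm (x - x0) > R \<Longrightarrow> f x \<le> f x0"
  obtains x where "\<And>y. f y \<le> f x"
proof -
  have "\<exists>x\<in>cball x0 \<bar>R\<bar>. \<forall>y\<in>cball x0 \<bar>R\<bar>. f y \<le> f x"
    by (rule continuous_attains_sup) (auto intro: continuous_on_subset[OF assms(1)])
  then obtain x where x: "x \<in> cball x0 \<bar>R\<bar>" "\<And>y. y \<in> cball x0 \<bar>R\<bar> \<Longrightarrow> f y \<le> f x" by blast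
  have "f y \<le> f x" for y
  proof (cases "y \<in> cball x0 \<bar>R\<bar>")
    case False
    then have "f y \<le> f x0" by (intro assms(2)) (auto simp: dist_norm norm_minus_commute)
    also have "\<dots> \<le> f x" by (rule x(2)) simp
    finally show ?thesis .
  qed (rule x(2))
  then show ?thesis by (rule that)
qed

text \<open>Gives an explicit radius, the same for all \<open>K \<ge> 1\<close>, within which the
  maxima of perturbed functions must lie.\<close>

lemma quadratic_bound:
  fixes t :: real
  assumes "K \<ge> 1" "0 \<le> t" "K * t\<^sup>2 \<le> B + c * t" "B \<ge> 0" "c \<ge> 0"
  shows "t \<le> B + c + 1"
proof (rule ccontr)
  assume "\<not> t \<le> B + c + 1"
  then have t: "t > B + c + 1" by simp
  have "1 * (t * t) \<le> K * (t * t)" using assms by (intro mult_right_mono) auto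
  moreover have "(B + c + 1) * t \<le> t * t" using t assms by (intro mult_right_mono) auto
  moreover have "B * 1 \<le> B * t" using t assms by (intro mult_left_mono) auto
  moreover have "(B + c + 1) * t = B * t + c * t + t" by (simp add: algebra_simps)
  ultimately have "t \<le> 0" using assms(3) unfolding power2_eq_square by linarith
  then show False using t assms by linarith
qed

text \<open>One constant serves the quadratic bound for small \<open>z\<close> and the bound by the
  oscillation for large \<open>z\<close>; the result is the minorant expected by
  \<open>fatou_fker\<close>.\<close>

lemma sdiff_lower_bound:
  assumes M: "\<And>x. \<bar>u x\<bar> \<le> M" and q: "\<And>z. - (2 * K * (norm z)\<^sup>2) \<le> sdiff u x z" and K: "K \<ge> 0"
  shows "- ((4 * M + 2 * K) * min 1 ((norm z)\<^sup>2)) \<le> sdiff u x z"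
proof -
  have M0: "M \<ge> 0" using M[of x] by linarith
  have 1: "- (4 * M) \<le> sdiff u x z" unfolding sdiff_def using M[of x] M[of "x + z"] M[of "x - z"] by linarith
  show ?thesis
  proof (cases "(norm z)\<^sup>2 \<le> 1")
    case True
    have "0 \<le> M * (norm z)\<^sup>2" using M0 by simp
    then show ?thesis using True q[of z] by (simp add: min_def algebra_simps)
  next
    case False
    then show ?thesis using 1 K by (simp add: min_def)
  qed
qed

text \<open>Once the touching paraboloid is made strict, the maximum points of \<open>u j\<close>
  minus this paraboloid converge to \<open>x\<close>. There \<open>u j\<close> is touched from above
  with an opening common to all \<open>j\<close>, so the inequalities at these points pass to the
  limit by Fatou.\<close>

lemma fsub_limit:
  fixes u :: "nat \<Rightarrow> 'a::euclidean_space \<Rightarrow> real"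
  assumes s: "0 < s" "s < 1" and cont: "\<And>j. continuous_on UNIV (u j)" and M: "\<And>j x. \<bar>u j x\<bar> \<le> M"
    and conv: "cconv u u'" and f: "\<And>X x. x \<in> A' \<Longrightarrow> X \<longlonglongrightarrow> x \<Longrightarrow> (\<lambda>j. f j (X j)) \<longlonglongrightarrow> f' x"
    and A: "\<And>X x. x \<in> A' \<Longrightarrow> X \<longlonglongrightarrow> x \<Longrightarrow> \<forall>\<^sub>F j in sequentially. X j \<in> A j"
    and sub: "\<And>j. fsub s (A j) (f j) (u j)"
  shows "fsub s A' f' u'"
  unfolding fsub_def
proof (intro ballI allI impI)
  fix x b K assume x: "x \<in> A'" and "\<forall>z. u' (x + z) \<le> u' x + b \<bullet> z + K * (norm z)\<^sup>2"
  then have touch: "u' (x + z) \<le> u' x + b \<bullet> z + K * (norm z)\<^sup>2" for z by blast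
  \<comment> \<open>The added 1 makes \<open>x\<close> the only point of contact with the limit
    function; the absolute value makes \<open>h j\<close> coercive.\<close>
  define K' where "K' = \<bar>K\<bar> + 1"
  have M0: "M \<ge> 0" using M[of 0 0] by linarith
  define h where "h j y = u j y - b \<bullet> (y - x) - K' * (norm (y - x))\<^sup>2" for j y
  define R where "R = 2 * M + norm b + 1"
  have hR: "norm (y - x) \<le> R" if "h j y \<ge> h j x" for j y
    unfolding R_def
  proof (rule quadratic_bound)
    show "K' * (norm (y - x))\<^sup>2 \<le> 2 * M + norm b * norm (y - x)"
      using that M[of j x] M[of j y] Cauchy_Schwarz_ineq2[of b "y - x"] unfolding h_def by simp
  qed (use M0 in \<open>auto simp: K'_def\<close>)
  have "\<exists>y. \<forall>w. h j w \<le> h j y" for j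
  proof -
    have "continuous_on UNIV (h j)" unfolding h_def by (intro continuous_intros cont)
    from coercive_attains_sup[OF this, where ?x0.0=x and R=R] hR[of j] show ?thesis by (metis linorder_not_le nle_le)
  qed
  then obtain X where X: "\<And>j w. h j w \<le> h j (X j)" by metis
  have XR: "norm (X j - x) \<le> R" for j by (rule hR) (rule X)
  \<comment> \<open>Otherwise a subsequence of the maximum points stays away from \<open>x\<close>
    and, being bounded, has a limit point which is a second point of contact.\<close>
  have "X \<longlonglongrightarrow> x"
  proof (rule ccontr)
    assume "\<not> X \<longlonglongrightarrow> x"
    then obtain e where e: "e > 0" "\<And>N. \<exists>n\<ge>N. dist (X n) x \<ge> e"
      unfolding lim_sequentially by (auto simp: not_less)
    then have inf: "infinite {n. dist (X n) x \<ge> e}"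
      by (auto simp: infinite_nat_iff_unbounded_le)
    define r where "r = enumerate {n. dist (X n) x \<ge> e}"
    have r: "strict_mono r" "\<And>n. dist (X (r n)) x \<ge> e"
      unfolding r_def using strict_mono_enumerate[OF inf] enumerate_in_set[OF inf] by auto
    have "compact (cball x R)" by simp
    moreover have "\<forall>n. X (r n) \<in> cball x R" using XR by (simp add: dist_norm norm_minus_commute)
    ultimately obtain y r' where r': "strict_mono r'" "(\<lambda>n. X (r (r' n))) \<longlonglongrightarrow> y"
      unfolding compact_def o_def by (drule_tac spec[of _ "\<lambda>n. X (r n)"]) blast
    have rr: "strict_mono (\<lambda>n. r (r' n))" using r(1) r'(1) by (simp add: strict_mono_def)
    have 1: "(\<lambda>n. u (r (r' n)) (X (r (r' n)))) \<longlonglongrightarrow> u' y"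
      using cconvD[OF cconv_subseq[OF conv rr] r'(2)] .
    have 2: "(\<lambda>n. u (r (r' n)) x) \<longlonglongrightarrow> u' x"
      using cconvD[OF cconv_subseq[OF conv rr] tendsto_const] .
    have "(\<lambda>n. h (r (r' n)) (X (r (r' n)))) \<longlonglongrightarrow> u' y - b \<bullet> (y - x) - K' * (norm (y - x))\<^sup>2"
      unfolding h_def by (intro tendsto_intros 1 r'(2))
    moreover have "(\<lambda>n. h (r (r' n)) x) \<longlonglongrightarrow> u' x"
      unfolding h_def using 2 by simp
    ultimately have "u' x \<le> u' y - b \<bullet> (y - x) - K' * (norm (y - x))\<^sup>2"
      using X by (intro LIMSEQ_le[where X="\<lambda>n. h (r (r' n)) x"]) auto
    moreover have "u' y \<le> u' x + b \<bullet> (y - x) + K * (norm (y - x))\<^sup>2" using touch[of "y - x"] by simp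
    ultimately have "(K' - K) * (norm (y - x))\<^sup>2 \<le> 0" unfolding left_diff_distrib by linarith
    moreover have "1 * (norm (y - x))\<^sup>2 \<le> (K' - K) * (norm (y - x))\<^sup>2"
      by (intro mult_right_mono) (auto simp: K'_def)
    ultimately have "(norm (y - x))\<^sup>2 \<le> 0" by linarith
    then have "y = x" by simp
    moreover have "e \<le> dist y x"
      by (rule LIMSEQ_le_const[OF tendsto_dist[OF r'(2) tendsto_const]]) (use r(2) in auto)
    ultimately show False using e by simp
  qed
  have touchX: "u j (X j + z) \<le> u j (X j) + (b + (2 * K') *\<^sub>R (X j - x)) \<bullet> z + K' * (norm z)\<^sup>2" for j z
  proof -
    have eq: "X j + z - x = X j - x + z" by simp
    have "(norm (X j - x + z))\<^sup>2 = (norm (X j - x))\<^sup>2 + 2 * ((X j - x) \<bullet> z) + (norm z)\<^sup>2"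
      using dot_norm[of "X j - x" z] by simp
    then have "K' * (norm (X j + z - x))\<^sup>2 = K' * (norm (X j - x))\<^sup>2 + 2 * K' * ((X j - x) \<bullet> z) + K' * (norm z)\<^sup>2"
      unfolding eq by (simp only: distrib_left mult.assoc mult.left_commute)
    then show ?thesis using X[of j "X j + z"] unfolding h_def
      by (simp add: inner_add_left inner_add_right inner_diff_right)
  qed
  have q: "- (2 * K' * (norm z)\<^sup>2) \<le> sdiff (u j) (X j) z" for j z
    using touchX[of j z] touchX[of j "- z"] unfolding sdiff_def by simp
  obtain N where N: "\<And>j. j \<ge> N \<Longrightarrow> X j \<in> A j"
    using A[OF x \<open>X \<longlonglongrightarrow> x\<close>] by (auto simp: eventually_sequentially)
  have I: "integrable lborel (\<lambda>z. sdiff (u (j + N)) (X (j + N)) z * fker s z)"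
    "(LINT z|lborel. sdiff (u (j + N)) (X (j + N)) z * fker s z) \<le> f (j + N) (X (j + N))" for j
    using fsubD[OF sub N touchX] by auto
  have low: "- ((4 * M + 2 * K') * min 1 ((norm z)\<^sup>2)) \<le> sdiff (u (j + N)) (X (j + N)) z" for j z
    by (rule sdiff_lower_bound[OF M q]) (simp add: K'_def)
  have l: "(\<lambda>j. sdiff (u (j + N)) (X (j + N)) z) \<longlonglongrightarrow> sdiff u' x z" for z
    unfolding sdiff_def
    by (intro LIMSEQ_ignore_initial_segment[where f="\<lambda>j. 2 * u j (X j) - u j (X j + z)
        - u j (X j - z)"] tendsto_intros cconvD[OF conv] \<open>X \<longlonglongrightarrow> x\<close>)
  have l2: "(\<lambda>j. f (j + N) (X (j + N))) \<longlonglongrightarrow> f' x"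
    by (rule LIMSEQ_ignore_initial_segment[OF f[OF x \<open>X \<longlonglongrightarrow> x\<close>]])
  show "integrable lborel (\<lambda>z. sdiff u' x z * fker s z) \<and> (LINT z|lborel. sdiff u' x z * fker s z) \<le> f' x"
    using fatou_fker[OF s I(1) low l I(2) l2] by blast
qed

text \<open>
  The sum is touched from above, but not the summands. Maximizing
  \<open>u y + w z - (paraboloid) - j * (norm (y - z))\<^sup>2\<close> produces points near \<open>x\<close> at which both are touched.
\<close>

lemma fsub_add:
  fixes u w :: "'a::euclidean_space \<Rightarrow> real"
  assumes s: "0 < s" "s < 1" and cont: "continuous_on UNIV u" "continuous_on UNIV w"
    and M: "\<And>x. \<bar>u x\<bar> \<le> M" "\<And>x. \<bar>w x\<bar> \<le> M" and A: "open A"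
    and fg: "continuous_on A f" "continuous_on A g"
    and sub: "fsub s A f u" "fsub s A g w"
  shows "fsub s A (\<lambda>x. f x + g x) (\<lambda>x. u x + w x)"
  unfolding fsub_def
proof (intro ballI allI impI)
  fix x b K assume x: "x \<in> A" and "\<forall>z. u (x + z) + w (x + z) \<le> u x + w x + b \<bullet> z + K * (norm z)\<^sup>2"
  then have touch: "u (x + z) + w (x + z) \<le> u x + w x + b \<bullet> z + K * (norm z)\<^sup>2" for z by blast
  define K' where "K' = \<bar>K\<bar> + 1"
  have M0: "M \<ge> 0" using M(1)[of 0] by linarith
  define h where "h j p = u (fst p) + w (snd p) - b \<bullet> (fst p - x) - K' * (norm (fst p - x))\<^sup>2 - real j
      * (norm (fst p - snd p))\<^sup>2"
    for j :: nat and p :: "'a \<times> 'a"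
  define R where "R = 4 * M + norm b + 1"
  have cs: "b \<bullet> v \<ge> - (norm b * norm v)" for v using Cauchy_Schwarz_ineq2[of b v] by linarith
  have hb: "K' * (norm (fst p - x))\<^sup>2 + real j * (norm (fst p - snd p))\<^sup>2 \<le> 4 * M + norm b * norm (fst p - x)"
    if "h j p \<ge> h j (x, x)" for j p
    using that M(1)[of x] M(1)[of "fst p"] M(2)[of x] M(2)[of "snd p"] cs[of "fst p - x"] unfolding h_def by simp
  have hR: "norm (fst p - x) \<le> R" if "h j p \<ge> h j (x, x)" for j p
    unfolding R_def
  proof (rule quadratic_bound)
    have "0 \<le> real j * (norm (fst p - snd p))\<^sup>2" by simp
    then show "K' * (norm (fst p - x))\<^sup>2 \<le> 4 * M + norm b * norm (fst p - x)"
      using hb[OF that] by linarith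
  qed (use M0 in \<open>auto simp: K'_def\<close>)
  have hj: "real j * (norm (fst p - snd p))\<^sup>2 \<le> 4 * M + norm b * R" if "h j p \<ge> h j (x, x)" for j p
  proof -
    have "norm b * norm (fst p - x) \<le> norm b * R" by (intro mult_left_mono hR[OF that]) auto
    moreover have "0 \<le> K' * (norm (fst p - x))\<^sup>2" by (simp add: K'_def)
    ultimately show ?thesis using hb[OF that] by linarith
  qed
  have R0: "R \<ge> 0" using M0 by (simp add: R_def)
  define Q where "Q = R + (4 * M + norm b * R + 1)"
  have "\<exists>p. \<forall>q. h (Suc j) q \<le> h (Suc j) p" for j
  proof -
    have "continuous_on UNIV (h (Suc j))" unfolding h_def
      by (intro continuous_intros continuous_on_compose2[OF cont(1)] continuous_on_compose2[OF cont(2)]) auto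
    moreover have "h (Suc j) p \<le> h (Suc j) (x, x)" if p: "norm (p - (x, x)) > R + Q" for p
    proof (rule ccontr)
      assume "\<not> h (Suc j) p \<le> h (Suc j) (x, x)"
      then have ge: "h (Suc j) p \<ge> h (Suc j) (x, x)" by simp
      have "1 * (norm (fst p - snd p))\<^sup>2 \<le> real (Suc j) * (norm (fst p - snd p))\<^sup>2" by (intro mult_right_mono) auto
      with hj[OF ge] have "1 * (norm (fst p - snd p))\<^sup>2 \<le> (4 * M + norm b * R) + 0 * norm (fst p - snd p)" by simp
      then have "norm (fst p - snd p) \<le> (4 * M + norm b * R) + 0 + 1"
        using M0 R0 by (intro quadratic_bound) auto
      moreover have "norm (snd p - x) \<le> norm (fst p - x) + norm (fst p - snd p)"
        using norm_triangle_ineq4[of "fst p - x" "fst p - snd p"] by simp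
      moreover have "norm (p - (x, x)) \<le> norm (fst p - x) + norm (snd p - x)"
        using norm_Pair_le[of "fst p - x" "snd p - x"] by (cases p) simp
      ultimately show False using hR[OF ge] p by (simp add: Q_def)
    qed
    ultimately show ?thesis using coercive_attains_sup[where f="h (Suc j)" and ?x0.0="(x, x)" and R="R + Q"] by metis
  qed
  then obtain P where P: "\<And>j q. h (Suc j) q \<le> h (Suc j) (P j)" by metis
  define X Y where "X j = fst (P j)" and "Y j = snd (P j)" for j
  have XYj: "(norm (X j - Y j))\<^sup>2 \<le> (4 * M + norm b * R) / real (Suc j)" for j
    using hj[OF P, of j] unfolding X_def Y_def by (simp add: field_simps)
  have XYs: "(\<lambda>j. X j - Y j) \<longlonglongrightarrow> 0"
  proof -
    have "(\<lambda>j. (4 * M + norm b * R) / real (Suc j)) \<longlonglongrightarrow> 0"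
      by (rule LIMSEQ_Suc) (rule lim_const_over_n)
    then have "(\<lambda>j. (norm (X j - Y j))\<^sup>2) \<longlonglongrightarrow> 0"
      by (rule real_tendsto_sandwich[OF _ _ tendsto_const, rotated 2]) (use XYj in auto)
    then have "(\<lambda>j. sqrt ((norm (X j - Y j))\<^sup>2)) \<longlonglongrightarrow> sqrt 0" by (intro tendsto_intros)
    then show ?thesis by (simp add: tendsto_norm_zero_iff)
  qed
  have XR: "norm (X j - x) \<le> R" for j unfolding X_def by (rule hR) (rule P)
  \<comment> \<open>The maximum is compared with the value at \<open>(x, x)\<close> and with the
    touching of the sum. What remains is the increment of \<open>w\<close> between two points
    already known to approach each other.\<close>
  have Xx: "(norm (X j - x))\<^sup>2 \<le> w (Y j) - w (X j)" for j
  proof -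
    have "0 \<le> real (Suc j) * (norm (X j - Y j))\<^sup>2" by simp
    then have "u x + w x + b \<bullet> (X j - x) + K' * (norm (X j - x))\<^sup>2 \<le> u (X j) + w (Y j)"
      using P[of j "(x, x)"] unfolding h_def X_def Y_def fst_conv snd_conv diff_self norm_zero inner_zero_right
        zero_power2 mult_zero_right
      by linarith
    moreover have "u (X j) + w (X j) \<le> u x + w x + b \<bullet> (X j - x) + K * (norm (X j - x))\<^sup>2"
      using touch[of "X j - x"] by simp
    ultimately have "(K' - K) * (norm (X j - x))\<^sup>2 \<le> w (Y j) - w (X j)" unfolding left_diff_distrib by linarith
    moreover have "1 * (norm (X j - x))\<^sup>2 \<le> (K' - K) * (norm (X j - x))\<^sup>2"
      by (intro mult_right_mono) (auto simp: K'_def)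
    ultimately show ?thesis by simp
  qed
  have uc: "uniformly_continuous_on (cball x (R + 1)) w"
    by (intro compact_uniformly_continuous continuous_on_subset[OF cont(2)]) auto
  have XC: "\<forall>\<^sub>F j in sequentially. X j \<in> cball x (R + 1)"
    using XR R0 by (auto simp: dist_norm norm_minus_commute intro!: always_eventually add_increasing2)
  have YC: "\<forall>\<^sub>F j in sequentially. Y j \<in> cball x (R + 1)"
  proof -
    have "\<forall>\<^sub>F j in sequentially. norm (X j - Y j) < 1"
      using XYs by (auto simp: tendsto_iff)
    then show ?thesis
    proof eventually_elim
      case (elim j)
      have "norm (Y j - x) \<le> norm (X j - x) + norm (X j - Y j)"
        using norm_triangle_ineq4[of "X j - x" "X j - Y j"] by simp
      then show ?case using elim XR[of j] by (simp add: dist_norm norm_minus_commute)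
    qed
  qed
  have dXY: "(\<lambda>j. dist (Y j) (X j)) \<longlonglongrightarrow> 0"
    using tendsto_norm_zero[OF XYs] by (simp add: dist_norm norm_minus_commute)
  have "(\<lambda>j. dist (w (Y j)) (w (X j))) \<longlonglongrightarrow> 0"
  proof (rule tendstoI)
    fix e :: real assume "e > 0"
    then obtain d where d: "d > 0" "\<And>y z. y \<in> cball x (R + 1) \<Longrightarrow> z \<in> cball x (R + 1) \<Longrightarrow> dist z y < d \<Longrightarrow>
        dist (w z) (w y) < e"
      using uc unfolding uniformly_continuous_on_def by metis
    show "\<forall>\<^sub>F j in sequentially. dist (dist (w (Y j)) (w (X j))) 0 < e"
      using XC YC tendstoD[OF dXY d(1)] by eventually_elim (use d(2) in auto)
  qed
  then have "(\<lambda>j. (norm (X j - x))\<^sup>2) \<longlonglongrightarrow> 0"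
    by (rule real_tendsto_sandwich[OF _ _ tendsto_const, rotated 2])
       (use Xx in \<open>auto simp: dist_real_def intro!: always_eventually order_trans[OF Xx]\<close>)
  then have "(\<lambda>j. sqrt ((norm (X j - x))\<^sup>2)) \<longlonglongrightarrow> sqrt 0" by (intro tendsto_intros)
  then have Xl: "X \<longlonglongrightarrow> x" using LIM_zero_iff[of X x] by (simp add: tendsto_norm_zero_iff)
  have Yl: "Y \<longlonglongrightarrow> x" using tendsto_diff[OF Xl XYs] by simp
  have sq: "(norm (v + z))\<^sup>2 = (norm v)\<^sup>2 + 2 * (v \<bullet> z) + (norm z)\<^sup>2" for v z :: 'a
    using dot_norm[of v z] by simp
  have ksq: "c * (norm (v + z))\<^sup>2 = c * (norm v)\<^sup>2 + 2 * c * (v \<bullet> z) + c * (norm z)\<^sup>2" for c and v z :: 'a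
    unfolding sq by (simp only: distrib_left mult.assoc mult.left_commute)
  have touchX: "u (X j + z) \<le> u (X j) + (b + (2 * K') *\<^sub>R (X j - x) + (2 * real (Suc j)) *\<^sub>R (X j - Y j)) \<bullet> z
       + (K' + real (Suc j)) * (norm z)\<^sup>2" for j z
  proof -
    have e: "X j + z - x = X j - x + z" "X j + z - Y j = X j - Y j + z" by simp_all
    show ?thesis
      using P[of j "(X j + z, Y j)"] ksq[of K' "X j - x" z] ksq[of "real (Suc j)" "X j - Y j" z]
      unfolding h_def X_def[symmetric] Y_def[symmetric] fst_conv snd_conv e inner_add_right[of b]
        inner_add_left[of _ _ z] inner_scaleR_left distrib_right
      by linarith
  qed
  have touchY: "w (Y j + z) \<le> w (Y j) + ((2 * real (Suc j)) *\<^sub>R (Y j - X j)) \<bullet> z + real (Suc j) * (norm z)\<^sup>2" for j z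
  proof -
    have e: "Y j + z - X j = Y j - X j + z" by simp
    show ?thesis
      using P[of j "(X j, Y j + z)"] ksq[of "real (Suc j)" "Y j - X j" z]
      unfolding h_def X_def[symmetric] Y_def[symmetric] fst_conv snd_conv norm_minus_commute[of "X j"] e
        inner_scaleR_left
      by linarith
  qed
  define S where "S j z = sdiff u (X j) z + sdiff w (Y j) z" for j z
  \<comment> \<open>Each summand is touched with an opening growing with \<open>j\<close>, which
    gives no uniform bound. Shifting both points by the same \<open>z\<close> leaves the penalty
    unchanged, so the sum of the second differences is bounded below independently of
    \<open>j\<close>.\<close>
  have low: "- ((8 * M + 2 * K') * min 1 ((norm z)\<^sup>2)) \<le> S j z" for j z
  proof -
    have 1: "u (X j + z) + w (Y j + z) - u (X j) - w (Y j) \<le> b \<bullet> z + 2 * K' * ((X j - x) \<bullet> z) + K' * (norm z)\<^sup>2" for z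
    proof -
      have e: "X j + z - x = X j - x + z" "X j + z - (Y j + z) = X j - Y j" by simp_all
      show ?thesis using P[of j "(X j + z, Y j + z)"] ksq[of K' "X j - x" z]
        unfolding h_def X_def[symmetric] Y_def[symmetric] fst_conv snd_conv e inner_add_right[of b] by linarith
    qed
    have 2: "- (2 * K' * (norm z)\<^sup>2) \<le> S j z"
      using 1[of z] 1[of "- z"] unfolding S_def sdiff_def by simp
    have 3: "- (8 * M) \<le> S j z" unfolding S_def sdiff_def
      using M(1)[of "X j"] M(1)[of "X j + z"] M(1)[of "X j - z"] M(2)[of "Y j"] M(2)[of "Y j + z"] M(2)[of "Y j - z"]
      by linarith
    have "0 \<le> M * (norm z)\<^sup>2" "0 \<le> K'" using M0 by (auto simp: K'_def)
    then show ?thesis using 2 3 by (simp add: min_def algebra_simps)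
  qed
  obtain N where N: "\<And>j. j \<ge> N \<Longrightarrow> X j \<in> A \<and> Y j \<in> A"
    using eventually_conj[OF topological_tendstoD[OF Xl A x] topological_tendstoD[OF Yl A x]]
    by (auto simp: eventually_sequentially)
  have I: "integrable lborel (\<lambda>z. S (j + N) z * fker s z)"
    "(LINT z|lborel. S (j + N) z * fker s z) \<le> f (X (j + N)) + g (Y (j + N))" for j
    using fsubD[OF sub(1) _ touchX, of "j + N"] fsubD[OF sub(2) _ touchY, of "j + N"] N[of "j + N"]
    unfolding S_def distrib_right by (auto simp: Bochner_Integration.integral_add)
  have l: "(\<lambda>j. S (j + N) z) \<longlonglongrightarrow> sdiff (\<lambda>x. u x + w x) x z" for z
  proof (rule LIMSEQ_ignore_initial_segment)
    have "(\<lambda>j. S j z) \<longlonglongrightarrow> sdiff u x z + sdiff w x z" unfolding S_def sdiff_def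
      by (intro tendsto_intros continuous_on_tendsto_compose[OF cont(1)] continuous_on_tendsto_compose[OF cont(2)] Xl
        Yl) auto
    then show "(\<lambda>j. S j z) \<longlonglongrightarrow> sdiff (\<lambda>x. u x + w x) x z" by (simp add: sdiff_def algebra_simps)
  qed
  have l2: "(\<lambda>j. f (X (j + N)) + g (Y (j + N))) \<longlonglongrightarrow> f x + g x"
  proof -
    have "isCont f x" "isCont g x"
      using fg x A by (auto simp: continuous_on_eq_continuous_at)
    then have "(\<lambda>j. f (X j)) \<longlonglongrightarrow> f x" "(\<lambda>j. g (Y j)) \<longlonglongrightarrow> g x"
      using Xl Yl by (auto intro: isCont_tendsto_compose)
    then show ?thesis by (intro tendsto_add LIMSEQ_ignore_initial_segment)
  qed
  show "integrable lborel (\<lambda>z. sdiff (\<lambda>x. u x + w x) x z * fker s z) \<and>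
       (LINT z|lborel. sdiff (\<lambda>x. u x + w x) x z * fker s z) \<le> f x + g x"
    using fatou_fker[OF s I(1) low l I(2) l2] by blast
qed

section \<open>Viscosity solutions and the integral inequalities\<close>

lemma AE_lborel_open:
  fixes U :: "'a::euclidean_space set"
  assumes "open U" "U \<noteq> {}" "AE x in lborel. P x"
  shows "\<exists>x\<in>U. P x"
proof (rule ccontr)
  assume n: "\<not> (\<exists>x\<in>U. P x)"
  from assms(3) obtain N where N: "N \<in> null_sets lborel" "{x. \<not> P x} \<subseteq> N"
    by (auto elim!: AE_E simp: null_sets_def)
  have "N \<in> null_sets lebesgue" using N(1) by (rule null_sets_completionI)
  then have "negligible N" by (simp add: negligible_iff_null_sets)
  then have "negligible U" by (rule negligible_subset) (use n N in auto)
  then show False using open_not_negligible[OF assms(1,2)] by simp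
qed

lemma one_minus_cos_le: "1 - cos x \<le> 2 * min 1 ((x::real)\<^sup>2)"
proof -
  have "(sin (x/2))\<^sup>2 = \<bar>sin (x/2)\<bar>\<^sup>2" by simp
  also have "\<dots> \<le> \<bar>x/2\<bar>\<^sup>2" by (intro power_mono abs_sin_x_le_abs_x) auto
  finally have "1 - cos x \<le> x\<^sup>2 / 2" using cos_double_sin[of "x/2"] by (simp add: power_divide)
  moreover have "1 - cos x \<le> 2" using cos_ge_minus_one[of x] by linarith
  moreover have "1 - cos x \<le> 2 * x\<^sup>2"
    using \<open>1 - cos x \<le> x\<^sup>2 / 2\<close> zero_le_power2[of x] by linarith
  ultimately show ?thesis by (simp add: min_def)
qed

text \<open>The integrand is nonnegative and positive on a ball. Integrability matters too: without
  it the integral, and hence its inverse, would be 0 by convention.\<close>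

lemma frac_const_pos:
  assumes s: "0 < s" "s < 1"
  shows "frac_const TYPE('n::{finite,linorder}) s > 0"
proof -
  let ?i = "Min UNIV :: 'n"
  let ?f = "\<lambda>z::real^'n::_. (1 - cos (z $ ?i)) * fker s z"
  have eq: "(\<lambda>\<zeta>::real^'n::_. (1 - cos (\<zeta> $ ?i)) / norm \<zeta> powr (real CARD('n) + 2 * s)) = ?f"
    by (simp add: fker_def powr_minus_divide fun_eq_iff del: minus_add_distrib)
  have m: "integrable lborel (\<lambda>z::real^'n::_. 2 * (min 1 ((norm z)\<^sup>2) * fker s z))"
    by (intro integrable_mult_right integrable_fker_min s)
  have le: "?f z \<le> 2 * (min 1 ((norm z)\<^sup>2) * fker s z)" for z
  proof -
    have "(z $ ?i)\<^sup>2 \<le> (norm z)\<^sup>2" using component_le_norm_cart[of z ?i] by (metis abs_le_square_iff abs_norm_cancel)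
    then have "1 - cos (z $ ?i) \<le> 2 * min 1 ((norm z)\<^sup>2)" using one_minus_cos_le[of "z $ ?i"] by linarith
    then show ?thesis using mult_right_mono[OF _ fker_nonneg] by (metis mult.assoc)
  qed
  have int: "integrable lborel ?f"
    by (rule Bochner_Integration.integrable_bound[OF m]) (use le in \<open>auto intro!: AE_I2\<close>)
  have "integral\<^sup>L lborel ?f \<noteq> 0"
  proof
    assume "integral\<^sup>L lborel ?f = 0"
    then have "AE z in lborel. ?f z = 0"
      using integral_nonneg_eq_0_iff_AE[OF int] by simp
    moreover have "open (ball (axis ?i 1 :: real^'n::_) 1)" "ball (axis ?i 1 :: real^'n::_) 1 \<noteq> {}" by simp_all
    ultimately obtain z :: "real^'n::_" where z: "z \<in> ball (axis ?i 1) 1" "?f z = 0"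
      using AE_lborel_open by blast
    have "\<bar>(axis ?i 1 - z) $ ?i\<bar> < 1"
      using component_le_norm_cart[of "axis ?i 1 - z" ?i] z(1) by (simp add: dist_norm)
    then have zi: "0 < z $ ?i" "z $ ?i < 2" by (auto simp: abs_less_iff)
    then have "cos (z $ ?i) < 1"
      using cos_monotone_0_pi[of 0 "z $ ?i"] pi_gt3 by simp
    moreover have "z \<noteq> 0" using zi by auto
    ultimately show False using z(2) fker_pos[of z s] by simp
  qed
  moreover have "integral\<^sup>L lborel ?f \<ge> 0" by (intro Bochner_Integration.integral_nonneg) simp
  ultimately have "integral\<^sup>L lborel ?f > 0" by linarith
  then show ?thesis unfolding frac_const_def eq by simp
qed

section \<open>Construction of smooth test functions\<close>

definition C2_fun :: "(real ^ 'n \<Rightarrow> real) \<Rightarrow> bool" where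
  "C2_fun \<phi> \<longleftrightarrow> (\<exists>(D :: real ^ 'n \<Rightarrow> real ^ 'n) (H :: real ^ 'n \<Rightarrow> real ^ 'n ^ 'n).
        continuous_on UNIV H \<and> (\<forall>x. (\<phi> has_derivative (\<lambda>h. D x \<bullet> h)) (at x)) \<and>
        (\<forall>x. (D has_derivative (\<lambda>h. H x *v h)) (at x)))"

lemma C2_fun_imp_C2_closure: "C2_fun \<phi> \<Longrightarrow> C2_closure U \<phi>"
proof -
  assume "C2_fun \<phi>"
  then obtain D H where H: "continuous_on UNIV H" and \<phi>: "\<And>x. (\<phi> has_derivative (\<lambda>h. D x \<bullet> h)) (at x)"
    and D: "\<And>x. (D has_derivative (\<lambda>h. H x *v h)) (at x)" unfolding C2_fun_def by blast
  have "continuous_on UNIV \<phi>" by (rule has_derivative_continuous_on[where f'="\<lambda>x h. D x \<bullet> h"]) (use \<phi> in auto)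
  moreover have "continuous_on UNIV D" by (rule has_derivative_continuous_on[where f'="\<lambda>x h. H x *v h"])
    (use D in auto)
  ultimately show ?thesis unfolding C2_closure_def using H \<phi> D
    by (intro conjI exI[of _ D] exI[of _ H] ballI) (auto intro: continuous_on_subset)
qed

lemma C2_fun_const: "C2_fun (\<lambda>_. c)"
  unfolding C2_fun_def
  by (rule exI[of _ "\<lambda>_. 0"], rule exI[of _ "\<lambda>_. 0"]) (auto intro!: derivative_eq_intros)

lemma C2_fun_inner: "C2_fun (\<lambda>x. b \<bullet> x)"
  unfolding C2_fun_def
  by (rule exI[of _ "\<lambda>_. b"], rule exI[of _ "\<lambda>_. 0"]) (auto intro!: derivative_eq_intros)

lemma C2_fun_add: 
  assumes "C2_fun \<phi>" "C2_fun \<psi>" shows "C2_fun (\<lambda>x. \<phi> x + \<psi> x)"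
proof -
  from assms obtain D H E K where "continuous_on UNIV H" "\<forall>x. (\<phi> has_derivative (\<lambda>h. D x \<bullet> h)) (at x)"
    "\<forall>x. (D has_derivative (\<lambda>h. H x *v h)) (at x)"
    "continuous_on UNIV K" "\<forall>x. (\<psi> has_derivative (\<lambda>h. E x \<bullet> h)) (at x)"
    "\<forall>x. (E has_derivative (\<lambda>h. K x *v h)) (at x)" unfolding C2_fun_def by metis
  note DH = this
  show ?thesis unfolding C2_fun_def
  proof (intro exI[of _ "\<lambda>x. D x + E x"] exI[of _ "\<lambda>x. H x + K x"] conjI allI)
    show "continuous_on UNIV (\<lambda>x. H x + K x)" using DH by (intro continuous_intros)
    fix x
    show "((\<lambda>x. \<phi> x + \<psi> x) has_derivative (\<bullet>) (D x + E x)) (at x)"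
    proof -
      have eq: "(\<bullet>) (D x + E x) = (\<lambda>h. D x \<bullet> h + E x \<bullet> h)" by (simp add: fun_eq_iff inner_add_left)
      show ?thesis unfolding eq using DH by (intro has_derivative_add) auto
    qed
    show "((\<lambda>x. D x + E x) has_derivative (*v) (H x + K x)) (at x)"
    proof -
      have eq: "(*v) (H x + K x) = (\<lambda>h. H x *v h + K x *v h)"
        by (simp add: fun_eq_iff matrix_vector_mult_add_rdistrib)
      show ?thesis unfolding eq using DH by (intro has_derivative_add) auto
    qed
  qed
qed

lemma C2_fun_compose:
  fixes h h' h'' :: "real \<Rightarrow> real"
  assumes "C2_fun \<phi>" and h: "\<And>r. (h has_real_derivative h' r) (at r)" "\<And>r. (h' has_real_derivative h'' r) (at r)"
    and cont: "continuous_on UNIV h''"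
  shows "C2_fun (\<lambda>x. h (\<phi> x))"
proof -
  from assms(1) obtain D H where H: "continuous_on UNIV H" and \<phi>: "\<And>x. (\<phi> has_derivative (\<lambda>h. D x \<bullet> h)) (at x)"
    and D: "\<And>x. (D has_derivative (\<lambda>h. H x *v h)) (at x)" unfolding C2_fun_def by metis
  have c\<phi>: "continuous_on UNIV \<phi>" by (rule has_derivative_continuous_on[where f'="\<lambda>x h. D x \<bullet> h"]) (use \<phi> in auto)
  have cD: "continuous_on UNIV D" by (rule has_derivative_continuous_on[where f'="\<lambda>x h. H x *v h"]) (use D in auto)
  have ch': "continuous_on UNIV h'" by (rule DERIV_continuous_on[where D=h'']) (use h(2) in auto)
  \<comment> \<open>The Hessian of a composition has a rank-one part coming from \<open>h''\<close>
    and a multiple of the old Hessian.\<close>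
  let ?O = "\<lambda>x. (\<chi> i j. D x $ i * D x $ j) :: real^'a^'a"
  let ?K = "\<lambda>x. h'' (\<phi> x) *\<^sub>R ?O x + h' (\<phi> x) *\<^sub>R H x"
  have O: "?O x *v v = (D x \<bullet> v) *\<^sub>R D x" for x v
    by (simp add: vec_eq_iff matrix_vector_mult_def inner_vec_def sum_distrib_right sum_distrib_left mult_ac)
  have sc: "(c *\<^sub>R A) *v v = c *\<^sub>R (A *v v)" for c and A :: "real^'a^'a" and v
    by (simp add: vec_eq_iff matrix_vector_mult_def sum_distrib_left mult.assoc)
  have cO: "continuous_on UNIV ?O"
    by (intro continuous_on_vec_lambda continuous_intros cD)
  show ?thesis unfolding C2_fun_def
  proof (intro exI[of _ "\<lambda>x. h' (\<phi> x) *\<^sub>R D x"] exI[of _ ?K] conjI allI)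
    show "continuous_on UNIV ?K"
      by (intro continuous_intros cO H continuous_on_compose2[OF cont c\<phi>] continuous_on_compose2[OF ch' c\<phi>]) auto
    fix x
    have "((\<lambda>x. h (\<phi> x)) has_derivative (\<lambda>v. (D x \<bullet> v) * h' (\<phi> x))) (at x)"
      using DERIV_compose_FDERIV[OF h(1) \<phi>] .
    then show "((\<lambda>x. h (\<phi> x)) has_derivative (\<lambda>v. h' (\<phi> x) *\<^sub>R D x \<bullet> v)) (at x)"
      by (simp add: mult.commute)
    have "((\<lambda>x. h' (\<phi> x)) has_derivative (\<lambda>v. (D x \<bullet> v) * h'' (\<phi> x))) (at x)"
      using DERIV_compose_FDERIV[OF h(2) \<phi>] .
    from has_derivative_scaleR[OF this D]
    show "((\<lambda>x. h' (\<phi> x) *\<^sub>R D x) has_derivative (\<lambda>v. ?K x *v v)) (at x)"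
      by (simp add: matrix_vector_mult_add_rdistrib O sc mult.commute add.commute)
  qed
qed

lemma C2_fun_cmult: "C2_fun \<phi> \<Longrightarrow> C2_fun (\<lambda>x. c * \<phi> x)"
  by (rule C2_fun_compose[where h'="\<lambda>_. c" and h''="\<lambda>_. 0"]) (auto intro!: derivative_eq_intros)

lemma C2_fun_square: "C2_fun \<phi> \<Longrightarrow> C2_fun (\<lambda>x. (\<phi> x)\<^sup>2)"
  by (rule C2_fun_compose[where h'="\<lambda>r. 2 * r" and h''="\<lambda>_. 2"]) (auto intro!: derivative_eq_intros)

text \<open>Polarization reduces products to squares, which are compositions.\<close>

lemma C2_fun_mult:
  assumes "C2_fun \<phi>" "C2_fun \<psi>" shows "C2_fun (\<lambda>x. \<phi> x * \<psi> x)"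
proof -
  have "(\<lambda>x. \<phi> x * \<psi> x) = (\<lambda>x. (1/2) * ((\<phi> x + \<psi> x)\<^sup>2 + ((-1) * (\<phi> x)\<^sup>2 + (-1) * (\<psi> x)\<^sup>2)))"
    by (auto simp: power2_eq_square algebra_simps)
  then show ?thesis using assms
    by (simp only:) (intro C2_fun_cmult C2_fun_add C2_fun_square)
qed

lemma C2_fun_sqdist: "C2_fun (\<lambda>x. (norm (x - x0))\<^sup>2)"
  unfolding C2_fun_def power2_norm_eq_inner
proof (intro exI[of _ "\<lambda>x. 2 *\<^sub>R (x - x0)"] exI[of _ "\<lambda>_. 2 *\<^sub>R mat 1"] conjI allI)
  fix x :: "real^'a"
  show "((\<lambda>x. (x - x0) \<bullet> (x - x0)) has_derivative (\<bullet>) (2 *\<^sub>R (x - x0))) (at x)"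
    by (rule has_derivative_eq_rhs, (rule derivative_intros)+) (auto simp: inner_commute fun_eq_iff)
  have "(2 *\<^sub>R mat 1 :: real^'a^'a) *v v = 2 *\<^sub>R v" for v
    by (metis matrix_vector_mul_lid scaleR_matrix_vector_assoc)
  then have eq: "(*v) (2 *\<^sub>R mat 1 :: real^'a^'a) = (\<lambda>v. 2 *\<^sub>R v)" by blast
  show "((\<lambda>x. 2 *\<^sub>R (x - x0)) has_derivative (*v) (2 *\<^sub>R mat 1)) (at x)"
    unfolding eq by (rule has_derivative_eq_rhs, (rule derivative_intros)+) auto
qed auto

lemma C2_fun_polynomial: "real_polynomial_function f \<Longrightarrow> C2_fun f"
proof (induction rule: real_polynomial_function.induct)
  case (linear f)
  then have l: "linear f" by (rule bounded_linear.linear)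
  have "f = (\<lambda>x. (\<Sum>i\<in>Basis. f i *\<^sub>R i) \<bullet> x)"
  proof
    fix x
    have "f x = f (\<Sum>i\<in>Basis. (x \<bullet> i) *\<^sub>R i)" by (simp add: euclidean_representation)
    also have "\<dots> = (\<Sum>i\<in>Basis. (x \<bullet> i) * f i)" by (simp add: linear_sum[OF l] linear_cmul[OF l])
    finally show "f x = (\<Sum>i\<in>Basis. f i *\<^sub>R i) \<bullet> x"
      by (simp add: inner_sum_left) (intro sum.cong refl, simp add: inner_commute mult.commute)
  qed
  then show ?case by (metis C2_fun_inner)
qed (auto intro: C2_fun_const C2_fun_add C2_fun_mult)

text \<open>Away from 1 the function is a polynomial on either side; at 1 the difference quotient is
  bounded by a positive power of the distance to 1.\<close>

lemma DERIV_pos_part_power: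
  "((\<lambda>r::real. max 0 (1 - r) ^ (k + 2)) has_real_derivative - (real (k + 2) * max 0 (1 - r) ^ (k + 1))) (at r)"
proof (cases r "1::real" rule: linorder_cases)
  case less
  have "((\<lambda>r::real. (1 - r) ^ (k + 2)) has_real_derivative - (real (k + 2) * (1 - r) ^ (k + 1))) (at r)"
    by (rule derivative_eq_intros refl | simp)+
  then have "((\<lambda>r::real. max 0 (1 - r) ^ (k + 2)) has_real_derivative - (real (k + 2) * (1 - r) ^ (k + 1))) (at r)"
    by (rule has_field_derivative_transform_within_open[where S="{..<1}"]) (use less in auto)
  then show ?thesis using less by simp
next
  case greater
  have "((\<lambda>r::real. 0) has_real_derivative 0) (at r)" by simp
  then have "((\<lambda>r::real. max 0 (1 - r) ^ (k + 2)) has_real_derivative 0) (at r)"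
    by (rule has_field_derivative_transform_within_open[where S="{1<..}"]) (use greater in auto)
  then show ?thesis using greater by simp
next
  case equal
  have "((\<lambda>y. max 0 (1 - y) ^ (k + 2) / (y - 1)) \<longlongrightarrow> 0) (at (1::real))"
  proof (rule Lim_null_comparison)
    have "((\<lambda>y. \<bar>1 - y\<bar> ^ (k + 1)) \<longlongrightarrow> \<bar>1 - 1\<bar> ^ (k + 1)) (at (1::real))" by (intro tendsto_intros)
    then show "((\<lambda>y. \<bar>1 - y\<bar> ^ (k + 1)) \<longlongrightarrow> 0) (at (1::real))" by simp
    show "\<forall>\<^sub>F y in at (1::real). norm (max 0 (1 - y) ^ (k + 2) / (y - 1)) \<le> \<bar>1 - y\<bar> ^ (k + 1)"
      unfolding eventually_at_filter
    proof (intro always_eventually allI impI)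
      fix y :: real assume y: "y \<noteq> 1"
      have "\<bar>max 0 (1 - y)\<bar> ^ (k + 2) \<le> \<bar>1 - y\<bar> ^ (k + 2)" by (intro power_mono) auto
      also have "\<dots> = \<bar>1 - y\<bar> ^ (k + 1) * \<bar>y - 1\<bar>" by (simp add: abs_minus_commute)
      finally show "norm (max 0 (1 - y) ^ (k + 2) / (y - 1)) \<le> \<bar>1 - y\<bar> ^ (k + 1)"
        using y by (simp add: abs_div power_abs divide_le_eq)
    qed
  qed
  then show ?thesis using equal by (simp add: has_field_derivative_iff)
qed

text \<open>The cube is the lowest integer power of the positive part that is twice continuously
  differentiable. On nonnegative arguments the value 1 is taken at 0 only; a linear bound on
  \<open>1 - cutoff r\<close> does the work of a plateau.\<close>

definition cutoff :: "real \<Rightarrow> real" where "cutoff r = max 0 (1 - r) ^ 3"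

lemma cutoff_bounds: "0 \<le> r \<Longrightarrow> 0 \<le> cutoff r" "0 \<le> r \<Longrightarrow> cutoff r \<le> 1" "r \<ge> 1 \<Longrightarrow> cutoff r = 0" "cutoff 0 = 1"
  by (auto simp: cutoff_def max_def power_le_one)

lemma cutoff_lower: "0 \<le> r \<Longrightarrow> 1 - cutoff r \<le> 3 * r"
proof -
  assume r: "0 \<le> r"
  show ?thesis
  proof (cases "r \<le> 1")
    case True
    have "0 \<le> r\<^sup>2 * (3 - r)" using True r by simp
    then show ?thesis using True r by (simp add: cutoff_def max_def power2_eq_square power3_eq_cube algebra_simps)
  qed (use cutoff_bounds(3)[of r] in auto)
qed

lemma C2_fun_cutoff:
  assumes "C2_fun \<phi>" shows "C2_fun (\<lambda>x. cutoff (\<phi> x))"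
proof (rule C2_fun_compose[OF assms, where h=cutoff and h'="\<lambda>r. - (3 * max 0 (1 - r) ^ 2)" and h''="\<lambda>r. 6
    * max 0 (1 - r)"])
  fix r
  show "(cutoff has_real_derivative - (3 * (max 0 (1 - r))\<^sup>2)) (at r)"
    using DERIV_pos_part_power[of 1 r] unfolding cutoff_def[abs_def] by (simp add: numeral_2_eq_2 numeral_3_eq_3)
  show "((\<lambda>r. - (3 * (max 0 (1 - r))\<^sup>2)) has_real_derivative 6 * max 0 (1 - r)) (at r)"
    using DERIV_cmult[OF DERIV_pos_part_power[of 0 r], of "-3"] by (simp add: numeral_2_eq_2)
qed (auto intro!: continuous_intros)

section \<open>From principal values to second differences\<close>

lemma has_frac_laplacian_uminus:
  assumes "has_frac_laplacian s w x L"
  shows "has_frac_laplacian s (\<lambda>y. - w y) x (- L)"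
proof -
  have eq: "(\<lambda>y. (- w x - - w y) / norm (x - y) powr (real CARD('a) + 2 * s))
      = (\<lambda>y. - ((w x - w y) / norm (x - y) powr (real CARD('a) + 2 * s)))"
    by (simp add: fun_eq_iff field_simps add_divide_distrib diff_divide_distrib)
  obtain I where I: "((\<lambda>\<epsilon>. LINT y:(- ball x \<epsilon>)|lborel. (w x - w y) / norm (x - y) powr (real CARD('a) + 2
      * s)) \<longlongrightarrow> I) (at_right 0)"
     "L = frac_const TYPE('a) s * I"
    using assms unfolding has_frac_laplacian_def Let_def by blast
  show ?thesis unfolding has_frac_laplacian_def Let_def eq
  proof (intro conjI exI[of _ "- I"] allI impI)
    fix \<epsilon> :: real assume "\<epsilon> > 0"
    then show "set_integrable lborel (- ball x \<epsilon>) (\<lambda>y. - ((w x - w y) / norm (x - y) powr (real CARD('a) + 2 * s)))"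
      using assms unfolding has_frac_laplacian_def Let_def set_integrable_def by simp
  next
    show "((\<lambda>\<epsilon>. LINT y:- ball x \<epsilon>|lborel. - ((w x - w y) / norm (x - y) powr (real CARD('a) + 2 * s))) \<longlongrightarrow>
        - I) (at_right 0)"
      using tendsto_minus[OF I(1)] unfolding set_lebesgue_integral_def by simp
  qed (use I in simp)
qed

text \<open>The truncated domain is symmetric about \<open>x\<close>, so the integrand may be added
  to its image under the point reflection. This doubles the integral, whence the limit
  \<open>2 * I\<close>.\<close>

lemma has_frac_laplacian_sdiff:
  fixes x :: "real^'n::{finite,linorder}"
  assumes w: "has_frac_laplacian s w x L"
  shows "\<exists>I. L = frac_const TYPE('n) s * I \<and>
     (\<forall>\<epsilon>>0. integrable lborel (\<lambda>z. indicator (- ball 0 \<epsilon>) z * sdiff w x z * fker s z)) \<and>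
     ((\<lambda>\<epsilon>. LINT z|lborel. indicator (- ball 0 \<epsilon>) z * sdiff w x z * fker s z) \<longlongrightarrow> 2 * I) (at_right 0)"
proof -
  let ?k = "\<lambda>y. (w x - w y) / norm (x - y) powr (real CARD('n) + 2 * s)"
  obtain I where I: "((\<lambda>\<epsilon>. LINT y:(- ball x \<epsilon>)|lborel. ?k y) \<longlongrightarrow> I) (at_right 0)"
     "L = frac_const TYPE('n) s * I" and int: "\<And>\<epsilon>. \<epsilon> > 0 \<Longrightarrow> set_integrable lborel (- ball x \<epsilon>) ?k"
    using w unfolding has_frac_laplacian_def Let_def by blast
  define g where "g \<epsilon> z = indicator (- ball 0 \<epsilon>) z * (w x - w (x + z)) * fker s z" for \<epsilon> z
  have tr: "indicator (- ball x \<epsilon>) (x + z) *\<^sub>R ?k (x + z) = g \<epsilon> z" for \<epsilon> z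
    by (simp add: g_def fker_def powr_minus_divide indicator_def dist_norm del: minus_add_distrib)
  have A: "integrable lborel (g \<epsilon>)" "integrable lborel (\<lambda>z. g \<epsilon> (- z))"
    "(LINT z|lborel. g \<epsilon> z) = (LINT y:(- ball x \<epsilon>)|lborel. ?k y)"
    "(LINT z|lborel. g \<epsilon> (- z)) = (LINT y:(- ball x \<epsilon>)|lborel. ?k y)" if "\<epsilon> > 0" for \<epsilon>
  proof -
    have i: "integrable lborel (\<lambda>y. indicator (- ball x \<epsilon>) y *\<^sub>R ?k y)"
      using int[OF that] unfolding set_integrable_def .
    then have [measurable]: "(\<lambda>y. indicator (- ball x \<epsilon>) y *\<^sub>R ?k y) \<in> borel_measurable borel"
      using borel_measurable_integrable by fastforce
    show g: "integrable lborel (g \<epsilon>)"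
      using lborel_integrable_translate[of "\<lambda>y. indicator (- ball x \<epsilon>) y *\<^sub>R ?k y" x] i unfolding tr by simp
    then have [measurable]: "g \<epsilon> \<in> borel_measurable borel"
      using borel_measurable_integrable by fastforce
    show "integrable lborel (\<lambda>z. g \<epsilon> (- z))"
      using lborel_integrable_reflect[of "g \<epsilon>" 0] g by simp
    show G: "(LINT z|lborel. g \<epsilon> z) = (LINT y:(- ball x \<epsilon>)|lborel. ?k y)"
    proof -
      have "(LINT z|lborel. g \<epsilon> z) = (LINT z|lborel. (\<lambda>y. indicator (- ball x \<epsilon>) y *\<^sub>R ?k y) (x + z))"
        by (simp only: tr)
      also have "\<dots> = (LINT y|lborel. indicator (- ball x \<epsilon>) y *\<^sub>R ?k y)"
        by (rule lborel_integral_translate) fact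
      finally show ?thesis unfolding set_lebesgue_integral_def .
    qed
    show "(LINT z|lborel. g \<epsilon> (- z)) = (LINT y:(- ball x \<epsilon>)|lborel. ?k y)"
      using lborel_integral_reflect[of "g \<epsilon>" 0] G by simp
  qed
  have eq: "indicator (- ball 0 \<epsilon>) z * sdiff w x z * fker s z = g \<epsilon> z + g \<epsilon> (- z)" for \<epsilon> z
    by (simp add: g_def sdiff_def indicator_def algebra_simps)
  have B: "integrable lborel (\<lambda>z. indicator (- ball 0 \<epsilon>) z * sdiff w x z * fker s z)" if "\<epsilon> > 0" for \<epsilon>
    unfolding eq by (intro Bochner_Integration.integrable_add A that)
  have C: "(LINT z|lborel. indicator (- ball 0 \<epsilon>) z * sdiff w x z * fker s z)
      = 2 * (LINT y:(- ball x \<epsilon>)|lborel. ?k y)"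
    if "\<epsilon> > 0" for \<epsilon>
    unfolding eq using A[OF that] by (subst Bochner_Integration.integral_add) auto
  have "((\<lambda>\<epsilon>. LINT z|lborel. indicator (- ball 0 \<epsilon>) z * sdiff w x z * fker s z) \<longlongrightarrow> 2 * I) (at_right 0)"
  proof (rule Lim_transform_eventually)
    show "((\<lambda>\<epsilon>. 2 * (LINT y:(- ball x \<epsilon>)|lborel. ?k y)) \<longlongrightarrow> 2 * I) (at_right 0)"
      by (intro tendsto_intros I)
    show "\<forall>\<^sub>F \<epsilon> in at_right 0. 2 * (LINT y:(- ball x \<epsilon>)|lborel. ?k y)
        = (LINT z|lborel. indicator (- ball 0 \<epsilon>) z * sdiff w x z * fker s z)"
      by (rule eventually_mono[OF eventually_at_right_less]) (rule C[symmetric])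
  qed
  with B I(2) show ?thesis by (intro exI[of _ I] conjI allI impI) assumption+
qed

text \<open>Testing with the paraboloid itself gives the inequality for \<open>u\<close> modified in
  \<open>U\<close>, not for \<open>u\<close>. These smooth majorants converge to \<open>u\<close>
  but keep one common paraboloid at \<open>x0\<close>, so that the modification disappears in the
  limit. They blend three functions: the paraboloid at \<open>x0\<close>, a Stone-Weierstrass
  polynomial slightly above \<open>u\<close> on a large ball, and the constant \<open>M\<close> far
  away.\<close>

lemma C2_majorants:
  fixes u :: "real ^ 'n \<Rightarrow> real"
  assumes u: "continuous_on UNIV u" and M: "\<And>x. \<bar>u x\<bar> \<le> M" and K: "K \<ge> 0"
    and touch: "\<And>z. u (x0 + z) \<le> u x0 + b \<bullet> z + K * (norm z)\<^sup>2"
  obtains \<Psi> C K' where "\<And>j::nat. C2_fun (\<Psi> j)" "\<And>j x. u x \<le> \<Psi> j x" "\<And>j. \<Psi> j x0 = u x0"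
    "\<And>j x. \<Psi> j x \<le> C" "K' \<ge> K" "\<And>j z. \<Psi> j (x0 + z) \<le> u x0 + b \<bullet> z + K' * (norm z)\<^sup>2"
    "\<And>x. (\<lambda>j. \<Psi> j x) \<longlonglongrightarrow> u x"
proof -
  define \<delta> where "\<delta> j = 1 / real (Suc j)" for j
  have \<delta>: "\<delta> j > 0" "\<delta> j \<le> 1" for j by (auto simp: \<delta>_def)
  have \<delta>0: "\<delta> \<longlonglongrightarrow> 0" unfolding \<delta>_def by (rule LIMSEQ_inverse_real_of_nat[unfolded inverse_eq_divide])
  \<comment> \<open>The square is what makes the paraboloid common to all \<open>j\<close>: the
    weight \<open>1 - g\<close> of the polynomial at displacement \<open>z\<close> is at most 3
    |z|^2 / \<delta>^2, so the approximation error \<epsilon> costs at most 3 |z|^2.\<close>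
  define \<epsilon> where "\<epsilon> j = (\<delta> j)\<^sup>2" for j
  have \<epsilon>: "\<epsilon> j > 0" "\<epsilon> j \<le> 1" for j using \<delta>[of j] by (auto simp: \<epsilon>_def power_le_one)
  have M0: "M \<ge> 0" using M[of x0] by linarith
  have "\<exists>p. real_polynomial_function p \<and> (\<forall>x\<in>cball x0 (real (Suc j)). u x \<le> p x \<and> p x \<le> u x + \<epsilon> j)" for j
  proof -
    have "\<epsilon> j / 2 > 0" using \<epsilon>(1)[of j] by simp
    have cont: "continuous_on (cball x0 (real (Suc j))) (\<lambda>x. u x + \<epsilon> j / 2)"
      by (intro continuous_intros continuous_on_subset[OF u]) auto
    obtain p where p: "real_polynomial_function p" "\<And>x. x \<in> cball x0 (real (Suc j)) \<Longrightarrow> \<bar>u x + \<epsilon> j / 2 - p x\<bar> < \<epsilon> j / 2"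
      by (rule Stone_Weierstrass_real_polynomial_function[OF compact_cball cont \<open>\<epsilon> j / 2 > 0\<close>]) blast
    have "u x \<le> p x \<and> p x \<le> u x + \<epsilon> j" if "x \<in> cball x0 (real (Suc j))" for x
      using p(2)[OF that] by linarith
    then show ?thesis using p(1) by blast
  qed
  then obtain p where pp: "\<And>j. real_polynomial_function (p j)"
    and p: "\<And>j x. x \<in> cball x0 (real (Suc j)) \<Longrightarrow> u x \<le> p j x \<and> p j x \<le> u x + \<epsilon> j" by metis
  \<comment> \<open>\<open>G\<close> vanishes beyond the radius \<open>real (Suc j)\<close>, where
    the polynomial is not controlled, and \<open>g\<close> beyond the small radius
    \<open>\<delta> j\<close>.\<close>
  define G where "G j x = cutoff ((\<delta> j)\<^sup>2 * (norm (x - x0))\<^sup>2)" for j x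
  define g where "g j x = cutoff ((1 / (\<delta> j)\<^sup>2) * (norm (x - x0))\<^sup>2)" for j x
  define P where "P x = u x0 + (b \<bullet> (x - x0) + K * (norm (x - x0))\<^sup>2)" for x
  define Q where "Q j x = G j x * p j x + (1 + (-1) * G j x) * M" for j x
  define \<Psi> where "\<Psi> j x = g j x * P x + (1 + (-1) * g j x) * Q j x" for j x
  have G: "0 \<le> G j x" "G j x \<le> 1" "1 - G j x \<le> 3 * ((\<delta> j)\<^sup>2 * (norm (x - x0))\<^sup>2)" for j x
    unfolding G_def by (rule cutoff_bounds cutoff_lower; simp)+
  have g: "0 \<le> g j x" "g j x \<le> 1" "1 - g j x \<le> 3 * ((1 / (\<delta> j)\<^sup>2) * (norm (x - x0))\<^sup>2)" for j x
    unfolding g_def by (rule cutoff_bounds cutoff_lower; simp)+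
  have g0: "g j x = 0" if "\<delta> j \<le> norm (x - x0)" for j x
  proof -
    have "(\<delta> j)\<^sup>2 \<le> (norm (x - x0))\<^sup>2" using that \<delta>(1)[of j] by (intro power_mono) auto
    then have "1 / (\<delta> j)\<^sup>2 * (norm (x - x0))\<^sup>2 \<ge> 1" using \<delta>(1)[of j] by (simp add: field_simps)
    then show ?thesis unfolding g_def by (rule cutoff_bounds(3))
  qed
  have G0: "G j x = 0" if "x \<notin> cball x0 (real (Suc j))" for j x
  proof -
    have "real (Suc j) \<le> norm (x - x0)" using that by (simp add: dist_norm norm_minus_commute)
    then have "1 \<le> \<delta> j * norm (x - x0)" unfolding \<delta>_def by (simp add: field_simps)
    then have "1 \<le> (\<delta> j * norm (x - x0))\<^sup>2" by (simp add: one_le_power)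
    then show ?thesis unfolding G_def by (intro cutoff_bounds(3)) (simp add: power_mult_distrib)
  qed
  have Qdiff: "Q j x - u x = G j x * (p j x - u x) + (1 - G j x) * (M - u x)" for j x
    by (simp add: Q_def algebra_simps)
  have Gp: "0 \<le> G j x * (p j x - u x)" "G j x * (p j x - u x) \<le> \<epsilon> j" for j x
  proof -
    have "0 \<le> G j x * (p j x - u x) \<and> G j x * (p j x - u x) \<le> \<epsilon> j"
    proof (cases "x \<in> cball x0 (real (Suc j))")
      case True
      have "G j x * (p j x - u x) \<le> 1 * \<epsilon> j" using p[OF True] G[of j x] by (intro mult_mono) auto
      then show ?thesis using p[OF True] G[of j x] by simp
    qed (use G0 \<epsilon>(1)[of j] in auto)
    then show "0 \<le> G j x * (p j x - u x)" "G j x * (p j x - u x) \<le> \<epsilon> j" by auto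
  qed
  have Mu: "0 \<le> M - u x" "M - u x \<le> 2 * M" for x using M[of x] by (auto simp: abs_le_iff)
  have QM: "0 \<le> (1 - G j x) * (M - u x)" "(1 - G j x) * (M - u x) \<le> 6 * M * ((\<delta> j)\<^sup>2 * (norm (x - x0))\<^sup>2)" for j x
  proof -
    show "0 \<le> (1 - G j x) * (M - u x)" using G(2)[of j x] Mu[of x] by simp
    have "(1 - G j x) * (M - u x) \<le> (3 * ((\<delta> j)\<^sup>2 * (norm (x - x0))\<^sup>2)) * (2 * M)"
      using G[of j x] Mu[of x] by (intro mult_mono) auto
    also have "\<dots> = 6 * M * ((\<delta> j)\<^sup>2 * (norm (x - x0))\<^sup>2)" by (simp add: mult_ac)
    finally show "(1 - G j x) * (M - u x) \<le> 6 * M * ((\<delta> j)\<^sup>2 * (norm (x - x0))\<^sup>2)" .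
  qed
  have Qu: "u x \<le> Q j x" for j x using Qdiff[of j x] Gp(1)[of j x] QM(1)[of j x] by linarith
  have Qle: "Q j x \<le> u x + \<epsilon> j + 6 * M * ((\<delta> j)\<^sup>2 * (norm (x - x0))\<^sup>2)" for j x
    using Qdiff[of j x] Gp(2)[of j x] QM(2)[of j x] by linarith
  have QMle: "Q j x \<le> M + 1" for j x
  proof -
    have "(1 - G j x) * (M - u x) \<le> 1 * (M - u x)" using G[of j x] Mu[of x] by (intro mult_right_mono) auto
    then have "(1 - G j x) * (M - u x) \<le> M - u x" by simp
    then show ?thesis using Qdiff[of j x] Gp(2)[of j x] \<epsilon>(2)[of j] by linarith
  qed
  have Pu: "u x \<le> P x" for x using touch[of "x - x0"] by (simp add: P_def add.assoc)
  have \<Psi>u: "\<Psi> j x - u x = g j x * (P x - u x) + (1 - g j x) * (Q j x - u x)" for j x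
    by (simp add: \<Psi>_def algebra_simps)
  have \<Psi>P: "\<Psi> j x - P x = (1 - g j x) * (Q j x - P x)" for j x
    by (simp add: \<Psi>_def algebra_simps)
  define K' where "K' = K + 3 + 6 * M"
  define C where "C = M + 1 + (\<bar>u x0\<bar> + norm b + K)"
  have CM: "M + 1 \<le> C" using K norm_ge_zero[of b] abs_ge_zero[of "u x0"] unfolding C_def by linarith
  have C2_inner: "C2_fun (\<lambda>x. b \<bullet> (x - x0))"
    using C2_fun_add[OF C2_fun_inner C2_fun_const[of "- (b \<bullet> x0)"], of b] by (simp add: inner_diff_right)
  show ?thesis
  proof (rule that[of \<Psi> C K'])
    fix j x
    show "C2_fun (\<Psi> j)"
      unfolding \<Psi>_def[abs_def] g_def[abs_def] P_def[abs_def] Q_def[abs_def] G_def[abs_def]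
      by (intro C2_fun_add C2_fun_mult C2_fun_const C2_fun_cmult C2_fun_cutoff C2_fun_polynomial[OF pp] C2_inner
        C2_fun_sqdist)
    show "u x \<le> \<Psi> j x"
    proof -
      have "0 \<le> g j x * (P x - u x)" "0 \<le> (1 - g j x) * (Q j x - u x)"
        using g[of j x] Pu[of x] Qu[of x j] by simp_all
      then show ?thesis using \<Psi>u[of j x] by linarith
    qed
    show "\<Psi> j x0 = u x0" by (simp add: \<Psi>_def g_def P_def cutoff_bounds)
    show "K' \<ge> K" using M0 by (simp add: K'_def)
    show "\<Psi> j x \<le> C"
    proof (cases "\<delta> j \<le> norm (x - x0)")
      case True
      then have "\<Psi> j x = Q j x" by (simp add: \<Psi>_def g0)
      also have "\<dots> \<le> C" using QMle[of j x] CM by linarith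
      finally show ?thesis .
    next
      case False
      then have n: "norm (x - x0) \<le> 1" using \<delta>(2)[of j] by linarith
      have "b \<bullet> (x - x0) \<le> norm b * norm (x - x0)" by (rule norm_cauchy_schwarz)
      also have "\<dots> \<le> norm b * 1" using n by (intro mult_left_mono) auto
      finally have 1: "b \<bullet> (x - x0) \<le> norm b" by simp
      have "K * (norm (x - x0))\<^sup>2 \<le> K * 1" using n K by (intro mult_left_mono) (auto simp: power_le_one)
      then have "P x \<le> \<bar>u x0\<bar> + norm b + K" using 1 unfolding P_def by linarith
      then have "P x \<le> C" "Q j x \<le> C" using QMle[of j x] CM M0 unfolding C_def by linarith+
      then have "g j x * P x + (1 - g j x) * Q j x \<le> C" using g[of j x] by (intro convex_bound_le) auto
      then show ?thesis by (simp add: \<Psi>_def)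
    qed
    show "\<Psi> j (x0 + z) \<le> u x0 + b \<bullet> z + K' * (norm z)\<^sup>2" for z
    proof -
      have *: "(1 - g j (x0 + z)) * \<epsilon> j \<le> 3 * (norm z)\<^sup>2"
      proof -
        have "(1 - g j (x0 + z)) * \<epsilon> j \<le> (3 * ((1 / (\<delta> j)\<^sup>2) * (norm z)\<^sup>2)) * \<epsilon> j"
          using g(3)[of j "x0 + z"] \<epsilon>(1)[of j] by (intro mult_right_mono) auto
        also have "\<dots> = 3 * (norm z)\<^sup>2" using \<delta>(1)[of j] by (simp add: \<epsilon>_def)
        finally show ?thesis .
      qed
      have d2: "(\<delta> j)\<^sup>2 * (norm z)\<^sup>2 \<le> 1 * (norm z)\<^sup>2" using \<epsilon>(2)[of j] unfolding \<epsilon>_def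
        by (intro mult_right_mono) auto
      have d3: "6 * M * ((\<delta> j)\<^sup>2 * (norm z)\<^sup>2) \<le> 6 * M * (norm z)\<^sup>2" using d2 M0 by (intro mult_left_mono) auto
      have "Q j (x0 + z) - P (x0 + z) \<le> \<epsilon> j + 6 * M * (norm z)\<^sup>2"
        using Qle[of j "x0 + z"] Pu[of "x0 + z"] d3 by simp
      then have "(1 - g j (x0 + z)) * (Q j (x0 + z) - P (x0 + z)) \<le> (1 - g j (x0 + z)) * (\<epsilon> j + 6 * M * (norm z)\<^sup>2)"
        using g(2)[of j "x0 + z"] by (intro mult_left_mono) auto
      also have "\<dots> = (1 - g j (x0 + z)) * \<epsilon> j + (1 - g j (x0 + z)) * (6 * M * (norm z)\<^sup>2)"
        by (simp only: distrib_left)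
      also have "(1 - g j (x0 + z)) * (6 * M * (norm z)\<^sup>2) \<le> 1 * (6 * M * (norm z)\<^sup>2)"
        using g(1)[of j "x0 + z"] M0 by (intro mult_right_mono) auto
      finally have "\<Psi> j (x0 + z) \<le> P (x0 + z) + 3 * (norm z)\<^sup>2 + 6 * M * (norm z)\<^sup>2"
        using \<Psi>P[of j "x0 + z"] * by linarith
      then show ?thesis by (simp add: P_def K'_def algebra_simps)
    qed
    show "(\<lambda>j. \<Psi> j x) \<longlonglongrightarrow> u x"
    proof (cases "x = x0")
      case True
      then show ?thesis by (simp add: \<Psi>_def g_def P_def cutoff_bounds)
    next
      case False
      then have "\<forall>\<^sub>F j in sequentially. \<delta> j < norm (x - x0)" using \<delta>0 by (intro order_tendstoD) auto
      then have ev: "\<forall>\<^sub>F j in sequentially. Q j x = \<Psi> j x"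
        by eventually_elim (simp add: \<Psi>_def g0)
      have "(\<lambda>j. Q j x) \<longlonglongrightarrow> u x"
      proof (rule real_tendsto_sandwich[where f="\<lambda>_. u x" and h="\<lambda>j. u x + \<epsilon> j + 6 * M
          * ((\<delta> j)\<^sup>2 * (norm (x - x0))\<^sup>2)"])
        show "(\<lambda>j. u x + \<epsilon> j + 6 * M * ((\<delta> j)\<^sup>2 * (norm (x - x0))\<^sup>2)) \<longlonglongrightarrow> u x"
          unfolding \<epsilon>_def by (rule tendsto_eq_intros \<delta>0 refl | simp)+
      qed (use Qu Qle in auto)
      then show ?thesis using ev by (rule Lim_transform_eventually)
    qed
  qed
qed

text \<open>The majorants are admissible tests, so their principal values exist and are bounded.
  Truncated at small radii these are integrals of second differences, and Fatou applies to them with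
  the common paraboloid. As \<open>U\<close> is prescribed, the majorants live on the whole space
  and are cut down to \<open>U\<close> afterwards.\<close>

lemma viscosity_test_imp:
  fixes u :: "real ^ 'n::{finite,linorder} \<Rightarrow> real"
  assumes s: "0 < s" "s < 1" and u: "continuous_on UNIV u" and M: "\<And>x. \<bar>u x\<bar> \<le> M"
    and U: "open U" "x0 \<in> U"
    and test: "\<And>\<phi>. C2_closure U \<phi> \<Longrightarrow> u x0 = \<phi> x0 \<Longrightarrow> (\<forall>x\<in>U. u x \<le> \<phi> x) \<Longrightarrow>
        \<exists>L. has_frac_laplacian s (override_on u \<phi> U) x0 L \<and> L \<le> F"
    and touch: "\<And>z. u (x0 + z) \<le> u x0 + b \<bullet> z + K * (norm z)\<^sup>2"
  shows "integrable lborel (\<lambda>z. sdiff u x0 z * fker s z)"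
    "(LINT z|lborel. sdiff u x0 z * fker s z) \<le> 2 / frac_const TYPE('n) s * F"
proof -
  let ?c = "frac_const TYPE('n) s"
  have c: "?c > 0" by (rule frac_const_pos[OF s])
  have "K * (norm z)\<^sup>2 \<le> \<bar>K\<bar> * (norm z)\<^sup>2" for z :: "real^'n::_" by (intro mult_right_mono) auto
  then have touch': "u (x0 + z) \<le> u x0 + b \<bullet> z + \<bar>K\<bar> * (norm z)\<^sup>2" for z
    using touch[of z] by (smt (verit, best))
  obtain \<Psi> C K' where \<Psi>: "\<And>j::nat. C2_fun (\<Psi> j)" "\<And>j x. u x \<le> \<Psi> j x" "\<And>j. \<Psi> j x0 = u x0"
    "\<And>j x. \<Psi> j x \<le> C" "K' \<ge> \<bar>K\<bar>" "\<And>j z. \<Psi> j (x0 + z) \<le> u x0 + b \<bullet> z + K' * (norm z)\<^sup>2"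
    "\<And>x. (\<lambda>j. \<Psi> j x) \<longlonglongrightarrow> u x"
    using C2_majorants[OF u M abs_ge_zero touch'] by blast
  \<comment> \<open>Lies between \<open>u\<close> and \<open>\<Psi> j\<close> with equality at
    \<open>x0\<close>; hence it inherits the common paraboloid and converges to \<open>u\<close>
    everywhere.\<close>
  define w where "w j = override_on u (\<Psi> j) U" for j
  have wx0: "w j x0 = u x0" for j by (simp add: w_def override_on_def \<Psi>)
  have wu: "u x \<le> w j x" for j x by (simp add: w_def override_on_def \<Psi>)
  have w\<Psi>: "w j x \<le> \<Psi> j x" for j x by (simp add: w_def override_on_def \<Psi>)
  have wC: "\<bar>w j x\<bar> \<le> M + \<bar>C\<bar>" for j x
    using wu[of x j] w\<Psi>[of j x] \<Psi>(4)[of j x] M[of x] by linarith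
  have wl: "(\<lambda>j. w j x) \<longlonglongrightarrow> u x" for x
    using \<Psi>(7)[of x] by (cases "x \<in> U") (simp_all add: w_def override_on_def)
  define V where "V j \<epsilon> = (LINT z|lborel. indicator (- ball 0 \<epsilon>) z * sdiff (w j) x0 z * fker s z)" for j \<epsilon>
  have "\<forall>j. \<exists>I. I \<le> F / ?c \<and> (V j \<longlongrightarrow> 2 * I) (at_right 0)"
    and I2: "integrable lborel (\<lambda>z. indicator (- ball 0 \<epsilon>) z * sdiff (w j) x0 z * fker s z)" if "\<epsilon> > 0" for j \<epsilon>
  proof -
    have "(\<exists>I. I \<le> F / ?c \<and> (V j \<longlongrightarrow> 2 * I) (at_right 0)) \<and>
        (\<forall>\<epsilon>>0. integrable lborel (\<lambda>z. indicator (- ball 0 \<epsilon>) z * sdiff (w j) x0 z * fker s z))" for j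
    proof -
      obtain L where L: "has_frac_laplacian s (w j) x0 L" "L \<le> F"
        using test[OF C2_fun_imp_C2_closure[OF \<Psi>(1)[of j]] \<Psi>(3)[symmetric]] \<Psi>(2) unfolding w_def by blast
      obtain I where I: "L = ?c * I" "\<forall>\<epsilon>>0. integrable lborel (\<lambda>z. indicator (- ball 0 \<epsilon>) z * sdiff (w j) x0 z
          * fker s z)"
       "(V j \<longlongrightarrow> 2 * I) (at_right 0)"
        using has_frac_laplacian_sdiff[OF L(1)] unfolding V_def[abs_def] by blast
      have "I \<le> F / ?c" using I(1) L(2) c by (simp add: field_simps)
      then show ?thesis using I(2,3) by blast
    qed
    then show "\<forall>j. \<exists>I. I \<le> F / ?c \<and> (V j \<longlongrightarrow> 2 * I) (at_right 0)"
      "integrable lborel (\<lambda>z. indicator (- ball 0 \<epsilon>) z * sdiff (w j) x0 z * fker s z)" using that by blast+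
  qed
  from choice[OF this(1)[OF zero_less_one]]
  obtain I where I: "\<And>j. I j \<le> F / ?c" "\<And>j. (V j \<longlongrightarrow> 2 * I j) (at_right 0)" by blast
  define \<delta> where "\<delta> j = 1 / real (Suc j)" for j
  have \<delta>: "\<delta> j > 0" for j by (auto simp: \<delta>_def)
  have \<delta>0: "\<delta> \<longlonglongrightarrow> 0" unfolding \<delta>_def by (rule LIMSEQ_inverse_real_of_nat[unfolded inverse_eq_divide])
  \<comment> \<open>A diagonal choice: for each \<open>j\<close> a radius below
    \<open>\<delta> j\<close> at which the truncated integral exceeds its limit by less than
    \<open>\<delta> j\<close>. The limits in the radius and in \<open>j\<close> are then taken
    together.\<close>
  have "\<forall>j. \<exists>e. 0 < e \<and> e < \<delta> j \<and> V j e < 2 * I j + \<delta> j"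
  proof
    fix j
    have "\<forall>\<^sub>F e in at_right 0. V j e < 2 * I j + \<delta> j"
      using order_tendstoD(2)[OF I(2)[of j]] \<delta>[of j] by simp
    moreover have "\<forall>\<^sub>F e in at_right 0. e \<in> {0<..<\<delta> j}" using \<delta>[of j] by (rule eventually_at_right_real)
    ultimately have "\<forall>\<^sub>F e in at_right 0. 0 < e \<and> e < \<delta> j \<and> V j e < 2 * I j + \<delta> j"
      by eventually_elim auto
    then show "\<exists>e. 0 < e \<and> e < \<delta> j \<and> V j e < 2 * I j + \<delta> j" by (rule eventually_happens'[rotated]) simp
  qed
  from choice[OF this] obtain e where e: "\<And>j. 0 < e j" "\<And>j. e j < \<delta> j" "\<And>j. V j (e j) < 2 * I j + \<delta> j" by blast
  define S where "S j z = indicator (- ball 0 (e j)) z * sdiff (w j) x0 z" for j z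
  have Sint: "integrable lborel (\<lambda>z. S j z * fker s z)" for j unfolding S_def by (rule I2[OF e(1)])
  have Sle: "(LINT z|lborel. S j z * fker s z) \<le> 2 / ?c * F + \<delta> j" for j
    unfolding S_def V_def[symmetric] using e(3)[of j] I(1)[of j] by simp
  have q: "- (2 * K' * (norm z)\<^sup>2) \<le> sdiff (w j) x0 z" for j z
    using order_trans[OF w\<Psi> \<Psi>(6)[of j z]] order_trans[OF w\<Psi> \<Psi>(6)[of j "- z"]] wx0[of j] unfolding sdiff_def by simp
  have K'0: "K' \<ge> 0" using \<Psi>(5) by linarith
  have M0: "M \<ge> 0" using M[of x0] by linarith
  have low0: "- ((4 * (M + \<bar>C\<bar>) + 2 * K') * min 1 ((norm z)\<^sup>2)) \<le> sdiff (w j) x0 z" for j z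
    by (rule sdiff_lower_bound[OF wC q K'0])
  have low: "- ((4 * (M + \<bar>C\<bar>) + 2 * K') * min 1 ((norm z)\<^sup>2)) \<le> S j z" for j z
  proof (cases "z \<in> ball 0 (e j)")
    case True
    have "0 \<le> (4 * (M + \<bar>C\<bar>) + 2 * K') * min 1 ((norm z)\<^sup>2)" using M0 K'0 by (intro mult_nonneg_nonneg) auto
    then show ?thesis using True by (simp add: S_def)
  qed (use low0[of z j] in \<open>simp add: S_def\<close>)
  have lim: "(\<lambda>j. S j z) \<longlonglongrightarrow> sdiff u x0 z" if "z \<noteq> 0" for z
  proof -
    have l: "(\<lambda>j. sdiff (w j) x0 z) \<longlonglongrightarrow> sdiff u x0 z" unfolding sdiff_def by (intro tendsto_intros wl)
    have "\<forall>\<^sub>F j in sequentially. \<delta> j < norm z" using \<delta>0 that by (intro order_tendstoD) auto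
    then have "\<forall>\<^sub>F j in sequentially. sdiff (w j) x0 z = S j z"
    proof eventually_elim
      case (elim j)
      then have "e j < norm z" using e(2)[of j] by linarith
      then show ?case by (simp add: S_def indicator_def)
    qed
    with l show ?thesis by (rule Lim_transform_eventually)
  qed
  have a: "(\<lambda>j. 2 / ?c * F + \<delta> j) \<longlonglongrightarrow> 2 / ?c * F"
    using tendsto_add[OF tendsto_const \<delta>0, of "2 / ?c * F"] by simp
  show "integrable lborel (\<lambda>z. sdiff u x0 z * fker s z)"
    "(LINT z|lborel. sdiff u x0 z * fker s z) \<le> 2 / ?c * F"
    using fatou_fker[OF s Sint low lim Sle a] by blast+
qed

lemma C2_closure_uminus:
  assumes "C2_closure U \<phi>" shows "C2_closure U (\<lambda>x. - \<phi> x)"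
proof -
  obtain D H where DH: "continuous_on (closure U) D" "continuous_on (closure U) H"
    "\<forall>x\<in>U. (\<phi> has_derivative (\<lambda>h. D x \<bullet> h)) (at x)"  "\<forall>x\<in>U. (D has_derivative (\<lambda>h. H x *v h)) (at x)"
    and c: "continuous_on (closure U) \<phi>"
    using assms unfolding C2_closure_def by blast
  have 1: "(\<lambda>h. - D x \<bullet> h) = (\<lambda>h. - (D x \<bullet> h))" "(\<lambda>h. - H x *v h) = (\<lambda>h. - (H x *v h))" for x
    by (auto simp: matrix_vector_mult_def vec_eq_iff sum_negf)
  show ?thesis unfolding C2_closure_def
    by (intro conjI exI[of _ "\<lambda>x. - D x"] exI[of _ "\<lambda>x. - H x"] ballI continuous_intros c DH(1,2), unfold 1)
       (use DH(3,4) in \<open>auto intro: has_derivative_minus\<close>)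
qed

lemma viscosity_subsolution_fsub:
  fixes u v :: "real ^ 'n::{finite,linorder} \<Rightarrow> real"
  assumes st: "0 < s" "s < 1" "0 < t" "t < 1" and sub: "viscosity_subsolution s t p q G u v"
    and M: "\<And>x. \<bar>u x\<bar> \<le> M" "\<And>x. \<bar>v x\<bar> \<le> M"
  shows "fsub s G (\<lambda>x. 2 / frac_const TYPE('n) s * v x powr p) u"
    "fsub t G (\<lambda>x. 2 / frac_const TYPE('n) t * u x powr q) v"
proof -
  have c: "continuous_on UNIV u" "continuous_on UNIV v" using sub unfolding viscosity_subsolution_def by auto
  have T: "\<exists>U. open U \<and> x0 \<in> U \<and> closure U \<subseteq> G \<and>
        (\<forall>\<phi>. C2_closure U \<phi> \<and> u x0 = \<phi> x0 \<and> (\<forall>x\<in>U. u x \<le> \<phi> x) \<longrightarrow>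
           (\<exists>L. has_frac_laplacian s (override_on u \<phi> U) x0 L \<and> L \<le> v x0 powr p)) \<and>
        (\<forall>\<psi>. C2_closure U \<psi> \<and> v x0 = \<psi> x0 \<and> (\<forall>x\<in>U. v x \<le> \<psi> x) \<longrightarrow>
           (\<exists>L. has_frac_laplacian t (override_on v \<psi> U) x0 L \<and> L \<le> u x0 powr q))" if "x0 \<in> G" for x0
    using sub that unfolding viscosity_subsolution_def by blast
  show "fsub s G (\<lambda>x. 2 / frac_const TYPE('n) s * v x powr p) u"
    unfolding fsub_def
  proof (intro ballI allI impI)
    fix x0 b K assume "x0 \<in> G" and touch: "\<forall>z. u (x0 + z) \<le> u x0 + b \<bullet> z + K * (norm z)\<^sup>2"
    from T[OF this(1)] obtain U where U: "open U" "x0 \<in> U"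
      "\<And>\<phi>. C2_closure U \<phi> \<Longrightarrow> u x0 = \<phi> x0 \<Longrightarrow> (\<forall>x\<in>U. u x \<le> \<phi> x) \<Longrightarrow>
           (\<exists>L. has_frac_laplacian s (override_on u \<phi> U) x0 L \<and> L \<le> v x0 powr p)" by blast
    show "integrable lborel (\<lambda>z. sdiff u x0 z * fker s z) \<and>
       (LINT z|lborel. sdiff u x0 z * fker s z) \<le> 2 / frac_const TYPE('n) s * v x0 powr p"
      by (intro conjI viscosity_test_imp[OF st(1,2) c(1) M(1) U, of b K]) (use touch in auto)
  qed
  show "fsub t G (\<lambda>x. 2 / frac_const TYPE('n) t * u x powr q) v"
    unfolding fsub_def
  proof (intro ballI allI impI)
    fix x0 b K assume "x0 \<in> G" and touch: "\<forall>z. v (x0 + z) \<le> v x0 + b \<bullet> z + K * (norm z)\<^sup>2"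
    from T[OF this(1)] obtain U where U: "open U" "x0 \<in> U"
      "\<And>\<phi>. C2_closure U \<phi> \<Longrightarrow> v x0 = \<phi> x0 \<Longrightarrow> (\<forall>x\<in>U. v x \<le> \<phi> x) \<Longrightarrow>
           (\<exists>L. has_frac_laplacian t (override_on v \<phi> U) x0 L \<and> L \<le> u x0 powr q)" by blast
    show "integrable lborel (\<lambda>z. sdiff v x0 z * fker t z) \<and>
       (LINT z|lborel. sdiff v x0 z * fker t z) \<le> 2 / frac_const TYPE('n) t * u x0 powr q"
      by (intro conjI viscosity_test_imp[OF st(3,4) c(2) M(2) U, of b K]) (use touch in auto)
  qed
qed

lemma viscosity_supersolution_fsub:
  fixes u v :: "real ^ 'n::{finite,linorder} \<Rightarrow> real"
  assumes st: "0 < s" "s < 1" "0 < t" "t < 1" and sup: "viscosity_supersolution s t p q G u v"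
    and M: "\<And>x. \<bar>u x\<bar> \<le> M" "\<And>x. \<bar>v x\<bar> \<le> M"
  shows "fsub s G (\<lambda>x. - (2 / frac_const TYPE('n) s * v x powr p)) (\<lambda>x. - u x)"
    "fsub t G (\<lambda>x. - (2 / frac_const TYPE('n) t * u x powr q)) (\<lambda>x. - v x)"
proof -
  have c: "continuous_on UNIV (\<lambda>x. - u x)" "continuous_on UNIV (\<lambda>x. - v x)"
    using sup unfolding viscosity_supersolution_def by (auto intro: continuous_intros)
  have T: "\<exists>U. open U \<and> x0 \<in> U \<and> closure U \<subseteq> G \<and>
        (\<forall>\<phi>. C2_closure U \<phi> \<and> u x0 = \<phi> x0 \<and> (\<forall>x\<in>U. u x \<ge> \<phi> x) \<longrightarrow>
           (\<exists>L. has_frac_laplacian s (override_on u \<phi> U) x0 L \<and> L \<ge> v x0 powr p)) \<and>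
        (\<forall>\<psi>. C2_closure U \<psi> \<and> v x0 = \<psi> x0 \<and> (\<forall>x\<in>U. v x \<ge> \<psi> x) \<longrightarrow>
           (\<exists>L. has_frac_laplacian t (override_on v \<psi> U) x0 L \<and> L \<ge> u x0 powr q))" if "x0 \<in> G" for x0
    using sup that unfolding viscosity_supersolution_def by blast
  \<comment> \<open>Tests of \<open>w\<close> from below are tests of \<open>- w\<close> from above,
    with the right-hand side negated.\<close>
  have flip: "\<exists>L. has_frac_laplacian r (override_on (\<lambda>x. - w x) \<phi> U) x0 L \<and> L \<le> - F"
    if T: "\<And>\<phi>. C2_closure U \<phi> \<Longrightarrow> w x0 = \<phi> x0 \<Longrightarrow> (\<forall>x\<in>U. w x \<ge> \<phi> x) \<Longrightarrow>
           (\<exists>L. has_frac_laplacian r (override_on w \<phi> U) x0 L \<and> L \<ge> F)"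
      and \<phi>: "C2_closure U \<phi>" "- w x0 = \<phi> x0" "\<forall>x\<in>U. - w x \<le> \<phi> x" for r w U x0 F and \<phi> :: "real ^ 'n::_ \<Rightarrow> real"
  proof -
    have "w x0 = - \<phi> x0" "\<forall>x\<in>U. w x \<ge> - \<phi> x" using \<phi>(2,3) by auto
    then obtain L where "has_frac_laplacian r (override_on w (\<lambda>x. - \<phi> x) U) x0 L" "L \<ge> F"
      using T[OF C2_closure_uminus[OF \<phi>(1)]] by blast
    moreover have "override_on (\<lambda>x. - w x) \<phi> U = (\<lambda>x. - override_on w (\<lambda>x. - \<phi> x) U x)"
      by (auto simp: override_on_def)
    ultimately show ?thesis using has_frac_laplacian_uminus by (metis neg_le_iff_le)
  qed
  show "fsub s G (\<lambda>x. - (2 / frac_const TYPE('n) s * v x powr p)) (\<lambda>x. - u x)"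
    unfolding fsub_def
  proof (intro ballI allI impI)
    fix x0 b K assume "x0 \<in> G" and touch: "\<forall>z. - u (x0 + z) \<le> - u x0 + b \<bullet> z + K * (norm z)\<^sup>2"
    from T[OF this(1)] obtain U where U: "open U" "x0 \<in> U"
      "\<And>\<phi>. C2_closure U \<phi> \<Longrightarrow> u x0 = \<phi> x0 \<Longrightarrow> (\<forall>x\<in>U. u x \<ge> \<phi> x) \<Longrightarrow>
           (\<exists>L. has_frac_laplacian s (override_on u \<phi> U) x0 L \<and> L \<ge> v x0 powr p)" by blast
    have "integrable lborel (\<lambda>z. sdiff (\<lambda>x. - u x) x0 z * fker s z) \<and>
       (LINT z|lborel. sdiff (\<lambda>x. - u x) x0 z * fker s z) \<le> 2 / frac_const TYPE('n) s * (- (v x0 powr p))"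
      by (intro conjI viscosity_test_imp[OF st(1,2) c(1) _ U(1,2) flip[OF U(3)], where M=M and b=b and K=K])
         (use M(1) touch in auto)
    then show "integrable lborel (\<lambda>z. sdiff (\<lambda>x. - u x) x0 z * fker s z) \<and>
       (LINT z|lborel. sdiff (\<lambda>x. - u x) x0 z * fker s z) \<le> - (2 / frac_const TYPE('n) s * v x0 powr p)" by simp
  qed
  show "fsub t G (\<lambda>x. - (2 / frac_const TYPE('n) t * u x powr q)) (\<lambda>x. - v x)"
    unfolding fsub_def
  proof (intro ballI allI impI)
    fix x0 b K assume "x0 \<in> G" and touch: "\<forall>z. - v (x0 + z) \<le> - v x0 + b \<bullet> z + K * (norm z)\<^sup>2"
    from T[OF this(1)] obtain U where U: "open U" "x0 \<in> U"
      "\<And>\<phi>. C2_closure U \<phi> \<Longrightarrow> v x0 = \<phi> x0 \<Longrightarrow> (\<forall>x\<in>U. v x \<ge> \<phi> x) \<Longrightarrow>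
           (\<exists>L. has_frac_laplacian t (override_on v \<phi> U) x0 L \<and> L \<ge> u x0 powr q)" by blast
    have "integrable lborel (\<lambda>z. sdiff (\<lambda>x. - v x) x0 z * fker t z) \<and>
       (LINT z|lborel. sdiff (\<lambda>x. - v x) x0 z * fker t z) \<le> 2 / frac_const TYPE('n) t * (- (u x0 powr q))"
      by (intro conjI viscosity_test_imp[OF st(3,4) c(2) _ U(1,2) flip[OF U(3)], where M=M and b=b and K=K])
         (use M(2) touch in auto)
    then show "integrable lborel (\<lambda>z. sdiff (\<lambda>x. - v x) x0 z * fker t z) \<and>
       (LINT z|lborel. sdiff (\<lambda>x. - v x) x0 z * fker t z) \<le> - (2 / frac_const TYPE('n) t * u x0 powr q)" by simp
  qed
qed

section \<open>The zero pair is a solution\<close>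

lemma C2_closure_max_quadratic:
  fixes \<phi> :: "real ^ 'n \<Rightarrow> real"
  assumes C2: "C2_closure (ball x0 r) \<phi>" and r: "r > 0" and max: "\<And>x. x \<in> ball x0 r \<Longrightarrow> \<phi> x \<le> \<phi> x0"
  obtains \<rho> B where "\<rho> > 0" "\<And>z. norm z < \<rho> \<Longrightarrow> \<bar>\<phi> (x0 + z) - \<phi> x0\<bar> \<le> B * (norm z)\<^sup>2"
proof -
  obtain D H where \<phi>: "\<And>x. x \<in> ball x0 r \<Longrightarrow> (\<phi> has_derivative (\<lambda>h. D x \<bullet> h)) (at x)"
    and D: "\<And>x. x \<in> ball x0 r \<Longrightarrow> (D has_derivative (\<lambda>h. H x *v h)) (at x)"
    using C2 unfolding C2_closure_def by blast
  have x0: "x0 \<in> ball x0 r" using r by simp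
  have "(\<lambda>h. D x0 \<bullet> h) = (\<lambda>h. 0)"
    using differential_zero_maxmin[OF x0 open_ball \<phi>[OF x0]] max by blast
  from fun_cong[OF this, of "D x0"] have D0: "D x0 = 0" by simp
  obtain B where B: "\<And>v. norm (H x0 *v v) \<le> norm v * B"
    using bounded_linear.bounded[OF has_derivative_bounded_linear[OF D[OF x0]]] by blast
  obtain d where d: "d > 0" "\<And>y. norm (y - x0) < d \<Longrightarrow> norm (D y - D x0 - H x0 *v (y - x0)) \<le> 1 * norm (y - x0)"
    using D[OF x0] zero_less_one unfolding has_derivative_at_alt by blast
  have Dle: "norm (D y) \<le> (1 + B) * norm (y - x0)" if "norm (y - x0) < d" for y
  proof -
    have "norm (D y) \<le> norm (D y - H x0 *v (y - x0)) + norm (H x0 *v (y - x0))" 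
      using norm_triangle_sub[of "D y" "H x0 *v (y - x0)"] by linarith
    then show ?thesis using d(2)[OF that] B[of "y - x0"] by (simp add: D0 algebra_simps)
  qed
  show ?thesis
  proof (rule that[of "min d r" "1 + B"])
    show "min d r > 0" using d r by simp
    fix z :: "real^'n" assume z: "norm z < min d r"
    have "norm (\<phi> (x0 + z) - \<phi> x0) \<le> ((1 + B) * norm z) * norm (x0 + z - x0)"
    proof (rule differentiable_bound[where S="cball x0 (norm z)" and f'="\<lambda>x h. D x \<bullet> h" and f=\<phi> and x="x0
        + z" and y=x0])
      fix x assume x: "x \<in> cball x0 (norm z)"
      then have xz: "norm (x - x0) \<le> norm z" by (simp add: dist_norm norm_minus_commute)
      then have "x \<in> ball x0 r" using z by (simp add: dist_norm norm_minus_commute)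
      then show "(\<phi> has_derivative (\<lambda>h. D x \<bullet> h)) (at x within cball x0 (norm z))"
        using \<phi> has_derivative_at_withinI by blast
      have B0: "0 \<le> 1 + B"
      proof -
        have "0 \<le> norm (axis undefined 1 :: real^'n) * B" using B[of "axis undefined 1"] norm_ge_zero order_trans
          by blast
        then show ?thesis by simp
      qed
      have "norm (D x) \<le> (1 + B) * norm (x - x0)" using Dle xz z by simp
      also have "\<dots> \<le> (1 + B) * norm z" using xz B0 by (intro mult_left_mono) auto
      finally have Dz: "norm (D x) \<le> (1 + B) * norm z" .
      show "onorm (\<lambda>h. D x \<bullet> h) \<le> (1 + B) * norm z"
      proof (intro onorm_le)
        fix h
        show "norm (D x \<bullet> h) \<le> (1 + B) * norm z * norm h"
          using Dz Cauchy_Schwarz_ineq2[of "D x" h] mult_right_mono[of "norm (D x)" "(1 + B) * norm z" "norm h"]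
            by simp
      qed
    qed (use r in \<open>auto simp: dist_norm\<close>)
    then show "\<bar>\<phi> (x0 + z) - \<phi> x0\<bar> \<le> (1 + B) * (norm z)\<^sup>2" by (simp add: power2_eq_square mult.assoc)
  qed
qed

text \<open>The existence of the principal value is what needs proof. At its maximum
  \<open>x0\<close> the test function is quadratically small, so the integrand is absolutely
  integrable and the truncated integrals converge by domination; the sign is then evident.\<close>

lemma frac_laplacian_nonpos_bump:
  fixes \<phi> :: "real ^ 'n::{finite,linorder} \<Rightarrow> real"
  assumes s: "0 < s" "s < 1" and r: "r > 0" and C2: "C2_closure (ball x0 r) \<phi>" and \<phi>0: "\<phi> x0 = 0"
    and le: "\<And>x. x \<in> ball x0 r \<Longrightarrow> \<phi> x \<le> 0"
  shows "\<exists>L\<ge>0. has_frac_laplacian s (override_on (\<lambda>_. 0) \<phi> (ball x0 r)) x0 L"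
proof -
  define w where "w = override_on (\<lambda>_. 0) \<phi> (ball x0 r)"
  have w: "w = (\<lambda>x. indicator (ball x0 r) x *\<^sub>R \<phi> x)" by (auto simp: w_def override_on_def indicator_def)
  have wx0: "w x0 = 0" using \<phi>0 by (simp add: w)
  have w0: "w x \<le> 0" for x using le by (simp add: w indicator_def)
  have cont: "continuous_on (closure (ball x0 r)) \<phi>" using C2 unfolding C2_closure_def by blast
  have [measurable]: "w \<in> borel_measurable borel"
    unfolding w using borel_measurable_continuous_on_indicator[of "ball x0 r" \<phi>]
      continuous_on_subset[OF cont closure_subset]
    by simp
  have "compact (closure (ball x0 r))" using r by simp
  then have "bounded (\<phi> ` closure (ball x0 r))" by (intro compact_imp_bounded compact_continuous_image cont)
  then obtain C1 where C1: "\<And>x. x \<in> ball x0 r \<Longrightarrow> \<bar>\<phi> x\<bar> \<le> C1"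
    unfolding bounded_iff real_norm_def using subsetD[OF closure_subset] by blast
  have C10: "0 \<le> C1" using C1[of x0] r by (simp add: \<phi>0)
  obtain \<rho> B where \<rho>: "\<rho> > 0" "\<And>z. norm z < \<rho> \<Longrightarrow> \<bar>\<phi> (x0 + z) - \<phi> x0\<bar> \<le> B * (norm z)\<^sup>2"
    using C2_closure_max_quadratic[OF C2 r] le unfolding \<phi>0 by blast
  define \<rho>' where "\<rho>' = min \<rho> 1"
  have \<rho>': "0 < \<rho>'" "\<rho>' \<le> 1" "\<rho>' \<le> \<rho>" using \<rho> by (auto simp: \<rho>'_def)
  define C where "C = \<bar>B\<bar> + C1 / \<rho>'\<^sup>2"
  have bound: "\<bar>w (x0 + z)\<bar> \<le> C * min 1 ((norm z)\<^sup>2)" for z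
  proof (cases "norm z < \<rho>'")
    case True
    then have "(norm z)\<^sup>2 \<le> 1" using \<rho>' by (simp add: power_le_one)
    have "\<bar>w (x0 + z)\<bar> \<le> \<bar>\<phi> (x0 + z) - \<phi> x0\<bar>" by (simp add: w \<phi>0 indicator_def)
    also have "\<dots> \<le> B * (norm z)\<^sup>2" using \<rho>(2)[of z] True \<rho>' by simp
    also have "\<dots> \<le> C * (norm z)\<^sup>2" unfolding C_def using C10 by (intro mult_right_mono add_increasing2) auto
    finally show ?thesis using \<open>(norm z)\<^sup>2 \<le> 1\<close> by (simp add: min_def)
  next
    case False
    then have "\<rho>'\<^sup>2 \<le> (norm z)\<^sup>2" using \<rho>' by (intro power_mono) auto
    moreover have "\<rho>'\<^sup>2 \<le> 1" using \<rho>' by (simp add: power_le_one)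
    ultimately have m: "\<rho>'\<^sup>2 \<le> min 1 ((norm z)\<^sup>2)" by simp
    have "\<bar>w (x0 + z)\<bar> \<le> C1" using C1[of "x0 + z"] C10 by (auto simp: w indicator_def)
    also have "\<dots> = C1 / \<rho>'\<^sup>2 * \<rho>'\<^sup>2" using \<rho>' by simp
    also have "\<dots> \<le> C * min 1 ((norm z)\<^sup>2)" using m C10 unfolding C_def by (intro mult_mono) auto
    finally show ?thesis .
  qed
  define k where "k y = (w x0 - w y) / norm (x0 - y) powr (real CARD('n) + 2 * s)" for y
  have k: "k (x0 + z) = - w (x0 + z) * fker s z" for z
    by (simp add: k_def wx0 fker_def powr_minus_divide del: minus_add_distrib)
  have k0: "k y \<ge> 0" for y unfolding k_def using w0[of y] wx0 by (intro divide_nonneg_nonneg) auto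
  have [measurable]: "k \<in> borel_measurable borel" unfolding k_def by measurable
  have "integrable lborel (\<lambda>z. k (x0 + z))"
  proof (rule Bochner_Integration.integrable_bound)
    show "integrable lborel (\<lambda>z::real^'n::_. C * (min 1 ((norm z)\<^sup>2) * fker s z))"
      by (intro integrable_mult_right integrable_fker_min s)
    show "AE z in lborel. norm (k (x0 + z)) \<le> norm (C * (min 1 ((norm z)\<^sup>2) * fker s z))"
    proof (rule AE_I2)
      fix z :: "real^'n::_"
      have "norm (k (x0 + z)) = \<bar>w (x0 + z)\<bar> * fker s z" by (simp add: k abs_mult)
      also have "\<dots> \<le> (C * min 1 ((norm z)\<^sup>2)) * fker s z" by (intro mult_right_mono bound) auto
      finally show "norm (k (x0 + z)) \<le> norm (C * (min 1 ((norm z)\<^sup>2) * fker s z))" by (simp add: mult.assoc)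
    qed
  qed measurable
  then have kint: "integrable lborel k" using lborel_integrable_translate[of k x0] by simp
  have lim: "((\<lambda>\<epsilon>. LINT y:(- ball x0 \<epsilon>)|lborel. k y) \<longlongrightarrow> integral\<^sup>L lborel k) (at_right 0)"
    unfolding tendsto_at_iff_sequentially
  proof (intro allI impI)
    fix X :: "nat \<Rightarrow> real" assume X: "\<forall>i. X i \<in> {0<..} - {0}" "X \<longlonglongrightarrow> 0"
    have "(\<lambda>i. LINT y|lborel. indicator (- ball x0 (X i)) y *\<^sub>R k y) \<longlonglongrightarrow> integral\<^sup>L lborel k"
    proof (rule integral_dominated_convergence[where w=k])
      show "AE y in lborel. (\<lambda>i. indicator (- ball x0 (X i)) y *\<^sub>R k y) \<longlonglongrightarrow> k y"
      proof (rule AE_I2)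
        fix y
        show "(\<lambda>i. indicator (- ball x0 (X i)) y *\<^sub>R k y) \<longlonglongrightarrow> k y"
        proof (cases "y = x0")
          case False
          then have "\<forall>\<^sub>F i in sequentially. X i < dist x0 y" using X(2) by (intro order_tendstoD) auto
          then have "\<forall>\<^sub>F i in sequentially. k y = indicator (- ball x0 (X i)) y *\<^sub>R k y"
            by eventually_elim (simp add: indicator_def)
          then show ?thesis by (rule Lim_transform_eventually[OF tendsto_const])
        qed (simp add: k_def)
      qed
    qed (use kint k0 in \<open>auto simp: indicator_def\<close>)
    then show "((\<lambda>\<epsilon>. LINT y:(- ball x0 \<epsilon>)|lborel. k y) \<circ> X) \<longlonglongrightarrow> integral\<^sup>L lborel k"
      unfolding set_lebesgue_integral_def o_def .
  qed
  have si: "set_integrable lborel (- ball x0 \<epsilon>) k" for \<epsilon>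
    unfolding set_integrable_def by (rule integrable_mult_indicator) (use kint in auto)
  have "has_frac_laplacian s w x0 (frac_const TYPE('n) s * integral\<^sup>L lborel k)"
    unfolding has_frac_laplacian_def Let_def k_def[symmetric]
    by (intro conjI allI impI si exI[of _ "integral\<^sup>L lborel k"] lim refl)
  moreover have "0 \<le> frac_const TYPE('n) s * integral\<^sup>L lborel k"
    using frac_const_pos[OF s, where 'n='n] k0 by (intro mult_nonneg_nonneg Bochner_Integration.integral_nonneg) auto
  ultimately show ?thesis unfolding w_def by (intro exI conjI)
qed

text \<open>Every test function touching zero has an extremum of value 0 at the point, and
  \<open>0 powr p = 0\<close> for all exponents.\<close>

lemma viscosity_solution_zero:
  assumes st: "0 < s" "s < 1" "0 < t" "t < 1" and G: "open G"
  shows "viscosity_solution s t p q G (\<lambda>x::real^'n::{finite,linorder}. 0) (\<lambda>x. 0)"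
proof -
  have ball: "\<exists>r>0. closure (ball x r) \<subseteq> G" if xG: "x \<in> G" for x
  proof -
    obtain r where "r > 0" "cball x r \<subseteq> G" using bspec[OF G[unfolded open_contains_cball] xG] by auto
    then show ?thesis by (intro exI[of _ r]) auto
  qed
  have sup: "\<exists>L. has_frac_laplacian r' (override_on (\<lambda>x. 0) \<phi> (ball x r)) x L \<and> 0 \<le> L"
    if "0 < r'" "r' < 1" "r > 0" "C2_closure (ball x r) \<phi>" "0 = \<phi> x" "\<forall>y\<in>ball x r. \<phi> y \<le> 0"
    for r r' and \<phi> :: "real^'n::_ \<Rightarrow> real" and x
    using frac_laplacian_nonpos_bump[OF that(1-4)] that(5,6) by auto
  have sub: "\<exists>L. has_frac_laplacian r' (override_on (\<lambda>x. 0) \<phi> (ball x r)) x L \<and> L \<le> 0"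
    if a: "0 < r'" "r' < 1" "r > 0" "C2_closure (ball x r) \<phi>" "0 = \<phi> x" "\<forall>y\<in>ball x r. 0 \<le> \<phi> y"
    for r r' and \<phi> :: "real^'n::_ \<Rightarrow> real" and x
  proof -
    obtain L where L: "L \<ge> 0" "has_frac_laplacian r' (override_on (\<lambda>_. 0) (\<lambda>x. - \<phi> x) (ball x r)) x L"
      using frac_laplacian_nonpos_bump[OF a(1-3) C2_closure_uminus[OF a(4)]] a(5,6) by auto
    have "(\<lambda>y. - override_on (\<lambda>_. 0) (\<lambda>x. - \<phi> x) (ball x r) y) = override_on (\<lambda>_. 0) \<phi> (ball x r)"
      by (auto simp: override_on_def)
    then show ?thesis using has_frac_laplacian_uminus[OF L(2)] L(1) by (intro exI[of _ "- L"]) simp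
  qed
  have "viscosity_supersolution s t p q G (\<lambda>x::real^'n::_. 0) (\<lambda>x. 0)"
    unfolding viscosity_supersolution_def
  proof (intro conjI ballI)
    fix x0 assume "x0 \<in> G"
    from ball[OF this] obtain r where r: "r > 0" "closure (ball x0 r) \<subseteq> G" by blast
    show "\<exists>U. open U \<and> x0 \<in> U \<and> closure U \<subseteq> G \<and>
        (\<forall>\<phi>. C2_closure U \<phi> \<and> 0 = \<phi> x0 \<and> (\<forall>x\<in>U. \<phi> x \<le> 0) \<longrightarrow>
           (\<exists>L. has_frac_laplacian s (override_on (\<lambda>x. 0) \<phi> U) x0 L \<and> 0 powr p \<le> L)) \<and>
        (\<forall>\<psi>. C2_closure U \<psi> \<and> 0 = \<psi> x0 \<and> (\<forall>x\<in>U. \<psi> x \<le> 0) \<longrightarrow>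
           (\<exists>L. has_frac_laplacian t (override_on (\<lambda>x. 0) \<psi> U) x0 L \<and> 0 powr q \<le> L))"
      by (rule exI[of _ "ball x0 r"]) (use r sup[OF st(1,2) r(1)] sup[OF st(3,4) r(1)] in simp)
  qed auto
  moreover have "viscosity_subsolution s t p q G (\<lambda>x::real^'n::_. 0) (\<lambda>x. 0)"
    unfolding viscosity_subsolution_def
  proof (intro conjI ballI)
    fix x0 assume "x0 \<in> G"
    from ball[OF this] obtain r where r: "r > 0" "closure (ball x0 r) \<subseteq> G" by blast
    show "\<exists>U. open U \<and> x0 \<in> U \<and> closure U \<subseteq> G \<and>
        (\<forall>\<phi>. C2_closure U \<phi> \<and> 0 = \<phi> x0 \<and> (\<forall>x\<in>U. 0 \<le> \<phi> x) \<longrightarrow>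
           (\<exists>L. has_frac_laplacian s (override_on (\<lambda>x. 0) \<phi> U) x0 L \<and> L \<le> 0 powr p)) \<and>
        (\<forall>\<psi>. C2_closure U \<psi> \<and> 0 = \<psi> x0 \<and> (\<forall>x\<in>U. 0 \<le> \<psi> x) \<longrightarrow>
           (\<exists>L. has_frac_laplacian t (override_on (\<lambda>x. 0) \<psi> U) x0 L \<and> L \<le> 0 powr q))"
      by (rule exI[of _ "ball x0 r"]) (use r sub[OF st(1,2) r(1)] sub[OF st(3,4) r(1)] in simp)
  qed auto
  ultimately show ?thesis unfolding viscosity_solution_def by simp
qed

section \<open>Maximum principles for odd functions\<close>

lemma fker_scale: "c > 0 \<Longrightarrow> fker s (c *\<^sub>R z) = c powr (- (real DIM('a) + 2 * s)) * fker s (z::'a::euclidean_space)"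
  by (simp add: fker_def powr_mult)

lemma fker_integral_scale:
  fixes f :: "'a::euclidean_space \<Rightarrow> real"
  assumes [measurable]: "f \<in> borel_measurable borel" and c: "c > 0"
  shows "(LINT z|lborel. f z * fker s z) = c powr (- (2 * s)) * (LINT z|lborel. f (c *\<^sub>R z) * fker s z)"
proof -
  have "(LINT z|lborel. f z * fker s z) = c ^ DIM('a) * (LINT z|lborel. f (c *\<^sub>R z) * fker s (c *\<^sub>R z))"
    by (rule lborel_integral_scale) (use c in auto)
  also have "(\<lambda>z. f (c *\<^sub>R z) * fker s (c *\<^sub>R z))
      = (\<lambda>z. c powr (- (real DIM('a) + 2 * s)) * (f (c *\<^sub>R z) * fker s z))"
    by (simp add: fker_scale[OF c] mult_ac)
  also have "c ^ DIM('a) * (LINT z|lborel. c powr (- (real DIM('a) + 2 * s)) * (f (c *\<^sub>R z) * fker s z))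
     = c powr (- (2 * s)) * (LINT z|lborel. f (c *\<^sub>R z) * fker s z)"
    by (subst integral_mult_right_zero)
       (use c in \<open>simp add: powr_realpow[symmetric] mult.assoc[symmetric] powr_add[symmetric]\<close>)
  finally show ?thesis .
qed

lemma integrable_fker_bounded:
  fixes f :: "'a::euclidean_space \<Rightarrow> real"
  assumes [measurable]: "f \<in> borel_measurable borel" and s: "s > 0" and r: "r > 0"
    and b: "\<And>z. \<bar>f z\<bar> \<le> M" and z: "\<And>z. norm z < r \<Longrightarrow> f z = 0"
  shows "integrable lborel (\<lambda>z. f z * fker s z)"
proof (rule Bochner_Integration.integrable_bound)
  show "integrable lborel (\<lambda>z::'a. M * (indicator {z. r \<le> norm z} z * fker s z))"
    by (intro integrable_mult_right integrable_fker_outside r s)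
  show "AE z in lborel. norm (f z * fker s z) \<le> norm (M * (indicator {z. r \<le> norm z} z * fker s z))"
  proof (rule AE_I2)
    fix x :: 'a
    have "\<bar>f x\<bar> * fker s x \<le> M * (indicator {z. r \<le> norm z} x * fker s x)"
      using b[of x] z[of x] by (cases "norm x < r") (auto intro: mult_right_mono)
    also have "\<dots> \<le> \<bar>M * (indicator {z. r \<le> norm z} x * fker s x)\<bar>" by (rule abs_ge_self)
    finally show "norm (f x * fker s x) \<le> norm (M * (indicator {z. r \<le> norm z} x * fker s x))"
      by (simp add: abs_mult)
  qed
qed measurable

lemma integral_punctured_tendsto:
  fixes f :: "'a::euclidean_space \<Rightarrow> real"
  assumes f: "integrable lborel f" and r: "r \<longlonglongrightarrow> 0" and f0: "f 0 = 0"
  shows "(\<lambda>j. LINT z|lborel. indicator (- ball 0 (r j)) z * f z) \<longlonglongrightarrow> integral\<^sup>L lborel f"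
proof (rule integral_dominated_convergence[where w="\<lambda>z. \<bar>f z\<bar>"])
  show "AE z in lborel. (\<lambda>j. indicator (- ball 0 (r j)) z * f z) \<longlonglongrightarrow> f z"
  proof (rule AE_I2)
    fix z :: 'a
    show "(\<lambda>j. indicator (- ball 0 (r j)) z * f z) \<longlonglongrightarrow> f z"
    proof (cases "z = 0")
      case False
      then have "\<forall>\<^sub>F j in sequentially. r j < norm z" using r by (intro order_tendstoD) auto
      then have "\<forall>\<^sub>F j in sequentially. f z = indicator (- ball 0 (r j)) z * f z"
        by eventually_elim (simp add: indicator_def)
      then show ?thesis by (rule Lim_transform_eventually[OF tendsto_const])
    qed (simp add: f0)
  qed
qed (use f in \<open>auto simp: indicator_def\<close>)

text \<open>The squared distances differ by a product of the signed distances to the plane, whose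
  sign decides which of the two kernels is larger.\<close>

lemma norm_crefl_diff_sq:
  assumes i: "i \<in> Basis"
  shows "(norm (crefl i a y - x))\<^sup>2 = (norm (y - x))\<^sup>2 + 4 * (a - y \<bullet> i) * (a - x \<bullet> i)"
proof -
  have e: "crefl i a y - x = (y - x) + (2 * (a - y \<bullet> i)) *\<^sub>R i" by (simp add: crefl_def)
  show ?thesis unfolding e power2_norm_eq_inner using i
    by (simp add: inner_add_left inner_add_right inner_diff_left inner_diff_right inner_commute algebra_simps)
qed

lemma norm_crefl_diff_ge:
  assumes i: "i \<in> Basis" and "y \<bullet> i \<le> a" "x \<bullet> i \<le> a"
  shows "norm (y - x) \<le> norm (crefl i a y - x)"
proof -
  have "0 \<le> 4 * (a - y \<bullet> i) * (a - x \<bullet> i)" using assms by (intro mult_nonneg_nonneg) auto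
  then have "(norm (y - x))\<^sup>2 \<le> (norm (crefl i a y - x))\<^sup>2" unfolding norm_crefl_diff_sq[OF i] by linarith
  then show ?thesis by (rule power2_le_imp_le) simp
qed

text \<open>
  For \<open>e\<close> odd under the reflection in \<open>{y. y \<bullet> i = a}\<close> the two values \<open>e y\<close> and \<open>- e y\<close> at reflected points
  see the kernels \<open>fker s (y - x)\<close> and \<open>fker s (crefl i a y - x)\<close>, the first of which is the larger one
  when \<open>x\<close> and \<open>y\<close> lie on the same side.
\<close>

lemma antisym_punctured_lower:
  fixes e :: "'a::euclidean_space \<Rightarrow> real"
  assumes i: "i \<in> Basis" and s: "s > 0" and [measurable]: "e \<in> borel_measurable borel"
    and M: "\<And>y. \<bar>e y\<bar> \<le> M" and anti: "\<And>y. e (crefl i a y) = - e y" and pos: "\<And>y. y \<bullet> i < a \<Longrightarrow> 0 \<le> e y"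
    and x: "x \<bullet> i < a" and r: "0 < r" "r \<le> r0" "r0 < a - x \<bullet> i"
  shows "integrable lborel (\<lambda>y. indicator {y. y \<bullet> i < a \<and>
      r0 \<le> norm (y - x)} y * (e y * (fker s (y - x) - fker s (crefl i a y - x))))"
    and "(LINT y|lborel. indicator {y. y \<bullet> i < a \<and>
        r0 \<le> norm (y - x)} y * (e y * (fker s (y - x) - fker s (crefl i a y - x))))
       - 2 * (M * (a - x \<bullet> i) powr (- (real DIM('a) + 2 * s)) * measure lborel (ball (0::'a) r))
     \<le> (LINT z|lborel. indicator (- ball 0 r) z * ((e (x + z) + e (x - z)) * fker s z))"
proof -
  define \<tau> where "\<tau> = a - x \<bullet> i"
  have \<tau>: "\<tau> > 0" using x by (simp add: \<tau>_def)
  define k\<tau> where "k\<tau> = \<tau> powr (- (real DIM('a) + 2 * s))"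
  have k\<tau>0: "k\<tau> \<ge> 0" by (simp add: k\<tau>_def)
  have M0: "M \<ge> 0" using M[of 0] by linarith
  define g where "g z = (indicator (- ball 0 r) z * e (x + z)) * fker s z" for z
  define h where "h y = g (y - x)" for y
  have gint: "integrable lborel g" unfolding g_def
    by (rule integrable_fker_bounded[OF _ s r(1), where M=M]) (use M M0 in \<open>auto simp: indicator_def\<close>)
  have [measurable]: "g \<in> borel_measurable borel" unfolding g_def by measurable
  have [measurable]: "h \<in> borel_measurable borel" unfolding h_def by measurable
  have gh: "g = (\<lambda>z. h (x + z))" by (simp add: h_def)
  have hint: "integrable lborel h" using lborel_integrable_translate[of h x] gint unfolding gh by simp
  have gmint: "integrable lborel (\<lambda>z. g (- z))" using lborel_integrable_reflect[of g 0] gint by simp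
  have "(LINT z|lborel. indicator (- ball 0 r) z * ((e (x + z) + e (x - z)) * fker s z))
      = (LINT z|lborel. g z + g (- z))"
    by (intro arg_cong[where f="integral\<^sup>L lborel"] ext) (simp add: g_def indicator_def algebra_simps)
  also have "\<dots> = (LINT z|lborel. g z) + (LINT z|lborel. g (- z))"
    by (rule Bochner_Integration.integral_add[OF gint gmint])
  also have "(LINT z|lborel. g (- z)) = (LINT z|lborel. g z)" using lborel_integral_reflect[of g 0] by simp
  also have "(LINT z|lborel. g z) = (LINT y|lborel. h y)" unfolding gh by (rule lborel_integral_translate) measurable
  finally have J: "(LINT z|lborel. indicator (- ball 0 r) z * ((e (x + z) + e (x - z)) * fker s z))
      = 2 * (LINT y|lborel. h y)" by simp
  have hRint: "integrable lborel (\<lambda>y. h (crefl i a y))" using lborel_integrable_crefl[OF i, of h a] hint by simp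
  have H2: "2 * (LINT y|lborel. h y) = (LINT y|lborel. h y + h (crefl i a y))"
    using lborel_integral_crefl[OF i, of h a] by (subst Bochner_Integration.integral_add[OF hint hRint]) simp
  define P where "P y = indicator {y. y \<bullet> i < a \<and>
      r0 \<le> norm (y - x)} y * (e y * (fker s (y - x) - fker s (crefl i a y - x)))" for y
  \<comment> \<open>The ball about \<open>x\<close> is removed but its mirror image is not. This
    asymmetry costs at most the bound of \<open>e\<close> times the kernel at distance \<tau>, on a
    ball of radius \<open>r\<close>, and it vanishes with \<open>r\<close>.\<close>
  define N where "N y = M * k\<tau> * (indicator (ball x r) y :: real)" for y
  have far: "norm (crefl i a y - x) \<ge> \<tau> \<and> norm (y - x) \<le> norm (crefl i a y - x)" if "y \<bullet> i < a" for y
  proof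
    have "\<tau> \<le> (crefl i a y - x) \<bullet> i" using that i by (simp add: inner_diff_left crefl_inner \<tau>_def)
    also have "\<dots> \<le> norm (crefl i a y - x)" using Basis_le_norm[OF i, of "crefl i a y - x"] by linarith
    finally show "\<tau> \<le> norm (crefl i a y - x)" .
    show "norm (y - x) \<le> norm (crefl i a y - x)" using norm_crefl_diff_ge[OF i] that x by simp
  qed
  have kmono: "fker s (crefl i a y - x) \<le> fker s (y - x)" if "y \<bullet> i < a" "y \<noteq> x" for y
    using far[OF that(1)] that(2) s by (intro fker_antimono) auto
  have kfar: "fker s (crefl i a y - x) \<le> k\<tau>" if "y \<bullet> i < a" for y
    unfolding k\<tau>_def fker_def using far[OF that] \<tau> s by (intro powr_mono2') auto
  have hR: "h (crefl i a y) = - (indicator (- ball x r) (crefl i a y) * e y * fker s (crefl i a y - x))" for y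
    by (simp add: h_def g_def anti indicator_def dist_norm norm_minus_commute)
  have hy: "h y = indicator (- ball x r) y * e y * fker s (y - x)" for y
    by (simp add: h_def g_def indicator_def dist_norm norm_minus_commute)
  have ge1: "P y - N y \<le> h y + h (crefl i a y)" if y: "y \<bullet> i < a" for y
  proof -
    have eR: "e y * fker s (crefl i a y - x) \<le> M * k\<tau>"
      using M[of y] pos[OF y] kfar[OF y] by (intro mult_mono) auto
    have notR: "indicator (- ball x r) (crefl i a y) = (1::real)"
      using far[OF y] r by (auto simp: indicator_def dist_norm norm_minus_commute \<tau>_def)
    show ?thesis
    proof (cases "norm (y - x) < r")
      case True
      then have "h y + h (crefl i a y) = - (e y * fker s (crefl i a y - x))" unfolding hR notR unfolding hy
        by (simp add: indicator_def dist_norm norm_minus_commute)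
      moreover have "P y = 0" "N y = M * k\<tau>" using True r
        by (auto simp: P_def N_def indicator_def dist_norm norm_minus_commute)
      ultimately show ?thesis using eR by linarith
    next
      case False
      then have 1: "h y + h (crefl i a y) = e y * (fker s (y - x) - fker s (crefl i a y - x))" unfolding hR notR
        unfolding hy
        by (simp add: indicator_def dist_norm norm_minus_commute algebra_simps)
      have "y \<noteq> x" using False r by auto
      then have "0 \<le> e y * (fker s (y - x) - fker s (crefl i a y - x))"
        using kmono[OF y] pos[OF y] by (intro mult_nonneg_nonneg) auto
      moreover have "N y = 0" using False by (simp add: N_def indicator_def dist_norm norm_minus_commute)
      ultimately show ?thesis unfolding 1 by (auto simp: P_def indicator_def)
    qed
  qed
  have P0: "P y = 0" if "\<not> y \<bullet> i < a" for y using that by (simp add: P_def)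
  have NN: "N y \<ge> 0" for y using M0 k\<tau>0 by (simp add: N_def)
  \<comment> \<open>The symmetrized integrand is unchanged by the reflection, so on the other side
    the estimate is the one at the mirror image; on the plane itself \<open>e\<close> is 0.\<close>
  have PN: "P y - N y - N (crefl i a y) \<le> h y + h (crefl i a y)" for y
  proof (cases "y \<bullet> i < a")
    case True
    then show ?thesis using ge1[OF True] NN[of "crefl i a y"] by linarith
  next
    case False
    then consider "y \<bullet> i = a" | "crefl i a y \<bullet> i < a" using i by (fastforce simp: crefl_inner)
    then show ?thesis
    proof cases
      case 1
      then have "crefl i a y = y" by (simp add: crefl_def)
      then have "e y = 0" using anti[of y] by simp
      then show ?thesis using P0[OF False] NN[of y] NN[of "crefl i a y"] unfolding hR unfolding hy by simp
    next
      case 2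
      have "0 \<le> P (crefl i a y)"
      proof -
        have "0 \<le> fker s (crefl i a y - x) - fker s (crefl i a (crefl i a y) - x)" if "r0 \<le> norm (crefl i a y - x)"
          using kmono[OF 2] that r by fastforce
        then show ?thesis using pos[OF 2] unfolding P_def indicator_def by (auto intro!: mult_nonneg_nonneg)
      qed
      then show ?thesis using ge1[OF 2] P0[OF False] NN[of y] i by simp
    qed
  qed
  have Pint: "integrable lborel P"
  proof (rule Bochner_Integration.integrable_bound)
    have "integrable lborel (\<lambda>y. (\<lambda>z. M * (indicator {z. r0 \<le> norm z} z * fker s z)) (- x + y))"
      by (subst lborel_integrable_translate) (use r s in \<open>auto intro!: integrable_mult_right integrable_fker_outside\<close>)
    then show "integrable lborel (\<lambda>y. M * (indicator {z. r0 \<le> norm z} (y - x) * fker s (y - x)))" by simp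
    show "AE y in lborel. norm (P y) \<le> norm (M * (indicator {z. r0 \<le> norm z} (y - x) * fker s (y - x)))"
    proof (rule AE_I2)
      fix y
      show "norm (P y) \<le> norm (M * (indicator {z. r0 \<le> norm z} (y - x) * fker s (y - x)))"
      proof (cases "y \<bullet> i < a \<and> r0 \<le> norm (y - x)")
        case True
        then have "y \<noteq> x" using r by auto
        then have "0 \<le> fker s (y - x) - fker s (crefl i a y - x)" using kmono True by simp
        moreover have "fker s (y - x) - fker s (crefl i a y - x) \<le> fker s (y - x)" by simp
        ultimately have "\<bar>e y\<bar> * \<bar>fker s (y - x) - fker s (crefl i a y - x)\<bar> \<le> M * fker s (y - x)"
          using M[of y] by (intro mult_mono) auto
        then show ?thesis using True M0 by (simp add: P_def abs_mult)
      qed (simp add: P_def)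
    qed
  qed (unfold P_def, measurable)
  have bm: "emeasure lborel (ball x r) < \<infinity>" by (rule emeasure_bounded_finite) simp
  have Nint: "integrable lborel N" unfolding N_def
    by (intro integrable_mult_right integrable_real_indicator bm) auto
  have [measurable]: "N \<in> borel_measurable borel"
    using borel_measurable_integrable[OF Nint] by simp
  have NRint: "integrable lborel (\<lambda>y. N (crefl i a y))" using lborel_integrable_crefl[OF i, of N a] Nint by simp
  have "measure lborel (ball x r) = measure lborel (ball (0::'a) r)"
    using content_ball_conv_unit_ball[of r x] content_ball_conv_unit_ball[of r "0::'a"] r by simp
  then have NI: "integral\<^sup>L lborel N = M * k\<tau> * measure lborel (ball (0::'a) r)"
    unfolding N_def by simp
  have "integral\<^sup>L lborel P - 2 * (M * k\<tau> * measure lborel (ball (0::'a) r))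
      = (LINT y|lborel. P y - N y - N (crefl i a y))"
    using lborel_integral_crefl[OF i, of N a] NI Pint Nint NRint by simp
  also have "\<dots> \<le> (LINT y|lborel. h y + h (crefl i a y))"
    by (intro integral_mono Bochner_Integration.integrable_add Bochner_Integration.integrable_diff Pint Nint NRint
      hint hRint PN)
  finally show "(LINT y|lborel. indicator {y. y \<bullet> i < a \<and>
      r0 \<le> norm (y - x)} y * (e y * (fker s (y - x) - fker s (crefl i a y - x))))
       - 2 * (M * (a - x \<bullet> i) powr (- (real DIM('a) + 2 * s)) * measure lborel (ball (0::'a) r))
     \<le> (LINT z|lborel. indicator (- ball 0 r) z * ((e (x + z) + e (x - z)) * fker s z))"
    unfolding J H2 P_def k\<tau>_def \<tau>_def .
  show "integrable lborel (\<lambda>y. indicator {y. y \<bullet> i < a \<and>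
      r0 \<le> norm (y - x)} y * (e y * (fker s (y - x) - fker s (crefl i a y - x))))"
    using Pint unfolding P_def .
qed

text \<open>\<open>G - d\<close> is odd, nonnegative on the side of \<open>x\<close> and zero at
  \<open>x\<close>, so its truncated integrals are bounded below by an error that vanishes with the
  radius. \<open>G\<close> may be too rough for its own second difference to be integrable; the
  minorant \<open>l\<close> takes its place.\<close>

lemma antisym_comparison:
  fixes d G l :: "'a::euclidean_space \<Rightarrow> real"
  assumes i: "i \<in> Basis" and s: "s > 0"
    and [measurable]: "d \<in> borel_measurable borel" "G \<in> borel_measurable borel" "l \<in> borel_measurable borel"
    and M: "\<And>y. \<bar>d y\<bar> \<le> M" "\<And>y. \<bar>G y\<bar> \<le> M'"
    and anti: "\<And>y. d (crefl i a y) = - d y" "\<And>y. G (crefl i a y) = - G y"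
    and le: "\<And>y. y \<bullet> i < a \<Longrightarrow> d y \<le> G y"
    and x: "x \<bullet> i < a" "d x = G x"
    and int: "integrable lborel (\<lambda>z. sdiff d x z * fker s z)" "integrable lborel (\<lambda>z. l z * fker s z)"
    and l: "\<And>z. l z \<le> sdiff G x z"
  shows "(LINT z|lborel. l z * fker s z) \<le> (LINT z|lborel. sdiff d x z * fker s z)"
proof -
  define e where "e y = G y - d y" for y
  have em [measurable]: "e \<in> borel_measurable borel" unfolding e_def by measurable
  have eM: "\<bar>e y\<bar> \<le> M + M'" for y unfolding e_def using M(1)[of y] M(2)[of y] by linarith
  have eanti: "e (crefl i a y) = - e y" for y by (simp add: e_def anti)
  have epos: "0 \<le> e y" if "y \<bullet> i < a" for y using le[OF that] by (simp add: e_def)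
  have es: "e (x + z) + e (x - z) = sdiff d x z - sdiff G x z" for z
    using x(2) by (simp add: e_def sdiff_def)
  define \<tau> where "\<tau> = a - x \<bullet> i"
  have \<tau>: "\<tau> > 0" using x by (simp add: \<tau>_def)
  define r where "r j = \<tau> / 2 / real (Suc j)" for j
  have r: "r j > 0" "r j \<le> \<tau> / 2" "r j < \<tau>" for j
  proof -
    show "r j > 0" using \<tau> by (simp add: r_def)
    show *: "r j \<le> \<tau> / 2" using \<tau> by (simp add: r_def divide_le_eq mult_le_cancel_left1)
    show "r j < \<tau>" using \<tau> * by linarith
  qed
  have r0: "r \<longlonglongrightarrow> 0" unfolding r_def
    by (rule LIMSEQ_Suc) (rule lim_const_over_n)
  let ?C = "(M + M') * \<tau> powr (- (real DIM('a) + 2 * s))"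
  have A: "- 2 * (?C * measure lborel (ball (0::'a) (r j)))
     \<le> (LINT z|lborel. indicator (- ball 0 (r j)) z * (sdiff d x z * fker s z - l z * fker s z))" for j
  proof -
    \<comment> \<open>Here the retained region reaches down to the removed ball,
      \<open>r0 = r\<close>, and only the sign of its contribution is used.\<close>
    have "0 \<le> (LINT y|lborel. indicator {y. y \<bullet> i < a \<and>
        r j \<le> norm (y - x)} y * (e y * (fker s (y - x) - fker s (crefl i a y - x))))"
    proof (intro Bochner_Integration.integral_nonneg)
      fix y
      have "fker s (crefl i a y - x) \<le> fker s (y - x)" if "y \<bullet> i < a" "r j \<le> norm (y - x)"
      proof (rule fker_antimono[OF s])
        show "0 < norm (y - x)" using that(2) r(1)[of j] by linarith
        show "norm (y - x) \<le> norm (crefl i a y - x)" using norm_crefl_diff_ge[OF i] that x by simp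
      qed
      then show "0 \<le> indicator {y. y \<bullet> i < a \<and>
          r j \<le> norm (y - x)} y * (e y * (fker s (y - x) - fker s (crefl i a y - x)))"
        using epos[of y] by (auto simp: indicator_def)
    qed
    with antisym_punctured_lower(2)[OF i s em eM eanti epos x(1) r(1)[of j] order_refl[of "r j"]
      r(3)[of j, unfolded \<tau>_def]]
    have "- 2 * (?C * measure lborel (ball (0::'a) (r j)))
      \<le> (LINT z|lborel. indicator (- ball 0 (r j)) z * ((e (x + z) + e (x - z)) * fker s z))"
      unfolding \<tau>_def by simp
    also have "\<dots> \<le> (LINT z|lborel. indicator (- ball 0 (r j)) z * (sdiff d x z * fker s z - l z * fker s z))"
    proof (rule integral_mono)
      have "integrable lborel (\<lambda>z. (indicator (- ball 0 (r j)) z * (e (x + z) + e (x - z))) * fker s z)"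
        by (rule integrable_fker_bounded[OF _ s r(1)[of j], where M="2 * (M + M')"])
           (use eM[of "x + _"] eM[of "x - _"] eM[of 0] in \<open>auto simp: indicator_def intro!:
             order_trans[OF abs_triangle_ineq] add_mono[of _ "M + M'" _ "M + M'", simplified]\<close>)
      then show "integrable lborel (\<lambda>z. indicator (- ball 0 (r j)) z * ((e (x + z) + e (x - z)) * fker s z))"
        by (simp add: mult.assoc)
      have "integrable lborel (\<lambda>z. indicator (- ball 0 (r j)) z *\<^sub>R (sdiff d x z * fker s z - l z * fker s z))"
        by (intro integrable_mult_indicator Bochner_Integration.integrable_diff int) simp
      then show "integrable lborel (\<lambda>z. indicator (- ball 0 (r j)) z * (sdiff d x z * fker s z - l z * fker s z))"
        by simp
      fix z
      have "(e (x + z) + e (x - z)) * fker s z \<le> (sdiff d x z - l z) * fker s z"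
        unfolding es using l[of z] by (intro mult_right_mono) auto
      then show "indicator (- ball 0 (r j)) z * ((e (x + z) + e (x - z)) * fker s z)
         \<le> indicator (- ball 0 (r j)) z * (sdiff d x z * fker s z - l z * fker s z)"
        by (simp add: indicator_def left_diff_distrib)
    qed
    finally show ?thesis .
  qed
  have ballr: "measure lborel (ball (0::'a) (r j)) = r j ^ DIM('a) * measure lborel (ball (0::'a) 1)" for j
    using content_ball_conv_unit_ball[of "r j" "0::'a"] r(1)[of j] by simp
  have "(\<lambda>j. - 2 * (?C * measure lborel (ball (0::'a) (r j)))) \<longlonglongrightarrow> - 2
      * (?C * (0 ^ DIM('a) * measure lborel (ball (0::'a) 1)))"
    unfolding ballr by (intro tendsto_intros r0)
  moreover have "(\<lambda>j. LINT z|lborel. indicator (- ball 0 (r j)) z * (sdiff d x z * fker s z - l z * fker s z))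
     \<longlonglongrightarrow> (LINT z|lborel. sdiff d x z * fker s z - l z * fker s z)"
    by (intro integral_punctured_tendsto r0 Bochner_Integration.integrable_diff int) simp
  ultimately have "- 2 * (?C * (0 ^ DIM('a) * measure lborel (ball (0::'a) 1)))
      \<le> (LINT z|lborel. sdiff d x z * fker s z - l z * fker s z)"
    by (rule LIMSEQ_le) (use A in blast)
  then show ?thesis using int by (simp add: zero_power)
qed

lemma fker_strict_antimono:
  fixes x y :: "'a::euclidean_space"
  assumes "s > 0" "0 < norm y" "norm y < norm x" shows "fker s x < fker s y"
  unfolding fker_def using assms by (intro powr_less_mono2_neg) (auto simp: add_pos_pos)

text \<open>While the removed ball shrinks, the contribution from distance at least
  \<open>r0\<close> is retained. It is nonnegative and at most 0 in total, and as the kernel is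
  strictly decreasing its integrand can vanish in that region only where \<open>d\<close>
  does.\<close>

lemma antisym_strong_maximum:
  fixes d :: "'a::euclidean_space \<Rightarrow> real"
  assumes i: "i \<in> Basis" and s: "s > 0" and cont: "continuous_on UNIV d"
    and M: "\<And>y. \<bar>d y\<bar> \<le> M" and anti: "\<And>y. d (crefl i a y) = - d y"
    and le: "\<And>y. y \<bullet> i < a \<Longrightarrow> d y \<le> 0"
    and x: "x \<bullet> i < a" "d x = 0"
    and int: "integrable lborel (\<lambda>z. sdiff d x z * fker s z)" "(LINT z|lborel. sdiff d x z * fker s z) \<le> 0"
    and y: "y \<bullet> i < a"
  shows "d y = 0"
proof (rule ccontr)
  assume "d y \<noteq> 0"
  then have dy: "d y < 0" using le[OF y] by simp
  then have xy: "y \<noteq> x" using x by auto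
  define e where "e y = - d y" for y
  have em [measurable]: "e \<in> borel_measurable borel"
    unfolding e_def by (intro borel_measurable_continuous_onI continuous_intros cont)
  have eM: "\<bar>e y\<bar> \<le> M" for y unfolding e_def using M[of y] by simp
  have eanti: "e (crefl i a y) = - e y" for y by (simp add: e_def anti)
  have epos: "0 \<le> e y" if "y \<bullet> i < a" for y using le[OF that] by (simp add: e_def)
  have es: "e (x + z) + e (x - z) = sdiff d x z" for z
    using x(2) by (simp add: e_def sdiff_def)
  define \<tau> where "\<tau> = min (a - x \<bullet> i) (norm (y - x))"
  have \<tau>: "\<tau> > 0" using x xy by (simp add: \<tau>_def)
  \<comment> \<open>Half of the smaller distance, so that \<open>y\<close> lies strictly inside the
    region that is retained.\<close>
  define r0 where "r0 = \<tau> / 2"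
  have r0: "r0 < a - x \<bullet> i" "r0 < norm (y - x)" "r0 > 0" 
  proof -
    have "norm (y - x) > 0" using xy by simp
    moreover have "a - x \<bullet> i > 0" using x by simp
    ultimately show "r0 < a - x \<bullet> i" "r0 < norm (y - x)" "r0 > 0" unfolding r0_def \<tau>_def by (simp_all add: min_def)
  qed
  define r where "r j = r0 / real (Suc j)" for j
  have r: "r j > 0" "r j \<le> r0" for j
    using r0 by (auto simp: r_def divide_le_eq mult_le_cancel_left1)
  have rl: "r \<longlonglongrightarrow> 0" unfolding r_def
    by (rule LIMSEQ_Suc) (rule lim_const_over_n)
  define P where "P y = indicator {y. y \<bullet> i < a \<and>
      r0 \<le> norm (y - x)} y * (e y * (fker s (y - x) - fker s (crefl i a y - x)))" for y
  note apl = antisym_punctured_lower[OF i s em eM eanti epos x(1) r(1) r(2) r0(1), folded P_def]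
  have Pint: "integrable lborel P" using apl(1) .
  let ?C = "M * (a - x \<bullet> i) powr (- (real DIM('a) + 2 * s))"
  have ballr: "measure lborel (ball (0::'a) (r j)) = r j ^ DIM('a) * measure lborel (ball (0::'a) 1)" for j
    using content_ball_conv_unit_ball[of "r j" "0::'a"] r(1)[of j] by simp
  have "(\<lambda>j. integral\<^sup>L lborel P - 2 * (?C * measure lborel (ball (0::'a) (r j)))) \<longlonglongrightarrow>
       integral\<^sup>L lborel P - 2 * (?C * (0 ^ DIM('a) * measure lborel (ball (0::'a) 1)))"
    unfolding ballr by (intro tendsto_intros rl)
  then have L1: "(\<lambda>j. integral\<^sup>L lborel P - 2 * (?C * measure lborel (ball (0::'a) (r j)))) \<longlonglongrightarrow> integral\<^sup>L lborel P"
    by (simp add: zero_power)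
  have L2: "(\<lambda>j. LINT z|lborel. indicator (- ball 0 (r j)) z * (sdiff d x z * fker s z))
     \<longlonglongrightarrow> (LINT z|lborel. sdiff d x z * fker s z)"
    by (intro integral_punctured_tendsto rl int) simp
  have "integral\<^sup>L lborel P \<le> (LINT z|lborel. sdiff d x z * fker s z)"
    by (rule LIMSEQ_le[OF L1 L2]) (use apl(2) in \<open>simp add: P_def[abs_def] es\<close>)
  then have P0: "integral\<^sup>L lborel P \<le> 0" using int(2) by simp
  have kl: "fker s (crefl i a y - x) < fker s (y - x)" if "y \<bullet> i < a" "r0 \<le> norm (y - x)" for y
  proof (rule fker_strict_antimono[OF s])
    show "0 < norm (y - x)" using that r0 by linarith
    have "0 < 4 * (a - y \<bullet> i) * (a - x \<bullet> i)" using that x by (intro mult_pos_pos) auto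
    then have "(norm (y - x))\<^sup>2 < (norm (crefl i a y - x))\<^sup>2" unfolding norm_crefl_diff_sq[OF i] by linarith
    then show "norm (y - x) < norm (crefl i a y - x)" by (rule power2_less_imp_less) simp
  qed
  have Ppos: "P y \<ge> 0" for y unfolding P_def indicator_def using epos[of y] kl[of y]
    by (auto intro!: mult_nonneg_nonneg)
  have "integral\<^sup>L lborel P = 0" using P0 Bochner_Integration.integral_nonneg[of lborel P] Ppos
    by (simp add: order_antisym)
  then have AE: "AE y in lborel. P y = 0"
    using integral_nonneg_eq_0_iff_AE[OF Pint] Ppos by simp
  let ?U = "{w. w \<bullet> i < a} \<inter> {w. r0 < norm (w - x)} \<inter> {w. d w < 0}"
  have "open ?U" by (intro open_Int open_Collect_less continuous_intros cont)
  moreover have "?U \<noteq> {}" using y r0 dy by blast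
  ultimately obtain w where w: "w \<in> ?U" "P w = 0" using AE_lborel_open[OF _ _ AE] by blast
  then have "0 < e w * (fker s (w - x) - fker s (crefl i a w - x))" using kl[of w]
    by (intro mult_pos_pos) (auto simp: e_def)
  then show False using w by (auto simp: P_def)
qed

text \<open>By scaling, this number times \<tau>^(- 2 s) is the mass of the kernel beyond two
  parallel planes at distance \<tau>. It measures how strongly a point at distance \<tau> from the
  plane feels the reversed sign on the other side.\<close>

definition slab_const :: "'a::euclidean_space \<Rightarrow> real \<Rightarrow> real" where
  "slab_const i s = (LINT z|lborel. indicator {z::'a. 1 < \<bar>z \<bullet> i\<bar>} z * fker s z)"

lemma integrable_slab:
  assumes "i \<in> Basis" "s > 0" "\<tau> > 0"
  shows "integrable lborel (\<lambda>z::'a::euclidean_space. indicator {z. \<tau> < \<bar>z \<bullet> i\<bar>} z * fker s z)"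
proof (rule integrable_fker_bounded[OF _ assms(2,3), where M=1])
  show "indicator {z. \<tau> < \<bar>z \<bullet> i\<bar>} z = (0::real)" if "norm z < \<tau>" for z :: 'a
    using Basis_le_norm[OF assms(1), of z] that by (simp add: indicator_def)
qed (auto simp: indicator_def)

lemma slab_integral:
  assumes \<tau>: "\<tau> > 0"
  shows "(LINT z|lborel. indicator {z::'a::euclidean_space. \<tau> < \<bar>z \<bullet> i\<bar>} z * fker s z)
      = slab_const i s * \<tau> powr (- (2 * s))"
proof -
  have "indicator {z::'a. \<tau> < \<bar>z \<bullet> i\<bar>} (\<tau> *\<^sub>R z) = (indicator {z. 1 < \<bar>z \<bullet> i\<bar>} z :: real)" for z
    using \<tau> by (simp add: indicator_def abs_mult)
  then show ?thesis
    by (subst fker_integral_scale[OF _ \<tau>]) (simp_all add: slab_const_def)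
qed

lemma slab_const_pos:
  assumes i: "i \<in> Basis" and s: "s > 0"
  shows "slab_const i s > 0"
proof -
  let ?f = "\<lambda>z::'a. indicator {z. 1 < \<bar>z \<bullet> i\<bar>} z * fker s z"
  have int: "integrable lborel ?f" by (rule integrable_slab[OF i s]) simp
  have "integral\<^sup>L lborel ?f \<noteq> 0"
  proof
    assume "integral\<^sup>L lborel ?f = 0"
    then have AE: "AE z in lborel. ?f z = 0"
      using integral_nonneg_eq_0_iff_AE[OF int] by simp
    have "open {z. 1 < z \<bullet> i}" by (intro open_Collect_less continuous_intros)
    moreover have "2 *\<^sub>R i \<in> {z. 1 < z \<bullet> i}" using i by simp
    ultimately obtain z where z: "1 < z \<bullet> i" "?f z = 0" using AE_lborel_open[OF _ _ AE] by blast
    then have "z \<noteq> 0" by auto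
    then show False using z fker_pos[of z s] by (simp add: indicator_def)
  qed
  moreover have "integral\<^sup>L lborel ?f \<ge> 0" by (intro Bochner_Integration.integral_nonneg) simp
  ultimately show ?thesis unfolding slab_const_def by linarith
qed

text \<open>
  Here \<open>d\<close> is compared with the odd function equal to the constant \<open>d x\<close> on the side of \<open>x\<close>.
\<close>

lemma antisym_narrow:
  fixes d :: "'a::euclidean_space \<Rightarrow> real"
  assumes i: "i \<in> Basis" and s: "s > 0" and [measurable]: "d \<in> borel_measurable borel"
    and M: "\<And>y. \<bar>d y\<bar> \<le> M" and anti: "\<And>y. d (crefl i a y) = - d y"
    and le: "\<And>y. y \<bullet> i < a \<Longrightarrow> d y \<le> d x"
    and x: "x \<bullet> i < a" "d x \<ge> 0" "x \<in> A" and sub: "fsub s A f d"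
  shows "2 * d x * slab_const i s * (a - x \<bullet> i) powr (- (2 * s)) \<le> f x"
proof -
  define \<tau> where "\<tau> = a - x \<bullet> i"
  have \<tau>: "\<tau> > 0" using x by (simp add: \<tau>_def)
  \<comment> \<open>The ball of radius \<tau> stays on the side where \<open>d x\<close> is the
    maximum, so a constant touches there.\<close>
  have "d (x + z) \<le> d x + 0 \<bullet> z + 0 * (norm z)\<^sup>2" if "norm z < \<tau>" for z
    using le[of "x + z"] Basis_le_norm[OF i, of z] that by (simp add: inner_add_left \<tau>_def)
  from touched_locally_imp[OF \<tau> this, of M]
  obtain K' where "\<And>z. d (x + z) \<le> d x + 0 \<bullet> z + K' * (norm z)\<^sup>2"
    using M by (metis abs_le_D1)
  from fsubD[OF sub x(3) this]
  have I: "integrable lborel (\<lambda>z. sdiff d x z * fker s z)" "(LINT z|lborel. sdiff d x z * fker s z) \<le> f x" by auto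
  define G where "G y = d x * sgn (a - y \<bullet> i)" for y
  \<comment> \<open>Once \<open>x + z\<close> or \<open>x - z\<close> has crossed the plane, the
    second difference of the step function is twice \<open>d x\<close>. Points exactly on the plane,
    where \<open>sgn\<close> is 0, are left out.\<close>
  define l where "l z = 2 * d x * indicator {z. \<tau> < \<bar>z \<bullet> i\<bar>} z" for z :: 'a
  have "(LINT z|lborel. l z * fker s z) \<le> (LINT z|lborel. sdiff d x z * fker s z)"
  proof (rule antisym_comparison[OF i s, where G=G and M=M and M'="d x" and a=a])
    show "G \<in> borel_measurable borel" "l \<in> borel_measurable borel" unfolding G_def l_def by measurable
    show "\<bar>G y\<bar> \<le> d x" for y using x by (auto simp: G_def sgn_if)
    show "G (crefl i a y) = - G y" for y using i by (simp add: G_def crefl_inner sgn_if)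
    show "d y \<le> G y" if "y \<bullet> i < a" for y using le[OF that] that by (simp add: G_def)
    show "d x = G x" using x by (simp add: G_def)
    show "integrable lborel (\<lambda>z. l z * fker s z)"
      unfolding l_def mult.assoc by (intro integrable_mult_right integrable_slab i s \<tau>)
    show "l z \<le> sdiff G x z" for z
    proof -
      have "a - (x + z) \<bullet> i = \<tau> - z \<bullet> i" "a - (x - z) \<bullet> i = \<tau> + z \<bullet> i"
        by (simp_all add: \<tau>_def inner_add_left inner_diff_left)
      then have S: "sdiff G x z = d x * (2 - sgn (\<tau> - z \<bullet> i) - sgn (\<tau> + z \<bullet> i))"
        using \<tau> by (simp add: sdiff_def G_def algebra_simps flip: \<tau>_def)
      have "2 * indicator {z. \<tau> < \<bar>z \<bullet> i\<bar>} z \<le> 2 - sgn (\<tau> - z \<bullet> i) - sgn (\<tau> + z \<bullet> i)"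
        using \<tau> by (auto simp: indicator_def sgn_if abs_if split: if_splits)
      from mult_left_mono[OF this x(2)] show ?thesis unfolding S l_def by (simp add: mult_ac)
    qed
  qed (use M anti x I(1) in auto)
  moreover have "(LINT z|lborel. l z * fker s z) = 2 * d x * slab_const i s * \<tau> powr (- (2 * s))"
    unfolding l_def mult.assoc using slab_integral[OF \<tau>, of i s] by simp
  ultimately show ?thesis using I(2) unfolding \<tau>_def by linarith
qed

section \<open>Hoelder regularity up to the boundary\<close>

lemma powr_le_tangent:
  fixes t t0 \<alpha> :: real
  assumes t: "t \<ge> 0" "t0 > 0" and \<alpha>: "0 < \<alpha>" "\<alpha> \<le> 1"
  shows "t powr \<alpha> \<le> t0 powr \<alpha> + \<alpha> * t0 powr (\<alpha> - 1) * (t - t0)"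
proof -
  have one: "y powr \<alpha> \<le> 1 + \<alpha> * (y - 1)" if "y \<ge> 0" for y :: real
  proof (cases "y = 0")
    case False
    then have y: "y > 0" using that by simp
    have "exp ((1 - \<alpha>) *\<^sub>R 0 + \<alpha> *\<^sub>R ln y) \<le> (1 - \<alpha>) * exp 0 + \<alpha> * exp (ln y)"
      by (rule convex_onD[OF exp_convex]) (use \<alpha> in auto)
    then show ?thesis using y by (simp add: powr_def algebra_simps)
  qed (use \<alpha> in simp)
  have "t powr \<alpha> = t0 powr \<alpha> * (t / t0) powr \<alpha>" using t by (simp add: powr_divide)
  also have "\<dots> \<le> t0 powr \<alpha> * (1 + \<alpha> * (t / t0 - 1))" using t by (intro mult_left_mono one) auto
  also have "\<dots> = t0 powr \<alpha> + \<alpha> * t0 powr (\<alpha> - 1) * (t - t0)" using t by (simp add: powr_diff field_simps)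
  finally show ?thesis .
qed

text \<open>The concave tangent inequality with exponent \<open>1 / p\<close>, applied to the p-th
  powers and solved for the convex power.\<close>

lemma powr_ge_tangent:
  fixes t t0 p :: real
  assumes t: "t \<ge> 0" "t0 > 0" and p: "p \<ge> 1"
  shows "t0 powr p + p * t0 powr (p - 1) * (t - t0) \<le> t powr p"
proof -
  have "(t powr p) powr (1 / p) \<le> (t0 powr p) powr (1 / p) + 1 / p * (t0 powr p) powr (1 / p - 1)
      * (t powr p - t0 powr p)"
    using t p by (intro powr_le_tangent) auto
  moreover have "(t powr p) powr (1 / p) = t" "(t0 powr p) powr (1 / p) = t0" using t p by (simp_all add: powr_powr)
  moreover have "(t0 powr p) powr (1 / p - 1) = t0 powr (1 - p)" using p by (simp add: powr_powr right_diff_distrib)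
  ultimately have "t - t0 \<le> 1 / p * (t0 powr (1 - p) * (t powr p - t0 powr p))" by simp
  then have "p * (t - t0) \<le> p * (1 / p * (t0 powr (1 - p) * (t powr p - t0 powr p)))" using p
    by (intro mult_left_mono) auto
  then have "p * (t - t0) \<le> t0 powr (1 - p) * (t powr p - t0 powr p)" using p by simp
  then have "t0 powr (p - 1) * (p * (t - t0)) \<le> t0 powr (p - 1) * (t0 powr (1 - p) * (t powr p - t0 powr p))"
    by (intro mult_left_mono) auto
  also have "\<dots> = t powr p - t0 powr p" using t by (simp add: mult.assoc[symmetric] powr_add[symmetric])
  finally show ?thesis by (simp add: mult_ac)
qed

lemma powr_midpoint_concave:
  fixes t h \<alpha> :: real
  assumes "\<bar>h\<bar> \<le> t" "0 < \<alpha>" "\<alpha> \<le> 1"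
  shows "(t + h) powr \<alpha> + (t - h) powr \<alpha> \<le> 2 * t powr \<alpha>"
proof (cases "t = 0")
  case False
  then have t: "t > 0" "0 \<le> t + h" "0 \<le> t - h" using assms by linarith+
  show ?thesis using assms powr_le_tangent[OF t(2,1), of \<alpha>] powr_le_tangent[OF t(3,1), of \<alpha>]
    by (simp add: algebra_simps)
qed (use assms in simp)

lemma powr_add_le:
  fixes x y \<alpha> :: real
  assumes x: "x \<ge> 0" "y \<ge> 0" and \<alpha>: "0 < \<alpha>" "\<alpha> \<le> 1"
  shows "(x + y) powr \<alpha> \<le> x powr \<alpha> + y powr \<alpha>"
proof (cases "x + y = 0")
  case False
  then have s: "x + y > 0" using x by simp
  have "x / (x + y) \<le> (x / (x + y)) powr \<alpha>" "y / (x + y) \<le> (y / (x + y)) powr \<alpha>"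
    using s x \<alpha> powr_mono'[of \<alpha> 1 "x / (x + y)"] powr_mono'[of \<alpha> 1 "y / (x + y)"] by auto
  moreover have "x / (x + y) + y / (x + y) = 1" using s by (simp add: add_divide_distrib[symmetric])
  ultimately have "1 \<le> (x / (x + y)) powr \<alpha> + (y / (x + y)) powr \<alpha>" by linarith
  then have "1 \<le> (x powr \<alpha> + y powr \<alpha>) / (x + y) powr \<alpha>" using s x by (simp add: powr_divide add_divide_distrib)
  then show ?thesis using s by (simp add: le_divide_eq)
qed (use x in simp)

section \<open>Barriers for odd functions\<close>

definition odd_profile :: "real \<Rightarrow> real \<Rightarrow> real" where
  "odd_profile \<alpha> t = sgn t * min \<bar>t\<bar> 1 powr \<alpha>"

lemma odd_profile_minus [simp]: "odd_profile \<alpha> (- t) = - odd_profile \<alpha> t"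
  by (simp add: odd_profile_def sgn_minus)

lemma odd_profile_pos: "t > 0 \<Longrightarrow> odd_profile \<alpha> t = min t 1 powr \<alpha>"
  by (simp add: odd_profile_def)

lemma odd_profile_measurable [measurable]: "odd_profile \<alpha> \<in> borel_measurable borel"
  unfolding odd_profile_def by measurable

lemma odd_profile_bound: "0 < \<alpha> \<Longrightarrow> \<bar>odd_profile \<alpha> t\<bar> \<le> 1"
proof -
  assume \<alpha>: "0 < \<alpha>"
  have "min \<bar>t\<bar> 1 powr \<alpha> \<le> 1 powr \<alpha>" by (intro powr_mono2) (use \<alpha> in auto)
  then show ?thesis by (auto simp: odd_profile_def abs_mult sgn_if)
qed

text \<open>As long as neither point crosses the plane, midpoint concavity makes the second
  difference nonnegative. Beyond, the bases \<open>min (\<tau> + h) 1\<close> and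
  \<open>min (h - \<tau>) 1\<close> differ by at most \<open>2 * min \<tau> 1\<close>, and
  subadditivity of the power leaves the gap \<open>2 - 2 powr \<alpha>\<close>.\<close>

lemma odd_profile_sdiff:
  assumes \<alpha>: "0 < \<alpha>" "\<alpha> \<le> 1" and \<tau>: "\<tau> > 0"
  shows "(2 - 2 powr \<alpha>) * indicator {h. \<tau> < \<bar>h\<bar>} h * min \<tau> 1 powr \<alpha>
     \<le> 2 * odd_profile \<alpha> \<tau> - odd_profile \<alpha> (\<tau> + h) - odd_profile \<alpha> (\<tau> - h)"
proof -
  have main: "(2 - 2 powr \<alpha>) * indicator {h. \<tau> < \<bar>h\<bar>} h * min \<tau> 1 powr \<alpha>
     \<le> 2 * odd_profile \<alpha> \<tau> - odd_profile \<alpha> (\<tau> + h) - odd_profile \<alpha> (\<tau> - h)" if h: "h \<ge> 0" for h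
  proof (cases "h \<le> \<tau>")
    case True
    have s: "odd_profile \<alpha> (\<tau> - h) \<le> min (\<tau> - h) 1 powr \<alpha>"
      using True by (cases "h = \<tau>") (auto simp: odd_profile_pos odd_profile_def)
    have a: "odd_profile \<alpha> (\<tau> + h) = min (\<tau> + h) 1 powr \<alpha>" using h \<tau> by (simp add: odd_profile_pos)
    define m1 m2 where "m1 = min (\<tau> + h) 1" and "m2 = min (\<tau> - h) 1"
    have m: "0 \<le> m2" "m2 \<le> m1" "(m1 + m2) / 2 \<le> min \<tau> 1" using True h by (auto simp: m1_def m2_def min_def)
    have "m1 powr \<alpha> + m2 powr \<alpha> \<le> 2 * ((m1 + m2) / 2) powr \<alpha>"
      using powr_midpoint_concave[of "(m1 - m2) / 2" "(m1 + m2) / 2" \<alpha>] m \<alpha> by (simp add: field_simps)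
    also have "\<dots> \<le> 2 * min \<tau> 1 powr \<alpha>" using m \<alpha> by (intro mult_left_mono powr_mono2) auto
    finally show ?thesis using True s h unfolding a m1_def m2_def odd_profile_pos[OF \<tau>] by (simp add: indicator_def)
  next
    case False
    then have b: "odd_profile \<alpha> (\<tau> - h) = - (min (h - \<tau>) 1 powr \<alpha>)"
      using odd_profile_minus[of \<alpha> "h - \<tau>"] by (simp add: odd_profile_pos)
    have a: "odd_profile \<alpha> (\<tau> + h) = min (\<tau> + h) 1 powr \<alpha>" using h \<tau> by (simp add: odd_profile_pos)
    have "min (\<tau> + h) 1 powr \<alpha> \<le> (min (h - \<tau>) 1 + 2 * min \<tau> 1) powr \<alpha>"
      using False \<tau> \<alpha> by (intro powr_mono2) (auto simp: min_def)
    also have "\<dots> \<le> min (h - \<tau>) 1 powr \<alpha> + (2 * min \<tau> 1) powr \<alpha>"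
      using False \<tau> \<alpha> by (intro powr_add_le) auto
    also have "(2 * min \<tau> 1) powr \<alpha> = 2 powr \<alpha> * min \<tau> 1 powr \<alpha>" using \<tau> by (simp add: powr_mult)
    finally show ?thesis using False h unfolding a b odd_profile_pos[OF \<tau>] by (simp add: indicator_def algebra_simps)
  qed
  show ?thesis using main[of h] main[of "- h"] by (cases "h \<ge> 0") (auto simp: indicator_def)
qed

text \<open>A localizing penalty: quadratic near \<open>x1\<close>, so that touching by paraboloids
  is preserved, and constant far away, so that barriers stay bounded.\<close>

definition bump :: "'a::euclidean_space \<Rightarrow> 'a \<Rightarrow> real" where
  "bump x1 y = min 1 ((norm (y - x1))\<^sup>2)"

lemma bump_bounds: "0 \<le> bump x1 y" "bump x1 y \<le> 1" "bump x1 x1 = 0"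
  by (auto simp: bump_def)

lemma continuous_on_bump [continuous_intros]: "continuous_on S f \<Longrightarrow> continuous_on S (\<lambda>y. bump x1 (f y))"
  unfolding bump_def by (intro continuous_intros)

lemma bump_measurable [measurable]: "bump x1 \<in> borel_measurable borel"
  by (intro borel_measurable_continuous_onI continuous_intros)

lemma bump_touch:
  assumes "bump x1 x < 1"
  shows "bump x1 (x + z) \<le> bump x1 x + (2 *\<^sub>R (x - x1)) \<bullet> z + 1 * (norm z)\<^sup>2"
proof -
  have e: "x + z - x1 = (x - x1) + z" by simp
  have "(norm (x + z - x1))\<^sup>2 = (norm (x - x1))\<^sup>2 + 2 * ((x - x1) \<bullet> z) + (norm z)\<^sup>2"
    unfolding e using dot_norm[of "x - x1" z] by simp
  then show ?thesis using assms by (auto simp: bump_def)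
qed

lemma bump_sdiff: "- (2 * min 1 ((norm z)\<^sup>2)) \<le> sdiff (bump x1) x z"
proof (cases "bump x1 x < 1")
  case True
  then have "- (2 * (norm z)\<^sup>2) \<le> sdiff (bump x1) x z"
    using bump_touch[OF True, of z] bump_touch[OF True, of "- z"] by (simp add: sdiff_def)
  moreover have "- 2 \<le> sdiff (bump x1) x z"
    using bump_bounds(1)[of x1 x] bump_bounds(2)[of x1 "x + z"] bump_bounds(2)[of x1 "x - z"] unfolding sdiff_def
      by linarith
  ultimately show ?thesis by (simp add: min_def)
next
  case False
  then have "sdiff (bump x1) x z \<ge> 0" 
    using bump_bounds(2)[of x1 "x + z"] bump_bounds(2)[of x1 "x - z"] unfolding sdiff_def by linarith
  moreover have "0 \<le> min 1 ((norm z)\<^sup>2)" by simp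
  ultimately show ?thesis by linarith
qed

text \<open>Up to the factor 2 this bounds the effect of the penalty on the integral. The same
  number reappears as the constant of the Gaussian averages.\<close>

definition bump_const :: "'a::euclidean_space itself \<Rightarrow> real \<Rightarrow> real" where
  "bump_const _ s = (LINT z|lborel. min 1 ((norm (z::'a))\<^sup>2) * fker s z)"

text \<open>At a positive maximum of \<open>d\<close> minus barrier minus penalty, at distance
  \<tau> < 1 from the plane, the barrier contributes a multiple of L \<tau>^(\<alpha> - 2 s), which
  is at least that multiple of L because \<alpha> is at most 2 s. Penalty and right-hand side
  contribute constants. The threshold for L depends neither on the plane nor on \<open>A\<close> or
  \<open>d\<close>.\<close>

lemma antisym_holder:
  assumes i: "i \<in> Basis" and s: "0 < s" "s < 1" and \<alpha>: "0 < \<alpha>" "\<alpha> < 1" "\<alpha> \<le> 2 * s" and M: "M \<ge> 0" and L0: "L0 \<ge> 0"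
  obtains L where "L \<ge> 0" "\<And>a A (d :: 'a::euclidean_space \<Rightarrow> real) y. \<lbrakk>continuous_on UNIV d; \<And>y. \<bar>d y\<bar> \<le> M;
     \<And>y. d (crefl i a y) = - d y; fsub s A (\<lambda>_. K0) d;
     \<And>y. y \<bullet> i < a \<Longrightarrow> y \<notin> A \<Longrightarrow> d y \<le> L0 * (a - y \<bullet> i) powr \<alpha>; y \<bullet> i < a\<rbrakk> \<Longrightarrow> d y \<le> L * (a - y \<bullet> i) powr \<alpha>"
proof -
  \<comment> \<open>Exceeds the bound on \<open>d\<close>, so the penalty alone excludes positive
    values at distance 1 or more from the point \<open>x1\<close> under examination.\<close>
  define c where "c = M + 1"
  define \<kappa> where "\<kappa> = (2 - 2 powr \<alpha>) * slab_const i s"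
  have two: "2 powr \<alpha> < (2::real)" using \<alpha> powr_less_mono[of \<alpha> 1 2] by simp
  have \<kappa>: "\<kappa> > 0" unfolding \<kappa>_def using slab_const_pos[OF i s(1)] two by simp
  define k0 where "k0 = bump_const TYPE('a) s"
  \<comment> \<open>The three bounds have separate roles: the first keeps the maximum within
    distance 1 of the plane, the second puts it into \<open>A\<close>, and the third contradicts the
    subsolution inequality there.\<close>
  define L where "L = max (max (M + 1) L0) ((\<bar>K0\<bar> + 2 * c * \<bar>k0\<bar> + 1) / \<kappa>)"
  have L: "L \<ge> M + 1" "L \<ge> L0" "L * \<kappa> \<ge> \<bar>K0\<bar> + 2 * c * \<bar>k0\<bar> + 1"
  proof -
    have "(\<bar>K0\<bar> + 2 * c * \<bar>k0\<bar> + 1) / \<kappa> \<le> L" by (simp add: L_def)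
    then show "L * \<kappa> \<ge> \<bar>K0\<bar> + 2 * c * \<bar>k0\<bar> + 1" using \<kappa> by (simp add: divide_le_eq)
  qed (auto simp: L_def)
  have L00: "L \<ge> 0" using L(1) M by linarith
  show ?thesis
  proof (rule that[OF L00], rule ccontr)
    fix a A and d :: "'a \<Rightarrow> real" and x1
    assume cont: "continuous_on UNIV d" and dM: "\<And>y. \<bar>d y\<bar> \<le> M" and anti: "\<And>y. d (crefl i a y) = - d y"
      and sub: "fsub s A (\<lambda>_. K0) d" and bd: "\<And>y. y \<bullet> i < a \<Longrightarrow> y \<notin> A \<Longrightarrow> d y \<le> L0 * (a - y \<bullet> i) powr \<alpha>"
      and x1: "x1 \<bullet> i < a" and n: "\<not> d x1 \<le> L * (a - x1 \<bullet> i) powr \<alpha>"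
    define \<phi> where "\<phi> y = L * min (a - y \<bullet> i) 1 powr \<alpha>" for y
    define \<psi> where "\<psi> y = d y - \<phi> y - c * bump x1 y" for y
    let ?S = "cball x1 1 \<inter> {y. y \<bullet> i \<le> a}"
    have cS: "compact ?S" by (intro compact_Int_closed closed_Collect_le continuous_intros) simp
    have "x1 \<in> ?S" using x1 by simp
    have \<phi>0: "0 \<le> \<phi> y" for y using L00 by (simp add: \<phi>_def)
    have "continuous_on ?S \<psi>" unfolding \<psi>_def \<phi>_def using \<alpha>
      by (intro continuous_intros continuous_on_subset[OF cont] continuous_on_powr') auto
    then obtain x where x: "x \<in> ?S" "\<And>y. y \<in> ?S \<Longrightarrow> \<psi> y \<le> \<psi> x"
      using continuous_attains_sup[OF cS, of \<psi>] \<open>x1 \<in> ?S\<close> by blast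
    have "\<psi> x1 > 0"
    proof -
      have "min (a - x1 \<bullet> i) 1 powr \<alpha> \<le> (a - x1 \<bullet> i) powr \<alpha>" using x1 \<alpha> by (intro powr_mono2) auto
      then have "\<phi> x1 \<le> L * (a - x1 \<bullet> i) powr \<alpha>" unfolding \<phi>_def using L00 by (intro mult_left_mono) auto
      then show ?thesis using n by (simp add: \<psi>_def bump_bounds)
    qed
    define m where "m = \<psi> x"
    have m: "m > 0" using x(2)[OF \<open>x1 \<in> ?S\<close>] \<open>\<psi> x1 > 0\<close> by (simp add: m_def)
    have c0: "c > 0" using M by (simp add: c_def)
    have glob: "\<psi> y \<le> m" if "y \<bullet> i \<le> a" for y
    proof (cases "y \<in> cball x1 1")
      case False
      then have "1 \<le> norm (y - x1)" by (simp add: dist_norm norm_minus_commute)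
      then have "bump x1 y = 1" by (simp add: bump_def one_le_power)
      moreover have "\<phi> y \<ge> 0" using L00 by (simp add: \<phi>_def)
      ultimately have "\<psi> y \<le> 0" using dM[of y] by (simp add: \<psi>_def c_def)
      then show ?thesis using m by simp
    qed (use x(2) that in \<open>auto simp: m_def\<close>)
    have dx: "d x = \<phi> x + c * bump x1 x + m" by (simp add: m_def \<psi>_def)
    have xa: "x \<bullet> i < a"
    proof (rule ccontr)
      assume "\<not> x \<bullet> i < a"
      then have "crefl i a x = x" using x(1) by (simp add: crefl_def)
      then have "d x = 0" using anti[of x] by simp
      moreover have "0 \<le> c * bump x1 x" using bump_bounds(1)[of x1 x] c0 by simp
      ultimately show False using dx m \<phi>0[of x] by linarith
    qed
    define \<tau> where "\<tau> = a - x \<bullet> i"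
    have \<tau>0: "\<tau> > 0" using xa by (simp add: \<tau>_def)
    have "0 \<le> c * bump x1 x" using bump_bounds(1)[of x1 x] c0 by simp
    then have \<phi>x: "\<phi> x < d x" using dx m by linarith
    have \<tau>1: "\<tau> < 1"
    proof (rule ccontr)
      assume "\<not> \<tau> < 1"
      then have "\<phi> x = L" by (simp add: \<phi>_def \<tau>_def)
      then show False using \<phi>x dM[of x] L(1) by linarith
    qed
    have \<phi>\<tau>: "\<phi> x = L * \<tau> powr \<alpha>" using \<tau>1 by (simp add: \<phi>_def \<tau>_def)
    have b1: "bump x1 x < 1"
    proof (rule ccontr)
      assume "\<not> bump x1 x < 1"
      then have "bump x1 x = 1" using bump_bounds(2)[of x1 x] by linarith
      then have "d x \<ge> c" using dx m \<phi>0[of x] by simp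
      then show False using dM[of x] by (simp add: c_def)
    qed
    have xA: "x \<in> A"
    proof (rule ccontr)
      assume "x \<notin> A"
      from bd[OF xa this] have "d x \<le> L0 * \<tau> powr \<alpha>" by (simp add: \<tau>_def)
      also have "\<dots> \<le> L * \<tau> powr \<alpha>" using L by (intro mult_right_mono) auto
      finally show False using \<phi>x \<phi>\<tau> by simp
    qed
    \<comment> \<open>The power is singular at the plane but concave, hence below its tangent at
      \<open>x\<close>; together with the quadratic penalty this gives a paraboloid on a ball that
      does not meet the plane.\<close>
    have touch: "d (x + z) \<le> d x + (c *\<^sub>R (2 *\<^sub>R (x - x1)) - (L * \<alpha> * \<tau> powr (\<alpha> - 1)) *\<^sub>R i) \<bullet> z + c * (norm z)\<^sup>2"
      if z: "norm z < \<tau>" for z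
    proof -
      have zi: "\<bar>z \<bullet> i\<bar> < \<tau>" using Basis_le_norm[OF i, of z] z by linarith
      have ai: "a - (x + z) \<bullet> i = \<tau> - z \<bullet> i" by (simp add: \<tau>_def inner_add_left)
      have "(x + z) \<bullet> i \<le> a" using zi ai by linarith
      from glob[OF this] have 1: "d (x + z) \<le> \<phi> (x + z) + c * bump x1 (x + z) + m" by (simp add: \<psi>_def)
      have "min (\<tau> - z \<bullet> i) 1 powr \<alpha> \<le> (\<tau> - z \<bullet> i) powr \<alpha>" using zi \<alpha> by (intro powr_mono2) auto
      also have "\<dots> \<le> \<tau> powr \<alpha> + \<alpha> * \<tau> powr (\<alpha> - 1) * (\<tau> - z \<bullet> i - \<tau>)"
        using zi \<tau>0 \<alpha> by (intro powr_le_tangent) auto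
      finally have "\<phi> (x + z) \<le> L * (\<tau> powr \<alpha> + \<alpha> * \<tau> powr (\<alpha> - 1) * (\<tau> - z \<bullet> i - \<tau>))"
        unfolding \<phi>_def ai using L00 by (intro mult_left_mono)
      then have 2: "\<phi> (x + z) \<le> \<phi> x - L * \<alpha> * \<tau> powr (\<alpha> - 1) * (z \<bullet> i)" unfolding \<phi>\<tau> by (simp add: algebra_simps)
      have "c * bump x1 (x + z) \<le> c * (bump x1 x + (2 *\<^sub>R (x - x1)) \<bullet> z + 1 * (norm z)\<^sup>2)"
        using c0 by (intro mult_left_mono bump_touch b1) auto
      then have 3: "c * bump x1 (x + z) \<le> c * bump x1 x + (c *\<^sub>R (2 *\<^sub>R (x - x1))) \<bullet> z + c * (norm z)\<^sup>2"
        by (simp add: algebra_simps)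
      have 4: "(c *\<^sub>R (2 *\<^sub>R (x - x1)) - (L * \<alpha> * \<tau> powr (\<alpha> - 1)) *\<^sub>R i) \<bullet> z
         = (c *\<^sub>R (2 *\<^sub>R (x - x1))) \<bullet> z - L * \<alpha> * \<tau> powr (\<alpha> - 1) * (z \<bullet> i)"
        by (simp only: inner_diff_left inner_scaleR_left inner_commute[of i z])
      show ?thesis using 1 2 3 4 dx by linarith
    qed
    obtain K' where K': "\<And>z. d (x + z) \<le> d x + (c *\<^sub>R (2 *\<^sub>R (x - x1)) - (L * \<alpha> * \<tau> powr (\<alpha> - 1)) *\<^sub>R i) \<bullet> z + K'
        * (norm z)\<^sup>2"
      by (rule touched_locally_imp[OF \<tau>0 touch, of M]) (use dM abs_le_D1 in blast)+
    have I: "integrable lborel (\<lambda>z. sdiff d x z * fker s z)" "(LINT z|lborel. sdiff d x z * fker s z) \<le> K0"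
      using fsubD[OF sub xA K'] by auto
    \<comment> \<open>\<open>G\<close> is the odd extension of \<open>g\<close> from the side of
      \<open>x\<close>. The part \<open>c * bump x1 y + m\<close> is nonnegative, and reversing its
      sign only lowers the function; so \<open>G\<close> lies below \<open>g\<close>, agrees with it
      at \<open>x\<close>, and has the larger second difference there.\<close>
    define g where "g y = L * odd_profile \<alpha> (a - y \<bullet> i) + c * bump x1 y + m" for y
    define G where "G y = (if y \<bullet> i < a then g y else if y \<bullet> i = a then 0 else - g (crefl i a y))" for y
    define l where "l z = (2 - 2 powr \<alpha>) * L * \<tau> powr \<alpha> * indicator {z. \<tau> < \<bar>z \<bullet> i\<bar>} z - 2 * c * min 1 ((norm z)\<^sup>2)"
      for z :: 'a
    have gpos: "0 \<le> c * bump x1 y + m" for y using c0 m bump_bounds(1)[of x1 y] by simp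
    have Gg: "G y \<le> g y" for y
    proof (cases "y \<bullet> i < a")
      case False
      have "a - crefl i a y \<bullet> i = - (a - y \<bullet> i)" using i by (simp add: crefl_inner)
      then have o: "odd_profile \<alpha> (a - crefl i a y \<bullet> i) = - odd_profile \<alpha> (a - y \<bullet> i)"
        by (simp only: odd_profile_minus)
      show ?thesis using False gpos[of y] gpos[of "crefl i a y"] unfolding G_def g_def o
        by (auto simp: odd_profile_def algebra_simps)
    qed (simp add: G_def)
    have gmeas [measurable]: "g \<in> borel_measurable borel" unfolding g_def by measurable
    have Gmeas: "G \<in> borel_measurable borel" unfolding G_def by measurable
    have gb: "\<bar>g y\<bar> \<le> L + c + m" for y
    proof -
      have "L * \<bar>odd_profile \<alpha> (a - y \<bullet> i)\<bar> \<le> L * 1" using odd_profile_bound[OF \<alpha>(1)] L00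
        by (intro mult_left_mono) auto
      moreover have "c * bump x1 y \<le> c * 1" using bump_bounds(2) c0 by (intro mult_left_mono) auto
      moreover have "\<bar>L * odd_profile \<alpha> (a - y \<bullet> i)\<bar> = L * \<bar>odd_profile \<alpha> (a - y \<bullet> i)\<bar>" using L00
        by (simp add: abs_mult)
      moreover have "0 \<le> c * bump x1 y" using bump_bounds(1)[of x1 y] c0 by simp
      ultimately show ?thesis unfolding g_def using m by linarith
    qed
    have lint: "integrable lborel (\<lambda>z. l z * fker s z)"
      unfolding l_def left_diff_distrib mult.assoc
      by (intro Bochner_Integration.integrable_diff integrable_mult_right integrable_slab integrable_fker_min i s \<tau>0)
    have "(LINT z|lborel. l z * fker s z) \<le> (LINT z|lborel. sdiff d x z * fker s z)"
    proof (rule antisym_comparison[OF i s(1), where G=G and M=M and M'="L + c + m" and a=a])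
      show "l \<in> borel_measurable borel" unfolding l_def by measurable
      show "d \<in> borel_measurable borel" by (rule borel_measurable_continuous_onI[OF cont])
      show "\<bar>G y\<bar> \<le> L + c + m" for y using gb[of y] gb[of "crefl i a y"] L00 c0 m by (simp add: G_def)
      show "G (crefl i a y) = - G y" for y using i by (simp add: G_def crefl_inner)
      show "d y \<le> G y" if "y \<bullet> i < a" for y
        using glob[of y] that by (simp add: G_def g_def \<psi>_def \<phi>_def odd_profile_pos)
      show "d x = G x" using xa by (simp add: G_def g_def dx \<phi>_def odd_profile_pos)
      show "l z \<le> sdiff G x z" for z
      proof -
        have "a - (x + z) \<bullet> i = \<tau> - z \<bullet> i" "a - (x - z) \<bullet> i = \<tau> + z \<bullet> i" "a - x \<bullet> i = \<tau>"
          by (simp_all add: \<tau>_def inner_add_left inner_diff_left)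
        then have e: "sdiff g x z = L * (2 * odd_profile \<alpha> \<tau> - odd_profile \<alpha> (\<tau> + z \<bullet> i) - odd_profile \<alpha> (\<tau> - z \<bullet> i))
            + c * sdiff (bump x1) x z"
          unfolding sdiff_def g_def by (simp only:) (simp add: algebra_simps)
        have "L * ((2 - 2 powr \<alpha>) * indicator {h. \<tau> < \<bar>h\<bar>} (z \<bullet> i) * min \<tau> 1 powr \<alpha>)
           \<le> L * (2 * odd_profile \<alpha> \<tau> - odd_profile \<alpha> (\<tau> + z \<bullet> i) - odd_profile \<alpha> (\<tau> - z \<bullet> i))"
          using L00 \<alpha> \<tau>0 by (intro mult_left_mono odd_profile_sdiff) auto
        moreover have "c * (- (2 * min 1 ((norm z)\<^sup>2))) \<le> c * sdiff (bump x1) x z"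
          using c0 by (intro mult_left_mono bump_sdiff) auto
        moreover have "l z = L * ((2 - 2 powr \<alpha>) * indicator {h. \<tau>
            < \<bar>h\<bar>} (z \<bullet> i) * min \<tau> 1 powr \<alpha>) + c * (- (2 * min 1 ((norm z)\<^sup>2)))"
          using \<tau>1 by (simp add: l_def indicator_def)
        ultimately have "l z \<le> sdiff g x z" unfolding e by linarith
        also have "\<dots> \<le> sdiff G x z" using Gg[of "x + z"] Gg[of "x - z"] xa by (simp add: sdiff_def G_def)
        finally show ?thesis .
      qed
    qed (use Gmeas dM anti xa I(1) lint in auto)
    moreover have "(LINT z|lborel. l z * fker s z)
        = (2 - 2 powr \<alpha>) * L * \<tau> powr \<alpha> * (slab_const i s * \<tau> powr (- (2 * s))) - 2 * c * k0"
    proof -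
      define q where "q = (2 - 2 powr \<alpha>) * L * \<tau> powr \<alpha>"
      have "(\<lambda>z. l z * fker s z) = (\<lambda>z. q * (indicator {z. \<tau>
          < \<bar>z \<bullet> i\<bar>} z * fker s z) - (2 * c) * (min 1 ((norm z)\<^sup>2) * fker s z))"
        unfolding l_def q_def[symmetric] by (simp add: fun_eq_iff algebra_simps)
      then show ?thesis
        using integrable_slab[OF i s(1) \<tau>0] integrable_fker_min[OF s, where 'a='a] slab_integral[OF \<tau>0, of i s]
        by (simp add: k0_def bump_const_def flip: q_def)
    qed
    moreover have "L * \<kappa> * 1 \<le> L * \<kappa> * \<tau> powr (\<alpha> - 2 * s)"
    proof (intro mult_left_mono)
      have "\<tau> powr 0 \<le> \<tau> powr (\<alpha> - 2 * s)" using \<tau>0 \<tau>1 \<alpha> by (intro powr_mono') auto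
      then show "1 \<le> \<tau> powr (\<alpha> - 2 * s)" using \<tau>0 by simp
    qed (use L00 \<kappa> in auto)
    moreover have "(2 - 2 powr \<alpha>) * L * \<tau> powr \<alpha> * (slab_const i s * \<tau> powr (- (2 * s))) = L * \<kappa> * \<tau> powr (\<alpha> - 2 * s)"
    proof -
      have "\<tau> powr (\<alpha> - 2 * s) = \<tau> powr \<alpha> * \<tau> powr (- (2 * s))" by (simp add: powr_add[symmetric])
      then show ?thesis by (simp add: \<kappa>_def mult_ac)
    qed
    ultimately have "L * \<kappa> - 2 * c * k0 \<le> K0" using I(2) by linarith
    moreover have "2 * c * k0 \<le> 2 * c * \<bar>k0\<bar>" using c0 by (intro mult_left_mono) auto
    ultimately show False using L(3) by linarith
  qed
qed

section \<open>Decay at the boundary and the global Hoelder bound\<close>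

lemma fsub_mono: "fsub s A f u \<Longrightarrow> B \<subseteq> A \<Longrightarrow> (\<And>x. x \<in> B \<Longrightarrow> f x \<le> g x) \<Longrightarrow> fsub s B g u"
  unfolding fsub_def by (meson order_trans subsetD)

lemma fsub_crefl:
  assumes i: "i \<in> Basis" and sub: "fsub s A f u"
  shows "fsub s {x. crefl i a x \<in> A} (\<lambda>x. f (crefl i a x)) (\<lambda>x. u (crefl i a x))"
  unfolding fsub_def
proof (intro ballI allI impI)
  fix x b K assume x: "x \<in> {x. crefl i a x \<in> A}"
    and t: "\<forall>z. u (crefl i a (x + z)) \<le> u (crefl i a x) + b \<bullet> z + K * (norm z)\<^sup>2"
  have "u (crefl i a x + z) \<le> u (crefl i a x) + crefl i 0 b \<bullet> z + K * (norm z)\<^sup>2" for z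
    using t[rule_format, of "crefl i 0 z"] i by (simp add: crefl_add inner_crefl[of i b])
  from fsubD[OF sub _ this] x
  have I: "integrable lborel (\<lambda>z. sdiff u (crefl i a x) z * fker s z)"
    "(LINT z|lborel. sdiff u (crefl i a x) z * fker s z) \<le> f (crefl i a x)" by auto
  let ?h = "\<lambda>z. sdiff u (crefl i a x) z * fker s z"
  have [measurable]: "?h \<in> borel_measurable borel" using borel_measurable_integrable[OF I(1)] by simp
  have eq: "(\<lambda>z. sdiff (\<lambda>x. u (crefl i a x)) x z * fker s z) = (\<lambda>z. ?h (crefl i 0 z))"
    using i crefl_add[OF i, of a x "- _"]
      by (auto simp: sdiff_def crefl_add crefl_minus simp flip: diff_conv_add_uminus)
  show "integrable lborel (\<lambda>z. sdiff (\<lambda>x. u (crefl i a x)) x z * fker s z) \<and>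
    (LINT z|lborel. sdiff (\<lambda>x. u (crefl i a x)) x z * fker s z) \<le> f (crefl i a x)"
    unfolding eq using I lborel_integrable_crefl[OF i, of ?h 0] lborel_integral_crefl[OF i, of ?h 0] by simp
qed

text \<open>
  The integral is the one of \<open>max 0 (x \<bullet> e) powr \<alpha>\<close> at distance \<open>1\<close> from the boundary, up to a part with
  the right sign by concavity. As \<open>\<alpha>\<close> tends to \<open>0\<close> the factor \<open>2 - (1 + \<bar>z \<bullet> e\<bar>) powr \<alpha>\<close> tends to \<open>1\<close>.
\<close>

lemma boundary_exponent:
  assumes e: "e \<in> Basis" and s: "0 < s" "s < 1"
  obtains \<alpha> where "0 < \<alpha>" "\<alpha> \<le> s"
    "integrable lborel (\<lambda>z::'a::euclidean_space. indicator {z. 1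
        < \<bar>z \<bullet> e\<bar>} z * (2 - (1 + \<bar>z \<bullet> e\<bar>) powr \<alpha>) * fker s z)"
    "0 < (LINT z|lborel. indicator {z::'a. 1 < \<bar>z \<bullet> e\<bar>} z * (2 - (1 + \<bar>z \<bullet> e\<bar>) powr \<alpha>) * fker s z)"
proof -
  define \<alpha> where "\<alpha> j = s / real (Suc j)" for j
  have \<alpha>: "0 < \<alpha> j" "\<alpha> j \<le> s" for j using s by (auto simp: \<alpha>_def divide_le_eq mult_le_cancel_left1)
  have \<alpha>0: "\<alpha> \<longlonglongrightarrow> 0" unfolding \<alpha>_def by (rule LIMSEQ_Suc) (rule lim_const_over_n)
  define f where "f j z = indicator {z. 1 < \<bar>z \<bullet> e\<bar>} z * (2 - (1 + \<bar>z \<bullet> e\<bar>) powr \<alpha> j) * fker s z" for j and z :: 'a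
  \<comment> \<open>Dominates all \<open>f j\<close>: as \<open>\<alpha> j\<close> is at most
    \<open>s\<close>, the power grows at most like \<open>norm z powr s\<close>, and the kernel
    times this power is still integrable at infinity.\<close>
  define w where "w z = 2 * (indicator {z. 1 \<le> norm z} z * fker s z) + 2 * (indicator {z. 1
      \<le> norm z} z * norm z powr (- (real DIM('a) + s)))" for z :: 'a
  have w: "integrable lborel w" unfolding w_def
    using integrable_fker_outside[of 1 s, where 'a='a] integrable_norm_powr_outside[of 1 s, where 'a='a] s
    by (intro Bochner_Integration.integrable_add integrable_mult_right) auto
  have [measurable]: "f j \<in> borel_measurable borel" for j unfolding f_def by measurable
  have bound: "norm (f j z) \<le> w z" for j z
  proof (cases "1 < \<bar>z \<bullet> e\<bar>")
    case True
    have ze: "\<bar>z \<bullet> e\<bar> \<le> norm z" by (rule Basis_le_norm[OF e])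
    then have n1: "1 \<le> norm z" using True by linarith
    have "(1 + \<bar>z \<bullet> e\<bar>) powr \<alpha> j \<le> (1 + \<bar>z \<bullet> e\<bar>) powr s" using \<alpha> by (intro powr_mono) auto
    also have "\<dots> \<le> (2 * norm z) powr s" using ze n1 s by (intro powr_mono2) auto
    also have "\<dots> = 2 powr s * norm z powr s" by (simp add: powr_mult)
    also have "\<dots> \<le> 2 powr 1 * norm z powr s" using s by (intro mult_right_mono powr_mono) auto
    finally have p: "(1 + \<bar>z \<bullet> e\<bar>) powr \<alpha> j \<le> 2 * norm z powr s" by simp
    have nk: "norm z powr s * fker s z = norm z powr (- (real DIM('a) + s))"
      by (simp add: fker_def powr_add[symmetric] algebra_simps)
    have "norm (f j z) = \<bar>2 - (1 + \<bar>z \<bullet> e\<bar>) powr \<alpha> j\<bar> * fker s z" using True by (simp add: f_def abs_mult)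
    also have "\<dots> \<le> (2 + 2 * norm z powr s) * fker s z" using p
      by (intro mult_right_mono) (auto simp: abs_le_iff intro: order_trans[of _ 0])
    also have "\<dots> = w z" using n1 nk by (simp add: w_def distrib_right mult.assoc)
    finally show ?thesis .
  next
    case False
    then show ?thesis by (simp add: f_def w_def)
  qed
  have fint: "integrable lborel (f j)" for j
    by (rule Bochner_Integration.integrable_bound[OF w]) (use order_trans[OF bound abs_ge_self] in \<open>auto intro!:
      AE_I2\<close>)
  have "(\<lambda>j. integral\<^sup>L lborel (f j)) \<longlonglongrightarrow> slab_const e s"
    unfolding slab_const_def
  proof (rule integral_dominated_convergence[where w=w])
    show "AE z in lborel. (\<lambda>j. f j z) \<longlonglongrightarrow> indicator {z. 1 < \<bar>z \<bullet> e\<bar>} z * fker s z"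
    proof (rule AE_I2)
      fix z :: 'a
      have "(\<lambda>j. indicator {z. 1 < \<bar>z \<bullet> e\<bar>} z * (2 - (1 + \<bar>z \<bullet> e\<bar>) powr \<alpha> j) * fker s z)
        \<longlonglongrightarrow> indicator {z. 1 < \<bar>z \<bullet> e\<bar>} z * (2 - (1 + \<bar>z \<bullet> e\<bar>) powr 0) * fker s z"
        by (intro tendsto_intros \<alpha>0) auto
      moreover have "(1 + \<bar>z \<bullet> e\<bar>) powr 0 = 1" using abs_ge_zero[of "z \<bullet> e"] by (simp del: abs_ge_zero)
      ultimately show "(\<lambda>j. f j z) \<longlonglongrightarrow> indicator {z. 1 < \<bar>z \<bullet> e\<bar>} z * fker s z" by (simp add: f_def)
    qed
  qed (use bound w in auto)
  then have "\<forall>\<^sub>F j in sequentially. 0 < integral\<^sup>L lborel (f j)"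
    using slab_const_pos[OF e s(1)] by (rule order_tendstoD)
  then obtain j where "0 < integral\<^sup>L lborel (f j)" by (auto simp: eventually_sequentially)
  with fint[of j] show ?thesis unfolding f_def by (intro that[OF \<alpha>]) auto
qed

text \<open>The argument of \<open>antisym_holder\<close> with the one-sided power, which like
  \<open>u\<close> vanishes outside the half-space. The positive integral \<kappa> replaces the gap
  of the odd barrier; by scaling, its effect at distance \<tau> is again a multiple of
  \<tau>^(\<alpha> - 2 s).\<close>

lemma fsub_boundary_barrier:
  fixes u :: "'a::euclidean_space \<Rightarrow> real"
  assumes e: "e \<in> Basis" and s: "0 < s" "s < 1" and \<alpha>: "0 < \<alpha>" "\<alpha> \<le> s"
    and bc: "integrable lborel (\<lambda>z::'a::euclidean_space. indicator {z. 1
        < \<bar>z \<bullet> e\<bar>} z * (2 - (1 + \<bar>z \<bullet> e\<bar>) powr \<alpha>) * fker s z)"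
    "0 < (LINT z|lborel. indicator {z::'a. 1 < \<bar>z \<bullet> e\<bar>} z * (2 - (1 + \<bar>z \<bullet> e\<bar>) powr \<alpha>) * fker s z)"
    and cont: "continuous_on UNIV u" and u: "\<And>x. 0 \<le> u x" "\<And>x. u x \<le> M" "\<And>x. x \<bullet> e \<le> 0 \<Longrightarrow> u x = 0"
    and sub: "fsub s {x. 0 < x \<bullet> e} (\<lambda>_. K0) u"
  obtains C where "C \<ge> 0" "\<And>x. x \<bullet> e > 0 \<Longrightarrow> u x \<le> C * (x \<bullet> e) powr \<alpha>"
proof -
  have M: "M \<ge> 0" using u(1,2)[of 0] by linarith
  define c where "c = M + 1"
  define hh where "hh z = indicator {z. 1 < \<bar>z \<bullet> e\<bar>} z * (2 - (1 + \<bar>z \<bullet> e\<bar>) powr \<alpha>)" for z :: 'a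
  define \<kappa> where "\<kappa> = (LINT z|lborel. hh z * fker s z)"
  have \<kappa>: "\<kappa> > 0" using bc(2) by (simp add: \<kappa>_def hh_def)
  have hhint: "integrable lborel (\<lambda>z. hh z * fker s z)" using bc(1) by (simp add: hh_def)
  have [measurable]: "hh \<in> borel_measurable borel" unfolding hh_def by measurable
  define k0 where "k0 = bump_const TYPE('a) s"
  define L where "L = max (M + 1) ((\<bar>K0\<bar> + 2 * c * \<bar>k0\<bar> + 1) / \<kappa>)"
  have L: "L \<ge> M + 1" "L * \<kappa> \<ge> \<bar>K0\<bar> + 2 * c * \<bar>k0\<bar> + 1"
  proof -
    have "(\<bar>K0\<bar> + 2 * c * \<bar>k0\<bar> + 1) / \<kappa> \<le> L" by (simp add: L_def)
    then show "L * \<kappa> \<ge> \<bar>K0\<bar> + 2 * c * \<bar>k0\<bar> + 1" using \<kappa> by (simp add: divide_le_eq)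
  qed (auto simp: L_def)
  have L00: "L \<ge> 0" using L(1) M by linarith
  have c0: "c > 0" using M by (simp add: c_def)
  define b where "b y = L * max 0 (y \<bullet> e) powr \<alpha>" for y
  have b0: "0 \<le> b y" for y using L00 by (simp add: b_def)
  show ?thesis
  proof (rule that[OF L00], rule ccontr)
    fix x1 assume x1: "x1 \<bullet> e > 0" and n: "\<not> u x1 \<le> L * (x1 \<bullet> e) powr \<alpha>"
    define \<psi> where "\<psi> y = u y - b y - c * bump x1 y" for y
    have cp: "continuous_on UNIV \<psi>" unfolding \<psi>_def b_def using \<alpha>
      by (intro continuous_intros cont continuous_on_powr') auto
    have \<psi>1: "\<psi> x1 > 0" using n x1 by (simp add: \<psi>_def b_def bump_bounds max_def)
    have "\<psi> y \<le> \<psi> x1" if "norm (y - x1) > 1" for y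
    proof -
      have "1 < (norm (y - x1))\<^sup>2" using that by (simp add: one_less_power)
      then have "bump x1 y = 1" by (simp add: bump_def)
      then have "\<psi> y \<le> 0" using u(2)[of y] b0[of y] by (simp add: \<psi>_def c_def)
      then show ?thesis using \<psi>1 by simp
    qed
    from coercive_attains_sup[OF cp this]
    obtain x where glob: "\<And>y. \<psi> y \<le> \<psi> x" by blast
    define m where "m = \<psi> x"
    have m: "m > 0" using glob[of x1] \<psi>1 by (simp add: m_def)
    have ux: "u x = b x + c * bump x1 x + m" by (simp add: m_def \<psi>_def)
    have uy: "u y \<le> b y + c * bump x1 y + m" for y using glob[of y] by (simp add: m_def \<psi>_def)
    have cb: "0 \<le> c * bump x1 y" for y using bump_bounds(1)[of x1 y] c0 by simp
    define \<tau> where "\<tau> = x \<bullet> e"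
    have \<tau>0: "\<tau> > 0" using u(3)[of x] ux m b0[of x] cb[of x] by (force simp: \<tau>_def)
    have bx: "b x = L * \<tau> powr \<alpha>" using \<tau>0 by (simp add: b_def \<tau>_def)
    have \<tau>1: "\<tau> < 1"
    proof (rule ccontr)
      assume "\<not> \<tau> < 1"
      then have "1 \<le> \<tau> powr \<alpha>" using \<alpha> by (intro ge_one_powr_ge_zero) auto
      then have "L * 1 \<le> b x" unfolding bx using L00 by (intro mult_left_mono)
      then show False using ux u(2)[of x] L(1) cb[of x] m by linarith
    qed
    have b1: "bump x1 x < 1"
    proof (rule ccontr)
      assume "\<not> bump x1 x < 1"
      then have "bump x1 x = 1" using bump_bounds(2)[of x1 x] by linarith
      then have "c \<le> u x" using ux m b0[of x] by simp
      then show False using u(2)[of x] by (simp add: c_def)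
    qed
    have touch: "u (x + z) \<le> u x + (c *\<^sub>R (2 *\<^sub>R (x - x1)) + (L * \<alpha> * \<tau> powr (\<alpha> - 1)) *\<^sub>R e) \<bullet> z + c * (norm z)\<^sup>2"
      if z: "norm z < \<tau>" for z
    proof -
      have ze: "\<bar>z \<bullet> e\<bar> < \<tau>" using Basis_le_norm[OF e, of z] z by linarith
      have xe: "max 0 ((x + z) \<bullet> e) = \<tau> + z \<bullet> e" using ze by (simp add: \<tau>_def inner_add_left)
      have "(\<tau> + z \<bullet> e) powr \<alpha> \<le> \<tau> powr \<alpha> + \<alpha> * \<tau> powr (\<alpha> - 1) * (\<tau> + z \<bullet> e - \<tau>)"
        using ze \<tau>0 \<alpha> s by (intro powr_le_tangent) auto
      then have "b (x + z) \<le> L * (\<tau> powr \<alpha> + \<alpha> * \<tau> powr (\<alpha> - 1) * (\<tau> + z \<bullet> e - \<tau>))"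
        unfolding b_def xe using L00 by (intro mult_left_mono)
      then have 2: "b (x + z) \<le> b x + L * \<alpha> * \<tau> powr (\<alpha> - 1) * (z \<bullet> e)" unfolding bx by (simp add: algebra_simps)
      have "c * bump x1 (x + z) \<le> c * (bump x1 x + (2 *\<^sub>R (x - x1)) \<bullet> z + 1 * (norm z)\<^sup>2)"
        using c0 by (intro mult_left_mono bump_touch b1) auto
      then have 3: "c * bump x1 (x + z) \<le> c * bump x1 x + (c *\<^sub>R (2 *\<^sub>R (x - x1))) \<bullet> z + c * (norm z)\<^sup>2"
        by (simp add: algebra_simps)
      have 4: "(c *\<^sub>R (2 *\<^sub>R (x - x1)) + (L * \<alpha> * \<tau> powr (\<alpha> - 1)) *\<^sub>R e) \<bullet> z
         = (c *\<^sub>R (2 *\<^sub>R (x - x1))) \<bullet> z + L * \<alpha> * \<tau> powr (\<alpha> - 1) * (z \<bullet> e)"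
        by (simp only: inner_add_left inner_scaleR_left inner_commute[of e z])
      show ?thesis using uy[of "x + z"] 2 3 4 ux by linarith
    qed
    obtain K' where K': "\<And>z. u (x + z) \<le> u x + (c *\<^sub>R (2 *\<^sub>R (x - x1)) + (L * \<alpha> * \<tau> powr (\<alpha> - 1)) *\<^sub>R e) \<bullet> z + K'
        * (norm z)\<^sup>2"
      by (rule touched_locally_imp[OF \<tau>0 touch, of M]) (use u(2) in blast)+
    have "x \<in> {x. 0 < x \<bullet> e}" using \<tau>0 by (simp add: \<tau>_def)
    from fsubD[OF sub this K']
    have I: "integrable lborel (\<lambda>z. sdiff u x z * fker s z)" "(LINT z|lborel. sdiff u x z * fker s z) \<le> K0" by auto
    define q where "q = L * \<tau> powr \<alpha>"
    have q0: "q \<ge> 0" using L00 by (simp add: q_def)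
    \<comment> \<open>While both points stay in the half-space, concavity makes the second
      difference nonnegative. Beyond, the barrier is 0 at one of them, which leaves exactly the
      integrand of \<kappa> rescaled by \<tau>.\<close>
    have sb: "q * hh ((1 / \<tau>) *\<^sub>R z) \<le> sdiff b x z" for z
    proof -
      have P: "max 0 (\<tau> + h) powr \<alpha> + max 0 (\<tau> - h) powr \<alpha> \<le> (if \<bar>h\<bar> \<le> \<tau> then 2 * \<tau> powr \<alpha> else (\<tau> + \<bar>h\<bar>) powr \<alpha>)"
        for h
      proof (cases "\<bar>h\<bar> \<le> \<tau>")
        case True
        then have "max 0 (\<tau> + h) = \<tau> + h" "max 0 (\<tau> - h) = \<tau> - h" by auto
        then show ?thesis using True powr_midpoint_concave[OF True \<alpha>(1)] \<alpha> s by simp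
      next
        case False
        then show ?thesis using \<tau>0 by (cases "h \<ge> 0") (auto simp: max_def)
      qed
      have e1: "max 0 ((x + z) \<bullet> e) = max 0 (\<tau> + z \<bullet> e)" "max 0 ((x - z) \<bullet> e) = max 0 (\<tau> - z \<bullet> e)"
        by (simp_all add: \<tau>_def inner_add_left inner_diff_left)
      have "sdiff b x z = 2 * b x - L * (max 0 (\<tau> + z \<bullet> e) powr \<alpha> + max 0 (\<tau> - z \<bullet> e) powr \<alpha>)"
        unfolding sdiff_def b_def[of "x + z"] b_def[of "x - z"] e1 by (simp add: algebra_simps)
      also have "\<dots> \<ge> 2 * b x - L * (if \<bar>z \<bullet> e\<bar> \<le> \<tau> then 2 * \<tau> powr \<alpha> else (\<tau> + \<bar>z \<bullet> e\<bar>) powr \<alpha>)"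
        using L00 by (intro diff_left_mono mult_left_mono P)
      finally have 1: "2 * b x - L * (if \<bar>z \<bullet> e\<bar> \<le> \<tau> then 2 * \<tau> powr \<alpha> else (\<tau> + \<bar>z \<bullet> e\<bar>) powr \<alpha>) \<le> sdiff b x z" .
      have a: "\<bar>((1 / \<tau>) *\<^sub>R z) \<bullet> e\<bar> = \<bar>z \<bullet> e\<bar> / \<tau>" using \<tau>0 by simp
      show ?thesis
      proof (cases "\<bar>z \<bullet> e\<bar> \<le> \<tau>")
        case True
        then have "hh ((1 / \<tau>) *\<^sub>R z) = 0" unfolding hh_def indicator_def mem_Collect_eq a using \<tau>0
          by (simp add: divide_le_eq)
        then show ?thesis using 1 True bx by simp
      next
        case False
        then have "1 < \<bar>z \<bullet> e\<bar> / \<tau>" using \<tau>0 by (simp add: less_divide_eq)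
        then have h: "hh ((1 / \<tau>) *\<^sub>R z) = 2 - (1 + \<bar>z \<bullet> e\<bar> / \<tau>) powr \<alpha>"
          unfolding hh_def indicator_def mem_Collect_eq a by simp
        have "\<tau> powr \<alpha> * (1 + \<bar>z \<bullet> e\<bar> / \<tau>) powr \<alpha> = (\<tau> * (1 + \<bar>z \<bullet> e\<bar> / \<tau>)) powr \<alpha>" using \<tau>0 by (simp add: powr_mult)
        also have "\<tau> * (1 + \<bar>z \<bullet> e\<bar> / \<tau>) = \<tau> + \<bar>z \<bullet> e\<bar>" using \<tau>0 by (simp add: distrib_left)
        finally have "q * hh ((1 / \<tau>) *\<^sub>R z) = 2 * b x - L * (\<tau> + \<bar>z \<bullet> e\<bar>) powr \<alpha>"
          unfolding h q_def bx by (simp add: right_diff_distrib mult.assoc)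
        then show ?thesis using 1 False by simp
      qed
    qed
    define l where "l z = q * hh ((1 / \<tau>) *\<^sub>R z) - 2 * c * min 1 ((norm z)\<^sup>2)" for z :: 'a
    have l: "l z \<le> sdiff u x z" for z
    proof -
      have "c * (- (2 * min 1 ((norm z)\<^sup>2))) \<le> c * sdiff (bump x1) x z"
        using c0 by (intro mult_left_mono bump_sdiff) auto
      moreover have "sdiff b x z + c * sdiff (bump x1) x z \<le> sdiff u x z"
        using uy[of "x + z"] uy[of "x - z"] ux by (simp add: sdiff_def algebra_simps)
      ultimately show ?thesis using sb[of z] by (simp add: l_def)
    qed
    have hsc: "(LINT z|lborel. hh ((1 / \<tau>) *\<^sub>R z) * fker s z) = \<tau> powr (- (2 * s)) * \<kappa>"
      using fker_integral_scale[OF _ \<tau>0, of "\<lambda>z. hh ((1 / \<tau>) *\<^sub>R z)" s] \<tau>0 by (simp add: \<kappa>_def)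
    \<comment> \<open>The Bochner integral of a function that is not integrable is 0, so the
      positive value proves integrability.\<close>
    have hsi: "integrable lborel (\<lambda>z. hh ((1 / \<tau>) *\<^sub>R z) * fker s z)"
      using hsc \<kappa> \<tau>0 not_integrable_integral_eq by fastforce
    have leq: "(\<lambda>z. l z * fker s z) = (\<lambda>z. q * (hh ((1 / \<tau>) *\<^sub>R z) * fker s z) - (2 * c)
        * (min 1 ((norm z)\<^sup>2) * fker s z))"
      by (simp add: l_def fun_eq_iff algebra_simps)
    have lint: "integrable lborel (\<lambda>z. l z * fker s z)"
      unfolding leq by (intro Bochner_Integration.integrable_diff integrable_mult_right hsi integrable_fker_min s)
    have lI: "(LINT z|lborel. l z * fker s z) = q * (\<tau> powr (- (2 * s)) * \<kappa>) - 2 * c * k0"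
      unfolding leq using hsi integrable_fker_min[OF s, where 'a='a] hsc by (simp add: k0_def bump_const_def)
    have "(LINT z|lborel. l z * fker s z) \<le> (LINT z|lborel. sdiff u x z * fker s z)"
      by (intro integral_mono lint I mult_right_mono l) auto
    moreover have "L * \<kappa> * 1 \<le> L * \<kappa> * \<tau> powr (\<alpha> - 2 * s)"
    proof (intro mult_left_mono)
      have "\<tau> powr 0 \<le> \<tau> powr (\<alpha> - 2 * s)" using \<tau>0 \<tau>1 \<alpha> s by (intro powr_mono') auto
      then show "1 \<le> \<tau> powr (\<alpha> - 2 * s)" using \<tau>0 by simp
    qed (use L00 \<kappa> in auto)
    moreover have "q * (\<tau> powr (- (2 * s)) * \<kappa>) = L * \<kappa> * \<tau> powr (\<alpha> - 2 * s)"
    proof -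
      have "\<tau> powr (\<alpha> - 2 * s) = \<tau> powr \<alpha> * \<tau> powr (- (2 * s))" by (simp add: powr_add[symmetric])
      then show ?thesis by (simp add: q_def mult_ac)
    qed
    ultimately have "L * \<kappa> - 2 * c * k0 \<le> K0" using I(2) lI by linarith
    moreover have "2 * c * k0 \<le> 2 * c * \<bar>k0\<bar>" using c0 by (intro mult_left_mono) auto
    ultimately show False using L(2) by linarith
  qed
qed

lemma crefl_diff_continuous:
  fixes u :: "'a::euclidean_space \<Rightarrow> real"
  assumes "continuous_on UNIV u" shows "continuous_on UNIV (\<lambda>x. u x - u (crefl i a x))"
  by (intro continuous_intros assms continuous_on_compose2[OF assms]) auto

text \<open>Reflection preserves the kernel, so the difference is a sum of two subsolutions:
  \<open>u\<close> and the reflected \<open>- u\<close>.\<close>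

lemma fsub_crefl_diff:
  fixes u :: "'a::euclidean_space \<Rightarrow> real"
  assumes i: "i \<in> Basis" and s: "0 < s" "s < 1" and cont: "continuous_on UNIV u" and M: "\<And>x. \<bar>u x\<bar> \<le> M"
    and A: "open A"
    and fg: "continuous_on A f" "continuous_on A g" and sub: "fsub s A f u" "fsub s A g (\<lambda>x. - u x)"
  shows "fsub s (A \<inter> {x. crefl i a x \<in> A}) (\<lambda>x. f x + g (crefl i a x)) (\<lambda>x. u x - u (crefl i a x))"
proof -
  let ?B = "A \<inter> {x. crefl i a x \<in> A}"
  have oB: "open {x. crefl i a x \<in> A}"
    using open_vimage[OF A, of "crefl i a"] by (simp add: vimage_def continuous_on_crefl)
  have "fsub s ?B (\<lambda>x. f x + g (crefl i a x)) (\<lambda>x. u x + - u (crefl i a x))"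
  proof (rule fsub_add[OF s, where M=M])
    show "open ?B" using A oB by auto
    show "continuous_on UNIV (\<lambda>x. - u (crefl i a x))"
      by (intro continuous_intros continuous_on_compose2[OF cont]) auto
    show "fsub s ?B f u" by (rule fsub_mono[OF sub(1)]) auto
    show "fsub s ?B (\<lambda>x. g (crefl i a x)) (\<lambda>x. - u (crefl i a x))"
      by (rule fsub_mono[OF fsub_crefl[OF i sub(2)]]) auto
    show "continuous_on ?B (\<lambda>x. g (crefl i a x))" by (intro continuous_intros continuous_on_compose2[OF fg(2)]) auto
  qed (use M cont in \<open>auto intro: continuous_on_subset[OF fg(1)]\<close>)
  then show ?thesis by simp
qed

text \<open>Any two points that differ in one coordinate are mirror images in a coordinate
  hyperplane, so the estimate for odd functions bounds increments along the axes, and a path along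
  the axes joins arbitrary points. The hyperplane may have any position, and thus interior and
  boundary regularity come out together.\<close>

lemma fsub_holder:
  fixes u :: "'a::euclidean_space \<Rightarrow> real"
  assumes e: "e \<in> Basis" and s: "0 < s" "s < 1"
    and cont: "continuous_on UNIV u" and u: "\<And>x. 0 \<le> u x" "\<And>x. u x \<le> M" "\<And>x. x \<bullet> e \<le> 0 \<Longrightarrow> u x = 0"
    and sub: "fsub s {x. 0 < x \<bullet> e} (\<lambda>_. K0) u" "fsub s {x. 0 < x \<bullet> e} (\<lambda>_. K0) (\<lambda>x. - u x)"
  obtains L \<alpha> where "L \<ge> 0" "0 < \<alpha>" "\<And>x y. \<bar>u x - u y\<bar> \<le> L * norm (x - y) powr \<alpha>"
proof -
  let ?H = "{x. 0 < x \<bullet> e}"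
  have oH: "open ?H" by (intro open_Collect_less continuous_intros)
  have M: "M \<ge> 0" using u(1,2)[of 0] by linarith
  have uM: "\<bar>u x\<bar> \<le> M" for x using u[of x] by simp
  obtain \<alpha> where \<alpha>: "0 < \<alpha>" "\<alpha> \<le> s"
    and bc: "integrable lborel (\<lambda>z::'a::euclidean_space. indicator {z. 1
        < \<bar>z \<bullet> e\<bar>} z * (2 - (1 + \<bar>z \<bullet> e\<bar>) powr \<alpha>) * fker s z)"
    "0 < (LINT z|lborel. indicator {z::'a. 1 < \<bar>z \<bullet> e\<bar>} z * (2 - (1 + \<bar>z \<bullet> e\<bar>) powr \<alpha>) * fker s z)"
    by (rule boundary_exponent[OF e s])
  obtain C where C: "C \<ge> 0" "\<And>x. x \<bullet> e > 0 \<Longrightarrow> u x \<le> C * (x \<bullet> e) powr \<alpha>"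
    by (rule fsub_boundary_barrier[OF e s \<alpha> bc cont u sub(1)]) blast+
  have \<alpha>': "\<alpha> < 1" "\<alpha> \<le> 2 * s" using \<alpha> s by auto
  have C2: "0 \<le> C * 2 powr \<alpha>" using C by simp
  have coord: "\<exists>L\<ge>0. \<forall>a x. x \<bullet> i < a \<longrightarrow> \<bar>u x - u (crefl i a x)\<bar> \<le> L * (a - x \<bullet> i) powr \<alpha>" if i: "i \<in> Basis" for i
  proof -
    obtain L where L: "L \<ge> 0" "\<And>a A (d :: 'a \<Rightarrow> real) y. \<lbrakk>continuous_on UNIV d; \<And>y. \<bar>d y\<bar> \<le> M;
       \<And>y. d (crefl i a y) = - d y; fsub s A (\<lambda>_. K0 + K0) d;
       \<And>y. y \<bullet> i < a \<Longrightarrow> y \<notin> A \<Longrightarrow> d y \<le> C * 2 powr \<alpha> * (a - y \<bullet> i) powr \<alpha>; y \<bullet> i < a\<rbrakk> \<Longrightarrow> d y \<le> L * (a - y \<bullet> i) powr \<alpha>"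
      by (rule antisym_holder[OF i s \<alpha>(1) \<alpha>' M C2, of "K0 + K0"]) blast+
    have "\<bar>u x - u (crefl i a x)\<bar> \<le> L * (a - x \<bullet> i) powr \<alpha>" if x: "x \<bullet> i < a" for a x
    proof -
      let ?A = "?H \<inter> {x. crefl i a x \<in> ?H}"
      have subs: "fsub s ?A (\<lambda>_. K0 + K0) (\<lambda>x. u x - u (crefl i a x))"
        using fsub_crefl_diff[OF i s cont uM oH _ _ sub, of a] by simp
      have subs': "fsub s ?A (\<lambda>_. K0 + K0) (\<lambda>x. - u x - (- u (crefl i a x)))"
      proof (rule fsub_crefl_diff[OF i s _ _ oH _ _ sub(2)])
        show "fsub s ?H (\<lambda>_. K0) (\<lambda>x. - (- u x))" using sub(1) by simp
      qed (use cont uM in \<open>auto intro: continuous_intros\<close>)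
      have dM: "\<bar>u y - u (crefl i a y)\<bar> \<le> M" "\<bar>- u y - (- u (crefl i a y))\<bar> \<le> M" for y
        using u(1,2)[of y] u(1,2)[of "crefl i a y"] by linarith+
      \<comment> \<open>The reflection either keeps the coordinate along \<open>e\<close> or
        increases it, so outside the set of validity \<open>y\<close> itself lies outside the
        half-space and \<open>u y = 0\<close>. If the image lies inside, its distance to the
        boundary is at most twice that of \<open>y\<close> to the mirror, whence the factor
        \<open>2 powr \<alpha>\<close>.\<close>
      have bd: "u y - u (crefl i a y) \<le> 0" "- u y - (- u (crefl i a y)) \<le> C * 2 powr \<alpha> * (a - y \<bullet> i) powr \<alpha>"
        if y: "y \<bullet> i < a" "y \<notin> ?A" for y
      proof -
        have ee: "crefl i a y \<bullet> e = (if e = i then 2 * a - y \<bullet> i else y \<bullet> e)" using i e by (simp add: crefl_inner)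
        have yH: "y \<bullet> e \<le> 0" using y ee by (auto split: if_splits)
        then have u0: "u y = 0" by (rule u(3))
        then show "u y - u (crefl i a y) \<le> 0" using u(1)[of "crefl i a y"] by simp
        have pos: "0 \<le> C * 2 powr \<alpha> * (a - y \<bullet> i) powr \<alpha>" using C2 by simp
        show "- u y - (- u (crefl i a y)) \<le> C * 2 powr \<alpha> * (a - y \<bullet> i) powr \<alpha>"
        proof (cases "crefl i a y \<bullet> e > 0")
          case True
          then have "e = i" using ee yH by (auto split: if_splits)
          then have le: "crefl i a y \<bullet> e \<le> 2 * (a - y \<bullet> i)" using ee yH by simp
          have "u (crefl i a y) \<le> C * (crefl i a y \<bullet> e) powr \<alpha>" by (rule C(2)[OF True])
          also have "\<dots> \<le> C * (2 * (a - y \<bullet> i)) powr \<alpha>" using le True \<alpha> C by (intro mult_left_mono powr_mono2) auto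
          also have "\<dots> = C * 2 powr \<alpha> * (a - y \<bullet> i) powr \<alpha>" by (simp only: powr_mult mult.assoc)
          finally show ?thesis using u0 by simp
        next
          case False
          then have "u (crefl i a y) = 0" by (intro u(3)) simp
          then show ?thesis using pos u0 by simp
        qed
      qed
      have bd1: "u y - u (crefl i a y) \<le> C * 2 powr \<alpha> * (a - y \<bullet> i) powr \<alpha>" if "y \<bullet> i < a" "y \<notin> ?A" for y
        by (rule order_trans[OF bd(1)[OF that]]) (use C2 in simp)
      have cm: "continuous_on UNIV (\<lambda>x. - u x)" by (intro continuous_intros cont)
      have 1: "u x - u (crefl i a x) \<le> L * (a - x \<bullet> i) powr \<alpha>"
        by (rule L(2)[where A="?A" and d="\<lambda>x. u x
            - u (crefl i a x)", OF crefl_diff_continuous[OF cont] dM(1) _ subs bd1 x]) (use i in auto)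
      have 2: "- u x - (- u (crefl i a x)) \<le> L * (a - x \<bullet> i) powr \<alpha>"
        by (rule L(2)[where A="?A" and d="\<lambda>x. - u x
            - (- u (crefl i a x))", OF crefl_diff_continuous[OF cm] dM(2) _ subs' bd(2) x]) (use i in auto)
      show ?thesis using 1 2 by linarith
    qed
    then show ?thesis using L(1) by blast
  qed
  then obtain Li where Li: "\<And>i. i \<in> Basis \<Longrightarrow> Li i \<ge> 0"
    "\<And>i a x. i \<in> Basis \<Longrightarrow> x \<bullet> i < a \<Longrightarrow> \<bar>u x - u (crefl i a x)\<bar> \<le> Li i * (a - x \<bullet> i) powr \<alpha>" by metis
  have step1: "\<bar>u x - u (x + h *\<^sub>R i)\<bar> \<le> Li i * h powr \<alpha>" if i: "i \<in> Basis" and h: "h > 0" for x i h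
  proof -
    have "crefl i (x \<bullet> i + h / 2) x = x + h *\<^sub>R i" by (simp add: crefl_def)
    then have "\<bar>u x - u (x + h *\<^sub>R i)\<bar> \<le> Li i * (h / 2) powr \<alpha>"
      using Li(2)[OF i, of x "x \<bullet> i + h / 2"] h by simp
    also have "\<dots> \<le> Li i * h powr \<alpha>" using h \<alpha> Li(1)[OF i] by (intro mult_left_mono powr_mono2) auto
    finally show ?thesis .
  qed
  have step: "\<bar>u x - u (x + h *\<^sub>R i)\<bar> \<le> Li i * \<bar>h\<bar> powr \<alpha>" if i: "i \<in> Basis" for x i h
  proof (cases h "0::real" rule: linorder_cases)
    case less
    then show ?thesis using step1[OF i, of "- h" "x + h *\<^sub>R i"] by (simp add: abs_minus_commute)
  qed (use step1[OF i, of h x] in auto)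
  define L where "L = (\<Sum>i\<in>Basis. Li i)"
  show ?thesis
  proof (rule that[of L \<alpha>])
    show "L \<ge> 0" unfolding L_def by (intro sum_nonneg Li)
    fix x y :: 'a
    have "\<bar>u x - u (x + (\<Sum>i\<in>S. ((y - x) \<bullet> i) *\<^sub>R i))\<bar> \<le> (\<Sum>i\<in>S. Li i) * norm (x - y) powr \<alpha>" if "finite S" "S \<subseteq> Basis"
      for S
      using that
    proof (induction S)
      case (insert i S)
      define w where "w = x + (\<Sum>i\<in>S. ((y - x) \<bullet> i) *\<^sub>R i)"
      have i: "i \<in> Basis" using insert by simp
      have "\<bar>u w - u (w + ((y - x) \<bullet> i) *\<^sub>R i)\<bar> \<le> Li i * \<bar>(y - x) \<bullet> i\<bar> powr \<alpha>" by (rule step[OF i])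
      also have "\<dots> \<le> Li i * norm (y - x) powr \<alpha>"
        using Basis_le_norm[OF i, of "y - x"] Li(1)[OF i] \<alpha> by (intro mult_left_mono powr_mono2) auto
      finally have 1: "\<bar>u w - u (w + ((y - x) \<bullet> i) *\<^sub>R i)\<bar> \<le> Li i * norm (x - y) powr \<alpha>"
        by (simp add: norm_minus_commute)
      have 2: "\<bar>u x - u w\<bar> \<le> (\<Sum>i\<in>S. Li i) * norm (x - y) powr \<alpha>" using insert by (simp add: w_def)
      have e1: "x + (\<Sum>i\<in>insert i S. ((y - x) \<bullet> i) *\<^sub>R i) = w + ((y - x) \<bullet> i) *\<^sub>R i"
        using insert by (simp add: w_def algebra_simps)
      have e2: "(\<Sum>i\<in>insert i S. Li i) * norm (x - y) powr \<alpha>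
          = Li i * norm (x - y) powr \<alpha> + (\<Sum>i\<in>S. Li i) * norm (x - y) powr \<alpha>"
        using insert by (simp add: distrib_right)
      show ?case unfolding e1 e2 using 1 2 by linarith
    qed simp
    from this[of Basis] show "\<bar>u x - u y\<bar> \<le> L * norm (x - y) powr \<alpha>"
      by (simp add: L_def euclidean_representation)
  qed (rule \<alpha>(1))
qed

section \<open>Moving planes on a compact class of solutions\<close>

lemma modulus_tendsto:
  fixes \<omega> :: "real \<Rightarrow> real"
  assumes "isCont \<omega> 0" "\<omega> 0 = 0" "X \<longlonglongrightarrow> x"
  shows "(\<lambda>j. \<omega> (norm (X j - x))) \<longlonglongrightarrow> 0"
proof -
  have "(\<lambda>j. norm (X j - x)) \<longlonglongrightarrow> 0" using assms(3) by (simp add: LIM_zero tendsto_norm_zero)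
  from isCont_tendsto_compose[OF assms(1) this] show ?thesis by (simp add: assms(2))
qed

lemma modulus_continuous:
  fixes \<omega> :: "real \<Rightarrow> real" and u :: "'a::euclidean_space \<Rightarrow> real"
  assumes \<omega>: "isCont \<omega> 0" "\<omega> 0 = 0" and u: "\<And>x y. \<bar>u x - u y\<bar> \<le> \<omega> (norm (x - y))"
  shows "continuous_on UNIV u"
  unfolding continuous_on_sequentially
proof (intro allI ballI impI)
  fix X :: "nat \<Rightarrow> 'a" and x assume X: "(\<forall>n. X n \<in> UNIV) \<and> X \<longlonglongrightarrow> x"
  have "(\<lambda>j. u (X j) - u x) \<longlonglongrightarrow> 0"
    by (rule Lim_null_comparison[OF always_eventually modulus_tendsto[OF \<omega>, of X x]]) (use u X in auto)
  then show "(u \<circ> X) \<longlonglongrightarrow> u x" by (simp add: LIM_zero_iff o_def)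
qed

lemma equicontinuous_cconv:
  fixes \<omega> :: "real \<Rightarrow> real" and F :: "nat \<Rightarrow> 'a::euclidean_space \<Rightarrow> real"
  assumes \<omega>: "isCont \<omega> 0" "\<omega> 0 = 0" and F: "\<And>j x y. \<bar>F j x - F j y\<bar> \<le> \<omega> (norm (x - y))"
    and g: "\<And>x. (\<lambda>j. F j x) \<longlonglongrightarrow> g x"
  shows "cconv F g" "\<bar>g x - g y\<bar> \<le> \<omega> (norm (x - y))"
proof -
  show "cconv F g"
    unfolding cconv_def
  proof (intro allI impI)
    fix X :: "nat \<Rightarrow> 'a" and x assume X: "X \<longlonglongrightarrow> x"
    have "(\<lambda>j. F j (X j) - F j x) \<longlonglongrightarrow> 0"
      by (rule Lim_null_comparison[OF always_eventually modulus_tendsto[OF \<omega> X]]) (use F in auto)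
    from tendsto_add[OF this g[of x]] show "(\<lambda>j. F j (X j)) \<longlonglongrightarrow> g x" by simp
  qed
  show "\<bar>g x - g y\<bar> \<le> \<omega> (norm (x - y))"
    by (rule LIMSEQ_le_const2[OF tendsto_rabs[OF tendsto_diff[OF g g]]]) (use F in blast)
qed

text \<open>Arzela-Ascoli on the whole space: a diagonal subsequence converges on a countable dense
  set, and the common modulus carries the Cauchy property to every point.\<close>

lemma equicontinuous_subseq:
  fixes \<omega> :: "real \<Rightarrow> real" and F :: "nat \<Rightarrow> 'a::euclidean_space \<Rightarrow> real"
  assumes \<omega>: "isCont \<omega> 0" "\<omega> 0 = 0" and F: "\<And>j x y. \<bar>F j x - F j y\<bar> \<le> \<omega> (norm (x - y))"
    and M: "\<And>j x. \<bar>F j x\<bar> \<le> M"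
  obtains r g where "strict_mono (r :: nat \<Rightarrow> nat)" "cconv (\<lambda>j. F (r j)) g"
proof -
  obtain D :: "'a set" where D: "countable D" "\<And>X. open X \<Longrightarrow> X \<noteq> {} \<Longrightarrow> \<exists>d\<in>D. d \<in> X"
    by (rule countable_dense_setE) blast
  obtain k where k: "strict_mono (k :: nat \<Rightarrow> nat)" "\<And>x. x \<in> D \<Longrightarrow> \<exists>l. (\<lambda>n. F (k n) x) \<longlonglongrightarrow> l"
    by (rule function_convergent_subsequence[OF D(1), of F M]) (use M in auto)
  have "\<exists>l. (\<lambda>n. F (k n) x) \<longlonglongrightarrow> l" for x
  proof -
    have "Cauchy (\<lambda>n. F (k n) x)"
    proof (rule metric_CauchyI)
      fix e :: real assume e: "e > 0"
      then have e3: "e / 3 > 0" by simp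
      obtain \<delta> where \<delta>: "\<delta> > 0" "\<And>t. \<bar>t\<bar> < \<delta> \<Longrightarrow> \<bar>\<omega> t\<bar> < e / 3"
      proof -
        have "\<forall>\<epsilon>>0. \<exists>\<delta>>0. \<forall>t. \<bar>t\<bar> < \<delta> \<longrightarrow> \<bar>\<omega> t\<bar> < \<epsilon>"
          using \<omega> by (simp add: continuous_at_eps_delta dist_real_def)
        then show ?thesis using e3 that by blast
      qed
      obtain d where d: "d \<in> D" "dist x d < \<delta>" using D(2)[of "ball x \<delta>"] \<delta> by auto
      have "convergent (\<lambda>n. F (k n) d)" using k(2)[OF d(1)] by (simp add: convergent_def)
      then obtain N where N: "\<And>m n. m \<ge> N \<Longrightarrow> n \<ge> N \<Longrightarrow> dist (F (k m) d) (F (k n) d) < e / 3"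
        using metric_CauchyD[OF convergent_Cauchy e3] by blast
      have c: "\<bar>F (k n) x - F (k n) d\<bar> < e / 3" for n
        using F[of "k n" x d] \<delta>(2)[of "norm (x - d)"] d(2) by (simp add: dist_norm)
      show "\<exists>N. \<forall>m\<ge>N. \<forall>n\<ge>N. dist (F (k m) x) (F (k n) x) < e"
      proof (intro exI[of _ N] allI impI)
        fix m n assume "m \<ge> N" "n \<ge> N"
        from N[OF this] c[of m] c[of n] show "dist (F (k m) x) (F (k n) x) < e"
          unfolding dist_real_def by linarith
      qed
    qed
    then show ?thesis by (simp add: Cauchy_convergent_iff convergent_def)
  qed
  then obtain g where "\<And>x. (\<lambda>n. F (k n) x) \<longlonglongrightarrow> g x" by metis
  from equicontinuous_cconv(1)[OF \<omega> F this] k(1) show ?thesis by (intro that)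
qed

lemma fsub_translate:
  assumes "fsub s A f u"
  shows "fsub s {x. x + h \<in> A} (\<lambda>x. f (x + h)) (\<lambda>x. u (x + h))"
  unfolding fsub_def
proof (intro ballI allI impI)
  fix x b K assume x: "x \<in> {x. x + h \<in> A}" and t: "\<forall>z. u (x + z + h) \<le> u (x + h) + b \<bullet> z + K * (norm z)\<^sup>2"
  have eq: "sdiff (\<lambda>x. u (x + h)) x = sdiff u (x + h)" by (auto simp: sdiff_def algebra_simps)
  have "u (x + h + z) \<le> u (x + h) + b \<bullet> z + K * (norm z)\<^sup>2" for z using t[rule_format, of z] by (simp add: add_ac)
  from fsubD[OF assms _ this] x
  show "integrable lborel (\<lambda>z. sdiff (\<lambda>x. u (x + h)) x z * fker s z) \<and>
       (LINT z|lborel. sdiff (\<lambda>x. u (x + h)) x z * fker s z) \<le> f (x + h)"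
    unfolding eq by simp
qed

lemma cconv_powr:
  assumes "cconv v w" and nn: "\<And>j x. 0 \<le> v j x" and p: "(p::real) \<ge> 1" and X: "X \<longlonglongrightarrow> x"
  shows "(\<lambda>j. c * v j (X j) powr p) \<longlonglongrightarrow> c * w x powr p"
  by (intro tendsto_intros tendsto_powr' cconvD[OF assms(1) X]) (use nn p in auto)

text \<open>\<open>c1\<close> and \<open>c2\<close> will be 2 over the normalizing constants, the
  factor that enters with second differences. The bound \<open>M\<close> and the modulus \<omega>
  are parameters, so that one can speak of the class of all solutions that obey them.\<close>

locale half_space_system =
  fixes s t p q c1 c2 M :: real and \<omega> :: "real \<Rightarrow> real" and e :: "'a::euclidean_space"
  assumes e: "e \<in> Basis" and s: "0 < s" "s < 1" and t: "0 < t" "t < 1"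
    and p: "p \<ge> 1" and q: "q \<ge> 1" and pq: "p * q > 1"
    and c: "c1 > 0" "c2 > 0" and M: "M > 0" and \<omega>: "isCont \<omega> 0" "\<omega> 0 = 0"
begin

abbreviation "H \<equiv> {x. 0 < x \<bullet> e}"
abbreviation "R \<equiv> crefl e"

definition sol :: "('a \<Rightarrow> real) \<Rightarrow> ('a \<Rightarrow> real) \<Rightarrow> bool" where
  "sol u v \<longleftrightarrow> (\<forall>x. 0 \<le> u x \<and> u x \<le> M) \<and> (\<forall>x. 0 \<le> v x \<and> v x \<le> M) \<and>
    (\<forall>x. x \<bullet> e \<le> 0 \<longrightarrow> u x = 0 \<and> v x = 0) \<and>
    (\<forall>x y. \<bar>u x - u y\<bar> \<le> \<omega> (norm (x - y)) \<and> \<bar>v x - v y\<bar> \<le> \<omega> (norm (x - y))) \<and>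
    fsub s H (\<lambda>x. c1 * v x powr p) u \<and> fsub s H (\<lambda>x. - (c1 * v x powr p)) (\<lambda>x. - u x) \<and>
    fsub t H (\<lambda>x. c2 * u x powr q) v \<and> fsub t H (\<lambda>x. - (c2 * u x powr q)) (\<lambda>x. - v x)"

lemma solD:
  assumes "sol u v"
  shows "\<And>x. 0 \<le> u x" "\<And>x. u x \<le> M" "\<And>x. 0 \<le> v x" "\<And>x. v x \<le> M" "\<And>x. x \<bullet> e \<le> 0 \<Longrightarrow> u x = 0" "\<And>x. x \<bullet> e \<le> 0 \<Longrightarrow> v x = 0"
    "\<And>x y. \<bar>u x - u y\<bar> \<le> \<omega> (norm (x - y))" "\<And>x y. \<bar>v x - v y\<bar> \<le> \<omega> (norm (x - y))"
    "fsub s H (\<lambda>x. c1 * v x powr p) u" "fsub s H (\<lambda>x. - (c1 * v x powr p)) (\<lambda>x. - u x)"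
    "fsub t H (\<lambda>x. c2 * u x powr q) v" "fsub t H (\<lambda>x. - (c2 * u x powr q)) (\<lambda>x. - v x)"
  using assms unfolding sol_def by auto

lemma sol_cont:
  assumes "sol u v" shows "continuous_on UNIV u" "continuous_on UNIV v"
  using modulus_continuous[OF \<omega> solD(7)[OF assms]] modulus_continuous[OF \<omega> solD(8)[OF assms]] .

lemma open_H: "open H"
  by (intro open_Collect_less continuous_intros)

lemma sol_limit:
  assumes uv: "\<And>j. sol (u j) (v j)" and cu: "cconv u u'" and cv: "cconv v v'"
  shows "sol u' v'"
proof -
  have lu: "(\<lambda>j. u j x) \<longlonglongrightarrow> u' x" and lv: "(\<lambda>j. v j x) \<longlonglongrightarrow> v' x" for x
    using cconvD[OF cu tendsto_const] cconvD[OF cv tendsto_const] by auto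
  have ev: "\<forall>\<^sub>F j in sequentially. X j \<in> H" if "x \<in> H" "X \<longlonglongrightarrow> x" for X and x :: 'a
    by (rule topological_tendstoD[OF that(2) open_H that(1)])
  have cm: "cconv (\<lambda>j x. - w j x) (\<lambda>x. - w' x)" if "cconv w w'" for w and w' :: "'a \<Rightarrow> real"
    using that unfolding cconv_def by (auto intro: tendsto_minus)
  have b: "\<bar>u j x\<bar> \<le> M" "\<bar>v j x\<bar> \<le> M" "\<bar>- u j x\<bar> \<le> M" "\<bar>- v j x\<bar> \<le> M" for j x
    using solD(1-4)[OF uv[of j], of x] by auto
  note su = sol_cont[OF uv]
  show ?thesis unfolding sol_def
  proof (intro conjI allI impI)
    fix x y
    show "0 \<le> u' x" "0 \<le> v' x" using LIMSEQ_le_const[OF lu] LIMSEQ_le_const[OF lv] solD(1,3)[OF uv] by blast+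
    show "u' x \<le> M" "v' x \<le> M" using LIMSEQ_le_const2[OF lu] LIMSEQ_le_const2[OF lv] solD(2,4)[OF uv] by blast+
    show "u' x = 0" "v' x = 0" if "x \<bullet> e \<le> 0"
      using lu[of x] lv[of x] solD(5,6)[OF uv that] by (auto simp: LIMSEQ_const_iff)
    show "\<bar>u' x - u' y\<bar> \<le> \<omega> (norm (x - y))" "\<bar>v' x - v' y\<bar> \<le> \<omega> (norm (x - y))"
      by (rule equicontinuous_cconv(2)[OF \<omega> _ lu], rule solD(7)[OF uv])
         (rule equicontinuous_cconv(2)[OF \<omega> _ lv], rule solD(8)[OF uv])
  next
    show "fsub s H (\<lambda>x. c1 * v' x powr p) u'"
      by (rule fsub_limit[OF s su(1) b(1) cu cconv_powr[OF cv solD(3)[OF uv] p] ev solD(9)[OF uv]])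
    show "fsub s H (\<lambda>x. - (c1 * v' x powr p)) (\<lambda>x. - u' x)"
      by (rule fsub_limit[OF s continuous_on_minus[OF su(1)] b(3) cm[OF cu]
        tendsto_minus[OF cconv_powr[OF cv solD(3)[OF uv] p]] ev solD(10)[OF uv]])
    show "fsub t H (\<lambda>x. c2 * u' x powr q) v'"
      by (rule fsub_limit[OF t su(2) b(2) cv cconv_powr[OF cu solD(1)[OF uv] q] ev solD(11)[OF uv]])
    show "fsub t H (\<lambda>x. - (c2 * u' x powr q)) (\<lambda>x. - v' x)"
      by (rule fsub_limit[OF t continuous_on_minus[OF su(2)] b(4) cm[OF cv]
        tendsto_minus[OF cconv_powr[OF cu solD(1)[OF uv] q]] ev solD(12)[OF uv]])
  qed
qed

lemma sol_translate:
  assumes uv: "sol u v" and h: "h \<bullet> e = 0"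
  shows "sol (\<lambda>x. u (x + h)) (\<lambda>x. v (x + h))"
proof -
  have Hh: "{x. x + h \<in> H} = H" using h by (auto simp: inner_add_left)
  show ?thesis unfolding sol_def
    using fsub_translate[OF solD(9)[OF uv], of h] fsub_translate[OF solD(10)[OF uv], of h]
      fsub_translate[OF solD(11)[OF uv], of h] fsub_translate[OF solD(12)[OF uv], of h] solD(7,8)[OF uv, of "_ + h" "_
          + h"]
    unfolding Hh by (simp add: solD[OF uv] inner_add_left h)
qed

text \<open>Translation parallel to the boundary brings the points to the axis spanned by
  \<open>e\<close>, where they stay in a segment; successive subsequences make their heights and
  both translated components converge. Reflections across planes orthogonal to \<open>e\<close>
  commute with these translations, so the values at mirror images converge too, even for a
  convergent sequence of planes.\<close>

lemma sol_compact:
  assumes uv: "\<And>j. sol (u j) (v j)" and x: "\<And>j. 0 \<le> x j \<bullet> e \<and> x j \<bullet> e \<le> B"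
  obtains r u' v' x' where "strict_mono (r :: nat \<Rightarrow> nat)" "sol u' v'" "(\<lambda>j. x (r j) \<bullet> e) \<longlonglongrightarrow> x' \<bullet> e"
    "(\<lambda>j. u (r j) (x (r j))) \<longlonglongrightarrow> u' x'" "(\<lambda>j. v (r j) (x (r j))) \<longlonglongrightarrow> v' x'"
    "\<And>l l'. l \<longlonglongrightarrow> l' \<Longrightarrow> (\<lambda>j. u (r j) (R (l (r j)) (x (r j)))) \<longlonglongrightarrow> u' (R l' x')"
    "\<And>l l'. l \<longlonglongrightarrow> l' \<Longrightarrow> (\<lambda>j. v (r j) (R (l (r j)) (x (r j)))) \<longlonglongrightarrow> v' (R l' x')"
proof -
  define h where "h j = x j - (x j \<bullet> e) *\<^sub>R e" for j
  define w where "w j = (x j \<bullet> e) *\<^sub>R e" for j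
  have ee: "e \<bullet> e = 1" using e by simp
  have h0: "h j \<bullet> e = 0" for j by (simp add: h_def inner_diff_left ee)
  have wh: "w j + h j = x j" for j by (simp add: w_def h_def)
  have Rwh: "R a (w j) + h j = R a (x j)" for a j using h0[of j] by (simp add: wh[symmetric] crefl_def inner_add_left)
  define U where "U j y = u j (y + h j)" for j y
  define V where "V j y = v j (y + h j)" for j y
  have UV: "sol (U j) (V j)" for j unfolding U_def[abs_def] V_def[abs_def] by (rule sol_translate[OF uv h0])
  have bU: "\<bar>U j y\<bar> \<le> M" "\<bar>V j y\<bar> \<le> M" for j y using solD(1-4)[OF UV[of j], of y] by auto
  have "compact {0..B}" by simp
  moreover have "\<forall>j. x j \<bullet> e \<in> {0..B}" using x by simp
  ultimately obtain a r0 where r0: "strict_mono r0" "(\<lambda>j. x (r0 j) \<bullet> e) \<longlonglongrightarrow> a"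
    unfolding compact_def by (drule_tac spec[of _ "\<lambda>j. x j \<bullet> e"]) (auto simp: o_def)
  obtain r1 u' where r1: "strict_mono r1" "cconv (\<lambda>j. U (r0 (r1 j))) u'"
    by (rule equicontinuous_subseq[OF \<omega>, of "\<lambda>j. U (r0 j)" M]) (use solD(7)[OF UV] bU in auto)
  obtain r2 v' where r2: "strict_mono r2" "cconv (\<lambda>j. V (r0 (r1 (r2 j)))) v'"
    by (rule equicontinuous_subseq[OF \<omega>, of "\<lambda>j. V (r0 (r1 j))" M]) (use solD(8)[OF UV] bU in auto)
  define r where "r j = r0 (r1 (r2 j))" for j
  have r: "strict_mono r" using r0(1) r1(1) r2(1) by (simp add: r_def strict_mono_def)
  have cu: "cconv (\<lambda>j. U (r j)) u'" unfolding r_def by (rule cconv_subseq[OF r1(2) r2(1)])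
  have cv: "cconv (\<lambda>j. V (r j)) v'" unfolding r_def by (rule r2(2))
  have r12: "strict_mono (\<lambda>j. r1 (r2 j))" using r1(1) r2(1) by (simp add: strict_mono_def)
  have xa: "(\<lambda>j. x (r j) \<bullet> e) \<longlonglongrightarrow> a"
    using LIMSEQ_subseq_LIMSEQ[OF r0(2) r12] by (simp add: o_def r_def)
  have wl: "(\<lambda>j. w (r j)) \<longlonglongrightarrow> a *\<^sub>R e" unfolding w_def by (intro tendsto_intros xa)
  show ?thesis
  proof (rule that[OF r, of u' v' "a *\<^sub>R e"])
    show "sol u' v'" by (rule sol_limit[OF UV cu cv])
    show "(\<lambda>j. x (r j) \<bullet> e) \<longlonglongrightarrow> a *\<^sub>R e \<bullet> e" using xa by (simp add: ee)
    show "(\<lambda>j. u (r j) (x (r j))) \<longlonglongrightarrow> u' (a *\<^sub>R e)" using cconvD[OF cu wl] by (simp add: U_def wh)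
    show "(\<lambda>j. v (r j) (x (r j))) \<longlonglongrightarrow> v' (a *\<^sub>R e)" using cconvD[OF cv wl] by (simp add: V_def wh)
    fix l :: "nat \<Rightarrow> real" and l' assume l: "l \<longlonglongrightarrow> l'"
    have lr: "(\<lambda>j. l (r j)) \<longlonglongrightarrow> l'" using LIMSEQ_subseq_LIMSEQ[OF l r] by (simp add: o_def)
    have R: "(\<lambda>j. R (l (r j)) (w (r j))) \<longlonglongrightarrow> R l' (a *\<^sub>R e)" by (rule tendsto_crefl[OF wl lr])
    show "(\<lambda>j. u (r j) (R (l (r j)) (x (r j)))) \<longlonglongrightarrow> u' (R l' (a *\<^sub>R e))" using cconvD[OF cu R] by (simp add: U_def Rwh)
    show "(\<lambda>j. v (r j) (R (l (r j)) (x (r j)))) \<longlonglongrightarrow> v' (R l' (a *\<^sub>R e))" using cconvD[OF cv R] by (simp add: V_def Rwh)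
  qed
qed

text \<open>Taken over the whole class, since for a single pair the supremum need not be attained.
  Only the first component is measured; the second is measured in the swapped system.\<close>

definition excess :: "real \<Rightarrow> real" where
  "excess l = Sup {d. \<exists>u v x. sol u v \<and> x \<bullet> e \<le> l \<and> d = u x - u (R l x)}"

text \<open>The exchange of the two equations is an instance of the same locale, so every statement
  on \<open>u\<close> is also one on \<open>v\<close>.\<close>

lemma system_swapped: "half_space_system t s q p c2 c1 M \<omega> e"
  using e s t p q pq c M \<omega> by unfold_locales (auto simp: mult.commute)

lemma sol_swapped: "half_space_system.sol t s q p c2 c1 M \<omega> e v u \<longleftrightarrow> sol u v"
  unfolding half_space_system.sol_def[OF system_swapped] sol_def by auto

lemma excess_upper: "sol u v \<Longrightarrow> x \<bullet> e \<le> l \<Longrightarrow> u x - u (R l x) \<le> excess l"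
  unfolding excess_def
proof (intro cSup_upper bdd_aboveI[of _ M])
  fix d assume "d \<in> {d. \<exists>u v x. sol u v \<and> x \<bullet> e \<le> l \<and> d = u x - u (R l x)}"
  then obtain u v x where a: "sol u v" "d = u x - u (R l x)" by blast
  show "d \<le> M" using solD(2)[OF a(1), of x] solD(1)[OF a(1), of "R l x"] a(2) by linarith
qed blast

lemma excess_nonneg: "sol u v \<Longrightarrow> 0 \<le> excess l"
proof -
  assume uv: "sol u v"
  have "R l (l *\<^sub>R e) = l *\<^sub>R e" using e by (simp add: crefl_def)
  then show ?thesis using excess_upper[OF uv, of "l *\<^sub>R e" l] e by simp
qed

text \<open>A maximizing sequence of solutions and points converges in the class. The limit point is
  strictly inside the slab: on the plane the difference is 0, and outside the half-space
  \<open>u\<close> vanishes while its mirror value is nonnegative.\<close>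

lemma excess_attained:
  assumes uv0: "sol u0 v0" and pos: "excess l > 0"
  obtains u v x where "sol u v" "0 < x \<bullet> e" "x \<bullet> e < l" "u x - u (R l x) = excess l"
proof -
  let ?D = "{d. \<exists>u v x. sol u v \<and> x \<bullet> e \<le> l \<and> d = u x - u (R l x)}"
  have ne: "?D \<noteq> {}"
  proof -
    have "u0 (l *\<^sub>R e) - u0 (R l (l *\<^sub>R e)) \<in> ?D" 
      by (intro CollectI exI[of _ u0] exI[of _ v0] exI[of _ "l *\<^sub>R e"] conjI) (use uv0 e in auto)
    then show ?thesis by blast
  qed
  \<comment> \<open>The maximum with 0 keeps the differences positive, which confines the points to
    heights between 0 and \<open>l\<close>.\<close>
  have "\<forall>n::nat. \<exists>w. sol (fst w) (fst (snd w)) \<and> snd (snd w) \<bullet> e \<le> l \<and>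
     max 0 (excess l - 1 / real (Suc n)) < fst w (snd (snd w)) - fst w (R l (snd (snd w)))"
  proof
    fix n :: nat
    have "max 0 (excess l - 1 / real (Suc n)) < Sup ?D" using pos by (simp add: excess_def)
    from less_cSupD[OF ne this] obtain d u v x
      where "sol u v" "x \<bullet> e \<le> l" "d = u x - u (R l x)" "max 0 (excess l - 1 / real (Suc n)) < d"
      by blast
    then show "\<exists>w. sol (fst w) (fst (snd w)) \<and> snd (snd w) \<bullet> e \<le> l \<and>
     max 0 (excess l - 1 / real (Suc n)) < fst w (snd (snd w)) - fst w (R l (snd (snd w)))"
      by (intro exI[of _ "(u, v, x)"]) simp
  qed
  from choice[OF this] obtain W where W: "\<And>n. sol (fst (W n)) (fst (snd (W n)))" "\<And>n. snd (snd (W n)) \<bullet> e \<le> l"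
     "\<And>n. max 0 (excess l - 1 / real (Suc n)) < fst (W n) (snd (snd (W n))) - fst (W n) (R l (snd (snd (W n))))"
    by blast
  define u where "u n = fst (W n)" for n
  define v where "v n = fst (snd (W n))" for n
  define x where "x n = snd (snd (W n))" for n
  have uv: "sol (u n) (v n)" and xl: "x n \<bullet> e \<le> l"
    and d: "max 0 (excess l - 1 / real (Suc n)) < u n (x n) - u n (R l (x n))" for n
    using W unfolding u_def v_def x_def by auto
  have x0: "0 \<le> x n \<bullet> e" for n
  proof (rule ccontr)
    assume "\<not> 0 \<le> x n \<bullet> e"
    then have "u n (x n) = 0" by (intro solD(5)[OF uv]) simp
    then show False using d[of n] solD(1)[OF uv, of n "R l (x n)"] by simp
  qed
  have xB: "0 \<le> x n \<bullet> e \<and> x n \<bullet> e \<le> l" for n using x0 xl by simp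
  obtain r u' v' x' where r: "strict_mono (r :: nat \<Rightarrow> nat)" "sol u' v'" "(\<lambda>j. x (r j) \<bullet> e) \<longlonglongrightarrow> x' \<bullet> e"
    "(\<lambda>j. u (r j) (x (r j))) \<longlonglongrightarrow> u' x'" "(\<lambda>j. v (r j) (x (r j))) \<longlonglongrightarrow> v' x'"
    "\<And>l l'. l \<longlonglongrightarrow> l' \<Longrightarrow> (\<lambda>j. u (r j) (R (l (r j)) (x (r j)))) \<longlonglongrightarrow> u' (R l' x')"
    "\<And>l l'. l \<longlonglongrightarrow> l' \<Longrightarrow> (\<lambda>j. v (r j) (R (l (r j)) (x (r j)))) \<longlonglongrightarrow> v' (R l' x')"
    by (rule sol_compact[where u=u and v=v and x=x, OF uv xB]) blast
  have lim: "(\<lambda>j. u (r j) (x (r j)) - u (r j) (R l (x (r j)))) \<longlonglongrightarrow> u' x' - u' (R l x')"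
    using r(4) r(6)[OF tendsto_const[of l]] by (intro tendsto_diff)
  have "(\<lambda>n. excess l - 1 / real (Suc n)) \<longlonglongrightarrow> excess l - 0"
    by (intro tendsto_intros LIMSEQ_inverse_real_of_nat[unfolded inverse_eq_divide])
  then have "(\<lambda>j. excess l - 1 / real (Suc (r j))) \<longlonglongrightarrow> excess l"
    using LIMSEQ_subseq_LIMSEQ[OF _ r(1)] by (simp add: o_def)
  then have "excess l \<le> u' x' - u' (R l x')"
    by (rule LIMSEQ_le[OF _ lim]) (use d in \<open>auto intro!: exI[of _ 0] simp: less_eq_real_def\<close>)
  moreover have xl': "x' \<bullet> e \<le> l" by (rule LIMSEQ_le_const2[OF r(3)]) (use xl in auto)
  ultimately have eq: "u' x' - u' (R l x') = excess l" using excess_upper[OF r(2)] by (simp add: order_antisym)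
  have "x' \<bullet> e \<noteq> l"
  proof
    assume "x' \<bullet> e = l"
    then have "R l x' = x'" by (simp add: crefl_def)
    then show False using eq pos by simp
  qed
  moreover have "0 < x' \<bullet> e"
  proof (rule ccontr)
    assume "\<not> 0 < x' \<bullet> e"
    then have "u' x' = 0" by (intro solD(5)[OF r(2)]) simp
    then show False using eq pos solD(1)[OF r(2), of "R l x'"] by simp
  qed
  ultimately show ?thesis using xl' eq r(2) by (intro that) auto
qed

lemma fsub_reflected_diff:
  assumes uv: "sol u v"
  shows "fsub s (H \<inter> {x. R l x \<in> H}) (\<lambda>x. c1 * v x powr p - c1 * v (R l x) powr p) (\<lambda>x. u x - u (R l x))"
proof -
  have cv: "continuous_on A (\<lambda>x. c1 * v x powr p)" for A
    using sol_cont(2)[OF uv] solD(3)[OF uv] p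
    by (intro continuous_intros continuous_on_powr' continuous_on_subset[OF sol_cont(2)[OF uv]]) auto
  have "fsub s (H \<inter> {x. R l x \<in> H}) (\<lambda>x. c1 * v x powr p + - (c1 * v (R l x) powr p)) (\<lambda>x. u x - u (R l x))"
  proof (rule fsub_crefl_diff[OF e s sol_cont(1)[OF uv] _ open_H cv _ solD(9,10)[OF uv]])
    show "continuous_on H (\<lambda>x. - (c1 * v x powr p))" by (intro continuous_intros cv)
    show "\<bar>u x\<bar> \<le> M" for x using solD(1,2)[OF uv, of x] by simp
  qed
  then show ?thesis by simp
qed

lemma powr_diff_le:
  fixes a b :: real
  assumes "0 < a" "0 \<le> b"
  shows "a powr p - b powr p \<le> p * a powr (p - 1) * (a - b)"
  using powr_ge_tangent[OF assms(2,1) p] by (simp add: algebra_simps)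

text \<open>At an extremal point the narrow-domain estimate bounds the excess by the increment of
  the power of \<open>v\<close>, and the tangent inequality bounds this by the derivative at
  \<open>v x\<close> times the excess of the other component. Positivity of the left side forces
  \<open>v (R l x) < v x\<close>, hence \<open>v x > 0\<close>.\<close>

lemma excess_narrow:
  assumes uv: "sol u v" and x: "0 < x \<bullet> e" "x \<bullet> e < l" "u x - u (R l x) = excess l" and pos: "excess l > 0"
  shows "v x > 0" "2 * slab_const e s * (l - x \<bullet> e) powr (- (2 * s)) * excess l
     \<le> c1 * p * v x powr (p - 1) * half_space_system.excess t s q p c2 c1 M \<omega> e l"
proof -
  interpret sw: half_space_system t s q p c2 c1 M \<omega> e by (rule system_swapped)
  let ?d = "\<lambda>x. u x - u (R l x)"
  have Rx: "R l x \<in> H" using x e by (simp add: crefl_inner)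
  have le: "?d y \<le> ?d x" if "y \<bullet> e < l" for y using excess_upper[OF uv, of y l] that x(3) by simp
  have "2 * ?d x * slab_const e s * (l - x \<bullet> e) powr (- (2 * s)) \<le> c1 * v x powr p - c1 * v (R l x) powr p"
  proof (rule antisym_narrow[OF e s(1) _ _ _ le x(2) _ _ fsub_reflected_diff[OF uv]])
    show "?d \<in> borel_measurable borel"
      by (intro borel_measurable_continuous_onI crefl_diff_continuous sol_cont[OF uv])
    show "\<bar>?d y\<bar> \<le> M" for y using solD(1,2)[OF uv, of y] solD(1,2)[OF uv, of "R l y"] by linarith
    show "?d (R l y) = - ?d y" for y using e by simp
  qed (use x pos Rx in auto)
  then have A: "2 * slab_const e s * (l - x \<bullet> e) powr (- (2 * s)) * excess l \<le> c1 * (v x powr p - v (R l x) powr p)"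
    unfolding x(3) by (simp add: algebra_simps)
  have "0 < 2 * slab_const e s * (l - x \<bullet> e) powr (- (2 * s)) * excess l"
    using slab_const_pos[OF e s(1)] x pos by simp
  then have "0 < c1 * (v x powr p - v (R l x) powr p)" using A by linarith
  then have "v (R l x) powr p < v x powr p" using c by (simp add: zero_less_mult_iff)
  then have lt: "v (R l x) < v x" using solD(3)[OF uv] p by (meson not_less powr_mono2 order_trans zero_le_one)
  then show vx: "v x > 0" using solD(3)[OF uv, of "R l x"] by linarith
  have "v x - v (R l x) \<le> sw.excess l" using sw.excess_upper[of v u x l] uv x unfolding sol_swapped by simp
  then have "p * v x powr (p - 1) * (v x - v (R l x)) \<le> p * v x powr (p - 1) * sw.excess l"
    using p by (intro mult_left_mono) auto
  then have "v x powr p - v (R l x) powr p \<le> p * v x powr (p - 1) * sw.excess l"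
    using powr_diff_le[OF vx solD(3)[OF uv, of "R l x"]] by linarith
  then have "c1 * (v x powr p - v (R l x) powr p) \<le> c1 * (p * v x powr (p - 1) * sw.excess l)"
    using c by (intro mult_left_mono) auto
  then show "2 * slab_const e s * (l - x \<bullet> e) powr (- (2 * s)) * excess l \<le> c1 * p * v x powr (p - 1) * sw.excess l"
    using A by (simp add: mult.assoc)
qed

definition mirror_mono :: "real \<Rightarrow> bool" where
  "mirror_mono l \<longleftrightarrow> (\<forall>u v x. sol u v \<longrightarrow> x \<bullet> e \<le> l \<longrightarrow> u x \<le> u (R l x) \<and> v x \<le> v (R l x))"

text \<open>Contact makes \<open>u\<close> symmetric about the plane. Points outside the half-space
  are mirrored to interior points, where \<open>u\<close> must therefore vanish. A nonnegative
  supersolution with an interior zero vanishes identically, and the equation then contradicts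
  \<open>v x > 0\<close>.\<close>

lemma strong_maximum:
  assumes uv: "sol u v" and l: "0 < l" "mirror_mono l" and x: "x \<bullet> e < l" "u x = u (R l x)" and v: "v x > 0"
  shows False
proof -
  let ?d = "\<lambda>x. u x - u (R l x)"
  have xH: "x \<bullet> e > 0" using solD(6)[OF uv, of x] v by force
  have Rx: "R l x \<in> H" using x xH l e by (simp add: crefl_inner)
  have le: "?d y \<le> 0" "v y \<le> v (R l y)" if "y \<bullet> e < l" for y
    using l(2) uv that unfolding mirror_mono_def by fastforce+
  have dM: "\<bar>?d y\<bar> \<le> M" for y using solD(1,2)[OF uv, of y] solD(1,2)[OF uv, of "R l y"] by linarith
  define \<tau> where "\<tau> = l - x \<bullet> e"
  have \<tau>: "\<tau> > 0" using x by (simp add: \<tau>_def)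
  have "?d (x + z) \<le> ?d x + 0 \<bullet> z + 0 * (norm z)\<^sup>2" if "norm z < \<tau>" for z
    using le(1)[of "x + z"] Basis_le_norm[OF e, of z] that x(2) by (simp add: inner_add_left \<tau>_def)
  from touched_locally_imp[OF \<tau> this, of M]
  obtain K' where "\<And>z. ?d (x + z) \<le> ?d x + 0 \<bullet> z + K' * (norm z)\<^sup>2"
    using dM by (metis abs_le_D1)
  from fsubD[OF fsub_reflected_diff[OF uv] _ this] xH Rx
  have I: "integrable lborel (\<lambda>z. sdiff ?d x z * fker s z)"
    "(LINT z|lborel. sdiff ?d x z * fker s z) \<le> c1 * v x powr p - c1 * v (R l x) powr p" by auto
  have "v x powr p \<le> v (R l x) powr p" using le(2)[OF x(1)] solD(3)[OF uv, of x] p by (intro powr_mono2) auto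
  then have "c1 * v x powr p \<le> c1 * v (R l x) powr p" using c by (intro mult_left_mono) auto
  then have I0: "(LINT z|lborel. sdiff ?d x z * fker s z) \<le> 0" using I(2) by linarith
  have d0: "?d y = 0" if "y \<bullet> e < l" for y
    by (rule antisym_strong_maximum[OF e s(1) crefl_diff_continuous[OF sol_cont(1)[OF uv]] dM _ le(1) x(1) _ I(1) I0
      that])
       (use e x(2) in auto)
  have uu: "u (y + z) \<ge> 0" for y z using solD(1)[OF uv] .
  \<comment> \<open>Chosen so that the mirror image has height
    \<open>2 * l - (2 * l + 1) = - 1\<close>.\<close>
  define y where "y = (2 * l + 1) *\<^sub>R e"
  have ye: "y \<bullet> e = 2 * l + 1" using e by (simp add: y_def)
  have uy: "u y = 0"
  proof -
    have "R l y \<bullet> e < 0" using e ye by (simp add: crefl_inner)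
    then show ?thesis using d0[of "R l y"] solD(5)[OF uv, of "R l y"] e l by simp
  qed
  \<comment> \<open>A zero of \<open>u\<close> is a minimum, so a constant touches from below and
    the supersolution inequality is available there.\<close>
  have super: "integrable lborel (\<lambda>z. sdiff (\<lambda>x. - u x) w z * fker s z) \<and>
     (LINT z|lborel. sdiff (\<lambda>x. - u x) w z * fker s z) \<le> - (c1 * v w powr p)" if "u w = 0" "w \<in> H" for w
  proof -
    have "- u (w + z) \<le> - u w + 0 \<bullet> z + 0 * (norm z)\<^sup>2" for z using solD(1)[OF uv, of "w + z"] that(1) by simp
    from fsubD[OF solD(10)[OF uv] that(2) this] show ?thesis by blast
  qed
  have yH: "y \<in> H" using ye l by simp
  have nn: "0 \<le> sdiff (\<lambda>x. - u x) y z * fker s z" for z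
    using uu[of y z] solD(1)[OF uv, of "y - z"] uy by (simp add: sdiff_def)
  have "0 \<le> c1 * v y powr p" using c by simp
  then have "(LINT z|lborel. sdiff (\<lambda>x. - u x) y z * fker s z) = 0"
    using super[OF uy yH] Bochner_Integration.integral_nonneg[of lborel "\<lambda>z. sdiff (\<lambda>x. - u x) y z * fker s z"] nn
      by fastforce
  then have AE: "AE z in lborel. sdiff (\<lambda>x. - u x) y z * fker s z = 0"
    using integral_nonneg_eq_0_iff_AE[of lborel "\<lambda>z. sdiff (\<lambda>x. - u x) y z * fker s z"] super[OF uy yH] nn by simp
  have uz: "u w = 0" for w
  proof (rule ccontr)
    assume "u w \<noteq> 0"
    then have uw: "u w > 0" using solD(1)[OF uv, of w] by simp
    have "open {z. 0 < u (y + z)}"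
      by (intro open_Collect_less continuous_intros continuous_on_compose2[OF sol_cont(1)[OF uv]]) auto
    moreover have "w - y \<in> {z. 0 < u (y + z)}" using uw by simp
    ultimately obtain z where z: "u (y + z) > 0" "sdiff (\<lambda>x. - u x) y z * fker s z = 0"
      using AE_lborel_open[OF _ _ AE] by blast
    have "z \<noteq> 0" using z(1) uy by auto
    moreover have "sdiff (\<lambda>x. - u x) y z > 0" using z(1) solD(1)[OF uv, of "y - z"] uy by (simp add: sdiff_def)
    ultimately show False using z(2) fker_pos[of z s] by simp
  qed
  have "(LINT z|lborel. sdiff (\<lambda>x. - u x) x z * fker s z) = 0" by (simp add: sdiff_def uz)
  then have "c1 * v x powr p \<le> 0" using super[OF uz, of x] xH by simp
  moreover have "0 < c1 * v x powr p" using c v by simp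
  ultimately show False by linarith
qed

lemma mirror_monoI:
  assumes "excess l \<le> 0" "half_space_system.excess t s q p c2 c1 M \<omega> e l \<le> 0"
  shows "mirror_mono l"
  unfolding mirror_mono_def
proof (intro allI impI)
  interpret sw: half_space_system t s q p c2 c1 M \<omega> e by (rule system_swapped)
  fix u v x assume "sol u v" "x \<bullet> e \<le> l"
  then show "u x \<le> u (R l x) \<and> v x \<le> v (R l x)"
    using excess_upper[of u v x l] sw.excess_upper[of v u x l] assms unfolding sol_swapped by simp
qed

text \<open>
  If the comparison fails at \<open>l\<close>, the extremal values for \<open>u\<close> and for \<open>v\<close> are both positive, and
  multiplying the two narrow-domain estimates cancels them.
\<close>

lemma not_mirror_mono:
  assumes uv0: "sol u0 v0" and l: "\<not> mirror_mono l"
  obtains u v x u' v' y where "sol u v" "0 < x \<bullet> e" "x \<bullet> e < l" "u (R l x) < u x" "v x > 0"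
    "sol u' v'" "0 < y \<bullet> e" "y \<bullet> e < l" "u' y > 0"
    "4 * slab_const e s * slab_const e t * ((l - x \<bullet> e) powr (- (2 * s)) * (l - y \<bullet> e) powr (- (2 * t)))
      \<le> c1 * p * c2 * q * (v x powr (p - 1) * u' y powr (q - 1))"
proof -
  interpret sw: half_space_system t s q p c2 c1 M \<omega> e by (rule system_swapped)
  have uv0': "sw.sol v0 u0" using uv0 by (simp add: sol_swapped)
  have nn: "0 \<le> excess l" "0 \<le> sw.excess l" using excess_nonneg[OF uv0] sw.excess_nonneg[OF uv0'] by auto
  have sk: "slab_const e s > 0" "slab_const e t > 0" using slab_const_pos[OF e] s t by auto
  \<comment> \<open>If the other excess were 0, the right side of the narrow-domain estimate would
    vanish while its left side is positive.\<close>
  have EF: "0 < sw.excess l" if pos: "0 < excess l"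
  proof (rule ccontr)
    assume "\<not> 0 < sw.excess l"
    then have F0: "sw.excess l = 0" using nn by simp
    obtain u v x where x: "sol u v" "0 < x \<bullet> e" "x \<bullet> e < l" "u x - u (R l x) = excess l"
      by (rule excess_attained[OF uv0 pos])
    have "2 * slab_const e s * (l - x \<bullet> e) powr (- (2 * s)) * excess l \<le> 0"
      using excess_narrow(2)[OF x pos] by (simp add: F0)
    moreover have "0 < 2 * slab_const e s * (l - x \<bullet> e) powr (- (2 * s)) * excess l" using sk x pos by simp
    ultimately show False by linarith
  qed
  have FE: "0 < excess l" if pos: "0 < sw.excess l"
  proof (rule ccontr)
    assume "\<not> 0 < excess l"
    then have F0: "excess l = 0" using nn by simp
    obtain v u x where x: "sw.sol v u" "0 < x \<bullet> e" "x \<bullet> e < l" "v x - v (R l x) = sw.excess l"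
      by (rule sw.excess_attained[OF uv0' pos])
    have "2 * slab_const e t * (l - x \<bullet> e) powr (- (2 * t)) * sw.excess l \<le> 0"
      using sw.excess_narrow(2)[OF x pos] by (simp add: F0)
    moreover have "0 < 2 * slab_const e t * (l - x \<bullet> e) powr (- (2 * t)) * sw.excess l" using sk x pos by simp
    ultimately show False by linarith
  qed
  have pos: "0 < excess l" "0 < sw.excess l" using mirror_monoI[of l] l EF FE by (meson not_less)+
  obtain u v x where x: "sol u v" "0 < x \<bullet> e" "x \<bullet> e < l" "u x - u (R l x) = excess l"
    by (rule excess_attained[OF uv0 pos(1)])
  obtain v' u' y where y: "sw.sol v' u'" "0 < y \<bullet> e" "y \<bullet> e < l" "v' y - v' (R l y) = sw.excess l"
    by (rule sw.excess_attained[OF uv0' pos(2)])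
  note nx = excess_narrow[OF x pos(1)] and ny = sw.excess_narrow[OF y pos(2)]
  define A where "A = 2 * slab_const e s * (l - x \<bullet> e) powr (- (2 * s))"
  define B where "B = 2 * slab_const e t * (l - y \<bullet> e) powr (- (2 * t))"
  define A' where "A' = c1 * p * v x powr (p - 1)"
  define B' where "B' = c2 * q * u' y powr (q - 1)"
  have AB: "0 \<le> A" "0 \<le> B" "0 \<le> A'" "0 \<le> B'" using sk c p q by (auto simp: A_def B_def A'_def B'_def)
  have "A * excess l * (B * sw.excess l) \<le> A' * sw.excess l * (B' * excess l)"
    by (rule mult_mono) (use nx(2) ny(2) AB pos in \<open>auto simp: A_def B_def A'_def B'_def\<close>)
  then have "(A * B) * (excess l * sw.excess l) \<le> (A' * B') * (excess l * sw.excess l)" by (simp add: mult_ac)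
  then have AB': "A * B \<le> A' * B'" using pos by (simp add: mult_le_cancel_right)
  show ?thesis
  proof (rule that[of u v x u' v' y])
    show "u (R l x) < u x" using x(4) pos by simp
    show "sol u' v'" using y(1) by (simp add: sol_swapped)
    show "sol u v" "0 < x \<bullet> e" "x \<bullet> e < l" "v x > 0" "0 < y \<bullet> e" "y \<bullet> e < l" "u' y > 0"
      using x(1-3) nx(1) y(2,3) ny(1) .
    show "4 * slab_const e s * slab_const e t * ((l - x \<bullet> e) powr (- (2 * s)) * (l - y \<bullet> e) powr (- (2 * t)))
      \<le> c1 * p * c2 * q * (v x powr (p - 1) * u' y powr (q - 1))"
      using AB' by (simp add: A_def B_def A'_def B'_def mult_ac)
  qed
qed

section \<open>Starting and continuing the motion of the plane\<close>

lemma mirror_mono_small: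
  assumes uv0: "sol u0 v0"
  obtains l0 where "l0 > 0" "\<And>l. 0 < l \<Longrightarrow> l < l0 \<Longrightarrow> mirror_mono l"
proof -
  have sk: "slab_const e s > 0" "slab_const e t > 0" using slab_const_pos[OF e] s t by auto
  define C where "C = c1 * p * c2 * q * (M powr (p - 1) * M powr (q - 1))"
  define D where "D = 4 * slab_const e s * slab_const e t"
  have CD: "C > 0" "D > 0" using c p q M sk by (auto simp: C_def D_def)
  \<comment> \<open>For lower planes the distances to the plane are less than \<open>l\<close>, and
    the kernel factors, at least l^(- 2 s - 2 t), exceed what the bound \<open>M\<close> allows on
    the other side.\<close>
  define l0 where "l0 = (D / C) powr (1 / (2 * s + 2 * t))"
  have l0: "l0 > 0" using CD by (simp add: l0_def)
  show ?thesis
  proof (rule that[OF l0], rule ccontr)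
    fix l assume l: "0 < l" "l < l0" "\<not> mirror_mono l"
    obtain u v x u' v' y where x: "sol u v" "0 < x \<bullet> e" "x \<bullet> e < l" "v x > 0"
      "sol u' v'" "0 < y \<bullet> e" "y \<bullet> e < l" "u' y > 0"
      and ineq: "4 * slab_const e s * slab_const e t * ((l - x \<bullet> e) powr (- (2 * s)) * (l - y \<bullet> e) powr (- (2 * t)))
      \<le> c1 * p * c2 * q * (v x powr (p - 1) * u' y powr (q - 1))"
      by (rule not_mirror_mono[OF uv0 l(3)]) blast
    have "v x powr (p - 1) * u' y powr (q - 1) \<le> M powr (p - 1) * M powr (q - 1)"
      using x solD(2)[OF x(5), of y] solD(4)[OF x(1), of x] p q by (intro mult_mono powr_mono2) auto
    then have "c1 * p * c2 * q * (v x powr (p - 1) * u' y powr (q - 1)) \<le> C"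
      unfolding C_def using c p q by (intro mult_left_mono) auto
    moreover have "l powr (- (2 * s)) * l powr (- (2 * t))
        \<le> (l - x \<bullet> e) powr (- (2 * s)) * (l - y \<bullet> e) powr (- (2 * t))"
      using x l s t by (intro mult_mono powr_mono2') auto
    then have "D * (l powr (- (2 * s)) * l powr (- (2 * t)))
        \<le> D * ((l - x \<bullet> e) powr (- (2 * s)) * (l - y \<bullet> e) powr (- (2 * t)))"
      using CD by (intro mult_left_mono) auto
    ultimately have "D * (l powr (- (2 * s)) * l powr (- (2 * t))) \<le> C" using ineq by (simp add: D_def)
    moreover have "l powr (- (2 * s)) * l powr (- (2 * t)) = 1 / l powr (2 * s + 2 * t)"
      by (simp add: powr_add powr_minus_divide)
    ultimately have "D * (1 / l powr (2 * s + 2 * t)) \<le> C" by metis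
    moreover have "0 < l powr (2 * s + 2 * t)" using l by simp
    ultimately have "D / C \<le> l powr (2 * s + 2 * t)" using CD by (simp add: divide_le_eq mult.commute)
    then have "(D / C) powr (1 / (2 * s + 2 * t)) \<le> (l powr (2 * s + 2 * t)) powr (1 / (2 * s + 2 * t))"
      using CD s t by (intro powr_mono2) auto
    also have "\<dots> = l" using l s t by (simp add: powr_powr)
    finally show False using l by (simp add: l0_def)
  qed
qed

lemma mirror_mono_closed:
  assumes "\<And>l. 0 < l \<Longrightarrow> l < L \<Longrightarrow> mirror_mono l" "L > 0"
  shows "mirror_mono L"
  unfolding mirror_mono_def
proof (intro allI impI)
  fix u v x assume uv: "sol u v" and x: "x \<bullet> e \<le> L"
  show "u x \<le> u (R L x) \<and> v x \<le> v (R L x)"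
  proof (cases "x \<bullet> e = L")
    case True
    then have "R L x = x" by (simp add: crefl_def)
    then show ?thesis by simp
  next
    case False
    then have xl: "x \<bullet> e < L" using x by simp
    \<comment> \<open>The maximum with 0 keeps the approximating planes at positive heights, where
      the assumption applies.\<close>
    define a where "a = max (x \<bullet> e) 0"
    have a: "0 \<le> a" "x \<bullet> e \<le> a" "a < L" using xl assms(2) by (auto simp: a_def)
    define l where "l n = L - (L - a) / real (Suc (Suc n))" for n
    have l: "a < l n" "l n < L" for n
    proof -
      have "(L - a) / real (Suc (Suc n)) < (L - a) / 1" using a by (intro divide_strict_left_mono) auto
      then show "a < l n" by (simp add: l_def)
      show "l n < L" using a by (simp add: l_def)
    qed
    have "(\<lambda>n. l n) \<longlonglongrightarrow> L - 0"
      unfolding l_def by (intro tendsto_diff tendsto_const LIMSEQ_Suc[of "\<lambda>n. (L - a) / real (Suc n)"]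
        LIMSEQ_Suc[of "\<lambda>n. (L - a) / real n"] lim_const_over_n)
    then have Rl: "(\<lambda>n. R (l n) x) \<longlonglongrightarrow> R L x" by (intro tendsto_crefl tendsto_const) simp
    have "u x \<le> u (R (l n) x) \<and> v x \<le> v (R (l n) x)" for n
      using assms(1)[of "l n"] l[of n] a uv unfolding mirror_mono_def by auto
    then show ?thesis
      using LIMSEQ_le_const[OF continuous_on_tendsto_compose[OF sol_cont(1)[OF uv] Rl]]
        LIMSEQ_le_const[OF continuous_on_tendsto_compose[OF sol_cont(2)[OF uv] Rl]] by auto
  qed
qed

text \<open>As \<open>p > 1\<close>, the combined estimate forces \<open>v\<close> to be bounded
  below at the extremal points, and its kernel factor keeps these points away from the plane. Both
  properties survive in a limit of extremal points for planes tending to \<open>L\<close>, which is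
  then a contact point excluded by \<open>strong_maximum\<close>.\<close>

lemma mirror_mono_open:
  assumes uv0: "sol u0 v0" and p1: "p > 1" and L: "L > 0" "mirror_mono L"
    and l: "l \<longlonglongrightarrow> L" "\<And>n. \<not> mirror_mono (l n)" "\<And>n. 0 < l n \<and> l n \<le> L + 1"
  shows False
proof -
  have sk: "slab_const e s > 0" "slab_const e t > 0" using slab_const_pos[OF e] s t by auto
  define K where "K = 4 * slab_const e s * slab_const e t"
  define C where "C = c1 * p * c2 * q * M powr (q - 1)"
  have KC: "K > 0" "C > 0" using c p q M sk by (auto simp: C_def K_def)
  \<comment> \<open>A lower bound for \<open>v x powr (p - 1)\<close>: both distances to the plane
    are at most \<open>L + 1\<close>, and the factor of \<open>u'\<close> is at most
    \<open>M powr (q - 1)\<close>.\<close>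
  define m where "m = K * ((L + 1) powr (- (2 * s)) * (L + 1) powr (- (2 * t))) / C"
  have m: "m > 0" using KC L by (simp add: m_def)
  define v0' where "v0' = m powr (1 / (p - 1))"
  have v0': "v0' > 0" using m by (simp add: v0'_def)
  \<comment> \<open>From the same estimate with \<open>v x\<close> bounded by \<open>M\<close>: a
    lower bound for the power \<open>2 * s\<close> of the distance between \<open>x\<close> and the
    plane.\<close>
  define D where "D = K * (L + 1) powr (- (2 * t)) / (C * M powr (p - 1))"
  have D: "D > 0" using KC L M by (simp add: D_def)
  define \<tau>0 where "\<tau>0 = D powr (1 / (2 * s))"
  have \<tau>0: "\<tau>0 > 0" using D by (simp add: \<tau>0_def)
  have "\<forall>n. \<exists>w. sol (fst w) (fst (snd w)) \<and> 0 < snd (snd w) \<bullet> e \<and> snd (snd w) \<bullet> e \<le> l n - \<tau>0 \<and>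
      fst w (R (l n) (snd (snd w))) \<le> fst w (snd (snd w)) \<and> v0' \<le> fst (snd w) (snd (snd w))"
  proof
    fix n
    obtain u v x u' v' y where x: "sol u v" "0 < x \<bullet> e" "x \<bullet> e < l n" "u (R (l n) x) < u x" "v x > 0"
      "sol u' v'" "0 < y \<bullet> e" "y \<bullet> e < l n" "u' y > 0"
      and ineq: "4 * slab_const e s * slab_const e t
          * ((l n - x \<bullet> e) powr (- (2 * s)) * (l n - y \<bullet> e) powr (- (2 * t)))
      \<le> c1 * p * c2 * q * (v x powr (p - 1) * u' y powr (q - 1))"
      by (rule not_mirror_mono[OF uv0 l(2)[of n]]) blast
    have "v x powr (p - 1) * u' y powr (q - 1) \<le> v x powr (p - 1) * M powr (q - 1)"
      using x solD(2)[OF x(6), of y] q by (intro mult_left_mono powr_mono2) auto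
    then have "c1 * p * c2 * q * (v x powr (p - 1) * u' y powr (q - 1))
        \<le> c1 * p * c2 * q * (v x powr (p - 1) * M powr (q - 1))"
      by (rule mult_left_mono) (use c p q in auto)
    also have "\<dots> = C * v x powr (p - 1)" by (simp add: C_def)
    finally have i1: "K * ((l n - x \<bullet> e) powr (- (2 * s)) * (l n - y \<bullet> e) powr (- (2 * t))) \<le> C * v x powr (p - 1)"
      using ineq by (simp add: K_def)
    have ty: "(L + 1) powr (- (2 * t)) \<le> (l n - y \<bullet> e) powr (- (2 * t))"
      using x l(3)[of n] t by (intro powr_mono2') auto
    have tx: "(L + 1) powr (- (2 * s)) \<le> (l n - x \<bullet> e) powr (- (2 * s))"
      using x l(3)[of n] s by (intro powr_mono2') auto
    have "K * ((L + 1) powr (- (2 * s)) * (L + 1) powr (- (2 * t))) \<le> C * v x powr (p - 1)"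
      by (rule order_trans[OF mult_left_mono[OF mult_mono[OF tx ty]] i1]) (use KC in auto)
    then have "m \<le> v x powr (p - 1)" using KC by (simp add: m_def divide_le_eq mult.commute)
    then have "m powr (1 / (p - 1)) \<le> (v x powr (p - 1)) powr (1 / (p - 1))" using p1 m by (intro powr_mono2) auto
    then have vx: "v0' \<le> v x" using p1 x(5) by (simp add: v0'_def powr_powr)
    have "v x powr (p - 1) \<le> M powr (p - 1)" using x(5) solD(4)[OF x(1), of x] p by (intro powr_mono2) auto
    then have "C * v x powr (p - 1) \<le> C * M powr (p - 1)" using KC by (intro mult_left_mono) auto
    moreover have "K * ((l n - x \<bullet> e) powr (- (2 * s)) * (L + 1) powr (- (2 * t)))
        \<le> K * ((l n - x \<bullet> e) powr (- (2 * s)) * (l n - y \<bullet> e) powr (- (2 * t)))"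
      using ty KC by (intro mult_left_mono) auto
    ultimately have "K * ((l n - x \<bullet> e) powr (- (2 * s)) * (L + 1) powr (- (2 * t))) \<le> C * M powr (p - 1)"
      using i1 by linarith
    then have "K * (L + 1) powr (- (2 * t)) * (1 / (l n - x \<bullet> e) powr (2 * s)) \<le> C * M powr (p - 1)"
      by (simp add: powr_minus_divide mult_ac)
    then have "D \<le> (l n - x \<bullet> e) powr (2 * s)" using x KC M by (simp add: D_def field_simps)
    then have "D powr (1 / (2 * s)) \<le> ((l n - x \<bullet> e) powr (2 * s)) powr (1 / (2 * s))" using s D
      by (intro powr_mono2) auto
    then have "\<tau>0 \<le> l n - x \<bullet> e" using s x by (simp add: \<tau>0_def powr_powr)
    then show "\<exists>w. sol (fst w) (fst (snd w)) \<and> 0 < snd (snd w) \<bullet> e \<and> snd (snd w) \<bullet> e \<le> l n - \<tau>0 \<and>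
      fst w (R (l n) (snd (snd w))) \<le> fst w (snd (snd w)) \<and> v0' \<le> fst (snd w) (snd (snd w))"
      using x vx by (intro exI[of _ "(u, v, x)"]) simp
  qed
  from choice[OF this] obtain W where W: "\<And>n. sol (fst (W n)) (fst (snd (W n)))" "\<And>n. 0 < snd (snd (W n)) \<bullet> e"
     "\<And>n. snd (snd (W n)) \<bullet> e \<le> l n - \<tau>0"
     "\<And>n. fst (W n) (R (l n) (snd (snd (W n)))) \<le> fst (W n) (snd (snd (W n)))"
       "\<And>n. v0' \<le> fst (snd (W n)) (snd (snd (W n)))"
    by blast
  define u where "u n = fst (W n)" for n
  define v where "v n = fst (snd (W n))" for n
  define x where "x n = snd (snd (W n))" for n
  have uv: "sol (u n) (v n)" and x0: "0 < x n \<bullet> e" and xl: "x n \<bullet> e \<le> l n - \<tau>0"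
    and d: "u n (R (l n) (x n)) \<le> u n (x n)" and vx: "v0' \<le> v n (x n)" for n
    using W unfolding u_def v_def x_def by auto
  have xB: "0 \<le> x n \<bullet> e \<and> x n \<bullet> e \<le> L + 1" for n using x0[of n] xl[of n] l(3)[of n] \<tau>0 by linarith
  obtain r u' v' x' where r: "strict_mono (r :: nat \<Rightarrow> nat)" "sol u' v'" "(\<lambda>j. x (r j) \<bullet> e) \<longlonglongrightarrow> x' \<bullet> e"
    "(\<lambda>j. u (r j) (x (r j))) \<longlonglongrightarrow> u' x'" "(\<lambda>j. v (r j) (x (r j))) \<longlonglongrightarrow> v' x'"
    "\<And>l l'. l \<longlonglongrightarrow> l' \<Longrightarrow> (\<lambda>j. u (r j) (R (l (r j)) (x (r j)))) \<longlonglongrightarrow> u' (R l' x')"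
    "\<And>l l'. l \<longlonglongrightarrow> l' \<Longrightarrow> (\<lambda>j. v (r j) (R (l (r j)) (x (r j)))) \<longlonglongrightarrow> v' (R l' x')"
    by (rule sol_compact[where u=u and v=v and x=x, OF uv xB]) blast
  have vp: "v' x' > 0" using LIMSEQ_le_const[OF r(5), of v0'] vx v0' by force
  have "(\<lambda>j. l (r j) - \<tau>0) \<longlonglongrightarrow> L - \<tau>0" using LIMSEQ_subseq_LIMSEQ[OF l(1) r(1)]
    by (intro tendsto_intros) (simp add: o_def)
  from LIMSEQ_le[OF r(3) this] xl have "x' \<bullet> e \<le> L - \<tau>0" by blast
  then have xL: "x' \<bullet> e < L" using \<tau>0 by simp
  have "u' (R L x') \<le> u' x'" using LIMSEQ_le[OF r(6)[OF l(1)] r(4)] d by blast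
  moreover have "u' x' \<le> u' (R L x')" using L(2) r(2) xL unfolding mirror_mono_def by force
  ultimately have "u' x' = u' (R L x')" by simp
  from strong_maximum[OF r(2) L xL this vp] show False .
qed

lemma mirror_mono_swapped: "half_space_system.mirror_mono t s q p c2 c1 M \<omega> e l \<longleftrightarrow> mirror_mono l"
  unfolding half_space_system.mirror_mono_def[OF system_swapped] mirror_mono_def sol_swapped by blast

text \<open>The infimum \<open>L\<close> of the bad heights is positive, the comparison persists at
  \<open>L\<close> by closedness, and bad heights converge to \<open>L\<close>, which the
  continuation lemma forbids.\<close>

lemma mirror_mono_all:
  assumes uv0: "sol u0 v0" and l: "l > 0"
  shows "mirror_mono l"
proof (rule ccontr)
  assume bad: "\<not> mirror_mono l"
  obtain l0 where l0: "l0 > 0" "\<And>l. 0 < l \<Longrightarrow> l < l0 \<Longrightarrow> mirror_mono l" by (rule mirror_mono_small[OF uv0]) blast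
  let ?B = "{l. 0 < l \<and> \<not> mirror_mono l}"
  define L where "L = Inf ?B"
  have ne: "?B \<noteq> {}" using bad l by blast
  have bdd: "bdd_below ?B" by (rule bdd_belowI[of _ 0]) auto
  have "l0 \<le> L" unfolding L_def using ne l0(2) by (intro cInf_greatest) (auto simp: not_less[symmetric])
  then have L0: "L > 0" using l0 by simp
  have gl: "mirror_mono l" if "0 < l" "l < L" for l using cInf_lower[OF _ bdd, of l] that unfolding L_def by fastforce
  have gL: "mirror_mono L" by (rule mirror_mono_closed[OF gl L0])
  have "\<forall>n. \<exists>l. l \<in> ?B \<and> l < L + 1 / real (Suc n)"
  proof
    fix n
    have "Inf ?B < L + 1 / real (Suc n)" by (simp add: L_def)
    from cInf_lessD[OF ne this] show "\<exists>l. l \<in> ?B \<and> l < L + 1 / real (Suc n)" by blast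
  qed
  from choice[OF this] obtain b where b: "\<And>n. b n \<in> ?B" "\<And>n. b n < L + 1 / real (Suc n)" by blast
  have bL: "L \<le> b n" for n unfolding L_def by (rule cInf_lower[OF b(1) bdd])
  have "(\<lambda>n. L + 1 / real (Suc n)) \<longlonglongrightarrow> L + 0"
    by (intro tendsto_intros LIMSEQ_inverse_real_of_nat[unfolded inverse_eq_divide])
  then have bu: "(\<lambda>n. L + 1 / real (Suc n)) \<longlonglongrightarrow> L" by simp
  have bl: "b \<longlonglongrightarrow> L"
  proof (rule real_tendsto_sandwich[OF _ _ tendsto_const bu])
    show "\<forall>\<^sub>F n in sequentially. L \<le> b n" using bL by simp
    show "\<forall>\<^sub>F n in sequentially. b n \<le> L + 1 / real (Suc n)" using b(2) by (simp add: less_imp_le)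
  qed
  have b1: "0 < b n \<and> b n \<le> L + 1" for n
  proof -
    have "1 / real (Suc n) \<le> 1" by simp
    then have "b n \<le> L + 1" using b(2)[of n] by linarith
    then show ?thesis using b(1)[of n] by auto
  qed
  have ng: "\<not> mirror_mono (b n)" for n using b(1) by simp
  show False
  proof (cases "p > 1")
    case True
    show ?thesis by (rule mirror_mono_open[OF uv0 True L0 gL bl ng b1])
  next
    case False
    \<comment> \<open>Here \<open>p = 1\<close>, so the product condition gives \<open>q > 1\<close>
      and the plane is continued in the swapped system.\<close>
    then have q1: "q > 1" using p q pq by (cases "p = 1") auto
    interpret sw: half_space_system t s q p c2 c1 M \<omega> e by (rule system_swapped)
    show ?thesis
      by (rule sw.mirror_mono_open[OF _ q1 L0 _ bl _ b1, unfolded mirror_mono_swapped sol_swapped, OF uv0 gL ng])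
  qed
qed

text \<open>The plane halfway between the two points reflects one into the other.\<close>

lemma sol_monotone:
  assumes uv: "sol u v" and h: "h \<ge> 0"
  shows "u x \<le> u (x + h *\<^sub>R e)" "v x \<le> v (x + h *\<^sub>R e)"
proof -
  have "u x \<le> u (x + h *\<^sub>R e) \<and> v x \<le> v (x + h *\<^sub>R e)"
  proof (cases "x \<bullet> e \<le> 0")
    case True
    then show ?thesis using solD[OF uv] by simp
  next
    case False
    define l where "l = x \<bullet> e + h / 2"
    have "l > 0" "x \<bullet> e \<le> l" using False h by (auto simp: l_def)
    moreover have "R l x = x + h *\<^sub>R e" by (simp add: crefl_def l_def)
    ultimately show ?thesis using mirror_mono_all[OF uv] uv unfolding mirror_mono_def by metis
  qed
  then show "u x \<le> u (x + h *\<^sub>R e)" "v x \<le> v (x + h *\<^sub>R e)" by auto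
qed

end

section \<open>Gaussian averages and the Liouville theorem\<close>

lemma fsub_scale:
  assumes "fsub s A f u" "c \<ge> 0"
  shows "fsub s A (\<lambda>x. c * f x) (\<lambda>x. c * u x)"
proof (cases "c = 0")
  case True
  then show ?thesis by (simp add: fsub_def sdiff_def)
next
  case False
  then have c: "c > 0" using assms(2) by simp
  show ?thesis unfolding fsub_def
  proof (intro ballI allI impI)
    fix x b K assume x: "x \<in> A" and t: "\<forall>z. c * u (x + z) \<le> c * u x + b \<bullet> z + K * (norm z)\<^sup>2"
    have "u (x + z) \<le> u x + ((1 / c) *\<^sub>R b) \<bullet> z + (K / c) * (norm z)\<^sup>2" for z
    proof -
      have "c * u (x + z) \<le> c * (u x + ((1 / c) *\<^sub>R b) \<bullet> z + (K / c) * (norm z)\<^sup>2)"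
        using t[rule_format, of z] c by (simp add: algebra_simps)
      then show ?thesis using c by simp
    qed
    note I = fsubD[OF assms(1) x this]
    have eq: "(\<lambda>z. sdiff (\<lambda>x. c * u x) x z * fker s z) = (\<lambda>z. c * (sdiff u x z * fker s z))"
      by (auto simp: sdiff_def algebra_simps)
    show "integrable lborel (\<lambda>z. sdiff (\<lambda>x. c * u x) x z * fker s z) \<and>
       (LINT z|lborel. sdiff (\<lambda>x. c * u x) x z * fker s z) \<le> c * f x"
      unfolding eq using I c by simp
  qed
qed

text \<open>Weights are nonnegative because a negative factor would turn subsolutions into
  supersolutions.\<close>

lemma fsub_sum:
  fixes w :: "'a::euclidean_space \<Rightarrow> real"
  assumes s: "0 < s" "s < 1" and w: "continuous_on UNIV w" "\<And>x. \<bar>w x\<bar> \<le> M" and f: "continuous_on UNIV f"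
    and sub: "fsub s UNIV f w" and G: "finite G" and m: "\<And>c. c \<in> G \<Longrightarrow> m c \<ge> 0"
  shows "fsub s UNIV (\<lambda>x. \<Sum>c\<in>G. m c * f (x + c)) (\<lambda>x. \<Sum>c\<in>G. m c * w (x + c))"
  using G m
proof (induction G)
  case empty
  then show ?case by (simp add: fsub_def sdiff_def)
next
  case (insert c G)
  define B where "B = \<bar>m c\<bar> * M + (\<Sum>c\<in>G. \<bar>m c\<bar> * M)"
  have M0: "M \<ge> 0" using w(2)[of 0] by linarith
  have cw: "continuous_on UNIV (\<lambda>x. w (x + c))" for c
    by (intro continuous_on_compose2[OF w(1)] continuous_intros) auto
  have cf: "continuous_on UNIV (\<lambda>x. f (x + c))" for c by (intro continuous_on_compose2[OF f] continuous_intros) auto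
  have "fsub s UNIV (\<lambda>x. m c * f (x + c) + (\<Sum>c\<in>G. m c * f (x + c))) (\<lambda>x. m c * w (x + c) + (\<Sum>c\<in>G. m c * w (x + c)))"
  proof (rule fsub_add[OF s, where M=B])
    show "fsub s UNIV (\<lambda>x. m c * f (x + c)) (\<lambda>x. m c * w (x + c))"
      using fsub_scale[OF fsub_translate[OF sub, of c], of "m c"] insert.prems by simp
    show "fsub s UNIV (\<lambda>x. \<Sum>c\<in>G. m c * f (x + c)) (\<lambda>x. \<Sum>c\<in>G. m c * w (x + c))"
      using insert by simp
    have 0: "0 \<le> \<bar>m c\<bar> * M" "0 \<le> (\<Sum>c\<in>G. \<bar>m c\<bar> * M)" using M0 by (auto intro: sum_nonneg)
    show "\<bar>m c * w (x + c)\<bar> \<le> B" for x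
    proof -
      have "\<bar>m c * w (x + c)\<bar> \<le> \<bar>m c\<bar> * M" unfolding abs_mult by (intro mult_left_mono w(2)) auto
      then show ?thesis using 0 by (simp add: B_def)
    qed
    show "\<bar>\<Sum>c\<in>G. m c * w (x + c)\<bar> \<le> B" for x
    proof -
      have "\<bar>\<Sum>c\<in>G. m c * w (x + c)\<bar> \<le> (\<Sum>c\<in>G. \<bar>m c\<bar> * M)"
        by (rule order_trans[OF sum_abs]) (auto simp: abs_mult intro!: sum_mono mult_left_mono w(2))
      then show ?thesis using 0 by (simp add: B_def)
    qed
  qed (auto intro!: continuous_intros cw cf)
  then show ?case using insert by simp
qed

lemma simple_integral_sum:
  fixes \<phi> :: "'a::euclidean_space \<Rightarrow> real" and h :: "'b \<Rightarrow> real"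
  assumes \<phi>: "integrable lborel \<phi>" and g: "simple_function lborel g"
  shows "(LINT y|lborel. h (g y) * \<phi> y) = (\<Sum>c\<in>range g. (LINT y|lborel. indicator (g -` {c}) y * \<phi> y) * h c)"
proof -
  have fin: "finite (range g)" using simple_functionD(1)[OF g] by simp
  have ms: "g -` {c} \<in> sets borel" for c using simple_functionD(2)[OF g, of "{c}"] by simp
  have int: "integrable lborel (\<lambda>y. indicator (g -` {c}) y * \<phi> y)" for c
    using integrable_mult_indicator[OF _ \<phi>, of "g -` {c}"] ms by simp
  have eq: "h (g y) * \<phi> y = (\<Sum>c\<in>range g. h c * (indicator (g -` {c}) y * \<phi> y))" for y
  proof -
    have "(\<Sum>c\<in>range g. h c * (indicator (g -` {c}) y * \<phi> y)) = (\<Sum>c\<in>range g. if c = g y then h c * \<phi> y else 0)"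
      by (intro sum.cong) (auto simp: indicator_def)
    also have "\<dots> = h (g y) * \<phi> y" using fin by (simp add: sum.delta)
    finally show ?thesis ..
  qed
  show ?thesis unfolding eq using int by (subst Bochner_Integration.integral_sum) (auto simp: mult.commute)
qed

text \<open>
  Discretizing the average turns it into a finite combination of translates, to which additivity
  applies; the limit is taken by stability. This gives mollification without any smoothness theory.
\<close>

lemma fsub_average:
  fixes w :: "'a::euclidean_space \<Rightarrow> real"
  assumes s: "0 < s" "s < 1" and w: "continuous_on UNIV w" "\<And>x. \<bar>w x\<bar> \<le> M"
    and f: "continuous_on UNIV f" "\<And>x. \<bar>f x\<bar> \<le> N"
    and sub: "fsub s UNIV f w" and \<phi>: "integrable lborel \<phi>" "\<And>y. 0 \<le> \<phi> y"
  shows "fsub s UNIV (\<lambda>x. LINT y|lborel. f (x + y) * \<phi> y) (\<lambda>x. LINT y|lborel. w (x + y) * \<phi> y)"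
proof -
  \<comment> \<open>Simple functions converging pointwise to the identity. Replacing
    \<open>y\<close> by \<open>g j y\<close> in the argument alone makes the average a finite sum of
    translates with nonnegative weights.\<close>
  obtain g :: "nat \<Rightarrow> 'a \<Rightarrow> 'a" where g: "\<And>j. simple_function lborel (g j)" "\<And>y. (\<lambda>j. g j y) \<longlonglongrightarrow> y"
  proof -
    have "(\<lambda>y::'a. y) \<in> borel_measurable lborel" by simp
    from borel_measurable_implies_sequence_metric[OF this, of 0] show ?thesis using that by auto
  qed
  have gm [measurable]: "g j \<in> borel_measurable borel" for j using borel_measurable_simple_function[OF g(1)[of j]]
    by simp
  have \<phi>m [measurable]: "\<phi> \<in> borel_measurable borel" using borel_measurable_integrable[OF \<phi>(1)] by simp
  have wm [measurable]: "w \<in> borel_measurable borel" by (rule borel_measurable_continuous_onI[OF w(1)])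
  have fm [measurable]: "f \<in> borel_measurable borel" by (rule borel_measurable_continuous_onI[OF f(1)])
  \<comment> \<open>The evaluation points move as well, since \<open>fsub_limit\<close> asks for
    convergence along moving points.\<close>
  have conv: "(\<lambda>j. LINT y|lborel. h (X j + g j y) * \<phi> y) \<longlonglongrightarrow> (LINT y|lborel. h (x + y) * \<phi> y)"
    if h: "continuous_on UNIV h" and B: "\<And>x. \<bar>h x\<bar> \<le> B" and X: "X \<longlonglongrightarrow> x" for h :: "'a \<Rightarrow> real" and B X x
  proof (rule integral_dominated_convergence[where w="\<lambda>y. B * \<phi> y"])
    have hm [measurable]: "h \<in> borel_measurable borel" by (rule borel_measurable_continuous_onI[OF h])
    show "(\<lambda>y. h (x + y) * \<phi> y) \<in> borel_measurable lborel" "(\<lambda>y. h (X j + g j y) * \<phi> y) \<in> borel_measurable lborel"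
      for j by measurable
    show "integrable lborel (\<lambda>y. B * \<phi> y)" using \<phi>(1) by simp
    show "AE y in lborel. (\<lambda>j. h (X j + g j y) * \<phi> y) \<longlonglongrightarrow> h (x + y) * \<phi> y"
      by (intro AE_I2 tendsto_mult tendsto_const continuous_on_tendsto_compose[OF h] tendsto_add X g(2)) auto
    show "AE y in lborel. norm (h (X j + g j y) * \<phi> y) \<le> B * \<phi> y" for j
      using B \<phi>(2) by (intro AE_I2) (simp add: abs_mult mult_right_mono)
  qed
  have fs: "fsub s UNIV (\<lambda>x. LINT y|lborel. f (x + g j y) * \<phi> y) (\<lambda>x. LINT y|lborel. w (x + g j y) * \<phi> y)" for j
  proof -
    have 0: "0 \<le> (LINT y|lborel. indicator (g j -` {c}) y * \<phi> y)" for c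
      using \<phi>(2) by (intro Bochner_Integration.integral_nonneg) simp
    have fin: "finite (range (g j))" using simple_functionD(1)[OF g(1)[of j]] by simp
    have e: "(LINT y|lborel. h (x + g j y) * \<phi> y)
        = (\<Sum>c\<in>range (g j). (LINT y|lborel. indicator (g j -` {c}) y * \<phi> y) * h (x + c))"
      for h :: "'a \<Rightarrow> real" and x
      by (rule simple_integral_sum[OF \<phi>(1) g(1), of "\<lambda>c. h (x + c)"])
    show ?thesis unfolding e by (rule fsub_sum[OF s w f(1) sub fin 0])
  qed
  have cont: "continuous_on UNIV (\<lambda>x. LINT y|lborel. w (x + g j y) * \<phi> y)" for j
  proof -
    have e: "(LINT y|lborel. w (x + g j y) * \<phi> y)
        = (\<Sum>c\<in>range (g j). (LINT y|lborel. indicator (g j -` {c}) y * \<phi> y) * w (x + c))" for x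
      by (rule simple_integral_sum[OF \<phi>(1) g(1), of "\<lambda>c. w (x + c)"])
    show ?thesis unfolding e by (intro continuous_intros continuous_on_compose2[OF w(1)]) auto
  qed
  have bound: "\<bar>LINT y|lborel. w (x + g j y) * \<phi> y\<bar> \<le> (LINT y|lborel. M * \<phi> y)" for j x
  proof -
    have "norm (LINT y|lborel. w (x + g j y) * \<phi> y) \<le> (LINT y|lborel. M * \<phi> y)"
    proof (rule Bochner_Integration.integral_norm_bound_integral)
      show "integrable lborel (\<lambda>y. M * \<phi> y)" using \<phi>(1) by simp
      show b: "norm (w (x + g j y) * \<phi> y) \<le> M * \<phi> y" for y using w(2) \<phi>(2) by (simp add: abs_mult mult_right_mono)
      show "integrable lborel (\<lambda>y. w (x + g j y) * \<phi> y)"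
      proof (rule Bochner_Integration.integrable_bound)
        show "integrable lborel (\<lambda>y. M * \<phi> y)" using \<phi>(1) by simp
        show "AE y in lborel. norm (w (x + g j y) * \<phi> y) \<le> norm (M * \<phi> y)"
          by (intro AE_I2 order_trans[OF b]) simp
      qed measurable
    qed
    then show ?thesis by simp
  qed
  show ?thesis
  proof (rule fsub_limit[OF s cont bound _ _ _ fs])
    show "cconv (\<lambda>j x. LINT y|lborel. w (x + g j y) * \<phi> y) (\<lambda>x. LINT y|lborel. w (x + y) * \<phi> y)"
      unfolding cconv_def using conv[OF w] by blast
    show "(\<lambda>j. LINT y|lborel. f (X j + g j y) * \<phi> y) \<longlonglongrightarrow> (LINT y|lborel. f (x + y) * \<phi> y)" if "X \<longlonglongrightarrow> x" for X x
      by (rule conv[OF f that])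
  qed simp
qed

section \<open>Gaussian weights\<close>

definition gauss :: "real \<Rightarrow> 'a::euclidean_space \<Rightarrow> real" where
  "gauss r y = exp (- ((norm y)\<^sup>2 / r\<^sup>2))"

lemma gauss_pos: "gauss r y > 0"
  by (simp add: gauss_def)

lemma gauss_measurable [measurable]: "gauss r \<in> borel_measurable borel"
  unfolding gauss_def by measurable

text \<open>Follows from exp x \<ge> 1 + x. A translated Gaussian is bounded below by a quadratic
  factor times the Gaussian itself, so the average of a nonnegative function is touched from below
  by a paraboloid whose opening is the average divided by \<open>r\<^sup>2\<close>. This
  self-reference is the reason for the choice of weight.\<close>

lemma gauss_diff_ge:
  "gauss r y * (1 + (2 * (y \<bullet> z) - (norm z)\<^sup>2) / r\<^sup>2) \<le> gauss r (y - z)"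
proof -
  have "(norm (y - z))\<^sup>2 = (norm y)\<^sup>2 - 2 * (y \<bullet> z) + (norm z)\<^sup>2"
    unfolding power2_norm_eq_inner by (simp add: inner_diff_left inner_diff_right inner_commute)
  then have e: "- ((norm (y - z))\<^sup>2 / r\<^sup>2) = - ((norm y)\<^sup>2 / r\<^sup>2) + (2 * (y \<bullet> z) - (norm z)\<^sup>2) / r\<^sup>2"
    by (simp add: diff_divide_distrib add_divide_distrib)
  show ?thesis unfolding gauss_def e exp_add by (intro mult_left_mono exp_ge_add_one_self) auto
qed

lemma integrable_gauss:
  assumes r: "r > 0"
  shows "integrable lborel (\<lambda>y::'a::euclidean_space. (1 + norm y) * gauss r y)"
proof -
  \<comment> \<open>With this exponent the bound exp (- x) \<le> m! / x^m leaves a power of the norm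
    integrable at infinity, even after the factor \<open>1 + norm y\<close>.\<close>
  define m where "m = Suc DIM('a)"
  define C where "C = 2 * (fact m * r ^ (2 * m))"
  have C: "C \<ge> 0" using r by (simp add: C_def)
  have bound: "(1 + norm y) * gauss r y \<le> 2 * indicator (ball 0 1) y + C * (indicator {z. 1
      \<le> norm z} y * norm y powr (- (real DIM('a) + 1)))" for y :: 'a
  proof (cases "norm y < 1")
    case True
    have "(1 + norm y) * gauss r y \<le> 2 * 1" using True by (intro mult_mono) (auto simp: gauss_def)
    then show ?thesis using True by simp
  next
    case False
    then have n: "1 \<le> norm y" by simp
    define x where "x = (norm y)\<^sup>2 / r\<^sup>2"
    have "norm y > 0" using n by linarith
    then have x: "x > 0" using r unfolding x_def by (intro divide_pos_pos zero_less_power)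
    have "x ^ m / fact m \<le> exp x"
    proof -
      have "(\<Sum>k\<in>{m}. inverse (fact k) * x ^ k) \<le> (\<Sum>k. inverse (fact k) * x ^ k)"
        by (rule sum_le_suminf) (use x summable_exp[of x] in auto)
      then show ?thesis by (simp add: exp_def divide_inverse mult.commute)
    qed
    then have "exp (- x) \<le> fact m / x ^ m" using x by (simp add: exp_minus field_simps)
    also have "\<dots> = fact m * r ^ (2 * m) / norm y ^ (2 * m)" using r n by (simp add: x_def power_divide power_mult)
    finally have g: "gauss r y \<le> fact m * r ^ (2 * m) / norm y ^ (2 * m)" by (simp add: gauss_def x_def)
    have "(1 + norm y) * gauss r y \<le> (2 * norm y) * (fact m * r ^ (2 * m) / norm y ^ (2 * m))"
      using n g r by (intro mult_mono) (auto simp: gauss_def)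
    also have "\<dots> = C * (norm y / norm y ^ (2 * m))" by (simp add: C_def)
    also have "norm y / norm y ^ (2 * m) = norm y powr (1 - real (2 * m))"
    proof -
      have "norm y ^ (2 * m) = norm y powr real (2 * m)"
        using \<open>norm y > 0\<close> by (rule powr_realpow[symmetric])
      then show ?thesis by (simp add: powr_diff)
    qed
    also have "C * norm y powr (1 - real (2 * m)) \<le> C * norm y powr (- (real DIM('a) + 1))"
      using n C by (intro mult_left_mono powr_mono) (auto simp: m_def)
    finally show ?thesis using n by simp
  qed
  have "emeasure lborel (ball (0::'a) 1) < \<infinity>" by (rule emeasure_bounded_finite) simp
  then have "integrable lborel (\<lambda>y::'a. 2 * indicator (ball 0 1) y + C * (indicator {z. 1
      \<le> norm z} y * norm y powr (- (real DIM('a) + 1))))"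
    using integrable_norm_powr_outside[of 1 1, where 'a='a]
    by (intro Bochner_Integration.integrable_add integrable_mult_right integrable_real_indicator) auto
  then show ?thesis
  proof (rule Bochner_Integration.integrable_bound)
    show "AE y in lborel. norm ((1 + norm (y::'a)) * gauss r y)
       \<le> norm (2 * indicator (ball 0 1) y + C * (indicator {z. 1 \<le> norm z} y * norm y powr (- (real DIM('a) + 1))))"
    proof (rule AE_I2)
      fix y :: 'a
      have "norm ((1 + norm y) * gauss r y) = (1 + norm y) * gauss r y" using gauss_pos[of r y]
        by (simp add: abs_mult)
      then show "norm ((1 + norm y) * gauss r y)
       \<le> norm (2 * indicator (ball 0 1) y + C * (indicator {z. 1 \<le> norm z} y * norm y powr (- (real DIM('a) + 1))))"
        using bound[of y] by (metis abs_ge_self order_trans real_norm_def)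
    qed
  qed measurable
qed

lemma integrable_gauss_bounded:
  fixes h :: "'a::euclidean_space \<Rightarrow> real"
  assumes r: "r > 0" and [measurable]: "h \<in> borel_measurable borel" and B: "\<And>y. \<bar>h y\<bar> \<le> B * (1 + norm y)"
  shows "integrable lborel (\<lambda>y. h y * gauss r y)"
proof (rule Bochner_Integration.integrable_bound)
  show "integrable lborel (\<lambda>y::'a. B * ((1 + norm y) * gauss r y))" using integrable_gauss[OF r]
    by (rule integrable_mult_right)
  show "AE y in lborel. norm (h y * gauss r y) \<le> norm (B * ((1 + norm y) * gauss r y))"
  proof (rule AE_I2)
    fix y
    have "norm (h y * gauss r y) = \<bar>h y\<bar> * gauss r y" using gauss_pos[of r y] by (simp add: abs_mult)
    also have "\<dots> \<le> B * (1 + norm y) * gauss r y" using B[of y] gauss_pos[of r y] by (intro mult_right_mono) auto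
    also have "\<dots> \<le> norm (B * ((1 + norm y) * gauss r y))" by (simp add: mult.assoc)
    finally show "norm (h y * gauss r y) \<le> norm (B * ((1 + norm y) * gauss r y))" .
  qed
qed measurable

text \<open>The averaged supersolution W is tested at the origin only. Its symmetric increment W(z)
  + W(- z) - 2 W(0) is at least - 2 W(0), as W is nonnegative, and at least - 2 W(0) |z|^2 / r^2, by
  the lower paraboloid. Rescaling the kernel then produces r^(- 2 s) and
  \<open>bump_const\<close>.\<close>

lemma gauss_average_ineq:
  fixes U F :: "'a::euclidean_space \<Rightarrow> real"
  assumes s: "0 < s" "s < 1" and U: "continuous_on UNIV U" "\<And>x. 0 \<le> U x" "\<And>x. U x \<le> M"
    and F: "continuous_on UNIV F" "\<And>x. \<bar>F x\<bar> \<le> N"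
    and sub: "fsub s UNIV (\<lambda>x. - F x) (\<lambda>x. - U x)" and r: "r > 0"
  shows "(LINT y|lborel. F y * gauss r y)
      \<le> 2 * bump_const TYPE('a) s * r powr (- (2 * s)) * (LINT y|lborel. U y * gauss r y)"
proof -
  have [measurable]: "U \<in> borel_measurable borel" by (rule borel_measurable_continuous_onI[OF U(1)])
  have M0: "M \<ge> 0" using U(2,3)[of 0] by linarith
  have g: "integrable lborel (gauss r :: 'a \<Rightarrow> real)"
    using integrable_gauss_bounded[OF r, of "\<lambda>_. 1" 1] by simp
  define W where "W x = (LINT y|lborel. U (x + y) * gauss r y)" for x
  have sub': "fsub s UNIV (\<lambda>x. LINT y|lborel. - F (x + y) * gauss r y) (\<lambda>x. - W x)"
    using fsub_average[OF s _ _ _ _ sub g less_imp_le[OF gauss_pos], of M N] U F unfolding W_def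
    by (auto intro: continuous_on_minus)
  have Wz: "W z = (LINT y|lborel. U y * gauss r (y - z))" for z
    using lborel_integral_translate[of "\<lambda>y. U y * gauss r (y - z)" z] by (simp add: W_def)
  have Wint: "integrable lborel (\<lambda>y. U y * gauss r (y - z))" for z
  proof -
    have "integrable lborel (\<lambda>y. U (z + y) * gauss r y)"
    proof (rule integrable_gauss_bounded[OF r, where B=M])
      fix y
      have "\<bar>U (z + y)\<bar> \<le> M" using U(2,3)[of "z + y"] by simp
      also have "\<dots> \<le> M * (1 + norm y)" using M0 by (simp add: distrib_left)
      finally show "\<bar>U (z + y)\<bar> \<le> M * (1 + norm y)" .
    qed measurable
    then show ?thesis using lborel_integrable_translate[of "\<lambda>y. U y * gauss r (y - z)" z] by simp
  qed
  have W0: "W 0 = (LINT y|lborel. U y * gauss r y)" using Wz[of 0] by simp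
  have Wpos: "W z \<ge> 0" for z unfolding W_def using U(2) gauss_pos[of r]
    by (intro Bochner_Integration.integral_nonneg mult_nonneg_nonneg) (auto intro: less_imp_le)
  have vint: "integrable lborel (\<lambda>y. (U y * gauss r y) *\<^sub>R y)"
  proof (rule Bochner_Integration.integrable_bound)
    show "integrable lborel (\<lambda>y::'a. M * ((1 + norm y) * gauss r y))" using integrable_gauss[OF r]
      by (rule integrable_mult_right)
    show "AE y in lborel. norm ((U y * gauss r y) *\<^sub>R y) \<le> norm (M * ((1 + norm y) * gauss r y))"
    proof (rule AE_I2)
      fix y
      have "norm ((U y * gauss r y) *\<^sub>R y) = U y * (norm y * gauss r y)" using gauss_pos[of r y] U(2)[of y]
        by (simp add: abs_mult)
      also have "\<dots> \<le> M * ((1 + norm y) * gauss r y)"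
        using gauss_pos[of r y] U(2,3)[of y] M0 by (intro mult_mono mult_right_mono) auto
      also have "\<dots> \<le> norm (M * ((1 + norm y) * gauss r y))" by simp
      finally show "norm ((U y * gauss r y) *\<^sub>R y) \<le> norm (M * ((1 + norm y) * gauss r y))" .
    qed
  qed measurable
  \<comment> \<open>The first moment supplies the linear term of the paraboloid touching from
    below.\<close>
  define b where "b = (LINT y|lborel. (U y * gauss r y) *\<^sub>R y)"
  have lower: "W 0 + 2 / r\<^sup>2 * (b \<bullet> z) - (norm z)\<^sup>2 / r\<^sup>2 * W 0 \<le> W z" for z
  proof -
    have bz: "b \<bullet> z = (LINT y|lborel. U y * gauss r y * (y \<bullet> z))"
      unfolding b_def using integral_inner_left[of z lborel "\<lambda>y. (U y * gauss r y) *\<^sub>R y"] vint by simp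
    have biz: "integrable lborel (\<lambda>y. U y * gauss r y * (y \<bullet> z))"
      using integrable_inner_left[of z lborel "\<lambda>y. (U y * gauss r y) *\<^sub>R y"] vint by simp
    have U0int: "integrable lborel (\<lambda>y. U y * gauss r y)" using Wint[of 0] by simp
    have "W 0 + 2 / r\<^sup>2 * (b \<bullet> z) - (norm z)\<^sup>2 / r\<^sup>2 * W 0
      = (LINT y|lborel. U y * gauss r y + 2 / r\<^sup>2 * (U y * gauss r y * (y \<bullet> z)) - (norm z)\<^sup>2 / r\<^sup>2 *
        (U y * gauss r y))"
      unfolding W0 bz using U0int biz by simp
    also have "\<dots> \<le> (LINT y|lborel. U y * gauss r (y - z))"
    proof (rule integral_mono)
      show "integrable lborel (\<lambda>y. U y * gauss r y + 2 / r\<^sup>2 * (U y * gauss r y * (y \<bullet> z)) - (norm z)\<^sup>2 / r\<^sup>2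
          * (U y * gauss r y))"
        using U0int biz by (intro Bochner_Integration.integrable_diff Bochner_Integration.integrable_add
          integrable_mult_right)
      show "integrable lborel (\<lambda>y. U y * gauss r (y - z))" by (rule Wint)
      fix y
      have "U y * (gauss r y * (1 + (2 * (y \<bullet> z) - (norm z)\<^sup>2) / r\<^sup>2)) \<le> U y * gauss r (y - z)"
        using U(2) by (intro mult_left_mono gauss_diff_ge)
      then show "U y * gauss r y + 2 / r\<^sup>2 * (U y * gauss r y * (y \<bullet> z)) - (norm z)\<^sup>2 / r\<^sup>2 * (U y * gauss r y)
          \<le> U y * gauss r (y - z)"
        by (simp add: algebra_simps diff_divide_distrib)
    qed
    finally show ?thesis by (simp add: Wz)
  qed
  have "- W (0 + z) \<le> - W 0 + (- (2 / r\<^sup>2) *\<^sub>R b) \<bullet> z + (W 0 / r\<^sup>2) * (norm z)\<^sup>2" for z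
    using lower[of z] by (simp add: algebra_simps)
  from fsubD[OF sub' UNIV_I this]
  have I: "integrable lborel (\<lambda>z. sdiff (\<lambda>x. - W x) 0 z * fker s z)"
    "(LINT z|lborel. sdiff (\<lambda>x. - W x) 0 z * fker s z) \<le> (LINT y|lborel. - F (0 + y) * gauss r y)" by auto
  define m where "m z = 2 * W 0 * min 1 ((norm ((1 / r) *\<^sub>R z))\<^sup>2)" for z :: 'a
  have msc: "(LINT z|lborel. min 1 ((norm ((1 / r) *\<^sub>R (z::'a)))\<^sup>2) * fker s z)
      = r powr (- (2 * s)) * bump_const TYPE('a) s"
    using fker_integral_scale[OF _ r, of "\<lambda>z::'a. min 1 ((norm ((1 / r) *\<^sub>R z))\<^sup>2)" s] r by (simp add: bump_const_def)
  have mint0: "integrable lborel (\<lambda>z::'a. min 1 ((norm ((1 / r) *\<^sub>R z))\<^sup>2) * fker s z)"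
  proof (rule Bochner_Integration.integrable_bound)
    show "integrable lborel (\<lambda>z::'a. max 1 (1 / r\<^sup>2) * (min 1 ((norm z)\<^sup>2) * fker s z))"
      by (intro integrable_mult_right integrable_fker_min s)
    show "AE z in lborel. norm (min 1 ((norm ((1 / r) *\<^sub>R (z::'a)))\<^sup>2) * fker s z)
        \<le> norm (max 1 (1 / r\<^sup>2) * (min 1 ((norm z)\<^sup>2) * fker s z))"
    proof (rule AE_I2)
      fix z :: 'a
      have e: "(norm ((1 / r) *\<^sub>R z))\<^sup>2 = 1 / r\<^sup>2 * (norm z)\<^sup>2" by (simp add: power_mult_distrib power_divide)
      have "min 1 (1 / r\<^sup>2 * (norm z)\<^sup>2) \<le> max 1 (1 / r\<^sup>2) * min 1 ((norm z)\<^sup>2)"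
      proof (cases "(norm z)\<^sup>2 \<le> 1")
        case True
        have "1 / r\<^sup>2 * (norm z)\<^sup>2 \<le> max 1 (1 / r\<^sup>2) * (norm z)\<^sup>2" by (intro mult_right_mono) auto
        then show ?thesis using True by (simp add: min_def)
      next
        case False
        then have "min 1 ((norm z)\<^sup>2) = 1" by simp
        moreover have "min 1 (1 / r\<^sup>2 * (norm z)\<^sup>2) \<le> 1" "1 \<le> max 1 (1 / r\<^sup>2)" by simp_all
        ultimately show ?thesis by linarith
      qed
      then have "min 1 ((norm ((1 / r) *\<^sub>R z))\<^sup>2) * fker s z \<le> max 1 (1 / r\<^sup>2) * min 1 ((norm z)\<^sup>2) * fker s z"
        unfolding e by (intro mult_right_mono) auto
      then show "norm (min 1 ((norm ((1 / r) *\<^sub>R z))\<^sup>2) * fker s z)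
          \<le> norm (max 1 (1 / r\<^sup>2) * (min 1 ((norm z)\<^sup>2) * fker s z))"
        by (simp add: abs_mult mult.assoc)
    qed
  qed measurable
  have le: "- (m z * fker s z) \<le> sdiff (\<lambda>x. - W x) 0 z * fker s z" for z
  proof -
    have 1: "2 * W 0 - W z - W (- z) \<le> 2 * W 0" using Wpos[of z] Wpos[of "- z"] by linarith
    have 2: "2 * W 0 - W z - W (- z) \<le> 2 * W 0 * ((norm z)\<^sup>2 / r\<^sup>2)"
    proof -
      have "2 * W 0 - W z - W (- z) \<le> 2 * ((norm z)\<^sup>2 / r\<^sup>2 * W 0)"
        using lower[of z] lower[of "- z"] unfolding inner_minus_right norm_minus_cancel mult_minus_right by linarith
      then show ?thesis by (simp add: mult_ac)
    qed
    have e: "(norm ((1 / r) *\<^sub>R z))\<^sup>2 = (norm z)\<^sup>2 / r\<^sup>2" by (simp add: power_mult_distrib power_divide)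
    have "- m z \<le> sdiff (\<lambda>x. - W x) 0 z"
      using 1 2 unfolding m_def e sdiff_def by (simp add: min_def)
    then have "- m z * fker s z \<le> sdiff (\<lambda>x. - W x) 0 z * fker s z" by (intro mult_right_mono) auto
    then show ?thesis by simp
  qed
  have meq: "(\<lambda>z. m z * fker s z) = (\<lambda>z. 2 * W 0 * (min 1 ((norm ((1 / r) *\<^sub>R z))\<^sup>2) * fker s z))"
    by (simp add: m_def mult.assoc)
  have mint: "integrable lborel (\<lambda>z. m z * fker s z)" unfolding meq using mint0 by simp
  have mI: "(LINT z|lborel. m z * fker s z) = 2 * W 0 * (r powr (- (2 * s)) * bump_const TYPE('a) s)"
    unfolding meq using msc by simp
  have "(LINT z|lborel. - (m z * fker s z)) \<le> (LINT z|lborel. sdiff (\<lambda>x. - W x) 0 z * fker s z)"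
    by (rule integral_mono[OF _ I(1) le]) (use mint in simp)
  then have "- (LINT z|lborel. m z * fker s z) \<le> - (LINT y|lborel. F y * gauss r y)" using I(2) by simp
  then show ?thesis using mI W0 by (simp add: mult_ac)
qed

lemma integral_pos_continuous:
  fixes f :: "'a::euclidean_space \<Rightarrow> real"
  assumes f: "continuous_on UNIV f" "\<And>x. 0 \<le> f x" and int: "integrable lborel f" and x: "f x > 0"
  shows "0 < integral\<^sup>L lborel f"
proof -
  have "integral\<^sup>L lborel f \<noteq> 0"
  proof
    assume "integral\<^sup>L lborel f = 0"
    then have AE: "AE y in lborel. f y = 0" using integral_nonneg_eq_0_iff_AE[OF int] f(2) by simp
    have "open {y. 0 < f y}" by (intro open_Collect_less continuous_intros f(1))
    moreover have "{y. 0 < f y} \<noteq> {}" using x by blast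
    ultimately show False using AE_lborel_open[OF _ _ AE] by force
  qed
  moreover have "0 \<le> integral\<^sup>L lborel f" using f(2) by (intro Bochner_Integration.integral_nonneg)
  ultimately show ?thesis by linarith
qed

lemma continuous_on_gauss [continuous_intros]: "continuous_on S (gauss r)"
  unfolding gauss_def[abs_def] divide_inverse by (intro continuous_intros)

definition gauss_mass :: "'a::euclidean_space itself \<Rightarrow> real \<Rightarrow> real" where
  "gauss_mass _ r = (LINT y|lborel. gauss r (y::'a))"

lemma gauss_mass_scale: "r > 0 \<Longrightarrow> gauss_mass TYPE('a::euclidean_space) r = r ^ DIM('a) * gauss_mass TYPE('a) 1"
proof -
  assume r: "r > 0"
  have "gauss r (r *\<^sub>R y) = gauss 1 y" for y :: 'a using r by (simp add: gauss_def power_mult_distrib)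
  then show ?thesis unfolding gauss_mass_def by (subst lborel_integral_scale[OF _ r]) simp_all
qed

lemma bounded_gauss_integrable:
  fixes f :: "'a::euclidean_space \<Rightarrow> real"
  assumes "continuous_on UNIV f" "\<And>x. \<bar>f x\<bar> \<le> M" "r > 0"
  shows "integrable lborel (\<lambda>y. f y * gauss r y)"
proof (rule integrable_gauss_bounded[OF assms(3), where B=M])
  show "f \<in> borel_measurable borel" by (rule borel_measurable_continuous_onI[OF assms(1)])
  fix y :: 'a
  have "M \<ge> 0" using assms(2)[of y] by linarith
  then have "M * 1 \<le> M * (1 + norm y)" by (intro mult_left_mono) auto
  then show "\<bar>f y\<bar> \<le> M * (1 + norm y)" using assms(2)[of y] by linarith
qed

lemma gauss_mass_pos: "r > 0 \<Longrightarrow> gauss_mass TYPE('a::euclidean_space) r > 0"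
  unfolding gauss_mass_def
proof (rule integral_pos_continuous[where x=0])
  assume "r > 0"
  then show "integrable lborel (gauss r :: 'a \<Rightarrow> real)" using bounded_gauss_integrable[of "\<lambda>_. 1" 1 r] by simp
qed (auto intro: continuous_intros gauss_pos less_imp_le)

text \<open>The tangent inequality at the mean is integrated. A zero mean is treated apart, because
  the tangent needs a positive base point.\<close>

lemma gauss_jensen:
  fixes f :: "'a::euclidean_space \<Rightarrow> real"
  assumes f: "continuous_on UNIV f" "\<And>x. 0 \<le> f x" "\<And>x. f x \<le> M" and p: "p \<ge> 1" and r: "r > 0"
  shows "gauss_mass TYPE('a) r * ((LINT y|lborel. f y * gauss r y) / gauss_mass TYPE('a) r) powr p
      \<le> (LINT y|lborel. f y powr p * gauss r y)"
proof -
  define Z where "Z = gauss_mass TYPE('a) r"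
  have Z: "Z > 0" using gauss_mass_pos[OF r] by (simp add: Z_def)
  define a where "a = (LINT y|lborel. f y * gauss r y) / Z"
  have nn: "0 \<le> (LINT y|lborel. f y powr p * gauss r y)" "0 \<le> (LINT y|lborel. f y * gauss r y)"
    by (intro Bochner_Integration.integral_nonneg mult_nonneg_nonneg f(2) powr_ge_zero less_imp_le[OF gauss_pos])+
  have i1: "integrable lborel (\<lambda>y. f y * gauss r y)"
    by (rule bounded_gauss_integrable[OF f(1) _ r, of M]) (use f in auto)
  have ip: "integrable lborel (\<lambda>y. f y powr p * gauss r y)"
  proof (rule bounded_gauss_integrable[OF _ _ r])
    show "continuous_on UNIV (\<lambda>y. f y powr p)" using f p by (intro continuous_on_powr' continuous_intros f(1)) auto
    show "\<bar>f x powr p\<bar> \<le> M powr p" for x using f p by (auto intro: powr_mono2)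
  qed
  have i0: "integrable lborel (gauss r :: 'a \<Rightarrow> real)" using bounded_gauss_integrable[of "\<lambda>_. 1" 1 r] r by simp
  show ?thesis
  proof (cases "a = 0")
    case True
    then show ?thesis using nn by (simp flip: Z_def a_def)
  next
    case False
    then have a: "a > 0" using nn Z by (simp add: a_def less_le)
    have "Z * a powr p = (a powr p - p * a powr (p - 1) * a) * Z + p * a powr (p - 1)
        * (LINT y|lborel. f y * gauss r y)"
      using Z by (simp add: a_def algebra_simps)
    also have "\<dots> = (LINT y|lborel. (a powr p - p * a powr (p - 1) * a) * gauss r y + p * a powr (p - 1)
        * (f y * gauss r y))"
      using i0 i1 by (simp add: Z_def gauss_mass_def)
    also have "\<dots> \<le> (LINT y|lborel. f y powr p * gauss r y)"
    proof (rule integral_mono)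
      fix y
      have "(a powr p + p * a powr (p - 1) * (f y - a)) * gauss r y \<le> f y powr p * gauss r y"
        using powr_ge_tangent[OF f(2)[of y] a p] gauss_pos[of r y] by (intro mult_right_mono) auto
      then show "(a powr p - p * a powr (p - 1) * a) * gauss r y + p * a powr (p - 1) * (f y * gauss r y)
          \<le> f y powr p * gauss r y"
        by (simp add: algebra_simps)
    qed (use i0 i1 ip in auto)
    finally show ?thesis by (simp flip: Z_def a_def)
  qed
qed

text \<open>
  The invariance in the direction \<open>e\<close> makes the Gaussian integrals of \<open>V powr p\<close> grow linearly in the
  radius. That is the slack which lets the borderline exponent be treated like a subcritical one.
\<close>

lemma liouville_translation_invariant:
  fixes U V :: "'a::euclidean_space \<Rightarrow> real"
  assumes s: "0 < s" "s < 1" and t: "0 < t" "t < 1" and p: "p \<ge> 1" and q: "q \<ge> 1" and pq: "p * q > 1"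
    and c: "c1 > 0" "c2 > 0"
    and U: "continuous_on UNIV U" "\<And>x. 0 \<le> U x" "\<And>x. U x \<le> M"
      and V: "continuous_on UNIV V" "\<And>x. 0 \<le> V x" "\<And>x. V x \<le> M"
    and e: "e \<in> Basis" and Ve: "\<And>x. V (x + e) = V x"
    and subU: "fsub s UNIV (\<lambda>x. - (c1 * V x powr p)) (\<lambda>x. - U x)"
      and subV: "fsub t UNIV (\<lambda>x. - (c2 * U x powr q)) (\<lambda>x. - V x)"
    and crit: "real DIM('a) - 2 * s \<le> (2 * s + 2 * t * p) / (p * q - 1)"
  shows "V x = 0" "U x = 0"
proof -
  have cpow: "continuous_on UNIV (\<lambda>x. c * f x powr a)" "\<And>x. \<bar>c * f x powr a\<bar> \<le> \<bar>c\<bar> * M powr a"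
    if "continuous_on UNIV f" "\<And>x. 0 \<le> f x" "\<And>x. f x \<le> M" "a \<ge> 1" for f :: "'a \<Rightarrow> real" and c a
    using that by (auto intro!: continuous_intros continuous_on_powr' mult_left_mono powr_mono2 simp: abs_mult)
  define k1 where "k1 = 2 * bump_const TYPE('a) s"
  define k2 where "k2 = 2 * bump_const TYPE('a) t"
  have k: "0 \<le> k1" "0 \<le> k2" unfolding k1_def k2_def bump_const_def
    by (auto intro!: Bochner_Integration.integral_nonneg)
  define Z where "Z r = gauss_mass TYPE('a) r" for r
  have Z: "Z r > 0" if "r > 0" for r using gauss_mass_pos[OF that] by (simp add: Z_def)
  define A where "A r = (LINT y|lborel. U y * gauss r y)" for r
  define B where "B r = (LINT y|lborel. V y * gauss r y)" for r
  define VP where "VP r = (LINT y|lborel. V y powr p * gauss r y)" for r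
  define UQ where "UQ r = (LINT y|lborel. U y powr q * gauss r y)" for r
  have ineq1: "c1 * VP r \<le> k1 * r powr (- (2 * s)) * A r" if r: "r > 0" for r
    using gauss_average_ineq[OF s U cpow(1)[OF V p, of c1] cpow(2)[OF V p, of c1] subU r]
    by (simp add: A_def VP_def k1_def mult.assoc)
  have ineq2: "c2 * UQ r \<le> k2 * r powr (- (2 * t)) * B r" if r: "r > 0" for r
    using gauss_average_ineq[OF t V cpow(1)[OF U q, of c2] cpow(2)[OF U q, of c2] subV r]
    by (simp add: B_def UQ_def k2_def mult.assoc)
  have V0: "V x = 0" for x
  proof (rule ccontr)
    assume "V x \<noteq> 0"
    then have Vx: "V x > 0" using V(2)[of x] by simp
    \<comment> \<open>The decay exponent of the Gaussian means of \<open>U\<close>, found by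
      eliminating the means of \<open>V\<close> from the two inequalities; \<open>crit\<close> says
      that it is at least n - 2 s.\<close>
    define al where "al = (2 * s + 2 * t * p) / (p * q - 1)"
    define C where "C = k2 powr p * k1 / (c1 * c2 powr p)"
    define C2 where "C2 = k1 / c1 * Z 1 * C powr (1 / (p * q - 1))"
    have C0: "C \<ge> 0" using k c by (simp add: C_def)
    have upper: "VP r \<le> C2" if r: "r \<ge> 1" for r
    proof -
      have r0: "r > 0" using r by simp
      define a where "a = A r / Z r"
      define b where "b = B r / Z r"
      have Bpos: "B r > 0" unfolding B_def
      proof (rule integral_pos_continuous[where x=x])
        show "integrable lborel (\<lambda>y. V y * gauss r y)"
          by (rule bounded_gauss_integrable[OF V(1) _ r0, of M]) (use V in auto)
        show "0 < V x * gauss r x" using Vx gauss_pos[of r x] by simp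
        show "0 \<le> V y * gauss r y" for y using V(2)[of y] gauss_pos[of r y] by simp
      qed (intro continuous_intros V)
      have b: "b > 0" using Bpos Z[OF r0] by (simp add: b_def)
      have "c1 * (Z r * b powr p) \<le> c1 * VP r"
        using gauss_jensen[OF V p r0] c by (intro mult_left_mono) (auto simp: b_def B_def Z_def VP_def)
      then have "c1 * (Z r * b powr p) \<le> k1 * r powr (- (2 * s)) * (a * Z r)"
        using ineq1[OF r0] Z[OF r0] by (simp add: a_def)
      then have "Z r * (c1 * b powr p) \<le> Z r * (k1 * r powr (- (2 * s)) * a)" by (simp add: mult_ac)
      then have j1: "c1 * b powr p \<le> k1 * r powr (- (2 * s)) * a" using Z[OF r0] by simp
      have "c2 * (Z r * a powr q) \<le> c2 * UQ r"
        using gauss_jensen[OF U q r0] c by (intro mult_left_mono) (auto simp: a_def A_def Z_def UQ_def)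
      then have "c2 * (Z r * a powr q) \<le> k2 * r powr (- (2 * t)) * (b * Z r)"
        using ineq2[OF r0] Z[OF r0] by (simp add: b_def)
      then have "Z r * (c2 * a powr q) \<le> Z r * (k2 * r powr (- (2 * t)) * b)" by (simp add: mult_ac)
      then have j2: "c2 * a powr q \<le> k2 * r powr (- (2 * t)) * b" using Z[OF r0] by simp
      have a0: "a \<ge> 0" unfolding a_def A_def
        by (intro divide_nonneg_pos Z[OF r0] Bochner_Integration.integral_nonneg mult_nonneg_nonneg U(2)
          less_imp_le[OF gauss_pos])
      \<comment> \<open>One factor \<open>a\<close> is cancelled below, so \<open>a > 0\<close> is
        needed; it comes from the positive mean of \<open>V\<close> through the first
        inequality.\<close>
      have "0 < c1 * b powr p" using c b by simp
      then have "a \<noteq> 0" using j1 by auto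
      then have a: "a > 0" using a0 by simp
      \<comment> \<open>The second inequality is raised to the power \<open>p\<close> so that the
        first one can replace \<open>b powr p\<close>.\<close>
      have "(c2 * a powr q) powr p \<le> (k2 * r powr (- (2 * t)) * b) powr p"
        using j2 c p by (intro powr_mono2) auto
      then have j3: "c2 powr p * a powr (p * q) \<le> k2 powr p * r powr (- (2 * t * p)) * b powr p"
        using c k b r0 by (simp add: powr_mult powr_powr mult_ac)
      have "c1 * (c2 powr p * a powr (p * q)) \<le> c1 * (k2 powr p * r powr (- (2 * t * p)) * b powr p)"
        using j3 c by (intro mult_left_mono) auto
      also have "\<dots> = k2 powr p * r powr (- (2 * t * p)) * (c1 * b powr p)" by (simp add: mult_ac)
      also have "\<dots> \<le> k2 powr p * r powr (- (2 * t * p)) * (k1 * r powr (- (2 * s)) * a)"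
        using j1 by (intro mult_left_mono) auto
      also have "\<dots> = k2 powr p * k1 * r powr (- (2 * s + 2 * t * p)) * a"
      proof -
        have "r powr (- (2 * s + 2 * t * p)) = r powr (- (2 * t * p)) * r powr (- (2 * s))"
          by (simp add: powr_add[symmetric] algebra_simps)
        then show ?thesis by (simp add: mult_ac)
      qed
      finally have "a powr (p * q) \<le> C * r powr (- (2 * s + 2 * t * p)) * a"
        using c by (simp add: C_def pos_le_divide_eq mult_ac)
      moreover have "a powr (p * q) = a powr (p * q - 1) * a" using a by (simp add: powr_diff)
      ultimately have "a powr (p * q - 1) \<le> C * r powr (- (2 * s + 2 * t * p))" using a by simp
      then have rt: "(a powr (p * q - 1)) powr (1 / (p * q - 1))
          \<le> (C * r powr (- (2 * s + 2 * t * p))) powr (1 / (p * q - 1))"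
        using pq by (intro powr_mono2) auto
      have ale: "a \<le> C powr (1 / (p * q - 1)) * r powr (- al)"
      proof -
        have ex: "(- (2 * s + 2 * t * p)) * (1 / (p * q - 1)) = - al"
          by (simp only: al_def mult_minus_left times_divide_eq_right mult_1_right)
        have "(a powr (p * q - 1)) powr (1 / (p * q - 1)) = a" using a pq by (simp add: powr_powr)
        moreover have "(C * r powr (- (2 * s + 2 * t * p))) powr (1 / (p * q - 1))
            = C powr (1 / (p * q - 1)) * r powr (- al)"
          by (simp only: powr_mult powr_powr ex)
        ultimately show ?thesis using rt by (simp only:)
      qed
      have "VP r \<le> k1 / c1 * r powr (- (2 * s)) * A r"
        using ineq1[OF r0] c by (simp add: field_simps)
      also have "A r = Z 1 * r ^ DIM('a) * a"
      proof -
        have "Z r = Z 1 * r ^ DIM('a)" using gauss_mass_scale[OF r0, where 'a='a] by (simp add: Z_def mult.commute)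
        moreover have "A r = Z r * a" using Z[OF r0] by (simp add: a_def)
        ultimately show ?thesis by (simp only:)
      qed
      also have "k1 / c1 * r powr (- (2 * s)) * (Z 1 * r ^ DIM('a) * a)
         \<le> k1 / c1 * r powr (- (2 * s)) * (Z 1 * r ^ DIM('a) * (C powr (1 / (p * q - 1)) * r powr (- al)))"
        using ale k c r0 Z[of 1] by (intro mult_left_mono) auto
      also have "\<dots> = C2 * (r powr (- (2 * s)) * r ^ DIM('a) * r powr (- al))" by (simp add: C2_def mult_ac)
      also have "r powr (- (2 * s)) * r ^ DIM('a) * r powr (- al) = r powr (real DIM('a) - 2 * s - al)"
        using r0 by (simp add: powr_realpow[symmetric] powr_add[symmetric])
      \<comment> \<open>By \<open>crit\<close> the exponent is at most 0; in the borderline case the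
        bound is still uniform in \<open>r \<ge> 1\<close>.\<close>
      also have "C2 * r powr (real DIM('a) - 2 * s - al) \<le> C2 * r powr 0"
        using r crit k c Z[of 1] by (intro mult_left_mono powr_mono) (auto simp: C2_def al_def)
      finally show ?thesis using r0 by simp
    qed
    define d where "d = V x / 2"
    have d: "d > 0" using Vx by (simp add: d_def)
    have "open {y. d < V y}" by (intro open_Collect_less continuous_intros V(1))
    moreover have "x \<in> {y. d < V y}" using Vx by (simp add: d_def)
    ultimately obtain \<rho>' where \<rho>': "\<rho>' > 0" "ball x \<rho>' \<subseteq> {y. d < V y}" by (rule openE)
    \<comment> \<open>At most 1/2, so that the balls about \<open>x + k e\<close> are disjoint for
      distinct integers k.\<close>
    define \<rho> where "\<rho> = min \<rho>' (1/2)"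
    have \<rho>: "\<rho> > 0" "\<rho> \<le> 1/2" "\<rho> \<le> \<rho>'" using \<rho>' by (auto simp: \<rho>_def)
    have Vk: "V (y + real k *\<^sub>R e) = V y" for k y
    proof (induction k)
      case (Suc k)
      then show ?case using Ve[of "y + real k *\<^sub>R e"] by (simp add: algebra_simps)
    qed simp
    define vol where "vol = measure lborel (ball (0::'a) \<rho>)"
    have vol: "vol > 0" using content_ball_pos[OF \<rho>(1), of "0::'a"] by (simp add: vol_def)
    have lower: "d powr p * exp (-1) * vol * real N \<le> VP (norm x + real N + 1)" for N :: nat
    proof -
      \<comment> \<open>All \<open>N\<close> balls lie within this distance of the origin, where the
        Gaussian of width \<open>r\<close> is at least exp (- 1).\<close>
      define r where "r = norm x + real N + 1"
      have r: "r > 0" by (simp add: r_def add_nonneg_pos)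
      let ?b = "\<lambda>k. ball (x + real k *\<^sub>R e) \<rho>"
      have uniq: "j = k" if "y \<in> ?b j" "y \<in> ?b k" for j k y
      proof -
        have "dist (x + real j *\<^sub>R e) (x + real k *\<^sub>R e) < 1"
          using dist_triangle3[of "x + real j *\<^sub>R e" "x + real k *\<^sub>R e" y] that \<rho>(2)
            unfolding mem_ball dist_commute[of _ y] by linarith
        moreover have "dist (x + real j *\<^sub>R e) (x + real k *\<^sub>R e) = \<bar>real j - real k\<bar>"
        proof -
          have "(x + real j *\<^sub>R e) - (x + real k *\<^sub>R e) = (real j - real k) *\<^sub>R e" by (simp add: algebra_simps)
          then show ?thesis using e by (simp add: dist_norm)
        qed
        ultimately show ?thesis by linarith
      qed
      have one: "(\<Sum>k<N. indicator (?b k) y) \<le> (1::real)" for y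
      proof (cases "\<exists>k<N. y \<in> ?b k")
        case True
        then obtain k0 where k0: "k0 < N" "y \<in> ?b k0" by blast
        have "(\<Sum>k<N. indicator (?b k) y) = (\<Sum>k<N. if k = k0 then 1 else (0::real))"
          by (rule sum.cong) (use uniq k0 in \<open>auto simp: indicator_def\<close>)
        then show ?thesis using k0 by simp
      next
        case False
        then have "(\<Sum>k<N. indicator (?b k) y) = (0::real)" by (intro sum.neutral) (auto simp: indicator_def)
        then show ?thesis by simp
      qed
      have pt: "d powr p * exp (-1) * (\<Sum>k<N. indicator (?b k) y) \<le> V y powr p * gauss r y" for y
      proof (cases "\<exists>k<N. y \<in> ?b k")
        case True
        then obtain k where k: "k < N" "y \<in> ?b k" by blast
        have "dist x (y - real k *\<^sub>R e) = dist (x + real k *\<^sub>R e) y" by (simp add: dist_norm algebra_simps)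
        then have "y - real k *\<^sub>R e \<in> ball x \<rho>'" using k \<rho> by simp
        then have "d < V (y - real k *\<^sub>R e)" using \<rho>' by blast
        then have "d < V y" using Vk[of "y - real k *\<^sub>R e" k] by simp
        then have 1: "d powr p \<le> V y powr p" using d p by (intro powr_mono2) auto
        have "norm y \<le> norm (x + real k *\<^sub>R e) + dist (x + real k *\<^sub>R e) y"
          using norm_triangle_ineq2[of y "x + real k *\<^sub>R e"] by (simp add: dist_norm norm_minus_commute)
        also have "\<dots> \<le> norm x + norm (real k *\<^sub>R e) + 1" using k \<rho> norm_triangle_ineq[of x "real k *\<^sub>R e"] by simp
        also have "\<dots> \<le> r" using k e by (simp add: r_def)
        finally have "(norm y)\<^sup>2 \<le> r\<^sup>2" by (intro power_mono) auto
        then have "(norm y)\<^sup>2 / r\<^sup>2 \<le> 1" using r by (simp add: divide_le_eq)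
        then have 2: "exp (-1) \<le> gauss r y" by (simp add: gauss_def)
        have "d powr p * exp (-1) * (\<Sum>k<N. indicator (?b k) y) \<le> d powr p * exp (-1) * 1"
          by (intro mult_left_mono one) auto
        also have "\<dots> \<le> V y powr p * gauss r y" using 1 2 by (simp add: mult_mono)
        finally show ?thesis .
      next
        case False
        then have "(\<Sum>k<N. indicator (?b k) y) = (0::real)" by (intro sum.neutral) (auto simp: indicator_def)
        then show ?thesis using gauss_pos[of r y] by simp
      qed
      have bi: "integrable lborel (\<lambda>y. indicator (?b k) y :: real)" for k
        by (intro integrable_real_indicator emeasure_bounded_finite) auto
      have "integral\<^sup>L lborel (\<lambda>y. indicator (?b k) y :: real) = vol" for k
        using content_ball_conv_unit_ball[of \<rho> "x + real k *\<^sub>R e"] content_ball_conv_unit_ball[of \<rho> "0::'a"] \<rho>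
          by (simp add: vol_def)
      then have "d powr p * exp (-1) * vol * real N
          = (LINT y|lborel. d powr p * exp (-1) * (\<Sum>k<N. indicator (?b k) y))"
        using bi by (simp add: Bochner_Integration.integral_sum mult_ac)
      also have "\<dots> \<le> (LINT y|lborel. V y powr p * gauss r y)"
      proof (rule integral_mono[OF _ _ pt])
        show "integrable lborel (\<lambda>y. V y powr p * gauss r y)"
          using cpow[OF V p, of 1] by (intro bounded_gauss_integrable[OF _ _ r]) auto
        show "integrable lborel (\<lambda>y. d powr p * exp (-1) * (\<Sum>k<N. indicator (?b k) y))"
          by (intro integrable_mult_right Bochner_Integration.integrable_sum bi)
      qed
      finally show ?thesis by (simp add: VP_def r_def)
    qed
    have pos: "0 < d powr p * exp (-1) * vol" using d vol by simp
    obtain N :: nat where N: "C2 / (d powr p * exp (-1) * vol) < real N" using reals_Archimedean2 by blast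
    then have "C2 < d powr p * exp (-1) * vol * real N" using pos by (simp add: divide_less_eq mult.commute)
    also have "\<dots> \<le> VP (norm x + real N + 1)" by (rule lower)
    also have "\<dots> \<le> C2" by (rule upper) simp
    finally show False by simp
  qed
  then show "V x = 0" .
  show "U x = 0"
  proof (rule ccontr)
    assume "U x \<noteq> 0"
    then have Ux: "U x > 0" using U(2)[of x] by simp
    \<comment> \<open>With \<open>V = 0\<close> the second averaged inequality leaves a nonpositive
      integral of a power of \<open>U\<close>, at any fixed width.\<close>
    have "UQ 1 > 0" unfolding UQ_def
    proof (rule integral_pos_continuous[where x=x])
      show "integrable lborel (\<lambda>y. U y powr q * gauss 1 y)"
        using cpow[OF U q, of 1] by (intro bounded_gauss_integrable) auto
      have "continuous_on UNIV (\<lambda>y. U y powr q)" using cpow(1)[OF U q, of 1] by simp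
      then show "continuous_on UNIV (\<lambda>y. U y powr q * gauss 1 y)"
        by (rule continuous_on_mult) (intro continuous_intros)
      show "0 < U x powr q * gauss 1 x" using Ux gauss_pos[of 1 x] by simp
      show "0 \<le> U y powr q * gauss 1 y" for y using gauss_pos[of 1 y] by simp
    qed
    moreover have "c2 * UQ 1 \<le> 0" using ineq2[of 1] V0 by (simp add: B_def)
    ultimately show False using c by (simp add: mult_le_0_iff)
  qed
qed

section \<open>The limit in the normal direction and the conclusion\<close>

context half_space_system
begin

lemma sol_trivial:
  assumes uv: "sol u v" and crit: "real DIM('a) - 2 * s \<le> (2 * s + 2 * t * p) / (p * q - 1)"
  shows "u x = 0" "v x = 0"
proof -
  have conv: "\<exists>W. (\<forall>x. (\<lambda>j. w (x + real j *\<^sub>R e)) \<longlonglongrightarrow> W x) \<and> (\<forall>x. w x \<le> W x)"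
    if mono: "\<And>x h. h \<ge> 0 \<Longrightarrow> w x \<le> w (x + h *\<^sub>R e)" and b: "\<And>x. w x \<le> M" for w :: "'a \<Rightarrow> real"
  proof -
    have inc: "incseq (\<lambda>j. w (x + real j *\<^sub>R e))" for x
    proof (rule incseq_SucI)
      fix j show "w (x + real j *\<^sub>R e) \<le> w (x + real (Suc j) *\<^sub>R e)"
        using mono[of 1 "x + real j *\<^sub>R e"] by (simp add: algebra_simps)
    qed
    have "\<exists>L. (\<lambda>j. w (x + real j *\<^sub>R e)) \<longlonglongrightarrow> L \<and> w x \<le> L" for x
    proof -
      obtain L where L: "(\<lambda>j. w (x + real j *\<^sub>R e)) \<longlonglongrightarrow> L" "\<forall>j. w (x + real j *\<^sub>R e) \<le> L"
        by (rule incseq_convergent[OF inc, of x M]) (use b in blast)+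
      then show ?thesis using spec[OF L(2), of 0] by (intro exI[of _ L]) simp
    qed
    then show ?thesis by metis
  qed
  obtain U where U: "\<And>x. (\<lambda>j. u (x + real j *\<^sub>R e)) \<longlonglongrightarrow> U x" "\<And>x. u x \<le> U x"
    using conv[OF sol_monotone(1)[OF uv] solD(2)[OF uv]] by blast
  obtain V where V: "\<And>x. (\<lambda>j. v (x + real j *\<^sub>R e)) \<longlonglongrightarrow> V x" "\<And>x. v x \<le> V x"
    using conv[OF sol_monotone(2)[OF uv] solD(4)[OF uv]] by blast
  have mu: "\<bar>u (x + real j *\<^sub>R e) - u (y + real j *\<^sub>R e)\<bar> \<le> \<omega> (norm (x - y))" for x y j
    using solD(7)[OF uv, of "x + real j *\<^sub>R e" "y + real j *\<^sub>R e"] by simp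
  have mv: "\<bar>v (x + real j *\<^sub>R e) - v (y + real j *\<^sub>R e)\<bar> \<le> \<omega> (norm (x - y))" for x y j
    using solD(8)[OF uv, of "x + real j *\<^sub>R e" "y + real j *\<^sub>R e"] by simp
  note cU = equicontinuous_cconv[OF \<omega> mu U(1)] and cV = equicontinuous_cconv[OF \<omega> mv V(1)]
  have cm: "cconv (\<lambda>j x. - w j x) (\<lambda>x. - W x)" if "cconv w W" for w and W :: "'a \<Rightarrow> real"
    using that unfolding cconv_def by (auto intro: tendsto_minus)
  \<comment> \<open>The domains of the translated inequalities exhaust the whole space, uniformly
    near each point, so the limit inequalities hold everywhere.\<close>
  have ev: "\<forall>\<^sub>F j in sequentially. X j \<in> {x. x + real j *\<^sub>R e \<in> H}" if X: "X \<longlonglongrightarrow> x" for X and x :: 'a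
  proof -
    have "(\<lambda>j. X j \<bullet> e) \<longlonglongrightarrow> x \<bullet> e" by (intro tendsto_intros X)
    then have 1: "\<forall>\<^sub>F j in sequentially. x \<bullet> e - 1 < X j \<bullet> e" by (rule order_tendstoD) simp
    obtain N :: nat where N: "1 - x \<bullet> e < real N" using reals_Archimedean2 by blast
    have 2: "\<forall>\<^sub>F j in sequentially. N \<le> j" by (rule eventually_ge_at_top)
    show ?thesis using 1 2
    proof eventually_elim
      case (elim j)
      then have "real N \<le> real j" by simp
      then show ?case using elim N e by (simp add: inner_add_left)
    qed
  qed
  have ch: "continuous_on UNIV (\<lambda>x. - w (x + h))" if "continuous_on UNIV w" for w :: "'a \<Rightarrow> real" and h
    by (intro continuous_intros continuous_on_compose2[OF that]) auto
  have bu: "\<bar>- u x\<bar> \<le> M" "\<bar>- v x\<bar> \<le> M" for x using solD(1-4)[OF uv, of x] by auto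
  have subU: "fsub s UNIV (\<lambda>x. - (c1 * V x powr p)) (\<lambda>x. - U x)"
    by (rule fsub_limit[OF s ch[OF sol_cont(1)[OF uv]] bu(1) cm[OF cU(1)]
        tendsto_minus[OF cconv_powr[OF cV(1) solD(3)[OF uv] p]] ev fsub_translate[OF solD(10)[OF uv]]])
  have subV: "fsub t UNIV (\<lambda>x. - (c2 * U x powr q)) (\<lambda>x. - V x)"
    by (rule fsub_limit[OF t ch[OF sol_cont(2)[OF uv]] bu(2) cm[OF cV(1)]
        tendsto_minus[OF cconv_powr[OF cU(1) solD(1)[OF uv] q]] ev fsub_translate[OF solD(12)[OF uv]]])
  have U01: "0 \<le> U x" "U x \<le> M" "0 \<le> V x" "V x \<le> M" for x
    using LIMSEQ_le_const[OF U(1)] LIMSEQ_le_const2[OF U(1)] LIMSEQ_le_const[OF V(1)] LIMSEQ_le_const2[OF V(1)]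
      solD(1-4)[OF uv] by blast+
  \<comment> \<open>A shift by \<open>e\<close> advances the index by one and leaves the limit
    unchanged.\<close>
  have Ve: "V (x + e) = V x" for x
  proof (rule LIMSEQ_unique[OF V(1)])
    have "(\<lambda>j. v (x + e + real j *\<^sub>R e)) = (\<lambda>j. v (x + real (Suc j) *\<^sub>R e))"
      by (simp add: algebra_simps)
    then show "(\<lambda>j. v (x + e + real j *\<^sub>R e)) \<longlonglongrightarrow> V x" using LIMSEQ_Suc[OF V(1)[of x]] by simp
  qed
  note L = liouville_translation_invariant[OF s t p q pq c modulus_continuous[OF \<omega> cU(2)] U01(1,2)
    modulus_continuous[OF \<omega> cV(2)] U01(3,4) e Ve subU subV crit]
  show "u x = 0" "v x = 0" using L[of x] U(2)[of x] V(2)[of x] solD(1,3)[OF uv, of x] by simp_all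
qed

end

lemma holder_modulus_isCont:
  assumes "0 < \<alpha>" shows "isCont (\<lambda>r::real. L * \<bar>r\<bar> powr \<alpha>) 0"
proof -
  have "continuous_on UNIV (\<lambda>r::real. L * \<bar>r\<bar> powr \<alpha>)"
    using assms by (intro continuous_intros continuous_on_powr') auto
  then show ?thesis by (simp add: continuous_on_eq_continuous_at)
qed

theorem theorem1p3:
  fixes s t p q :: real
    and u v :: "real ^ 'n::{finite,linorder} \<Rightarrow> real"
  assumes "CARD('n) \<ge> 2"
    and "0 < s" "s < 1" "0 < t" "t < 1"
    and "real CARD('n) > 2 * s + 1" "real CARD('n) > 2 * t + 1"
    and "p \<ge> 1" "q \<ge> 1" "p * q > 1"
    and "(2 * s / p + 2 * t) * (p / (p * q - 1)) \<ge> real CARD('n) - 2 * s \<or>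
         (2 * t / q + 2 * s) * (q / (p * q - 1)) \<ge> real CARD('n) - 2 * t"
  shows "(\<forall>x. u x \<ge> 0) \<and> (\<forall>x. v x \<ge> 0) \<and> bounded (range u) \<and> bounded (range v) \<and>
           viscosity_solution s t p q half_space u v
         \<longleftrightarrow> u = (\<lambda>x. 0) \<and> v = (\<lambda>x. 0)"
proof
  assume "u = (\<lambda>x. 0) \<and> v = (\<lambda>x. 0)"
  moreover have "open (half_space :: (real ^ 'n::_) set)"
    unfolding half_space_def by (intro open_Collect_less continuous_intros)
  ultimately show "(\<forall>x. u x \<ge> 0) \<and> (\<forall>x. v x \<ge> 0) \<and> bounded (range u) \<and> bounded (range v) \<and>
           viscosity_solution s t p q half_space u v"
    using viscosity_solution_zero[of s t half_space p q] assms by simp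
next
  assume a: "(\<forall>x. u x \<ge> 0) \<and> (\<forall>x. v x \<ge> 0) \<and> bounded (range u) \<and> bounded (range v) \<and>
           viscosity_solution s t p q half_space u v"
  define e where "e = (axis (Max UNIV) 1 :: real ^ 'n::_)"
  have e: "e \<in> Basis" unfolding e_def by (auto simp: Basis_vec_def)
  have H: "half_space = {x. 0 < x \<bullet> e}" unfolding half_space_def e_def by (simp add: inner_axis)
  obtain M1 M2 where M12: "\<forall>x. \<bar>u x\<bar> \<le> M1" "\<forall>x. \<bar>v x\<bar> \<le> M2"
    using a unfolding bounded_iff real_norm_def by (metis rangeI)
  \<comment> \<open>The maximum with 1 makes the common bound positive even for the zero
    pair.\<close>
  define M where "M = max 1 (max M1 M2)"
  have M: "M > 0" "\<And>x. \<bar>u x\<bar> \<le> M" "\<And>x. \<bar>v x\<bar> \<le> M"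
    using M12 by (auto simp: M_def le_max_iff_disj)
  have uv: "\<And>x. 0 \<le> u x" "\<And>x. u x \<le> M" "\<And>x. 0 \<le> v x" "\<And>x. v x \<le> M"
    using a M by (auto simp: abs_le_iff)
  have sup: "viscosity_supersolution s t p q half_space u v" and sub: "viscosity_subsolution s t p q half_space u v"
    and zero: "\<And>x. x \<bullet> e \<le> 0 \<Longrightarrow> u x = 0" "\<And>x. x \<bullet> e \<le> 0 \<Longrightarrow> v x = 0"
    using a unfolding viscosity_solution_def H by auto
  have cont: "continuous_on UNIV u" "continuous_on UNIV v" using sup unfolding viscosity_supersolution_def by auto
  define c1 where "c1 = 2 / frac_const TYPE('n) s"
  define c2 where "c2 = 2 / frac_const TYPE('n) t"
  have c: "c1 > 0" "c2 > 0" using frac_const_pos[of s, where 'n='n] frac_const_pos[of t, where 'n='n] assms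
    by (auto simp: c1_def c2_def)
  note S = viscosity_subsolution_fsub[OF assms(2-5) sub M(2,3), unfolded H, folded c1_def c2_def]
    viscosity_supersolution_fsub[OF assms(2-5) sup M(2,3), unfolded H, folded c1_def c2_def]
  have b1: "c1 * v x powr p \<le> c1 * M powr p" "- (c1 * v x powr p) \<le> c1 * M powr p" for x
  proof -
    show 1: "c1 * v x powr p \<le> c1 * M powr p" using c uv assms by (intro mult_left_mono powr_mono2) auto
    have "0 \<le> c1 * v x powr p" using c by simp
    then show "- (c1 * v x powr p) \<le> c1 * M powr p" using 1 by linarith
  qed
  have b2: "c2 * u x powr q \<le> c2 * M powr q" "- (c2 * u x powr q) \<le> c2 * M powr q" for x
  proof -
    show 1: "c2 * u x powr q \<le> c2 * M powr q" using c uv assms by (intro mult_left_mono powr_mono2) auto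
    have "0 \<le> c2 * u x powr q" using c by simp
    then show "- (c2 * u x powr q) \<le> c2 * M powr q" using 1 by linarith
  qed
  obtain L1 \<alpha>1 where L1: "L1 \<ge> 0" "0 < \<alpha>1" "\<And>x y. \<bar>u x - u y\<bar> \<le> L1 * norm (x - y) powr \<alpha>1"
    by (rule fsub_holder[OF e assms(2,3) cont(1) uv(1,2) zero(1) fsub_mono[OF S(1) order_refl b1(1)]
      fsub_mono[OF S(3) order_refl b1(2)]]) blast+
  obtain L2 \<alpha>2 where L2: "L2 \<ge> 0" "0 < \<alpha>2" "\<And>x y. \<bar>v x - v y\<bar> \<le> L2 * norm (x - y) powr \<alpha>2"
    by (rule fsub_holder[OF e assms(4,5) cont(2) uv(3,4) zero(2) fsub_mono[OF S(2) order_refl b2(1)]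
      fsub_mono[OF S(4) order_refl b2(2)]]) blast+
  \<comment> \<open>One modulus for both components, whose Hoelder exponents may differ.\<close>
  define \<omega> where "\<omega> r = L1 * \<bar>r\<bar> powr \<alpha>1 + L2 * \<bar>r\<bar> powr \<alpha>2" for r :: real
  have \<omega>u: "\<bar>u x - u y\<bar> \<le> \<omega> (norm (x - y))" and \<omega>v: "\<bar>v x - v y\<bar> \<le> \<omega> (norm (x - y))" for x y
    using L1(3)[of x y] L2(3)[of x y] L1(1) L2(1) by (auto simp: \<omega>_def intro: add_increasing add_increasing2)
  interpret half_space_system s t p q c1 c2 M \<omega> e
  proof unfold_locales
    show "isCont \<omega> 0" unfolding \<omega>_def by (intro isCont_add holder_modulus_isCont L1 L2)
    show "\<omega> 0 = 0" by (simp add: \<omega>_def)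
  qed (use assms e c M in auto)
  have sol: "sol u v" unfolding sol_def using uv zero \<omega>u \<omega>v S by blast
  from assms(11) show "u = (\<lambda>x. 0) \<and> v = (\<lambda>x. 0)"
  proof
    assume "real CARD('n) - 2 * s \<le> (2 * s / p + 2 * t) * (p / (p * q - 1))"
    also have "\<dots> = (2 * s + 2 * t * p) / (p * q - 1)"
    proof -
      have "(2 * s / p + 2 * t) * p = 2 * s + 2 * t * p" using p by (simp add: distrib_right)
      then show ?thesis by (simp only: times_divide_eq_right)
    qed
    finally show ?thesis using sol_trivial[OF sol] by auto
  next
    \<comment> \<open>The second alternative is the first one for the swapped system.\<close>
    interpret sw: half_space_system t s q p c2 c1 M \<omega> e by (rule system_swapped)
    assume "real CARD('n) - 2 * t \<le> (2 * t / q + 2 * s) * (q / (p * q - 1))"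
    also have "\<dots> = (2 * t + 2 * s * q) / (q * p - 1)"
    proof -
      have "(2 * t / q + 2 * s) * q = 2 * t + 2 * s * q" using q by (simp add: distrib_right)
      then show ?thesis by (simp only: times_divide_eq_right mult.commute[of p q])
    qed
    finally show ?thesis using sw.sol_trivial[of v u] sol unfolding sol_swapped by auto
  qed
qed

end
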